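(* Let $p_+,p_-\ge2$ be coprime integers, $\mathfrak g=\mathfrak g_{p_+,p_-}$, and let $\boldsymbol v\in\mathfrak g$ be its ribbon element as defined in the context. Then $$\boldsymbol v=\bar{\boldsymbol v}\,\boldsymbol v^*,\qquad \bar{\boldsymbol v}=\sum_{(r,r')\in\mathcal I}e^{2i\pi\Delta_{r,r'}}\boldsymbol e(r,r'),\qquad \Delta_{r,r'}=\frac{(p_+r'-p_-r)^2-(p_+-p_-)^2}{4p_+p_-},$$ where $\boldsymbol e(r,r')$ are the primitive idempotents of the center of $\mathfrak g$, and $$\boldsymbol v^*=\Bigl(1+\frac1{p_+}\boldsymbol\chi^{\nwarrow}(1,1)\Bigr)\Bigl(1+\frac1{p_-}\boldsymbol\chi^{\nearrow}(1,1)\Bigr),$$ where $\boldsymbol\chi^{\nwarrow}(1,1)=\boldsymbol\chi(\gamma^{\nearrow}(1,1))$ and $\boldsymbol\chi^{\nearrow}(1,1)=\boldsymbol\chi(\gamma^{\nwarrow}(1,1))$ are the Drinfeld-map images of the pseudotraces $\gamma^{\nearrow}(1,1)$, $\gamma^{\nwarrow}(1,1)$ defined in the context.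
   Context: **The algebra.** $\mathfrak q=e^{i\pi/(2p_+p_-)}$, $\mathfrak q_\pm=e^{i\pi/p_\pm}$, $Q_+=\mathfrak q_+^{p_-}$, $Q_-=\mathfrak q_-^{p_+}$, $[n]_\pm=\frac{Q_\pm^n-Q_\pm^{-n}}{Q_\pm-Q_\pm^{-1}}$, $[n]_\pm!=[1]_\pm\cdots[n]_\pm$. $\mathfrak g=\mathfrak g_{p_+,p_-}$ is the Hopf algebra over $\mathbb C$ generated by $e_+,f_+,e_-,f_-,K$ with relations $e_\pm^{p_\pm}=f_\pm^{p_\pm}=0$, $K^{2p_+p_-}=1$, $Ke_\pm K^{-1}=\mathfrak q_\pm^2e_\pm$, $Kf_\pm K^{-1}=\mathfrak q_\pm^{-2}f_\pm$, each of $e_+,f_+$ commutes with each of $e_-,f_-$, $[e_+,f_+]=\frac{K^{p_-}-K^{-p_-}}{Q_+-Q_+^{-1}}$, $[e_-,f_-]=\frac{K^{p_+}-K^{-p_+}}{Q_--Q_-^{-1}}$, and $\Delta(K)=K\otimes K$, $\Delta(e_+)=e_+\otimes1+K^{p_-}\otimes e_+$, $\Delta(f_-)=f_-\otimes1+K^{-p_+}\otimes f_-$, $\Delta(f_+)=f_+\otimes K^{-p_-}+1\otimes f_+$, $\Delta(e_-)=e_-\otimes K^{p_+}+1\otimes e_-$, $S(K)=K^{-1}$, $S(e_+)=-K^{-p_-}e_+$, $S(f_-)=-K^{p_+}f_-$, $S(f_+)=-f_+K^{p_-}$, $S(e_-)=-e_-K^{-p_+}$, $\epsilon(e_\pm)=\epsilon(f_\pm)=0$,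 $\epsilon(K)=1$. **Drinfeld map, ribbon element.** Let $\bar D\supset\mathfrak g$ be the Hopf algebra obtained by adjoining a group-like $k$ with $k^2=K$, $k^{4p_+p_-}=1$, $ke_\pm k^{-1}=\mathfrak q_\pm e_\pm$, $kf_\pm k^{-1}=\mathfrak q_\pm^{-1}f_\pm$. It is quasitriangular with $$R=\frac1{4p_+p_-}\sum_{m=0}^{p_+-1}\sum_{n=0}^{p_--1}\sum_{j,c=0}^{4p_+p_--1}\frac{(-1)^{m+n}(Q_+-Q_+^{-1})^m(Q_--Q_-^{-1})^n}{[m]_+!\,[n]_-!}\,\mathfrak q_+^{-mj}Q_+^{-m(m-1)/2}\mathfrak q_-^{nj}Q_-^{-n(n-1)/2}\mathfrak q^{-cj}\;k^je_+^mf_-^n\otimes f_+^me_-^nk^{-c}.$$ $\bar M=R_{21}R$ lies in $\mathfrak g\otimes\mathfrak g$; the Drinfeld map is $\boldsymbol\chi(\beta)=(\beta\otimes\mathrm{id})\bar M$ for $\beta\in\mathfrak g^*$. The balancing element is $\boldsymbol g=K^{p_+-p_-}$. The ribbon element is $\boldsymbol v=\boldsymbol u\,\boldsymbol g^{-1}$ with $\boldsymbol u=\mu((S\otimes\mathrm{id})R_{21})$, $\mu(a\otimes b)=ab$; it is a central element of $\mathfrak g$. **Irreducible modules.** $\mathsf X^\alpha_{r,r'}$ ($\alpha=\pm$, $1\le r\le p_+$, $1\le r'\le p_-$) has basis $|n,n'\rangle$, $0\le n<r$, $0\le n'<r'$, with $K|n,n'\rangle=\alpha\,\mathfrak q_+^{r-1-2n}\mathfrak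 q_-^{r'-1-2n'}|n,n'\rangle$, $e_+|n,n'\rangle=\alpha^{p_-}(-1)^{r'-1}[n]_+[r-n]_+|n-1,n'\rangle$, $e_-|n,n'\rangle=\alpha^{p_+}(-1)^{r-1}[n']_-[r'-n']_-|n,n'-1\rangle$, $f_+|n,n'\rangle=|n+1,n'\rangle$, $f_-|n,n'\rangle=|n,n'+1\rangle$ (out-of-range vectors are zero). **Index set and idempotents.** $\mathcal I_1=\{(r,r'):1\le r\le p_+-1,\,1\le r'\le p_--1,\,p_-r+p_+r'\le p_+p_-\}$, $\mathcal I=\mathcal I_1\cup\{(r,p_-):1\le r\le p_+-1\}\cup\{(p_+,r'):1\le r'\le p_--1\}\cup\{(p_+,p_-),(0,p_-)\}$. The primitive central idempotents are labeled by $\mathcal I$: $\boldsymbol e(r,r')$ acts as identity on the following irreducible modules and as zero on all the others: $\mathsf X^+_{r,r'},\mathsf X^-_{p_+-r,r'},\mathsf X^-_{r,p_--r'},\mathsf X^+_{p_+-r,p_--r'}$ for $(r,r')\in\mathcal I_1$; $\mathsf X^+_{r,p_-},\mathsf X^-_{p_+-r,p_-}$ for $(r,p_-)$, $1\le r\le p_+-1$; $\mathsf X^+_{p_+,r'},\mathsf X^-_{p_+,p_--r'}$ for $(p_+,r')$, $1\le r'\le p_--1$; $\mathsf X^+_{p_+,p_-}$ for $(p_+,p_-)$; $\mathsf X^-_{p_+,p_-}$ for $(0,p_-)$. **Projective modules and pseudotraces.** Put $K_+=K^{p_-}$, $K_-=K^{p_+}$ and let $\mathcal U_\pm\subset\mathfrak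 g$ be generated by $e_\pm,f_\pm,K_\pm$. For $1\le r\le p_\pm-1$ and $\varepsilon=\pm1$ put $\varepsilon'=\varepsilon Q_\pm^{p_\pm}\in\{\pm1\}$, and let $\mathcal P^{(\pm)}_r(\varepsilon)$ be the $\mathcal U_\pm$-module with basis $t^{\uparrow}_n,t^{\downarrow}_n$ ($0\le n\le r-1$), $t^{\leftarrow}_k,t^{\rightarrow}_k$ ($0\le k\le p_\pm-r-1$) and (omitting the subscript $\pm$ on $e,f,K,Q,p,[\cdot]$) $Kt^{\uparrow,\downarrow}_n=\varepsilon Q^{r-1-2n}t^{\uparrow,\downarrow}_n$, $Kt^{\leftarrow,\rightarrow}_k=\varepsilon'Q^{p-r-1-2k}t^{\leftarrow,\rightarrow}_k$; $et^\uparrow_n=\varepsilon[n][r-n]t^\uparrow_{n-1}+t^\downarrow_{n-1}$ for $n\ge1$, $et^\uparrow_0=t^\leftarrow_{p-r-1}$; $et^\rightarrow_k=\varepsilon'[k][p-r-k]t^\rightarrow_{k-1}$ for $k\ge1$, $et^\rightarrow_0=t^\downarrow_{r-1}$; $et^\leftarrow_k=\varepsilon'[k][p-r-k]t^\leftarrow_{k-1}$, $et^\downarrow_n=\varepsilon[n][r-n]t^\downarrow_{n-1}$ (zero for $k=0$, $n=0$); $f$ raises the index by one in each family, with $ft^\uparrow_{r-1}=t^\rightarrow_0$, $ft^\leftarrow_{p-r-1}=t^\downarrow_0$, $ft^\rightarrow_{p-r-1}=0$, $ft^\downarrow_{r-1}=0$. For $1\le r\le p_+-1$, $1\le r'\le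 p_--1$, the projective cover of $\mathsf X^\alpha_{r,r'}$ is $\mathsf P^\alpha_{r,r'}=\mathcal P^{(+)}_r(\alpha^{p_-}(-1)^{r'-1})\otimes\mathcal P^{(-)}_{r'}(\alpha^{p_+}(-1)^{r-1})$, with $\mathcal U_+$ acting on the first and $\mathcal U_-$ on the second factor. On either factor let $\mathsf N$ be the linear map $t^\downarrow_n\mapsto t^\uparrow_n$ and $\mathsf E$ the map $t^\downarrow_n\mapsto t^\downarrow_n$, both zero on the other basis vectors. Then, for $x\in\mathfrak g$, $$\gamma^{\nearrow}(1,1)(x)=\frac{1}{Q_+-Q_+^{-1}}\,\mathrm{Tr}_{\mathsf P^+_{1,1}\oplus\mathsf P^-_{p_+-1,1}}\bigl(\boldsymbol g^{-1}x(\mathsf N\otimes\mathsf E)\bigr),\qquad \gamma^{\nwarrow}(1,1)(x)=\frac{1}{Q_--Q_-^{-1}}\,\mathrm{Tr}_{\mathsf P^+_{1,1}\oplus\mathsf P^-_{1,p_--1}}\bigl(\boldsymbol g^{-1}x(\mathsf E\otimes\mathsf N)\bigr).$$ *)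

theory Defs
  imports
    Complex_Main
    "HOL-Library.Poly_Mapping"
    "HOL-Library.Product_Plus"
    "HOL-Algebra.QuotRing"
    "HOL-Algebra.Algebraic_Closure_Type"
    "HOL-Computational_Algebra.Euclidean_Algorithm"
begin

section \<open>Free algebras, presentations, tensor products\<close>

text \<open>
  With concatenation as addition on lists, the convolution product on finitely supported
  functions makes \<^typ>\<open>'g list \<Rightarrow>\<^sub>0 complex\<close> the free associative unital algebra on \<^typ>\<open>'g\<close>.
  Likewise \<^typ>\<open>('g list \<times> 'h list) \<Rightarrow>\<^sub>0 complex\<close>, with the product monoid, is the tensor product
  of two free algebras, with multiplication \<open>(a \<otimes> b)(c \<otimes> d) = ac \<otimes> bd\<close>.
\<close>

instantiation list :: (type) monoid_add
begin

definition zero_list :: "'a list" where "zero_list = []"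

definition plus_list :: "'a list \<Rightarrow> 'a list \<Rightarrow> 'a list" where "plus_list = (@)"

instance by standard (simp_all add: zero_list_def plus_list_def)

end

type_synonym 'g free_alg = "'g list \<Rightarrow>\<^sub>0 complex"

abbreviation vec :: "'b \<Rightarrow> 'b \<Rightarrow>\<^sub>0 complex" where
  "vec b \<equiv> Poly_Mapping.single b 1"

abbreviation gen :: "'g \<Rightarrow> 'g free_alg" where
  "gen x \<equiv> vec [x]"

definition scl :: "complex \<Rightarrow> ('b \<Rightarrow>\<^sub>0 complex) \<Rightarrow> ('b \<Rightarrow>\<^sub>0 complex)" where
  "scl c x = Poly_Mapping.map (\<lambda>a. c * a) x"

definition lin_ext :: "('a \<Rightarrow> 'b \<Rightarrow>\<^sub>0 complex) \<Rightarrow> ('a \<Rightarrow>\<^sub>0 complex) \<Rightarrow> ('b \<Rightarrow>\<^sub>0 complex)" where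
  "lin_ext f x = (\<Sum>a\<in>Poly_Mapping.keys x. scl (Poly_Mapping.lookup x a) (f a))"

definition tens :: "('a \<Rightarrow>\<^sub>0 complex) \<Rightarrow> ('b \<Rightarrow>\<^sub>0 complex) \<Rightarrow> ('a \<times> 'b \<Rightarrow>\<^sub>0 complex)"
    (infixl \<open>\<otimes>\<^sub>v\<close> 72) where
  "x \<otimes>\<^sub>v y = lin_ext (\<lambda>a. lin_ext (\<lambda>b. vec (a, b)) y) x"

text \<open>
  The quotient by the two-sided ideal generated by a set of relations (each relation \<open>l = r\<close> being
  given as \<open>l - r\<close>); its elements are cosets.
\<close>

definition presented :: "'a::ring_1 set \<Rightarrow> 'a set ring" where
  "presented R = ring_of_type_algebra Quot (genideal ring_of_type_algebra R)"

definition cls :: "'a::ring_1 set \<Rightarrow> 'a \<Rightarrow> 'a set" where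
  "cls R x = genideal ring_of_type_algebra R +>\<^bsub>ring_of_type_algebra\<^esub> x"

text \<open>The map on cosets induced by a map that is constant on each of them.\<close>

definition quot_map :: "('a \<Rightarrow> 'b) \<Rightarrow> 'a set \<Rightarrow> 'b" where
  "quot_map f C = the_elem (f ` C)"

definition scalar_mult ::
    "('m::monoid_add \<Rightarrow>\<^sub>0 complex) set \<Rightarrow> complex \<Rightarrow> ('m \<Rightarrow>\<^sub>0 complex) set \<Rightarrow> ('m \<Rightarrow>\<^sub>0 complex) set"
  where
  "scalar_mult R c C = cls R (scl c 1) \<otimes>\<^bsub>presented R\<^esub> C"

text \<open>
  \<open>(F/I) \<otimes> (F'/I') = (F \<otimes> F')/(I \<otimes> F' + F \<otimes> I')\<close>, and the ideal on the right is generated by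
  the following relations.
\<close>

definition tensor_rels ::
    "('m::monoid_add \<Rightarrow>\<^sub>0 complex) set \<Rightarrow> ('n::monoid_add \<Rightarrow>\<^sub>0 complex) set \<Rightarrow> ('m \<times> 'n \<Rightarrow>\<^sub>0 complex) set"
  where
  "tensor_rels R R' = (\<lambda>r. r \<otimes>\<^sub>v 1) ` R \<union> (\<lambda>r. 1 \<otimes>\<^sub>v r) ` R'"

definition ring_center :: "('a, 'b) ring_scheme \<Rightarrow> 'a set" where
  "ring_center A = {z \<in> carrier A. \<forall>x\<in>carrier A. z \<otimes>\<^bsub>A\<^esub> x = x \<otimes>\<^bsub>A\<^esub> z}"

definition primitive_central_idempotent :: "('a, 'b) ring_scheme \<Rightarrow> 'a \<Rightarrow> bool" where
  "primitive_central_idempotent A z \<longleftrightarrow>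
     z \<in> ring_center A \<and> z \<otimes>\<^bsub>A\<^esub> z = z \<and> z \<noteq> \<zero>\<^bsub>A\<^esub> \<and>
     (\<forall>a\<in>ring_center A. \<forall>b\<in>ring_center A.
        a \<otimes>\<^bsub>A\<^esub> a = a \<and> b \<otimes>\<^bsub>A\<^esub> b = b \<and> a \<otimes>\<^bsub>A\<^esub> b = \<zero>\<^bsub>A\<^esub> \<and> z = a \<oplus>\<^bsub>A\<^esub> b \<longrightarrow>
        a = \<zero>\<^bsub>A\<^esub> \<or> b = \<zero>\<^bsub>A\<^esub>)"


section \<open>The quantum group\<close>

text \<open>
  Throughout, \<open>pp\<close> and \<open>pm\<close> stand for $p_+$ and $p_-$. Then $\mathfrak q_\pm$ are \<open>qpar pp\<close>,
  \<open>qpar pm\<close>; $\mathfrak q$ is \<open>qpar (2 * pp * pm)\<close>; $Q_+$ is \<open>Qpar pp pm\<close> and $Q_-$ is \<open>Qpar pm pp\<close>.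
\<close>

definition qpar :: "nat \<Rightarrow> complex" where
  "qpar p = exp (\<i> * of_real pi / of_nat p)"

definition Qpar :: "nat \<Rightarrow> nat \<Rightarrow> complex" where
  "Qpar p p' = qpar p ^ p'"

definition qint :: "complex \<Rightarrow> nat \<Rightarrow> complex" where
  "qint Q n = (Q powi int n - Q powi (- int n)) / (Q - inverse Q)"

definition qfact :: "complex \<Rightarrow> nat \<Rightarrow> complex" where
  "qfact Q n = (\<Prod>k=1..n. qint Q k)"

datatype ggen = Ep | Fp | Em | Fm | Kg

text \<open>Negative powers are expressed through $K^{2p_+p_-}=1$.\<close>

definition Kpow :: "nat \<Rightarrow> nat \<Rightarrow> int \<Rightarrow> ggen free_alg" where
  "Kpow pp pm n = gen Kg ^ nat (n mod int (2 * pp * pm))"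

definition g_rels :: "nat \<Rightarrow> nat \<Rightarrow> ggen free_alg set" where
  "g_rels pp pm =
     {gen Ep ^ pp, gen Fp ^ pp, gen Em ^ pm, gen Fm ^ pm, gen Kg ^ (2 * pp * pm) - 1} \<union>
     {gen Kg * gen Ep * Kpow pp pm (- 1) - scl (qpar pp powi 2) (gen Ep),
      gen Kg * gen Em * Kpow pp pm (- 1) - scl (qpar pm powi 2) (gen Em),
      gen Kg * gen Fp * Kpow pp pm (- 1) - scl (qpar pp powi (- 2)) (gen Fp),
      gen Kg * gen Fm * Kpow pp pm (- 1) - scl (qpar pm powi (- 2)) (gen Fm)} \<union>
     {gen x * gen y - gen y * gen x | x y. x \<in> {Ep, Fp} \<and> y \<in> {Em, Fm}} \<union>
     {gen Ep * gen Fp - gen Fp * gen Ep -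
        scl (1 / (Qpar pp pm - inverse (Qpar pp pm))) (Kpow pp pm (int pm) - Kpow pp pm (- int pm)),
      gen Em * gen Fm - gen Fm * gen Em -
        scl (1 / (Qpar pm pp - inverse (Qpar pm pp))) (Kpow pp pm (int pp) - Kpow pp pm (- int pp))}"

definition g_alg :: "nat \<Rightarrow> nat \<Rightarrow> ggen free_alg set ring" where
  "g_alg pp pm = presented (g_rels pp pm)"

fun antipode_gen :: "nat \<Rightarrow> nat \<Rightarrow> ggen \<Rightarrow> ggen free_alg" where
  "antipode_gen pp pm Kg = Kpow pp pm (- 1)"
| "antipode_gen pp pm Ep = - (Kpow pp pm (- int pm) * gen Ep)"
| "antipode_gen pp pm Fm = - (Kpow pp pm (int pp) * gen Fm)"
| "antipode_gen pp pm Fp = - (gen Fp * Kpow pp pm (int pm))"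
| "antipode_gen pp pm Em = - (gen Em * Kpow pp pm (- int pp))"

text \<open>The algebra $\bar D$: the group-like element $k$ (\<open>Kroot\<close>) is adjoined to the presentation.\<close>

datatype dgen = Gen ggen | Kroot

definition emb :: "ggen free_alg \<Rightarrow> dgen free_alg" where
  "emb = lin_ext (\<lambda>w. vec (map Gen w))"

definition kpow :: "nat \<Rightarrow> nat \<Rightarrow> int \<Rightarrow> dgen free_alg" where
  "kpow pp pm n = gen Kroot ^ nat (n mod int (4 * pp * pm))"

definition d_rels :: "nat \<Rightarrow> nat \<Rightarrow> dgen free_alg set" where
  "d_rels pp pm =
     emb ` g_rels pp pm \<union>
     {gen Kroot ^ 2 - gen (Gen Kg), gen Kroot ^ (4 * pp * pm) - 1} \<union>
     {gen Kroot * gen (Gen Ep) * kpow pp pm (- 1) - scl (qpar pp) (gen (Gen Ep)),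
      gen Kroot * gen (Gen Em) * kpow pp pm (- 1) - scl (qpar pm) (gen (Gen Em)),
      gen Kroot * gen (Gen Fp) * kpow pp pm (- 1) - scl (inverse (qpar pp)) (gen (Gen Fp)),
      gen Kroot * gen (Gen Fm) * kpow pp pm (- 1) - scl (inverse (qpar pm)) (gen (Gen Fm))}"

definition d_alg :: "nat \<Rightarrow> nat \<Rightarrow> dgen free_alg set ring" where
  "d_alg pp pm = presented (d_rels pp pm)"

definition gg_rels :: "nat \<Rightarrow> nat \<Rightarrow> (ggen list \<times> ggen list \<Rightarrow>\<^sub>0 complex) set" where
  "gg_rels pp pm = tensor_rels (g_rels pp pm) (g_rels pp pm)"

definition dd_rels :: "nat \<Rightarrow> nat \<Rightarrow> (dgen list \<times> dgen list \<Rightarrow>\<^sub>0 complex) set" where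
  "dd_rels pp pm = tensor_rels (d_rels pp pm) (d_rels pp pm)"

text \<open>The inclusions $\mathfrak g\to\bar D$ and $\mathfrak g\otimes\mathfrak g\to\bar D\otimes\bar D$.\<close>

definition incl :: "nat \<Rightarrow> nat \<Rightarrow> ggen free_alg set \<Rightarrow> dgen free_alg set" where
  "incl pp pm = quot_map (\<lambda>x. cls (d_rels pp pm) (emb x))"

definition incl2 ::
    "nat \<Rightarrow> nat \<Rightarrow> (ggen list \<times> ggen list \<Rightarrow>\<^sub>0 complex) set \<Rightarrow> (dgen list \<times> dgen list \<Rightarrow>\<^sub>0 complex) set"
  where
  "incl2 pp pm =
     quot_map (\<lambda>t. cls (dd_rels pp pm) (lin_ext (\<lambda>(a, b). vec (map Gen a, map Gen b)) t))"

text \<open>The antipode of $\bar D$, an anti-homomorphism, on the free algebra.\<close>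

fun d_antipode_gen :: "nat \<Rightarrow> nat \<Rightarrow> dgen \<Rightarrow> dgen free_alg" where
  "d_antipode_gen pp pm (Gen x) = emb (antipode_gen pp pm x)"
| "d_antipode_gen pp pm Kroot = kpow pp pm (- 1)"

definition d_antipode :: "nat \<Rightarrow> nat \<Rightarrow> dgen free_alg \<Rightarrow> dgen free_alg" where
  "d_antipode pp pm = lin_ext (\<lambda>w. prod_list (map (d_antipode_gen pp pm) (rev w)))"


section \<open>Universal R-matrix, Drinfeld map, ribbon element\<close>

definition R_coeff :: "nat \<Rightarrow> nat \<Rightarrow> nat \<Rightarrow> nat \<Rightarrow> nat \<Rightarrow> nat \<Rightarrow> complex" where
  "R_coeff pp pm m n j c =
     (let Qp = Qpar pp pm; Qm = Qpar pm pp in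
      (- 1) ^ (m + n) * (Qp - inverse Qp) ^ m * (Qm - inverse Qm) ^ n / (qfact Qp m * qfact Qm n) *
      qpar pp powi (- int (m * j)) * Qp powi (- int (m * (m - 1) div 2)) *
      qpar pm powi int (n * j) * Qm powi (- int (n * (n - 1) div 2)) *
      qpar (2 * pp * pm) powi (- int (c * j)))"

definition R_matrix :: "nat \<Rightarrow> nat \<Rightarrow> (dgen list \<times> dgen list \<Rightarrow>\<^sub>0 complex) set" where
  "R_matrix pp pm =
     cls (dd_rels pp pm)
       (scl (1 / of_nat (4 * pp * pm))
         (\<Sum>m<pp. \<Sum>n<pm. \<Sum>j<4 * pp * pm. \<Sum>c<4 * pp * pm.
            scl (R_coeff pp pm m n j c)
              ((kpow pp pm (int j) * gen (Gen Ep) ^ m * gen (Gen Fm) ^ n) \<otimes>\<^sub>v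
               (gen (Gen Fp) ^ m * gen (Gen Em) ^ n * kpow pp pm (- int c)))))"

definition R21_matrix :: "nat \<Rightarrow> nat \<Rightarrow> (dgen list \<times> dgen list \<Rightarrow>\<^sub>0 complex) set" where
  "R21_matrix pp pm =
     quot_map (\<lambda>t. cls (dd_rels pp pm) (lin_ext (\<lambda>(a, b). vec (b, a)) t)) (R_matrix pp pm)"

text \<open>$\bar M=R_{21}R$, as an element of $\mathfrak g\otimes\mathfrak g$.\<close>

definition M_bar :: "nat \<Rightarrow> nat \<Rightarrow> (ggen list \<times> ggen list \<Rightarrow>\<^sub>0 complex) set" where
  "M_bar pp pm =
     (THE M. M \<in> carrier (presented (gg_rels pp pm)) \<and>
        incl2 pp pm M = R21_matrix pp pm \<otimes>\<^bsub>presented (dd_rels pp pm)\<^esub> R_matrix pp pm)"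

definition drinfeld_map ::
    "nat \<Rightarrow> nat \<Rightarrow> (ggen free_alg set \<Rightarrow> complex) \<Rightarrow> ggen free_alg set" where
  "drinfeld_map pp pm \<beta> =
     quot_map (\<lambda>t. cls (g_rels pp pm)
        (lin_ext (\<lambda>(a, b). scl (\<beta> (cls (g_rels pp pm) (vec a))) (vec b)) t)) (M_bar pp pm)"

definition balancing :: "nat \<Rightarrow> nat \<Rightarrow> ggen free_alg set" where
  "balancing pp pm = cls (g_rels pp pm) (Kpow pp pm (int pp - int pm))"

text \<open>$\boldsymbol u=\mu((S\otimes\mathrm{id})R_{21})$, an element of $\bar D$.\<close>

definition u_elem :: "nat \<Rightarrow> nat \<Rightarrow> dgen free_alg set" where
  "u_elem pp pm =
     quot_map (\<lambda>t. cls (d_rels pp pm) (lin_ext (\<lambda>(a, b). vec a * vec b) t))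
       (quot_map (\<lambda>t. cls (dd_rels pp pm)
            (lin_ext (\<lambda>(a, b). d_antipode pp pm (vec a) \<otimes>\<^sub>v vec b) t))
         (R21_matrix pp pm))"

text \<open>$\boldsymbol v=\boldsymbol u\,\boldsymbol g^{-1}$, as an element of $\mathfrak g$.\<close>

definition ribbon :: "nat \<Rightarrow> nat \<Rightarrow> ggen free_alg set" where
  "ribbon pp pm =
     (THE v. v \<in> carrier (g_alg pp pm) \<and>
        incl pp pm v =
          u_elem pp pm \<otimes>\<^bsub>d_alg pp pm\<^esub> incl pp pm (inv\<^bsub>g_alg pp pm\<^esub> (balancing pp pm)))"


section \<open>Modules\<close>

text \<open>
  A finite-dimensional module is given by a basis and the images of basis vectors under
  the generators. Only values of \<open>gen_act\<close> on \<open>basis\<close> are meaningful.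
\<close>

record 'b g_module =
  basis :: "'b set"
  gen_act :: "ggen \<Rightarrow> 'b \<Rightarrow> 'b \<Rightarrow>\<^sub>0 complex"

definition mspace :: "'b g_module \<Rightarrow> ('b \<Rightarrow>\<^sub>0 complex) set" where
  "mspace V = {v. Poly_Mapping.keys v \<subseteq> basis V}"

definition free_act :: "'b g_module \<Rightarrow> ggen free_alg \<Rightarrow> ('b \<Rightarrow>\<^sub>0 complex) \<Rightarrow> ('b \<Rightarrow>\<^sub>0 complex)" where
  "free_act V x v =
     (\<Sum>w\<in>Poly_Mapping.keys x. scl (Poly_Mapping.lookup x w) (foldr (\<lambda>g. lin_ext (gen_act V g)) w v))"

definition act :: "'b g_module \<Rightarrow> ggen free_alg set \<Rightarrow> ('b \<Rightarrow>\<^sub>0 complex) \<Rightarrow> ('b \<Rightarrow>\<^sub>0 complex)" where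
  "act V C v = quot_map (\<lambda>x. free_act V x v) C"

definition trace_on :: "'b g_module \<Rightarrow> (('b \<Rightarrow>\<^sub>0 complex) \<Rightarrow> ('b \<Rightarrow>\<^sub>0 complex)) \<Rightarrow> complex" where
  "trace_on V T = (\<Sum>b\<in>basis V. Poly_Mapping.lookup (T (vec b)) b)"

definition ket :: "nat \<Rightarrow> nat \<Rightarrow> nat \<Rightarrow> nat \<Rightarrow> (nat \<times> nat \<Rightarrow>\<^sub>0 complex)" where
  "ket r r' n n' = (if n < r \<and> n' < r' then vec (n, n') else 0)"

text \<open>
  $\mathsf X^\alpha_{r,r'}$, for $\alpha\in\{1,-1\}$. The truncated subtraction in \<open>n - 1\<close> is harmless, as
  the coefficient \<open>qint Q 0\<close> vanishes.
\<close>

definition irr_mod :: "nat \<Rightarrow> nat \<Rightarrow> complex \<Rightarrow> nat \<Rightarrow> nat \<Rightarrow> (nat \<times> nat) g_module" where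
  "irr_mod pp pm \<alpha> r r' =
     \<lparr>basis = {..<r} \<times> {..<r'},
      gen_act = (\<lambda>g (n, n'). case g of
          Kg \<Rightarrow> scl (\<alpha> * qpar pp powi (int r - 1 - 2 * int n) * qpar pm powi (int r' - 1 - 2 * int n'))
                  (ket r r' n n')
        | Ep \<Rightarrow> scl (\<alpha> ^ pm * (- 1) ^ (r' - 1) * qint (Qpar pp pm) n * qint (Qpar pp pm) (r - n))
                  (ket r r' (n - 1) n')
        | Em \<Rightarrow> scl (\<alpha> ^ pp * (- 1) ^ (r - 1) * qint (Qpar pm pp) n' * qint (Qpar pm pp) (r' - n'))
                  (ket r r' n (n' - 1))
        | Fp \<Rightarrow> ket r r' (n + 1) n'
        | Fm \<Rightarrow> ket r r' n (n' + 1))\<rparr>"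

subsection \<open>Projective modules\<close>

text \<open>Basis vectors $t^\uparrow_n$, $t^\downarrow_n$, $t^\leftarrow_k$, $t^\rightarrow_k$ of
  $\mathcal P^{(\pm)}_r(\varepsilon)$; below \<open>p\<close>, \<open>Q\<close> are $p_\pm$, $Q_\pm$.\<close>

datatype tbasis = Up nat | Dn nat | Lf nat | Rt nat

definition proj_basis :: "nat \<Rightarrow> nat \<Rightarrow> tbasis set" where
  "proj_basis p r = Up ` {..<r} \<union> Dn ` {..<r} \<union> Lf ` {..<p - r} \<union> Rt ` {..<p - r}"

definition eps' :: "nat \<Rightarrow> complex \<Rightarrow> complex \<Rightarrow> complex" where
  "eps' p Q \<epsilon> = \<epsilon> * Q ^ p"

fun proj_K :: "nat \<Rightarrow> complex \<Rightarrow> nat \<Rightarrow> complex \<Rightarrow> tbasis \<Rightarrow> complex" where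
  "proj_K p Q r \<epsilon> (Up n) = \<epsilon> * Q powi (int r - 1 - 2 * int n)"
| "proj_K p Q r \<epsilon> (Dn n) = \<epsilon> * Q powi (int r - 1 - 2 * int n)"
| "proj_K p Q r \<epsilon> (Lf k) = eps' p Q \<epsilon> * Q powi (int p - int r - 1 - 2 * int k)"
| "proj_K p Q r \<epsilon> (Rt k) = eps' p Q \<epsilon> * Q powi (int p - int r - 1 - 2 * int k)"

fun proj_e :: "nat \<Rightarrow> complex \<Rightarrow> nat \<Rightarrow> complex \<Rightarrow> tbasis \<Rightarrow> (tbasis \<Rightarrow>\<^sub>0 complex)" where
  "proj_e p Q r \<epsilon> (Up n) =
     (if n = 0 then vec (Lf (p - r - 1))
      else scl (\<epsilon> * qint Q n * qint Q (r - n)) (vec (Up (n - 1))) + vec (Dn (n - 1)))"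
| "proj_e p Q r \<epsilon> (Dn n) =
     (if n = 0 then 0 else scl (\<epsilon> * qint Q n * qint Q (r - n)) (vec (Dn (n - 1))))"
| "proj_e p Q r \<epsilon> (Lf k) =
     (if k = 0 then 0 else scl (eps' p Q \<epsilon> * qint Q k * qint Q (p - r - k)) (vec (Lf (k - 1))))"
| "proj_e p Q r \<epsilon> (Rt k) =
     (if k = 0 then vec (Dn (r - 1))
      else scl (eps' p Q \<epsilon> * qint Q k * qint Q (p - r - k)) (vec (Rt (k - 1))))"

fun proj_f :: "nat \<Rightarrow> nat \<Rightarrow> tbasis \<Rightarrow> (tbasis \<Rightarrow>\<^sub>0 complex)" where
  "proj_f p r (Up n) = (if n = r - 1 then vec (Rt 0) else vec (Up (n + 1)))"
| "proj_f p r (Dn n) = (if n = r - 1 then 0 else vec (Dn (n + 1)))"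
| "proj_f p r (Lf k) = (if k = p - r - 1 then vec (Dn 0) else vec (Lf (k + 1)))"
| "proj_f p r (Rt k) = (if k = p - r - 1 then 0 else vec (Rt (k + 1)))"

text \<open>
  $\mathsf P^\alpha_{r,r'}$. Since $K_+=K^{p_-}$ and $K_-=K^{p_+}$ with $p_\pm$ coprime, the action of $K$ is
  determined by those of $K_\pm$: $K=K_+^aK_-^{a'}$ where $ap_-+a'p_+=1$.
\<close>

definition proj_mod :: "nat \<Rightarrow> nat \<Rightarrow> complex \<Rightarrow> nat \<Rightarrow> nat \<Rightarrow> (tbasis \<times> tbasis) g_module" where
  "proj_mod pp pm \<alpha> r r' =
     (let Qp = Qpar pp pm; Qm = Qpar pm pp;
          \<epsilon> = \<alpha> ^ pm * (- 1) ^ (r' - 1); \<epsilon>\<^sub>m = \<alpha> ^ pp * (- 1) ^ (r - 1);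
          (a, a') = bezout_coefficients (int pm) (int pp)
      in
      \<lparr>basis = proj_basis pp r \<times> proj_basis pm r',
       gen_act = (\<lambda>g (b, b'). case g of
          Kg \<Rightarrow> scl (proj_K pp Qp r \<epsilon> b powi a * proj_K pm Qm r' \<epsilon>\<^sub>m b' powi a') (vec (b, b'))
        | Ep \<Rightarrow> proj_e pp Qp r \<epsilon> b \<otimes>\<^sub>v vec b'
        | Fp \<Rightarrow> proj_f pp r b \<otimes>\<^sub>v vec b'
        | Em \<Rightarrow> vec b \<otimes>\<^sub>v proj_e pm Qm r' \<epsilon>\<^sub>m b'
        | Fm \<Rightarrow> vec b \<otimes>\<^sub>v proj_f pm r' b')\<rparr>)"

fun N_map :: "tbasis \<Rightarrow> (tbasis \<Rightarrow>\<^sub>0 complex)" where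
  "N_map (Dn n) = vec (Up n)"
| "N_map _ = 0"

fun E_map :: "tbasis \<Rightarrow> (tbasis \<Rightarrow>\<^sub>0 complex)" where
  "E_map (Dn n) = vec (Dn n)"
| "E_map _ = 0"

text \<open>
  The traces \<open>C \<mapsto> Tr\<^sub>V(g\<^sup>-\<^sup>1 C T)\<close> and the pseudotraces
  $\gamma^{\nearrow}(1,1)$, $\gamma^{\nwarrow}(1,1)$; a trace over a direct sum of modules is the sum of traces.
\<close>

definition twisted_trace ::
    "nat \<Rightarrow> nat \<Rightarrow> 'b g_module \<Rightarrow> ('b \<Rightarrow> 'b \<Rightarrow>\<^sub>0 complex) \<Rightarrow> ggen free_alg set \<Rightarrow> complex" where
  "twisted_trace pp pm V T C =
     trace_on V (\<lambda>v. act V (inv\<^bsub>g_alg pp pm\<^esub> (balancing pp pm) \<otimes>\<^bsub>g_alg pp pm\<^esub> C) (lin_ext T v))"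

definition gamma_NE :: "nat \<Rightarrow> nat \<Rightarrow> ggen free_alg set \<Rightarrow> complex" where
  "gamma_NE pp pm C =
     1 / (Qpar pp pm - inverse (Qpar pp pm)) *
     (let T = (\<lambda>(b, b'). N_map b \<otimes>\<^sub>v E_map b') in
      twisted_trace pp pm (proj_mod pp pm 1 1 1) T C +
      twisted_trace pp pm (proj_mod pp pm (- 1) (pp - 1) 1) T C)"

definition gamma_NW :: "nat \<Rightarrow> nat \<Rightarrow> ggen free_alg set \<Rightarrow> complex" where
  "gamma_NW pp pm C =
     1 / (Qpar pm pp - inverse (Qpar pm pp)) *
     (let T = (\<lambda>(b, b'). E_map b \<otimes>\<^sub>v N_map b') in
      twisted_trace pp pm (proj_mod pp pm 1 1 1) T C +
      twisted_trace pp pm (proj_mod pp pm (- 1) 1 (pm - 1)) T C)"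

text \<open>The arrows are interchanged by the Drinfeld map.\<close>

definition chi_NW :: "nat \<Rightarrow> nat \<Rightarrow> ggen free_alg set" where
  "chi_NW pp pm = drinfeld_map pp pm (gamma_NE pp pm)"

definition chi_NE :: "nat \<Rightarrow> nat \<Rightarrow> ggen free_alg set" where
  "chi_NE pp pm = drinfeld_map pp pm (gamma_NW pp pm)"


section \<open>Central idempotents\<close>

definition index_set1 :: "nat \<Rightarrow> nat \<Rightarrow> (nat \<times> nat) set" where
  "index_set1 pp pm =
     {(r, r'). 1 \<le> r \<and> r \<le> pp - 1 \<and> 1 \<le> r' \<and> r' \<le> pm - 1 \<and> pm * r + pp * r' \<le> pp * pm}"

definition index_set :: "nat \<Rightarrow> nat \<Rightarrow> (nat \<times> nat) set" where
  "index_set pp pm =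
     index_set1 pp pm \<union> {(r, pm) | r. 1 \<le> r \<and> r \<le> pp - 1} \<union>
     {(pp, r') | r'. 1 \<le> r' \<and> r' \<le> pm - 1} \<union> {(pp, pm), (0, pm)}"

text \<open>The triples $(\alpha,s,s')$ such that $\boldsymbol e(r,r')$ acts as the identity on
  $\mathsf X^\alpha_{s,s'}$, for $(r,r')\in\mathcal I$.\<close>

definition block :: "nat \<Rightarrow> nat \<Rightarrow> nat \<times> nat \<Rightarrow> (complex \<times> nat \<times> nat) set" where
  "block pp pm = (\<lambda>(r, r').
     if (r, r') = (pp, pm) then {(1, pp, pm)}
     else if (r, r') = (0, pm) then {(- 1, pp, pm)}
     else if r' = pm then {(1, r, pm), (- 1, pp - r, pm)}
     else if r = pp then {(1, pp, r'), (- 1, pp, pm - r')}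
     else {(1, r, r'), (- 1, pp - r, r'), (- 1, r, pm - r'), (1, pp - r, pm - r')})"

text \<open>
  \<open>e\<close> is the labelling of the primitive central idempotents by the index set. These conditions
  determine \<open>e\<close> on the index set.
\<close>

definition block_idempotents :: "nat \<Rightarrow> nat \<Rightarrow> (nat \<times> nat \<Rightarrow> ggen free_alg set) \<Rightarrow> bool" where
  "block_idempotents pp pm e \<longleftrightarrow>
     (\<forall>i\<in>index_set pp pm.
        primitive_central_idempotent (g_alg pp pm) (e i) \<and>
        (\<forall>\<alpha>\<in>{1, - 1}. \<forall>s\<in>{1..pp}. \<forall>s'\<in>{1..pm}. \<forall>v\<in>mspace (irr_mod pp pm \<alpha> s s').
           act (irr_mod pp pm \<alpha> s s') (e i) v = (if (\<alpha>, s, s') \<in> block pp pm i then v else 0)))"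

definition conf_dim :: "nat \<Rightarrow> nat \<Rightarrow> nat \<times> nat \<Rightarrow> complex" where
  "conf_dim pp pm = (\<lambda>(r, r').
     ((of_nat pp * of_nat r' - of_nat pm * of_nat r) ^ 2 - (of_nat pp - of_nat pm) ^ 2) /
     (4 * of_nat pp * of_nat pm))"

end

(*
  Both sides are compared on each spectral projection 1_a of K (K = q^(2a) on its image). Carrying
  out the sums over powers of k in the R-matrix, v and the two Drinfeld images become, after
  multiplication with 1_a, combinations of monomials e^m f^m, hence polynomials in the two
  commuting central Casimir elements C_+ and C_-, written in Newton form. The nodes of these Newton
  expansions are the possible eigenvalues of C_+- on 1_a; each is a root of multiplicity at most 2.

  The Newton coefficients satisfy a recursion which relates the polynomial at a weight to the one at
  the next weight modulo the product over all nodes, so that values and derivatives at the nodes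
  reduce to those at the first node; there they are given by a q-harmonic sum for v, and for the
  pseudotraces by a double sum evaluated with the q-binomial theorem and by differentiation. The
  result is that the polynomial of v and that of 1 + chi/p agree to first order at every node up to
  the value of the former, which is the power of q that assembles to e^(2 i pi Delta).

  It remains to see that a central idempotent acts on a joint generalized eigenspace of C_+, C_-
  inside 1_a g by 0 or 1. By PBW, a central element times 1_a is a polynomial in C_+ and C_-, so on
  this eigenspace it is a scalar plus a nilpotent; for an idempotent the nilpotent part vanishes,
  and the scalar is read off from a weight vector with the same eigenvalues in an irreducible module.
*)

theory Submission
  imports Defs
begin

section \<open>Linear extensions\<close>

text \<open>The ribbon element and M-bar are given only as preimages of elements of the algebra with
  k adjoined, so explicit preimages and injectivity of the inclusion are needed. Injectivity comes
  from letting the large algebra act on pairs (a, b), standing for a + b k, and reading off the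
  first component. Preimages exist because the powers of k left over are even, or enter through
  q^(c^2), which agrees for the two eigenvalues of k over one eigenvalue of K. First order is the
  right precision because the nodes csum (x Q^(2l+1)), l < p, coincide in pairs with l + l' constant
  modulo p. A pseudotrace sees first order because it reads off the nilpotent part n of a Casimir
  element, and P(c + n) = P(c) + P'(c) n. The factor 1/p undoes the p of Fourier orthogonality over
  the p weights of the two modules in the trace. The derivative of chi at the first node rests on an
  identity with a free variable Z, differentiated at Z = Q, whose inner sums vanish as q-differences
  of polynomials of too small degree.\<close>

type_synonym 'a vect = "'a \<Rightarrow>\<^sub>0 complex"

abbreviation "keys \<equiv> Poly_Mapping.keys"
abbreviation "lookup \<equiv> Poly_Mapping.lookup"

text \<open>The scalar multiplication is a parameter, so that one extension principle serves formal
  combinations, complex numbers, the quotient algebras and pairs of their elements.\<close>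

definition lext :: "(complex \<Rightarrow> 'v \<Rightarrow> 'v) \<Rightarrow> ('a \<Rightarrow> 'v) \<Rightarrow> 'a vect \<Rightarrow> 'v::comm_monoid_add" where
  "lext s \<phi> x = (\<Sum>a\<in>keys x. s (lookup x a) (\<phi> a))"

lemma lin_ext_eq_lext: "lin_ext = lext scl"
  by (simp add: fun_eq_iff lin_ext_def lext_def)

lemma lookup_scl [simp]: "lookup (scl c x) a = c * lookup x a"
  by (simp add: scl_def Poly_Mapping.map.rep_eq when_def)

lemma scl_conv_mult: "scl c x = Poly_Mapping.single 0 c * x"
  by (simp add: scl_def mult_map_scale_conv_mult)

lemma vector_space_scl: "vector_space scl"
  by standard (auto intro!: poly_mapping_eqI simp: lookup_add algebra_simps)

interpretation scl: vector_space scl by (rule vector_space_scl)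

interpretation cmult: vector_space "(*) :: complex \<Rightarrow> complex \<Rightarrow> complex"
  by standard (auto simp: algebra_simps)

locale complex_vs = vector_space scale for scale :: "complex \<Rightarrow> 'v::ab_group_add \<Rightarrow> 'v"
begin

lemma lext_sup:
  assumes "finite A" "keys x \<subseteq> A"
  shows "lext scale \<phi> x = (\<Sum>a\<in>A. scale (lookup x a) (\<phi> a))"
  unfolding lext_def
  by (rule sum.mono_neutral_left) (use assms in \<open>auto simp: in_keys_iff\<close>)

lemma lext_add: "lext scale \<phi> (x + y) = lext scale \<phi> x + lext scale \<phi> y"
proof -
  let ?A = "keys x \<union> keys y"
  have "lext scale \<phi> z = (\<Sum>a\<in>?A. scale (lookup z a) (\<phi> a))" if "z \<in> {x, y, x + y}" for z
    using that keys_add[of x y] by (intro lext_sup) auto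
  thus ?thesis by (simp add: lookup_add scale_left_distrib sum.distrib)
qed

lemma lext_scl: "lext scale \<phi> (scl c x) = scale c (lext scale \<phi> x)"
proof -
  have "keys (scl c x) \<subseteq> keys x" by (auto simp: in_keys_iff)
  hence "lext scale \<phi> (scl c x) = (\<Sum>a\<in>keys x. scale (c * lookup x a) (\<phi> a))"
    by (subst lext_sup[of "keys x"]) auto
  thus ?thesis by (simp add: lext_def scale_sum_right)
qed

lemma lext_zero [simp]: "lext scale \<phi> 0 = 0" by (simp add: lext_def)

lemma lext_single: "lext scale \<phi> (Poly_Mapping.single a c) = scale c (\<phi> a)"
  by (subst lext_sup[of "{a}"]) auto

lemma lext_vec [simp]: "lext scale \<phi> (vec a) = \<phi> a"
  by (simp add: lext_single)

lemma lext_uminus: "lext scale \<phi> (- x) = - lext scale \<phi> x"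
  using lext_add[of \<phi> x "- x"] by (simp add: eq_neg_iff_add_eq_0 add.commute)

lemma lext_diff: "lext scale \<phi> (x - y) = lext scale \<phi> x - lext scale \<phi> y"
  using lext_add[of \<phi> x "- y"] by (simp add: lext_uminus)

lemma lext_sum: "lext scale \<phi> (sum g A) = (\<Sum>i\<in>A. lext scale \<phi> (g i))"
  by (induction A rule: infinite_finite_induct) (auto simp: lext_add)

lemma linear_eq_lext:
  assumes add: "\<And>x y. F (x + y) = F x + F y" and sc: "\<And>c x. F (scl c x) = scale c (F x)"
  shows "F x = lext scale (\<lambda>a. F (vec a)) x"
proof -
  have F0: "F 0 = 0" using add[of 0 0] by simp
  have s: "F (sum g A) = (\<Sum>i\<in>A. F (g i))" for g and A :: "'b set"
    by (induction A rule: infinite_finite_induct) (auto simp: add F0)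
  have "x = (\<Sum>a\<in>keys x. scl (lookup x a) (vec a))"
    by (rule poly_mapping_eqI)
      (simp add: lookup_sum lookup_single when_def if_distrib[where f = "(*) _"] in_keys_iff cong: if_cong)
  hence "F x = (\<Sum>a\<in>keys x. scale (lookup x a) (F (vec a)))"
    by (metis (no_types, lifting) s sc sum.cong)
  thus ?thesis by (simp add: lext_def)
qed

text \<open>Used to reduce identities on free algebras and modules to single words or basis
  vectors.\<close>

lemma linear_ext_eq:
  assumes "\<And>x y. F (x + y) = F x + F y" "\<And>c x. F (scl c x) = scale c (F x)"
    and "\<And>x y. G (x + y) = G x + G y" "\<And>c x. G (scl c x) = scale c (G x)"
    and "\<And>a. F (vec a) = G (vec a)"
  shows "F x = G x"
  using linear_eq_lext[of F x] linear_eq_lext[of G x] assms by simp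

end

interpretation scl: complex_vs scl by (simp add: complex_vs_def vector_space_scl)

interpretation cmult: complex_vs "(*) :: complex \<Rightarrow> complex \<Rightarrow> complex"
  by (simp add: complex_vs_def cmult.vector_space_axioms)

text \<open>At this instance the rule is associativity oriented to the left and would rearrange
  every product of complex numbers.\<close>

declare cmult.scale_scale [simp del]

lemma scl_mult_left: "scl c x * y = scl c (x * y)"
  by (simp add: scl_conv_mult mult.assoc)

text \<open>A scalar is a multiple of the empty word standing on the left. Moving it past a word
  uses that the empty word is neutral on both sides, so the claim is checked on words and extended
  linearly.\<close>

lemma scl_mult_right: "x * scl c y = scl c (x * y :: 'a::monoid_add vect)"
proof -
  have "vec a * scl c (vec b) = scl c (vec a * vec b)" for a b :: 'a
    by (simp add: scl_conv_mult mult_single)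
  hence "vec a * scl c y = scl c (vec a * y)" for a :: 'a and y
    by (intro scl.linear_ext_eq[where F = "\<lambda>y. vec a * scl c y" and x = y])
      (simp_all add: scl.scale_right_distrib distrib_left scl_conv_mult mult_single
        mult.assoc[symmetric] mult.commute[of c])
  thus ?thesis
    by (intro scl.linear_ext_eq[where F = "\<lambda>x. x * scl c y" and x = x])
      (simp_all add: scl.scale_right_distrib distrib_right scl_mult_left scl.scale_left_commute)
qed

lemma vec_mult: "vec a * vec b = vec (a + b)"
  by (simp add: mult_single)

lemma vec_zero: "vec 0 = 1"
  by simp

lemma keys_scl_subset: "keys (scl c x) \<subseteq> keys x"
  by (auto simp: in_keys_iff)

section \<open>Presented algebras as types\<close>

text \<open>
  A monoid with a set of relations for its monoid algebra. The augmentation \<open>aug\<close> ensures that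
  the presented algebra is nontrivial, so that it can be an instance of \<^class>\<open>ring_1\<close>.
\<close>

class presented_monoid = monoid_add +
  fixes rels :: "'a vect set" and aug :: "'a \<Rightarrow> complex"
  assumes aug_zero: "aug 0 = 1" and aug_add: "aug (a + b) = aug a * aug b"
    and aug_rels: "r \<in> rels \<Longrightarrow> lext (*) aug r = 0"

lemma ring_of_type: "ring (ring_of_type_algebra :: 'a::ring_1 ring)"
proof -
  have "\<exists>y. x + y = 0" for x :: 'a
    using add.right_inverse by blast
  thus ?thesis
    unfolding ring_of_type_algebra_def using add.right_inverse
    by unfold_locales (auto simp: algebra_simps Units_def)
qed

definition rel_ideal :: "'m::presented_monoid vect set" where
  "rel_ideal = genideal ring_of_type_algebra rels"

lemma ideal_rel_ideal: "ideal (rel_ideal :: 'm::presented_monoid vect set) ring_of_type_algebra"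
  unfolding rel_ideal_def by (rule ring.genideal_ideal[OF ring_of_type]) (simp add: ring_of_type_algebra_def)

lemma type_algebra_simps [simp]:
  "carrier ring_of_type_algebra = UNIV" "x \<otimes>\<^bsub>ring_of_type_algebra\<^esub> y = x * y"
  "x \<oplus>\<^bsub>ring_of_type_algebra\<^esub> y = x + y" "\<one>\<^bsub>ring_of_type_algebra\<^esub> = 1" "\<zero>\<^bsub>ring_of_type_algebra\<^esub> = 0"
  by (simp_all add: ring_of_type_algebra_def)

lemma rel_ideal_closed:
  shows rel_ideal_0: "0 \<in> rel_ideal"
    and rel_ideal_add: "x \<in> rel_ideal \<Longrightarrow> y \<in> rel_ideal \<Longrightarrow> x + y \<in> rel_ideal"
    and rel_ideal_multl: "x \<in> rel_ideal \<Longrightarrow> z * x \<in> rel_ideal"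
    and rel_ideal_multr: "x \<in> rel_ideal \<Longrightarrow> x * z \<in> rel_ideal"
    and rel_ideal_rels: "rels \<subseteq> rel_ideal"
  using additive_subgroup.zero_closed[OF ideal.axioms(1)[OF ideal_rel_ideal]]
    additive_subgroup.a_closed[OF ideal.axioms(1)[OF ideal_rel_ideal]]
    ideal.I_l_closed[OF ideal_rel_ideal] ideal.I_r_closed[OF ideal_rel_ideal]
    ring.genideal_self[OF ring_of_type, of rels]
  by (simp_all add: rel_ideal_def)

lemma rel_ideal_uminus: "x \<in> rel_ideal \<Longrightarrow> - x \<in> rel_ideal"
  using rel_ideal_multl[of x "- 1"] by simp

lemma rel_ideal_scl: "x \<in> rel_ideal \<Longrightarrow> scl c x \<in> rel_ideal"
  by (simp add: scl_conv_mult rel_ideal_multl)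

text \<open>The elements x with \<phi> (a x b) = 0 for all a, b form a two-sided ideal. Since \<phi>
  is only additive, this covers module actions, antihomomorphisms and tensoring with a fixed factor
  alike.\<close>

lemma ideal_kill:
  fixes \<phi> :: "'m::presented_monoid vect \<Rightarrow> 'v::ab_group_add"
  assumes x: "x \<in> rel_ideal"
    and add: "\<And>x y. \<phi> (x + y) = \<phi> x + \<phi> y"
    and kill: "\<And>r a b. r \<in> rels \<Longrightarrow> \<phi> (a * r * b) = 0"
  shows "\<phi> x = 0"
proof -
  define J where "J = {x. \<forall>a b. \<phi> (a * x * b) = 0}"
  have F0: "\<phi> 0 = 0" using add[of 0 0] by simp
  have neg: "\<phi> (- x) = - \<phi> x" for x using add[of x "- x"] F0 by (simp add: eq_neg_iff_add_eq_0 add.commute)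
  have "ideal J ring_of_type_algebra"
  proof (rule idealI[OF ring_of_type])
    show "subgroup J (add_monoid (ring_of_type_algebra :: 'm vect ring))"
    proof
      fix x assume "x \<in> J"
      moreover have "inv\<^bsub>add_monoid (ring_of_type_algebra :: 'm vect ring)\<^esub> x = - x"
        by (rule group.inv_equality[OF abelian_group.a_group[OF ring.is_abelian_group[OF ring_of_type]]])
          (simp_all add: ring_of_type_algebra_def)
      ultimately show "inv\<^bsub>add_monoid (ring_of_type_algebra :: 'm vect ring)\<^esub> x \<in> J"
        by (simp add: J_def neg)
    qed (auto simp: J_def F0 distrib_left distrib_right add ring_of_type_algebra_def)
  next
    fix a x :: "'m vect" assume "a \<in> J"
    thus "x \<otimes>\<^bsub>ring_of_type_algebra\<^esub> a \<in> J" "a \<otimes>\<^bsub>ring_of_type_algebra\<^esub> x \<in> J"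
      by (auto simp: J_def mult.assoc[symmetric]) (metis mult.assoc)
  qed
  moreover have "rels \<subseteq> J" using kill by (auto simp: J_def)
  ultimately have "rel_ideal \<subseteq> J"
    unfolding rel_ideal_def by (intro ring.genideal_minimal[OF ring_of_type])
  with x have "\<phi> (1 * x * 1) = 0" unfolding J_def by blast
  thus ?thesis by simp
qed

lemma (in complex_vs) ideal_kill_linear:
  fixes \<phi> :: "'m::presented_monoid \<Rightarrow> 'v"
  assumes x: "x \<in> rel_ideal"
    and kill: "\<And>r a b. r \<in> rels \<Longrightarrow> lext scale \<phi> (vec a * r * vec b) = 0"
  shows "lext scale \<phi> x = 0"
proof (rule ideal_kill[OF x lext_add])
  fix r a b :: "'m vect" assume r: "r \<in> rels"
  have "lext scale \<phi> (vec u * r * b) = 0" for u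
    by (subst linear_ext_eq[of "\<lambda>b. lext scale \<phi> (vec u * r * b)" "\<lambda>_. 0"])
      (simp_all add: distrib_left lext_add scl_mult_right lext_scl kill[OF r])
  thus "lext scale \<phi> (a * r * b) = 0"
    by (subst linear_ext_eq[of "\<lambda>a. lext scale \<phi> (a * r * b)" "\<lambda>_. 0"])
      (simp_all add: distrib_right lext_add scl_mult_left lext_scl)
qed

lemma lext_aug_mult: "lext (*) aug (x * y) = lext (*) aug x * lext (*) aug (y :: 'm::presented_monoid vect)"
proof -
  have "lext (*) aug (vec a * y) = aug a * lext (*) aug y" for a :: 'm
    by (rule cmult.linear_ext_eq)
      (simp_all add: distrib_left cmult.lext_add cmult.lext_scl scl_mult_right vec_mult aug_add mult.left_commute)
  thus ?thesis
    by (intro cmult.linear_ext_eq[where F = "\<lambda>x. lext (*) aug (x * y)" and x = x])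
      (simp_all add: distrib_right cmult.lext_add cmult.lext_scl scl_mult_left)
qed

text \<open>The augmentation is a character which kills every relation but sends 1 to 1.\<close>

lemma one_not_in_rel_ideal: "1 \<notin> (rel_ideal :: 'm::presented_monoid vect set)"
proof
  assume "1 \<in> (rel_ideal :: 'm vect set)"
  hence "lext (*) aug (1 :: 'm vect) = 0"
    by (rule cmult.ideal_kill_linear) (simp add: lext_aug_mult aug_rels)
  thus False by (metis vec_zero cmult.lext_vec aug_zero zero_neq_one)
qed

quotient_type (overloaded) 'm alg = "'m::presented_monoid vect" / "\<lambda>x y. x - y \<in> rel_ideal"
  morphisms rep_alg pr
proof (rule equivpI)
  show "reflp (\<lambda>x y. x - y \<in> rel_ideal)" by (simp add: reflp_def rel_ideal_0)
  show "symp (\<lambda>x y. x - y \<in> rel_ideal)" by (auto simp: symp_def dest: rel_ideal_uminus)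
  show "transp (\<lambda>x y. x - y \<in> rel_ideal)" by (auto simp: transp_def dest: rel_ideal_add)
qed

instantiation alg :: (presented_monoid) ring_1
begin

lift_definition zero_alg :: "'a alg" is 0 .
lift_definition one_alg :: "'a alg" is 1 .
lift_definition plus_alg :: "'a alg \<Rightarrow> 'a alg \<Rightarrow> 'a alg" is "(+)"
  by (metis (no_types, opaque_lifting) add_diff_add rel_ideal_add)
lift_definition uminus_alg :: "'a alg \<Rightarrow> 'a alg" is uminus
  by (metis minus_diff_eq minus_diff_minus rel_ideal_uminus)
lift_definition minus_alg :: "'a alg \<Rightarrow> 'a alg \<Rightarrow> 'a alg" is "(-)"
proof -
  fix a b c d :: "'a vect"
  assume "a - b \<in> rel_ideal" "c - d \<in> rel_ideal"
  hence "(a - b) + - (c - d) \<in> rel_ideal" by (intro rel_ideal_add rel_ideal_uminus)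
  thus "a - c - (b - d) \<in> rel_ideal" by (simp add: algebra_simps)
qed
lift_definition times_alg :: "'a alg \<Rightarrow> 'a alg \<Rightarrow> 'a alg" is "(*)"
proof -
  fix a b c d :: "'a vect"
  assume "a - b \<in> rel_ideal" "c - d \<in> rel_ideal"
  hence "(a - b) * c + b * (c - d) \<in> rel_ideal" by (intro rel_ideal_add rel_ideal_multl rel_ideal_multr)
  thus "a * c - b * d \<in> rel_ideal" by (simp add: algebra_simps)
qed

instance
proof
  show "(0 :: 'a alg) \<noteq> 1"
    by transfer (use one_not_in_rel_ideal[where 'm = 'a] rel_ideal_uminus in fastforce)
qed (transfer; simp add: algebra_simps rel_ideal_0)+

end

lift_definition sca :: "complex \<Rightarrow> 'm::presented_monoid alg \<Rightarrow> 'm alg" (infixr \<open>*s\<close> 75) is scl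
  by (metis rel_ideal_scl scl.scale_right_diff_distrib)

lemma pr_eq_iff: "pr x = pr y \<longleftrightarrow> x - y \<in> rel_ideal"
  by (rule alg.abs_eq_iff)

lemma pr_0 [simp]: "pr 0 = 0" and pr_1 [simp]: "pr 1 = 1"
  and pr_add [simp]: "pr (x + y) = pr x + pr y" and pr_diff [simp]: "pr (x - y) = pr x - pr y"
  and pr_uminus [simp]: "pr (- x) = - pr x" and pr_mult [simp]: "pr (x * y) = pr x * pr y"
  and pr_scl [simp]: "pr (scl c x) = c *s pr x"
  by (simp_all add: zero_alg_def one_alg_def plus_alg.abs_eq minus_alg.abs_eq uminus_alg.abs_eq
      times_alg.abs_eq sca.abs_eq)

lemma pr_eq_0_iff: "pr x = 0 \<longleftrightarrow> x \<in> rel_ideal"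
  using pr_eq_iff[of x 0] by simp

lemma pr_rel: "x \<in> rels \<Longrightarrow> pr x = 0"
  using pr_eq_0_iff rel_ideal_rels by blast

lemma pr_power [simp]: "pr (x ^ n) = pr x ^ n"
  by (induction n) simp_all

lemma pr_sum [simp]: "pr (sum f A) = (\<Sum>i\<in>A. pr (f i))"
  by (induction A rule: infinite_finite_induct) simp_all

lemma pr_surj: "\<exists>x. y = pr x"
  by (induction y rule: alg.abs_induct) auto

interpretation sca: complex_vs "(*s) :: complex \<Rightarrow> 'm::presented_monoid alg \<Rightarrow> 'm alg"
  by unfold_locales (transfer; simp add: rel_ideal_0 scl.scale_right_distrib scl.scale_left_distrib)+

lemma sca_mult_left [simp]: "(c *s x) * y = c *s (x * y)"
  and sca_mult_right [simp]: "x * (c *s y) = c *s (x * y)"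
  by (transfer; simp add: scl_mult_left scl_mult_right rel_ideal_0)+

lemma sca_power: "(c *s x) ^ n = c ^ n *s (x ^ n)"
  by (induction n) simp_all

lemma pr_lext: "pr (lext scl g x) = lext (*s) (\<lambda>a. pr (g a)) x"
  by (simp add: lext_def)

lemma pr_conv_lext: "pr x = lext (*s) (\<lambda>a. pr (vec a)) x"
  by (rule sca.linear_eq_lext) simp_all

subsection \<open>The quotient ring of cosets\<close>

lemma cls_eq: "cls rels x = {y. pr y = pr x}"
proof -
  have "cls rels x = (\<lambda>i. i + x) ` rel_ideal"
    by (auto simp: cls_def a_r_coset_def r_coset_def rel_ideal_def ring_of_type_algebra_def)
  also have "\<dots> = {y. pr y = pr x}"
    by (auto simp: pr_eq_iff intro!: image_eqI[of _ _ "_ - x"])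
  finally show ?thesis .
qed

text \<open>The link between the quotient type and the sets that form the carrier of
  \<open>presented rels\<close>; ring operations on cosets are computed in the type through
  it.\<close>

definition coset :: "'m::presented_monoid alg \<Rightarrow> 'm vect set" where
  "coset a = {y. pr y = a}"

lemma cls_conv_coset: "cls rels x = coset (pr x)"
  by (simp add: cls_eq coset_def)

lemma coset_inject [simp]: "coset a = coset b \<longleftrightarrow> a = b"
  using pr_surj[of a] pr_surj[of b] by (auto simp: coset_def)

text \<open>\<open>the_elem\<close> is meaningful once the map is constant on the class. This is the
  obligation behind each map in the definitions that is given on representatives.\<close>

lemma quot_map_coset:
  assumes "\<And>x y. pr x = pr y \<Longrightarrow> f x = f y"
  shows "quot_map f (coset (pr x)) = f x"
proof -
  have 1: "f y = f x" if "y \<in> coset (pr x)" for y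
    using assms[of y x] that by (simp add: coset_def)
  have 2: "x \<in> coset (pr x)" by (simp add: coset_def)
  have "f ` coset (pr x) = {f x}" using 1 2 by blast
  thus ?thesis by (simp add: quot_map_def)
qed

lemma presented_carrier: "carrier (presented (rels :: 'm::presented_monoid vect set)) = range coset"
proof -
  have "carrier (presented (rels :: 'm vect set)) = range (cls rels)"
    by (auto simp: presented_def FactRing_def A_RCOSETS_def RCOSETS_def cls_def a_r_coset_def
        ring_of_type_algebra_def)
  also have "\<dots> = range coset"
  proof safe
    fix a :: "'m alg" show "coset a \<in> range (cls rels)"
      using pr_surj[of a] by (auto simp: cls_conv_coset[symmetric])
  qed (simp add: cls_conv_coset)
  finally show ?thesis .
qed

lemma presented_simps [simp]:
  fixes a b :: "'m::presented_monoid alg"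
  shows "coset a \<otimes>\<^bsub>presented rels\<^esub> coset b = coset (a * b)"
    and "coset a \<oplus>\<^bsub>presented rels\<^esub> coset b = coset (a + b)"
    and "\<one>\<^bsub>presented (rels :: 'm vect set)\<^esub> = coset 1"
    and "\<zero>\<^bsub>presented (rels :: 'm vect set)\<^esub> = coset 0"
proof -
  obtain x y where xy: "a = pr x" "b = pr y" using pr_surj by metis
  interpret I: ideal "rel_ideal :: 'm vect set" ring_of_type_algebra by (rule ideal_rel_ideal)
  have c: "coset (pr z) = rel_ideal +>\<^bsub>ring_of_type_algebra\<^esub> z" for z :: "'m vect"
    by (simp add: cls_conv_coset[symmetric] cls_def rel_ideal_def)
  have P: "presented (rels :: 'm vect set) = ring_of_type_algebra Quot rel_ideal"
    by (simp add: presented_def rel_ideal_def)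
  show "coset a \<otimes>\<^bsub>presented rels\<^esub> coset b = coset (a * b)"
    using I.rcoset_mult_add[of x y] by (simp add: xy c P FactRing_def flip: pr_mult)
  show "coset a \<oplus>\<^bsub>presented rels\<^esub> coset b = coset (a + b)"
    using I.a_rcos_sum[of x y] by (simp add: xy c P FactRing_def flip: pr_add)
  show "\<one>\<^bsub>presented (rels :: 'm vect set)\<^esub> = coset 1"
    using c[of 1] by (simp add: P FactRing_def)
  have "coset (0 :: 'm alg) = rel_ideal"
    by (auto simp: coset_def pr_eq_0_iff)
  thus "\<zero>\<^bsub>presented (rels :: 'm vect set)\<^esub> = coset 0"
    by (simp add: P FactRing_def)
qed

lemma ring_presented: "ring (presented (rels :: 'm::presented_monoid vect set))"
  unfolding presented_def rel_ideal_def[symmetric] by (rule ideal.quotient_is_ring[OF ideal_rel_ideal])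

lemma scalar_mult_coset [simp]: "scalar_mult rels c (coset a) = coset (c *s a)"
  by (simp add: scalar_mult_def cls_conv_coset)

lemma finsum_coset:
  fixes f :: "'i \<Rightarrow> 'm::presented_monoid alg"
  assumes "finite A"
  shows "finsum (presented rels) (\<lambda>i. coset (f i)) A = coset (sum f A)"
proof -
  interpret ring "presented (rels :: 'm vect set)" by (rule ring_presented)
  show ?thesis using assms
    by (induction A) (simp_all add: Pi_def presented_carrier)
qed

lemma inv_coset:
  assumes "a * b = 1" "b * a = (1 :: 'm::presented_monoid alg)"
  shows "inv\<^bsub>presented rels\<^esub> (coset a) = coset b"
proof -
  interpret ring "presented (rels :: 'm vect set)" by (rule ring_presented)
  show ?thesis
    by (rule inv_char) (simp_all add: assms presented_carrier)
qed

section \<open>Newton expansions at a root of unity\<close>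

text \<open>The eigenvalues of the rescaled Casimir elements have this form. Its invariance under
  inversion is the reason why two nodes can coincide.\<close>

definition csum :: "complex \<Rightarrow> complex" where
  "csum x = x + inverse x"

lemma smult_sum_right: "smult c (sum f A) = (\<Sum>i\<in>A. smult c (f i))"
  by (induction A rule: infinite_finite_induct) (simp_all add: smult_add_right)

lemma csum_diff:
  assumes "a \<noteq> 0" "b \<noteq> 0"
  shows "csum a - csum b = (a - b) * (1 - inverse (a * b))"
proof -
  have "(a - b) * (1 - inverse a * inverse b) = a - b - (a * inverse a) * inverse b + (b * inverse b) * inverse a"
    by (simp add: algebra_simps)
  with assms show ?thesis by (simp add: csum_def)
qed

lemma csum_eq_iff:
  assumes "a \<noteq> 0" "b \<noteq> 0"
  shows "csum a = csum b \<longleftrightarrow> a = b \<or> a * b = 1"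
proof -
  have "csum a = csum b \<longleftrightarrow> (a - b) * (1 - inverse (a * b)) = 0"
    by (metis csum_diff[OF assms] eq_iff_diff_eq_0)
  also have "\<dots> \<longleftrightarrow> a = b \<or> a * b = 1"
    unfolding mult_eq_0_iff right_minus_eq by (metis inverse_eq_1_iff)
  finally show ?thesis .
qed

lemma csum_inverse [simp]: "csum (inverse x) = csum x"
  by (simp add: csum_def)

definition newton :: "(nat \<Rightarrow> complex) \<Rightarrow> nat \<Rightarrow> complex poly" where
  "newton n m = (\<Prod>l<m. [:- n l, 1:])"

lemma newton_0 [simp]: "newton n 0 = 1"
  by (simp add: newton_def)

lemma newton_Suc: "newton n (Suc m) = newton n m * [:- n m, 1:]"
  unfolding newton_def by (rule prod.lessThan_Suc)

lemma newton_shift: "newton n (Suc m) = [:- n 0, 1:] * newton (\<lambda>l. n (Suc l)) m"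
  unfolding newton_def by (rule prod.lessThan_Suc_shift)

lemma poly_newton: "poly (newton n m) c = (\<Prod>l<m. c - n l)"
  by (simp add: newton_def poly_prod)

text \<open>If the coefficients satisfy this recursion, two Newton expansions agree away from the first node.\<close>

lemma newton_recursion:
  assumes p: "0 < p" and rec: "\<And>m. Suc m < p \<Longrightarrow> b m - a m = (n (Suc m) - n 0) * a (Suc m)"
  shows "[:- n 0, 1:] * ((\<Sum>m<p. smult (b m) (newton (\<lambda>l. n (Suc l)) m)) - (\<Sum>m<p. smult (a m) (newton n m)))
    = smult (b (p - 1) - a (p - 1)) (newton n p)"
proof -
  obtain r where r: "p = Suc r" using p by (cases p) auto
  \<comment> \<open>From X - n_0 = (X - n_m) + (n_m - n_0). The extra multiple of the m-th Newton
    product is absorbed by \<open>rec\<close> after an index shift.\<close>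
  have s: "[:- n 0, 1:] * newton n m = newton n (Suc m) + smult (n m - n 0) (newton n m)" for m
  proof -
    have "[:- n 0, 1:] = [:- n m, 1:] + [:n m - n 0:]" by simp
    hence "[:- n 0, 1:] * newton n m = [:- n m, 1:] * newton n m + [:n m - n 0:] * newton n m"
      by (simp only: distrib_right)
    thus ?thesis by (simp add: newton_Suc mult.commute)
  qed
  have "[:- n 0, 1:] * ((\<Sum>m<p. smult (b m) (newton (\<lambda>l. n (Suc l)) m)) - (\<Sum>m<p. smult (a m) (newton n m)))
      = (\<Sum>m<p. smult (b m) (newton n (Suc m))) -
        (\<Sum>m<p. smult (a m) (newton n (Suc m) + smult (n m - n 0) (newton n m)))"
    by (simp only: right_diff_distrib sum_distrib_left mult_smult_right newton_shift[symmetric] s)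
  also have "\<dots> = (\<Sum>m<p. smult (b m - a m) (newton n (Suc m))) - (\<Sum>m<p. smult (a m * (n m - n 0)) (newton n m))"
  proof -
    have "smult \<beta> N - smult \<alpha> (N + smult \<delta> M) = smult (\<beta> - \<alpha>) N - smult (\<alpha> * \<delta>) M"
      for \<alpha> \<beta> \<delta> and M N :: "complex poly"
      by (simp add: smult_add_right smult_diff_left)
    thus ?thesis by (simp only: sum_subtractf[symmetric])
  qed
  also have "(\<Sum>m<p. smult (a m * (n m - n 0)) (newton n m)) =
      (\<Sum>m<r. smult (a (Suc m) * (n (Suc m) - n 0)) (newton n (Suc m)))"
    unfolding r by (subst sum.lessThan_Suc_shift) simp
  also have "\<dots> = (\<Sum>m<r. smult (b m - a m) (newton n (Suc m)))"
    by (rule sum.cong) (simp_all add: rec r mult.commute)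
  finally show ?thesis by (simp add: r)
qed

lemma newton_root:
  assumes "l < p"
  shows "poly (newton n p) (n l) = 0"
  using assms by (auto simp: poly_newton)

lemma newton_double_root:
  assumes "i < j" "j < p" "n i = n j"
  shows "[:- n i, 1:] ^ 2 dvd newton n p"
proof -
  have "newton n p = (\<Prod>l\<in>{i, j} \<union> ({..<p} - {i, j}). [:- n l, 1:])"
    unfolding newton_def by (rule prod.cong) (use assms in auto)
  also have "\<dots> = (\<Prod>l\<in>{i, j}. [:- n l, 1:]) * (\<Prod>l\<in>{..<p} - {i, j}. [:- n l, 1:])"
    by (rule prod.union_disjoint) auto
  also have "(\<Prod>l\<in>{i, j}. [:- n l, 1:]) = [:- n i, 1:] ^ 2"
    using assms by (simp add: power2_eq_square)
  finally show ?thesis by simp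
qed

lemma poly_pderiv_linear_mult:
  "poly (pderiv ([:- a, 1:] * P)) c = poly P c + (c - a) * poly (pderiv P) (c :: complex)"
  by (simp only: pderiv_mult poly_add poly_mult) (simp add: pderiv_pCons)

lemma linear_square_dvd_iff:
  "[:- c, 1:] ^ 2 dvd (P :: complex poly) \<longleftrightarrow> poly P c = 0 \<and> poly (pderiv P) c = 0"
proof
  assume "[:- c, 1:] ^ 2 dvd P"
  then obtain R where "P = [:- c, 1:] ^ 2 * R" by (rule dvdE)
  hence R: "P = [:- c, 1:] * ([:- c, 1:] * R)" by (simp only: power2_eq_square mult.assoc)
  show "poly P c = 0 \<and> poly (pderiv P) c = 0"
    unfolding R by (simp only: poly_pderiv_linear_mult) simp
next
  assume a: "poly P c = 0 \<and> poly (pderiv P) c = 0"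
  then obtain R where R: "P = [:- c, 1:] * R" by (auto simp: poly_eq_0_iff_dvd elim!: dvdE)
  with a have "poly R c = 0" by (simp add: R poly_pderiv_linear_mult del: mult_pCons_left)
  then obtain S where "R = [:- c, 1:] * S" by (auto simp: poly_eq_0_iff_dvd elim!: dvdE)
  with R have "P = [:- c, 1:] ^ 2 * S" by (simp only: power2_eq_square mult.assoc)
  thus "[:- c, 1:] ^ 2 dvd P" by (rule dvdI)
qed

text \<open>At a node other than n_0 the factor X - n_0 does not vanish, so H inherits the zeros of
  the full node product: a simple one at each such node, a double one where two indices give the
  same node.\<close>

lemma newton_recursion_jets:
  assumes eq: "[:- n 0, 1:] * H = smult k (newton n p)"
    and i: "i < p" "n i \<noteq> n 0"
  shows "poly H (n i) = 0" and "\<And>j. i < j \<Longrightarrow> j < p \<Longrightarrow> n i = n j \<Longrightarrow> poly (pderiv H) (n i) = 0"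
proof -
  show z: "poly H (n i) = 0"
    using arg_cong[OF eq, of "\<lambda>P. poly P (n i)"] newton_root[OF i(1)] i(2) by simp
  fix j assume "i < j" "j < p" "n i = n j"
  hence "poly (pderiv (newton n p)) (n i) = 0"
    using newton_double_root[of i j p n] by (simp add: linear_square_dvd_iff)
  hence "poly (pderiv ([:- n 0, 1:] * H)) (n i) = 0"
    by (simp only: eq pderiv_smult poly_smult mult_zero_right)
  with z i(2) show "poly (pderiv H) (n i) = 0"
    by (simp add: poly_pderiv_linear_mult del: mult_pCons_left)
qed

lemma pderiv_newton_first_node:
  assumes "0 < m"
  shows "poly (pderiv (newton n m)) (n 0) = (\<Prod>l=1..<m. n 0 - n l)"
proof -
  obtain r where r: "m = Suc r" using assms by (cases m) auto
  have "poly (pderiv (newton n m)) (n 0) = (\<Prod>l<r. n 0 - n (Suc l))"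
    by (simp only: r newton_shift poly_pderiv_linear_mult) (simp add: poly_newton)
  also have "\<dots> = (\<Prod>l=1..<m. n 0 - n l)"
    by (rule prod.reindex_bij_witness[of _ "\<lambda>l. l - 1" Suc]) (auto simp: r)
  finally show ?thesis .
qed

text \<open>At the first node every nonconstant Newton product vanishes. To first order a product
  survives until the node reappears at index j, so the derivative is a sum up to j.\<close>

lemma newton_sum_first_node:
  assumes p: "0 < p" and j: "0 < j" "j < p" "n j = n 0"
  shows "poly (\<Sum>m<p. smult (a m) (newton n m)) (n 0) = a 0"
    and "poly (pderiv (\<Sum>m<p. smult (a m) (newton n m))) (n 0) = (\<Sum>m=1..j. a m * (\<Prod>l=1..<m. n 0 - n l))"
proof -
  let ?N = "(\<Sum>m<p. smult (a m) (newton n m))"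
  have z: "poly (newton n m) (n 0) = 0" if "m \<noteq> 0" for m
    using that by (intro newton_root) simp
  have "poly ?N (n 0) = (\<Sum>m<p. if m = 0 then a 0 else 0)"
    unfolding poly_sum by (rule sum.cong) (auto simp: z)
  thus "poly ?N (n 0) = a 0" using p by simp
  have s: "pderiv ?N = (\<Sum>m<p. smult (a m) (pderiv (newton n m)))"
    by (simp add: higher_pderiv_sum[of 1, simplified] pderiv_smult)
  have "poly (pderiv ?N) (n 0) = (\<Sum>m<p. a m * poly (pderiv (newton n m)) (n 0))"
    by (simp add: s poly_sum)
  also have "\<dots> = (\<Sum>m=1..j. a m * poly (pderiv (newton n m)) (n 0))"
  proof (rule sum.mono_neutral_right)
    show "\<forall>m\<in>{..<p} - {1..j}. a m * poly (pderiv (newton n m)) (n 0) = 0"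
    proof
      fix m assume m: "m \<in> {..<p} - {1..j}"
      show "a m * poly (pderiv (newton n m)) (n 0) = 0"
      proof (cases "m = 0")
        case False
        with m j have "(\<Prod>l=1..<m. n 0 - n l) = 0" by (intro prod_zero) (auto intro!: bexI[of _ j])
        with False show ?thesis by (simp add: pderiv_newton_first_node)
      qed simp
    qed
  qed (use j in auto)
  also have "\<dots> = (\<Sum>m=1..j. a m * (\<Prod>l=1..<m. n 0 - n l))"
    by (intro sum.cong) (auto simp: pderiv_newton_first_node)
  finally show "poly (pderiv ?N) (n 0) = (\<Sum>m=1..j. a m * (\<Prod>l=1..<m. n 0 - n l))" .
qed

text \<open>When j grows by one, the m-th summand changes by \<open>a m - a (Suc m)\<close>. The
  changes telescope to \<open>a 1\<close> = 1, since the last \<open>a\<close> contains the factor 1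
  - t^0.\<close>

lemma sum_q_harmonic:
  fixes t :: complex
  assumes "\<And>m. 1 \<le> m \<Longrightarrow> m \<le> j \<Longrightarrow> t ^ m \<noteq> 1"
  shows "(\<Sum>m=1..j. (\<Prod>l<m. 1 - t ^ (j - l)) / (1 - t ^ m)) = of_nat j"
  using assms
proof (induction j)
  case (Suc j)
  define a where "a m = (\<Prod>l=1..<m. 1 - t ^ (Suc j - l))" for m
  let ?P = "\<lambda>m. (\<Prod>l<m. 1 - t ^ (j - l))"
  let ?R = "\<lambda>m. (\<Prod>l<m. 1 - t ^ (Suc j - l))"
  have a_Suc: "a (Suc m) = a m * (1 - t ^ (Suc j - m))" if "1 \<le> m" for m
    using that by (simp add: a_def)
  have step: "(?R m) / (1 - t ^ m) - (?P m) / (1 - t ^ m) = a m - a (Suc m)"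
    if m: "m \<in> {1..Suc j}" for m
  proof -
    obtain r where r: "m = Suc r" using m by (cases m) auto
    have e1: "(?R m) = (1 - t ^ Suc j) * a m"
    proof -
      have "(?R m) = (1 - t ^ Suc j) * (\<Prod>l<r. 1 - t ^ (Suc j - Suc l))"
        unfolding r by (subst prod.lessThan_Suc_shift) simp
      also have "(\<Prod>l<r. 1 - t ^ (Suc j - Suc l)) = a m" unfolding a_def
        by (rule prod.reindex_bij_witness[of _ "\<lambda>l. l - 1" Suc]) (auto simp: r)
      finally show ?thesis .
    qed
    have e2: "(?P m) = a m * (1 - t ^ (Suc j - m))"
    proof -
      have "(?P m) = a (Suc m)" unfolding a_def
        by (rule prod.reindex_bij_witness[of _ "\<lambda>l. l - 1" Suc]) auto
      thus ?thesis using m by (simp add: a_Suc)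
    qed
    have tm: "1 - t ^ m \<noteq> 0" using Suc.prems[of m] m by auto
    have tt: "t ^ Suc j = t ^ (Suc j - m) * t ^ m" using m by (simp flip: power_add)
    have "(?R m) - (?P m) = a m * t ^ (Suc j - m) * (1 - t ^ m)"
    proof -
      have "(1 - u * w) * A - A * (1 - u) = A * u * (1 - w)" for u w A :: complex
        by (simp add: algebra_simps)
      thus ?thesis unfolding e1 e2 tt .
    qed
    hence "((?R m) - (?P m)) / (1 - t ^ m) = a m * t ^ (Suc j - m)"
      using tm by simp
    also have "\<dots> = a m - a (Suc m)" using m by (simp add: a_Suc algebra_simps)
    finally show ?thesis by (simp add: diff_divide_distrib)
  qed
  have "(\<Sum>m=1..Suc j. (?R m) / (1 - t ^ m)) - (\<Sum>m=1..Suc j. (?P m) / (1 - t ^ m))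
     = (\<Sum>m=1..Suc j. a m - a (Suc m))"
    unfolding sum_subtractf[symmetric] by (rule sum.cong[OF refl step])
  also have "\<dots> = a 1 - a (Suc (Suc j))"
  proof -
    have "(\<Sum>m=1..n. a m - a (Suc m)) = a 1 - a (Suc n)" for n by (induction n) simp_all
    thus ?thesis .
  qed
  also have "a (Suc (Suc j)) = 0" unfolding a_def by (intro prod_zero) (auto intro!: bexI[of _ "Suc j"])
  also have "a 1 = 1" by (simp add: a_def)
  finally have "(\<Sum>m=1..Suc j. (?R m) / (1 - t ^ m)) = 1 + (\<Sum>m=1..Suc j. (?P m) / (1 - t ^ m))"
    by (simp add: algebra_simps)
  also have "(\<Sum>m=1..Suc j. (?P m) / (1 - t ^ m)) = (\<Sum>m=1..j. (?P m) / (1 - t ^ m))"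
  proof -
    have "(\<Prod>l<Suc j. 1 - t ^ (j - l)) = 0" by (intro prod_zero) (auto intro!: bexI[of _ j])
    thus ?thesis by simp
  qed
  also have "\<dots> = of_nat j" using Suc by simp
  finally show ?case by simp
qed simp

text \<open>In other words, Q^2 is a primitive p-th root of unity; Q^p is then a sign.\<close>

locale qroot =
  fixes Q :: complex and p :: nat
  assumes p_ge_2: "2 \<le> p" and Q_root: "Q ^ (2 * p) = 1"
    and Q_primitive: "\<And>k. 0 < k \<Longrightarrow> k < p \<Longrightarrow> Q ^ (2 * k) \<noteq> 1"
begin

abbreviation iQ :: complex where "iQ \<equiv> inverse Q"
definition h :: complex where "h = Q - iQ"
text \<open>\<open>br k\<close> is h [k] and \<open>brf m\<close> is h^m [m]!, the q-integer and
  q-factorial cleared of denominators.\<close>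

definition br :: "nat \<Rightarrow> complex" where "br k = Q ^ k - iQ ^ k"
definition brf :: "nat \<Rightarrow> complex" where "brf m = (\<Prod>k=1..m. br k)"

lemma Q_nz [simp]: "Q \<noteq> 0"
  using Q_root p_ge_2 by (intro notI) (simp add: power_0_left)

lemma Q_iQ [simp]: "Q ^ k * iQ ^ k = 1" "iQ ^ k * Q ^ k = 1"
  by (simp_all add: power_mult_distrib[symmetric])

lemma br_0 [simp]: "br 0 = 0" and br_1 [simp]: "br 1 = h" "br (Suc 0) = h"
  by (simp_all add: br_def h_def)

lemma br_nz: "0 < k \<Longrightarrow> k < p \<Longrightarrow> br k \<noteq> 0"
proof
  assume k: "0 < k" "k < p" and "br k = 0"
  hence "Q ^ k = iQ ^ k" by (simp add: br_def)
  hence "Q ^ k * Q ^ k = 1" using Q_iQ(1)[of k] by metis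
  with Q_primitive[OF k] show False by (simp add: mult_2 power_add)
qed

lemma h_nz [simp]: "h \<noteq> 0"
  using br_nz[of 1] p_ge_2 by simp

lemma brf_0 [simp]: "brf 0 = 1" and brf_Suc: "brf (Suc m) = brf m * br (Suc m)"
  by (simp_all add: brf_def)

lemma brf_nz: "m < p \<Longrightarrow> brf m \<noteq> 0"
  by (auto simp: brf_def br_nz)

lemma Q_square_minus_1: "Q ^ (2 * k) - 1 = Q ^ k * br k"
  by (simp add: br_def right_diff_distrib mult_2 power_add)

lemma iQ_square_minus_1: "iQ ^ (2 * k) - 1 = - (iQ ^ k * br k)"
  by (simp add: br_def right_diff_distrib mult_2 power_add)

subsection \<open>The ribbon polynomial\<close>

text \<open>The coefficients that remain when the sum over m in v is applied to a vector of weight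
  x, with y = x Q (see \<open>ribbon_sum\<close>). The nodes csum (y Q^(2l)) are those of f^m e^m in
  \<open>fe_power\<close>.\<close>

definition rib_coeff :: "complex \<Rightarrow> nat \<Rightarrow> complex" where
  "rib_coeff y m = Q ^ (m * (m + 1) div 2) * y ^ m / brf m"

definition rib_poly :: "complex \<Rightarrow> complex poly" where
  "rib_poly y = (\<Sum>m<p. smult (rib_coeff y m) (newton (\<lambda>l. csum (y * Q ^ (2 * l))) m))"

lemma rib_coeff_Suc:
  "rib_coeff y (Suc m) = rib_coeff y m * Q ^ Suc m * y / br (Suc m)"
proof -
  have "Suc m * (Suc m + 1) div 2 = m * (m + 1) div 2 + Suc m" by simp
  thus ?thesis by (simp add: rib_coeff_def brf_Suc power_add)
qed

text \<open>Replacing y by y Q^2 deletes the first node. The factor y^2 Q^2 is what makes the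
  differences of coefficients fit \<open>newton_recursion\<close>.\<close>

lemma rib_recursion:
  assumes y: "y \<noteq> 0"
  obtains k where "[:- csum y, 1:] * (smult (y ^ 2 * Q ^ 2) (rib_poly (y * Q ^ 2)) - rib_poly y)
    = smult k (newton (\<lambda>l. csum (y * Q ^ (2 * l))) p)"
proof -
  let ?n = "\<lambda>l. csum (y * Q ^ (2 * l))"
  let ?a = "rib_coeff y" and ?b = "\<lambda>m. y ^ 2 * Q ^ 2 * rib_coeff (y * Q ^ 2) m"
  have rec: "?b m - ?a m = (?n (Suc m) - ?n 0) * ?a (Suc m)" if m: "Suc m < p" for m
  proof -
    have nz: "br (Suc m) \<noteq> 0" using br_nz m by simp
    have "?n (Suc m) - ?n 0 = (y * Q ^ (2 * Suc m) - y) * (1 - inverse (y * Q ^ (2 * Suc m) * y))"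
      using csum_diff[of "y * Q ^ (2 * Suc m)" y] y by simp
    also have "y * Q ^ (2 * Suc m) - y = y * (Q ^ Suc m * br (Suc m))"
      unfolding Q_square_minus_1[symmetric] by (simp only: right_diff_distrib mult_1_right)
    finally have "(?n (Suc m) - ?n 0) * ?a (Suc m) =
        rib_coeff y m * (Q ^ (2 * Suc m) * y ^ 2 * (1 - inverse (y * Q ^ (2 * Suc m) * y)))"
      using nz by (simp add: rib_coeff_Suc mult_2 power_add power2_eq_square)
    also have "Q ^ (2 * Suc m) * y ^ 2 * (1 - inverse (y * Q ^ (2 * Suc m) * y)) = Q ^ (2 * Suc m) * y ^ 2 - 1"
      using y by (simp add: field_simps power2_eq_square)
    also have "rib_coeff y m * (Q ^ (2 * Suc m) * y ^ 2 - 1) = ?b m - ?a m"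
    proof -
      have "rib_coeff (y * Q ^ 2) m = rib_coeff y m * Q ^ (2 * m)"
        by (simp add: rib_coeff_def power_mult_distrib power_mult)
      thus ?thesis by (simp add: algebra_simps power2_eq_square)
    qed
    finally show ?thesis by simp
  qed
  have p: "0 < p" using p_ge_2 by simp
  have n1: "(\<lambda>l. ?n (Suc l)) = (\<lambda>l. csum (y * Q ^ 2 * Q ^ (2 * l)))"
    by (simp add: power_add mult.assoc power2_eq_square)
  have s: "smult (y ^ 2 * Q ^ 2) (rib_poly (y * Q ^ 2)) = (\<Sum>m<p. smult (?b m) (newton (\<lambda>l. ?n (Suc l)) m))"
    unfolding rib_poly_def n1 by (simp add: smult_sum_right)
  have "[:- csum y, 1:] * (smult (y ^ 2 * Q ^ 2) (rib_poly (y * Q ^ 2)) - rib_poly y)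
    = smult (?b (p - 1) - ?a (p - 1)) (newton ?n p)"
    using newton_recursion[of p ?b ?a ?n, OF p rec] unfolding s unfolding rib_poly_def by simp
  thus thesis by (rule that)
qed

text \<open>The relation for y says that the nodes i and j coincide. If they also coincided with the
  first node, then Q^(2i) or Q^(2j) would be 1.\<close>

lemma node_ne_first:
  assumes y: "y \<noteq> 0" "y ^ 2 * Q ^ (2 * (i + j)) = 1" and ij: "0 < i" "i \<le> j" "j < p"
  shows "csum (y * Q ^ (2 * i)) \<noteq> csum y"
proof
  assume "csum (y * Q ^ (2 * i)) = csum y"
  then consider "y * Q ^ (2 * i) = y" | "y * Q ^ (2 * i) * y = 1"
    using csum_eq_iff[of "y * Q ^ (2 * i)" y] y by auto
  thus False
  proof cases
    case 1 thus False using y Q_primitive[of i] ij by auto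
  next
    case 2
    have "y ^ 2 * Q ^ (2 * (i + j)) = (y * Q ^ (2 * i) * y) * Q ^ (2 * j)"
      by (simp add: power2_eq_square power_add distrib_left)
    with 2 y Q_primitive[of j] ij show False by auto
  qed
qed

lemma rib_poly_first_node:
  assumes y: "y \<noteq> 0"
  shows "poly (rib_poly y) (csum y) = 1"
proof -
  have "poly (rib_poly y) (csum y) = (\<Sum>m<p. if m = 0 then 1 else 0)"
    unfolding rib_poly_def poly_sum
  proof (rule sum.cong)
    fix m
    show "poly (smult (rib_coeff y m) (newton (\<lambda>l. csum (y * Q ^ (2 * l))) m)) (csum y) = (if m = 0 then 1 else 0)"
      using newton_root[of 0 m "\<lambda>l. csum (y * Q ^ (2 * l))"] by (auto simp: rib_coeff_def)
  qed simp
  also have "\<dots> = 1" using p_ge_2 by simp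
  finally show ?thesis .
qed

text \<open>With t = Q^(-2) the hypothesis reads y^2 = t^j, and each Newton term becomes a fixed
  factor times a summand of \<open>sum_q_harmonic\<close>.\<close>

lemma rib_poly_deriv_first_node:
  assumes y: "y \<noteq> 0" "y ^ 2 * Q ^ (2 * j) = 1" and j: "0 < j" "j < p"
  shows "poly (pderiv (rib_poly y)) (csum y) = of_nat j / (inverse y - y)"
proof -
  let ?n = "\<lambda>l. csum (y * Q ^ (2 * l))"
  let ?t = "iQ ^ 2"
  have y2: "y * y = ?t ^ j" 
  proof -
    have "y * y = y ^ 2 * (Q ^ (2 * j) * iQ ^ (2 * j))" by (simp only: Q_iQ mult_1_right power2_eq_square)
    also have "\<dots> = iQ ^ (2 * j)" by (simp only: mult.assoc[symmetric] y(2) mult_1_left)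
    finally show ?thesis by (simp only: power_mult)
  qed
  have tn: "?t ^ m \<noteq> 1" if "1 \<le> m" "m \<le> j" for m
    using Q_primitive[of m] that j by (auto simp: power_mult[symmetric] power_inverse inverse_eq_1_iff)
  have tQ: "Q ^ (2 * m) = inverse (?t ^ m)" for m
    by (simp add: power_mult power_inverse)
  have n0: "?n j = ?n 0"
    using csum_eq_iff[of "y * Q ^ (2 * j)" y] y by (simp add: power2_eq_square mult_ac)
  have coeff: "rib_coeff y m * (\<Prod>l=1..<m. ?n 0 - ?n l) =
      inverse y * (?t ^ j / (1 - ?t ^ j)) * ((\<Prod>l<m. 1 - ?t ^ (j - l)) / (1 - ?t ^ m))"
    if m: "1 \<le> m" "m \<le> j" for m
    using m
  proof (induction m rule: dec_induct)
    case base
    have a: "1 - ?t \<noteq> 0" "1 - ?t ^ j \<noteq> 0" using tn[of 1] tn[of j] j by auto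
    have b: "br 1 = Q * (1 - ?t)" by (simp add: br_def field_simps power2_eq_square)
    have "rib_coeff y 1 = y / (1 - ?t)" unfolding rib_coeff_def brf_def using a by (simp add: b[simplified] del: power_inverse)
    moreover have "y = inverse y * ?t ^ j" using y y2 by (metis mult.assoc left_inverse mult_1)
    ultimately show ?case using a by simp
  next
    case (step m)
    have a: "1 - ?t ^ m \<noteq> 0" "1 - ?t ^ Suc m \<noteq> 0" using tn[of m] tn[of "Suc m"] step by auto
    have b: "br (Suc m) = Q ^ Suc m * (1 - ?t ^ Suc m)"
    proof -
      have "Q ^ k * iQ ^ (2 * k) = iQ ^ k" for k
        by (simp only: mult_2 power_add mult.assoc[symmetric] Q_iQ mult_1_left)
      thus ?thesis by (simp only: br_def right_diff_distrib power_mult[symmetric] mult_1_right)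
    qed
    have c: "rib_coeff y (Suc m) = rib_coeff y m * y / (1 - ?t ^ Suc m)"
      unfolding rib_coeff_Suc b by simp
    have d: "y * (?n 0 - ?n m) = (1 - ?t ^ m) * (1 - ?t ^ (j - m))"
    proof -
      have tt: "?t ^ j = ?t ^ (j - m) * ?t ^ m" using step by (simp flip: power_add)
      have t0: "?t ^ m \<noteq> 0" "?t ^ (j - m) \<noteq> 0" by auto
      have "y * (?n 0 - ?n m) = y * ((y - y * Q ^ (2 * m)) * (1 - inverse (y * (y * Q ^ (2 * m)))))"
        using csum_diff[of y "y * Q ^ (2 * m)"] y by simp
      also have "\<dots> = (y * y) * (1 - Q ^ (2 * m)) * (1 - inverse ((y * y) * Q ^ (2 * m)))"
        by (simp add: algebra_simps)
      also have "\<dots> = (?t ^ (j - m) * ?t ^ m) * (1 - inverse (?t ^ m)) * (1 - inverse (?t ^ (j - m) * ?t ^ m * inverse (?t ^ m)))"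
        by (simp only: y2 tQ tt)
      also have "\<dots> = (1 - ?t ^ m) * (1 - ?t ^ (j - m))"
        using t0 by (simp add: field_simps)
      finally show ?thesis .
    qed
    have "rib_coeff y (Suc m) * (\<Prod>l=1..<Suc m. ?n 0 - ?n l) =
        (rib_coeff y m * (\<Prod>l=1..<m. ?n 0 - ?n l)) * (y * (?n 0 - ?n m)) / (1 - ?t ^ Suc m)"
      using step(1) by (simp add: c)
    also have "\<dots> = inverse y * (?t ^ j / (1 - ?t ^ j)) * ((\<Prod>l<m. 1 - ?t ^ (j - l)) / (1 - ?t ^ m)) *
        ((1 - ?t ^ m) * (1 - ?t ^ (j - m))) / (1 - ?t ^ Suc m)"
    proof -
      have "rib_coeff y m * (\<Prod>l=1..<m. ?n 0 - ?n l) =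
          inverse y * (?t ^ j / (1 - ?t ^ j)) * ((\<Prod>l<m. 1 - ?t ^ (j - l)) / (1 - ?t ^ m))"
        using step by simp
      thus ?thesis by (simp only: d)
    qed
    also have "\<dots> = inverse y * (?t ^ j / (1 - ?t ^ j)) * ((\<Prod>l<Suc m. 1 - ?t ^ (j - l)) / (1 - ?t ^ Suc m))"
      using a(1) by simp
    finally show ?case .
  qed
  have "poly (pderiv (rib_poly y)) (csum y) = (\<Sum>m=1..j. rib_coeff y m * (\<Prod>l=1..<m. ?n 0 - ?n l))"
    using newton_sum_first_node(2)[of p j ?n "rib_coeff y"] j n0 unfolding rib_poly_def by simp
  also have "\<dots> = (\<Sum>m=1..j. inverse y * (?t ^ j / (1 - ?t ^ j)) * ((\<Prod>l<m. 1 - ?t ^ (j - l)) / (1 - ?t ^ m)))"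
    by (rule sum.cong) (use coeff in auto)
  also have "\<dots> = inverse y * (?t ^ j / (1 - ?t ^ j)) * of_nat j"
    unfolding sum_distrib_left[symmetric] using sum_q_harmonic[of j ?t] tn by simp
  also have "\<dots> = of_nat j / (inverse y - y)"
    unfolding y2[symmetric] using y by (simp add: field_simps)
  finally show ?thesis .
qed

text \<open>Nodes i and j coincide by the hypothesis on y. Induction on i: the data y Q^2, i - 1, j
  - 1 describe the same node, and each step multiplies by the current y^2 Q^2, so that the odd
  numbers in the exponents of Q add up to i^2.\<close>

lemma rib_poly_jet:
  assumes "y \<noteq> 0" "y ^ 2 * Q ^ (2 * (i + j)) = 1" "i \<le> j" "j < p"
  shows "poly (rib_poly y) (csum (y * Q ^ (2 * i))) = y ^ (2 * i) * Q ^ (2 * i ^ 2) \<and>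
    (i < j \<longrightarrow> poly (pderiv (rib_poly y)) (csum (y * Q ^ (2 * i))) =
      y ^ (2 * i) * Q ^ (2 * i ^ 2) * (of_nat (j - i) / (y * Q ^ (2 * j) - inverse (y * Q ^ (2 * j)))))"
  using assms
proof (induction i arbitrary: y j)
  case 0
  have "inverse y = y * Q ^ (2 * j)"
    using 0 by (metis add_0 inverse_unique mult.assoc power2_eq_square)
  thus ?case using rib_poly_first_node[of y] rib_poly_deriv_first_node[of y j] 0 by auto
next
  case (Suc i)
  let ?y = "y * Q ^ 2"
  let ?n = "\<lambda>l. csum (y * Q ^ (2 * l))"
  let ?H = "smult (y ^ 2 * Q ^ 2) (rib_poly ?y) - rib_poly y"
  obtain r where r: "j = Suc r" using Suc.prems by (cases j) auto
  have e: "?y ^ 2 * Q ^ (2 * (i + r)) = 1"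
  proof -
    have "?y ^ 2 * Q ^ (2 * (i + r)) = y ^ 2 * Q ^ (2 * (Suc i + j))"
    proof -
      have "2 * (Suc i + j) = 2 * 2 + 2 * (i + r)" by (simp add: r)
      thus ?thesis by (simp only: power_add power_mult_distrib power_mult mult.assoc)
    qed
    with Suc.prems show ?thesis by simp
  qed
  have IH: "poly (rib_poly ?y) (csum (?y * Q ^ (2 * i))) = ?y ^ (2 * i) * Q ^ (2 * i ^ 2)"
    "i < r \<Longrightarrow> poly (pderiv (rib_poly ?y)) (csum (?y * Q ^ (2 * i))) =
      ?y ^ (2 * i) * Q ^ (2 * i ^ 2) * (of_nat (r - i) / (?y * Q ^ (2 * r) - inverse (?y * Q ^ (2 * r))))"
    using Suc.IH[of ?y r] e Suc.prems r by auto
  have node: "?y * Q ^ (2 * i) = y * Q ^ (2 * Suc i)" "?y * Q ^ (2 * r) = y * Q ^ (2 * j)"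
    by (simp_all add: r power_add power2_eq_square mult_ac)
  have fac: "(y ^ 2 * Q ^ 2) * (?y ^ (2 * i) * Q ^ (2 * i ^ 2)) = y ^ (2 * Suc i) * Q ^ (2 * (Suc i) ^ 2)"
    by (simp add: power_mult_distrib power_mult[symmetric] power_add[symmetric] power2_eq_square mult_ac algebra_simps)
  obtain k where k: "[:- ?n 0, 1:] * ?H = smult k (newton ?n p)"
    using rib_recursion[of y] Suc.prems by auto
  have ne: "?n (Suc i) \<noteq> ?n 0"
    using node_ne_first[of y "Suc i" j] Suc.prems by simp
  have H0: "poly ?H (?n (Suc i)) = 0"
    using newton_recursion_jets(1)[OF k _ ne] Suc.prems by simp
  have nj: "?n (Suc i) = ?n j"
  proof -
    have "y * Q ^ (2 * Suc i) * (y * Q ^ (2 * j)) = 1"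
      using Suc.prems(2) by (simp add: power2_eq_square power_add distrib_left mult_ac)
    thus ?thesis using csum_eq_iff[of "y * Q ^ (2 * Suc i)" "y * Q ^ (2 * j)"] Suc.prems by auto
  qed
  have H1: "poly (pderiv ?H) (?n (Suc i)) = 0" if "Suc i < j"
    using newton_recursion_jets(2)[OF k _ ne that _ nj] Suc.prems by simp
  have val: "poly (rib_poly y) (?n (Suc i)) = y ^ (2 * Suc i) * Q ^ (2 * (Suc i) ^ 2)"
  proof -
    have "poly (rib_poly y) (?n (Suc i)) = y ^ 2 * Q ^ 2 * poly (rib_poly ?y) (?n (Suc i))"
      using H0 by simp
    also have "\<dots> = (y ^ 2 * Q ^ 2) * (?y ^ (2 * i) * Q ^ (2 * i ^ 2))"
      by (simp only: IH(1)[unfolded node])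
    finally show ?thesis by (simp only: fac)
  qed
  have der: "poly (pderiv (rib_poly y)) (?n (Suc i)) = y ^ (2 * Suc i) * Q ^ (2 * (Suc i) ^ 2) *
      (of_nat (j - Suc i) / (y * Q ^ (2 * j) - inverse (y * Q ^ (2 * j))))" if ij: "Suc i < j"
  proof -
    have ir: "i < r" "r - i = j - Suc i" using ij r by auto
    have "poly (pderiv (rib_poly y)) (?n (Suc i)) = y ^ 2 * Q ^ 2 * poly (pderiv (rib_poly ?y)) (?n (Suc i))"
      using H1[OF ij] by (simp add: pderiv_diff pderiv_smult)
    also have "\<dots> = (y ^ 2 * Q ^ 2) * (?y ^ (2 * i) * Q ^ (2 * i ^ 2) *
        (of_nat (j - Suc i) / (y * Q ^ (2 * j) - inverse (y * Q ^ (2 * j)))))"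
      by (simp only: IH(2)[OF ir(1), unfolded node ir(2)])
    finally show ?thesis unfolding fac[symmetric] by (simp only: mult.assoc)
  qed
  show ?case using val der by blast
qed

end

lemma sum_atMost_split:
  "(\<Sum>k\<le>Suc m. f k) = f 0 + (\<Sum>k<m. f (Suc k)) + (f (Suc m) :: 'a::comm_monoid_add)"
  by (induction m) (simp_all add: add.assoc)

context qroot
begin

subsection \<open>Gaussian binomials\<close>

definition qb :: "nat \<Rightarrow> nat \<Rightarrow> complex" where
  "qb m k = brf m / (brf k * brf (m - k))"

lemma br_add: "k \<le> n \<Longrightarrow> br n = iQ ^ k * br (n - k) + Q ^ (n - k) * br k"
proof -
  assume k: "k \<le> n"
  then obtain r where r: "n = k + r" using le_Suc_ex by blast
  have "iQ ^ k * Q ^ r - iQ ^ k * iQ ^ r + (Q ^ r * Q ^ k - Q ^ r * iQ ^ k) = Q ^ k * Q ^ r - iQ ^ k * iQ ^ r"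
    by (simp add: mult.commute)
  thus ?thesis by (simp add: r br_def power_add right_diff_distrib del: power_inverse)
qed

text \<open>The q-binomial theorem in the symmetric normalisation. The induction step is the
  q-Pascal rule, which comes from \<open>br_add\<close>; the bound on m keeps the denominators
  nonzero.\<close>

lemma q_binomial:
  assumes "m < p"
  shows "(\<Prod>l<m. 1 + z * Q ^ (2 * l)) = (\<Sum>k\<le>m. qb m k * Q ^ (k * m) * iQ ^ k * z ^ k)"
  using assms
proof (induction m)
  case 0 thus ?case by (simp add: qb_def)
next
  case (Suc m)
  let ?a = "\<lambda>k. qb m k * Q ^ (k * m) * iQ ^ k" and ?b = "\<lambda>k. qb (Suc m) k * Q ^ (k * Suc m) * iQ ^ k"
  have nz: "brf k \<noteq> 0" if "k \<le> Suc m" for k using that Suc.prems by (intro brf_nz) auto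
  have b0: "?b 0 = ?a 0" using nz by (simp add: qb_def)
  have bm: "?b (Suc m) = ?a m * Q ^ (2 * m)"
  proof -
    have "Q ^ (Suc m * Suc m) * iQ ^ Suc m = Q ^ (m * Suc m) * (Q ^ Suc m * iQ ^ Suc m)"
      by (simp only: mult_Suc power_add) (simp only: mult_ac)
    moreover have "Q ^ (m * m) * iQ ^ m * Q ^ (2 * m) = Q ^ (m * m) * Q ^ m * (Q ^ m * iQ ^ m)"
      by (simp only: mult_2 power_add) (simp only: mult_ac)
    ultimately show ?thesis using nz[of m] nz[of "Suc m"]
      by (simp add: qb_def mult.assoc power_add del: power_Suc power_inverse)
  qed
  have bk: "?b (Suc k) = ?a (Suc k) + ?a k * Q ^ (2 * m)" if k: "k < m" for k
  proof -
    obtain r where r: "m = Suc k + r" using k less_imp_Suc_add by fastforce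
    have n: "brf m \<noteq> 0" "brf k \<noteq> 0" "br (Suc k) \<noteq> 0" "brf r \<noteq> 0" "br (Suc r) \<noteq> 0"
      using nz[of m] nz[of k] nz[of r] br_nz[of "Suc k"] br_nz[of "Suc r"] Suc.prems r by auto
    have d: "m - Suc k = r" "m - k = Suc r" "Suc m - Suc k = Suc r" using r by auto
    have e1: "qb (Suc m) (Suc k) = qb m (Suc k) * br (Suc m) / br (Suc r)"
      unfolding qb_def d by (simp add: brf_Suc)
    have e2: "qb m k = qb m (Suc k) * br (Suc k) / br (Suc r)"
      unfolding qb_def d using n by (simp add: brf_Suc)
    have e3: "br (Suc m) = iQ ^ Suc k * br (Suc r) + Q ^ Suc r * br (Suc k)"
      using br_add[of "Suc k" "Suc m"] d(3) r by (simp del: power_Suc power_inverse)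
    have q1: "iQ ^ Suc k * (Q ^ (Suc k * Suc m) * iQ ^ Suc k) = Q ^ (Suc k * m) * iQ ^ Suc k"
    proof -
      have "iQ ^ Suc k * (Q ^ (Suc k * Suc m) * iQ ^ Suc k) =
        (iQ ^ Suc k * Q ^ Suc k) * Q ^ (Suc k * m) * iQ ^ Suc k"
        by (simp only: mult_Suc_right power_add) (simp only: mult_ac)
      thus ?thesis by (simp only: Q_iQ mult_1_left)
    qed
    have q2: "Q ^ Suc r * (Q ^ (Suc k * Suc m) * iQ ^ Suc k) = Q ^ (k * m) * iQ ^ k * Q ^ (2 * m)"
    proof -
      have "Suc r + Suc k * Suc m = k * m + 2 * m + 1" by (simp add: r)
      hence "Q ^ Suc r * (Q ^ (Suc k * Suc m) * iQ ^ Suc k) = Q ^ (k * m + 2 * m + 1) * iQ ^ Suc k"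
        by (simp only: power_add[symmetric] mult.assoc[symmetric])
      also have "\<dots> = Q ^ (k * m) * iQ ^ k * Q ^ (2 * m) * (Q * iQ)"
        by (simp only: power_add power_Suc power_one_right) (simp only: mult_ac)
      finally show ?thesis by simp
    qed
    have "?b (Suc k) = qb m (Suc k) / br (Suc r) * (iQ ^ Suc k * (Q ^ (Suc k * Suc m) * iQ ^ Suc k) * br (Suc r)
        + Q ^ Suc r * (Q ^ (Suc k * Suc m) * iQ ^ Suc k) * br (Suc k))"
      unfolding e1 e3 by (simp add: ring_distribs add_divide_distrib mult_ac del: power_Suc mult_Suc mult_Suc_right)
    also have "\<dots> = ?a (Suc k) + ?a k * Q ^ (2 * m)"
      unfolding q1 q2 e2 using n by (simp add: ring_distribs add_divide_distrib mult_ac del: power_Suc mult_Suc mult_Suc_right)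
    finally show ?thesis .
  qed
  have "(\<Prod>l<Suc m. 1 + z * Q ^ (2 * l)) = (\<Sum>k\<le>m. ?a k * z ^ k) * (1 + z * Q ^ (2 * m))"
    using Suc by simp
  also have "\<dots> = (\<Sum>k\<le>m. ?a k * z ^ k) + (\<Sum>k\<le>m. ?a k * Q ^ (2 * m) * z ^ Suc k)"
    by (simp only: distrib_left mult_1_right sum_distrib_right) (simp add: mult_ac)
  also have "(\<Sum>k\<le>m. ?a k * z ^ k) = ?a 0 + (\<Sum>k<m. ?a (Suc k) * z ^ Suc k)"
    unfolding lessThan_Suc_atMost[symmetric] by (subst sum.lessThan_Suc_shift) simp
  also have "(\<Sum>k\<le>m. ?a k * Q ^ (2 * m) * z ^ Suc k) =
      (\<Sum>k<m. ?a k * Q ^ (2 * m) * z ^ Suc k) + ?a m * Q ^ (2 * m) * z ^ Suc m"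
    unfolding lessThan_Suc_atMost[symmetric] by simp
  also have "?a 0 + (\<Sum>k<m. ?a (Suc k) * z ^ Suc k) + ((\<Sum>k<m. ?a k * Q ^ (2 * m) * z ^ Suc k) + ?a m * Q ^ (2 * m) * z ^ Suc m)
     = ?b 0 + (\<Sum>k<m. ?b (Suc k) * z ^ Suc k) + ?b (Suc m) * z ^ Suc m"
  proof -
    have "(\<Sum>k<m. ?a (Suc k) * z ^ Suc k) + (\<Sum>k<m. ?a k * Q ^ (2 * m) * z ^ Suc k) = (\<Sum>k<m. ?b (Suc k) * z ^ Suc k)"
      unfolding sum.distrib[symmetric] by (rule sum.cong[OF refl]) (simp only: bk lessThan_iff distrib_right)
    note e = this[symmetric]
    show ?thesis unfolding b0 bm e by (simp only: add.assoc)
  qed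
  also have "\<dots> = (\<Sum>k\<le>Suc m. ?b k * z ^ k)"
    unfolding sum_atMost_split by simp
  finally show ?case .
qed

text \<open>The same product read from its last factor, with z rescaled accordingly.\<close>

lemma q_binomial_inverse:
  assumes "m < p"
  shows "(\<Prod>l<m. 1 + z * iQ ^ (2 * l)) = (\<Sum>k\<le>m. qb m k * iQ ^ (k * m) * Q ^ k * z ^ k)"
proof (cases m)
  case 0 thus ?thesis by (simp add: qb_def)
next
  case (Suc n)
  have "(\<Prod>l<m. 1 + z * iQ ^ (2 * l)) = (\<Prod>l<m. 1 + z * iQ ^ (2 * (m - Suc l)))"
    by (rule prod.nat_diff_reindex[symmetric])
  also have "\<dots> = (\<Prod>l<m. 1 + (z * iQ ^ (2 * n)) * Q ^ (2 * l))"
  proof (rule prod.cong[OF refl])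
    fix l assume "l \<in> {..<m}"
    hence "n = (m - Suc l) + l" using Suc by simp
    hence "iQ ^ (2 * n) = iQ ^ (2 * (m - Suc l)) * iQ ^ (2 * l)"
      by (metis distrib_left power_add)
    hence "iQ ^ (2 * n) * Q ^ (2 * l) = iQ ^ (2 * (m - Suc l))" by (simp only: mult.assoc Q_iQ mult_1_right)
    thus "1 + z * iQ ^ (2 * (m - Suc l)) = 1 + (z * iQ ^ (2 * n)) * Q ^ (2 * l)" by (simp only: mult.assoc)
  qed
  also have "\<dots> = (\<Sum>k\<le>m. qb m k * Q ^ (k * m) * iQ ^ k * (z * iQ ^ (2 * n)) ^ k)"
    using q_binomial[OF assms] .
  also have "\<dots> = (\<Sum>k\<le>m. qb m k * iQ ^ (k * m) * Q ^ k * z ^ k)"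
  proof (rule sum.cong[OF refl])
    fix k
    have km: "k * m = k * n + k" by (simp add: Suc)
    have L: "iQ ^ (k * m) * Q ^ k = iQ ^ (k * n)"
      by (simp only: km power_add mult.assoc Q_iQ mult_1_right)
    have "(iQ ^ (2 * n)) ^ k = iQ ^ (k * n) * iQ ^ (k * n)"
    proof -
      have "2 * n * k = k * n + k * n" by simp
      thus ?thesis by (simp only: power_mult[symmetric] power_add)
    qed
    moreover have "Q ^ (k * m) * iQ ^ k = Q ^ (k * n)"
      by (simp only: km power_add mult.assoc Q_iQ mult_1_right)
    ultimately have "Q ^ (k * m) * iQ ^ k * (iQ ^ (2 * n)) ^ k = iQ ^ (k * n)"
      by (simp only: mult.assoc[symmetric] Q_iQ mult_1_left)
    with L have e: "Q ^ (k * m) * iQ ^ k * (iQ ^ (2 * n)) ^ k = iQ ^ (k * m) * Q ^ k" by simp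
    have "qb m k * Q ^ (k * m) * iQ ^ k * (z * iQ ^ (2 * n)) ^ k = qb m k * (Q ^ (k * m) * iQ ^ k * (iQ ^ (2 * n)) ^ k) * z ^ k"
      by (simp only: power_mult_distrib mult_ac)
    thus "qb m k * Q ^ (k * m) * iQ ^ k * (z * iQ ^ (2 * n)) ^ k = qb m k * iQ ^ (k * m) * Q ^ k * z ^ k"
      unfolding e by (simp only: mult_ac)
  qed
  finally show ?thesis .
qed

text \<open>The q-analogue of the fact that a b-th finite difference kills polynomials of degree
  below b. On the monomial of degree s the sum is the q-binomial product at z = - Q^(-2s), whose
  factor with l = s is zero.\<close>

lemma alternating_q_binomial_sum:
  assumes b: "b < p" and R: "degree R < b"
  shows "(\<Sum>k\<le>b. (- 1) ^ k * qb b k * Q ^ (k * b) * iQ ^ k * poly R (iQ ^ (2 * k))) = 0"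
proof -
  let ?Z = "\<lambda>s. (\<Sum>k\<le>b. (- 1) ^ k * qb b k * Q ^ (k * b) * iQ ^ k * (iQ ^ (2 * k)) ^ s)"
  have z: "(?Z s) = 0" if s: "s < b" for s
  proof -
    have "(?Z s) =
       (\<Sum>k\<le>b. qb b k * Q ^ (k * b) * iQ ^ k * (- (iQ ^ (2 * s))) ^ k)"
    proof (rule sum.cong[OF refl])
      fix k
      have "(- (iQ ^ (2 * s))) ^ k = (- 1) ^ k * (iQ ^ (2 * k)) ^ s"
        unfolding power_minus[of "iQ ^ (2 * s)" k] by (simp only: power_mult[symmetric] mult_ac)
      thus "(- 1) ^ k * qb b k * Q ^ (k * b) * iQ ^ k * (iQ ^ (2 * k)) ^ s = qb b k * Q ^ (k * b) * iQ ^ k * (- (iQ ^ (2 * s))) ^ k"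
        by (simp only: mult_ac)
    qed
    also have "\<dots> = (\<Prod>l<b. 1 + - (iQ ^ (2 * s)) * Q ^ (2 * l))" by (rule q_binomial[OF b, symmetric])
    also have "\<dots> = 0"
    proof (rule prod_zero)
      have "1 + - (iQ ^ (2 * s)) * Q ^ (2 * s) = 0" by (simp only: mult_minus_left Q_iQ) simp
      with s show "\<exists>a\<in>{..<b}. 1 + - (iQ ^ (2 * s)) * Q ^ (2 * a) = 0" by blast
    qed simp
    finally show ?thesis .
  qed
  have "(\<Sum>k\<le>b. (- 1) ^ k * qb b k * Q ^ (k * b) * iQ ^ k * poly R (iQ ^ (2 * k))) =
     (\<Sum>k\<le>b. \<Sum>s\<le>degree R. coeff R s * ((- 1) ^ k * qb b k * Q ^ (k * b) * iQ ^ k * (iQ ^ (2 * k)) ^ s))"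
    by (simp only: poly_altdef sum_distrib_left mult_ac)
  also have "\<dots> = (\<Sum>s\<le>degree R. coeff R s * (?Z s))"
    unfolding sum_distrib_left by (rule sum.swap)
  also have "\<dots> = 0"
  proof (rule sum.neutral, rule ballI)
    fix s assume "s \<in> {..degree R}"
    hence "s < b" using R by simp
    thus "coeff R s * (?Z s) = 0"
      by (simp only: z mult_zero_right)
  qed
  finally show ?thesis .
qed

lemma brf_ratio:
  assumes "0 < b"
  shows "brf (n + b - 1) = brf n * (\<Prod>r=1..<b. br (n + b - r))"
proof -
  obtain s where s: "b = Suc s" using assms by (cases b) auto
  have "brf (n + s) = brf n * (\<Prod>i=1..s. br (n + i))" by (induction s) (simp_all add: brf_Suc)
  also have "(\<Prod>i=1..s. br (n + i)) = (\<Prod>r=1..<b. br (n + b - r))"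
    by (rule prod.reindex_bij_witness[of _ "\<lambda>i. b - i" "\<lambda>r. b - r"]) (auto simp: s)
  finally show ?thesis by (simp add: s)
qed

text \<open>The quotient \<open>brf (j - 1 - k) / brf (j - k - b)\<close> equals \<open>E k\<close>,
  which is a power of Q times a polynomial of degree below b in Q^(-2k). \<open>E k\<close> vanishes
  for the k up to b that the index set leaves out, so the sum is a full alternating q-binomial
  sum.\<close>

lemma inner_sum_vanishes:
  assumes b: "0 < b" "b < j" and j: "j < p"
  shows "(\<Sum>k\<in>{k. k \<le> b \<and> k \<le> j - b \<and> k < j}. (- 1) ^ k * brf (j - 1 - k) / (brf k * brf (b - k) * brf (j - k - b))) = 0"
proof -
  define E where "E k = (\<Prod>r=1..<b. Q ^ (j - r) * iQ ^ k - iQ ^ (j - r) * Q ^ k)" for k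
  have E1: "brf (j - 1 - k) = brf (j - k - b) * E k" if k: "k \<le> j - b" for k
  proof -
    have a: "j - 1 - k = (j - k - b) + b - 1" using k b by simp
    have "brf (j - 1 - k) = brf (j - k - b) * (\<Prod>r=1..<b. br ((j - k - b) + b - r))"
      unfolding a by (rule brf_ratio[OF b(1)])
    also have "(\<Prod>r=1..<b. br ((j - k - b) + b - r)) = E k"
      unfolding E_def
    proof (rule prod.cong[OF refl])
      fix r assume "r \<in> {1..<b}"
      hence r: "(j - k - b) + b - r = j - r - k" "j - r = (j - r - k) + k" using k b by auto
      have "Q ^ (j - r) * iQ ^ k = Q ^ (j - r - k)" "iQ ^ (j - r) * Q ^ k = iQ ^ (j - r - k)"
        by (subst r(2), simp only: power_add mult.assoc Q_iQ mult_1_right)+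
      thus "br ((j - k - b) + b - r) = Q ^ (j - r) * iQ ^ k - iQ ^ (j - r) * Q ^ k"
        by (simp only: r(1) br_def)
    qed
    finally show ?thesis .
  qed
  have E0: "E k = 0" if k: "k \<le> b" "\<not> k \<le> j - b" for k
    unfolding E_def
  proof (rule prod_zero)
    have "j - (j - k) = k" using k b by simp
    hence "Q ^ (j - (j - k)) * iQ ^ k - iQ ^ (j - (j - k)) * Q ^ k = 0" by (simp only: Q_iQ diff_self)
    moreover have "j - k \<in> {1..<b}" using k b by auto
    ultimately show "\<exists>r\<in>{1..<b}. Q ^ (j - r) * iQ ^ k - iQ ^ (j - r) * Q ^ k = 0" by blast
  qed simp
  \<comment> \<open>Taking Q^k out of each of the b - 1 factors of \<open>E k\<close> leaves linear
    polynomials in Q^(-2k).\<close>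
  define R where "R = (\<Prod>r=1..<b. [: - (iQ ^ (j - r)), Q ^ (j - r) :])"
  have "degree R \<le> (\<Sum>r=1..<b. 1)"
    unfolding R_def by (rule order.trans[OF degree_prod_sum_le]) (auto intro!: sum_mono)
  hence dR: "degree R < b" using b by simp
  have ER: "E k = Q ^ (k * b) * iQ ^ k * poly R (iQ ^ (2 * k))" for k
  proof -
    have "E k = (\<Prod>r=1..<b. Q ^ k * poly [: - (iQ ^ (j - r)), Q ^ (j - r) :] (iQ ^ (2 * k)))"
      unfolding E_def
    proof (rule prod.cong[OF refl])
      fix r
      have "Q ^ k * (iQ ^ (2 * k) * Q ^ (j - r)) = (Q ^ k * iQ ^ k) * iQ ^ k * Q ^ (j - r)"
      proof -
        have "iQ ^ (2 * k) = iQ ^ k * iQ ^ k" by (simp only: mult_2 power_add)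
        thus ?thesis by (simp only: mult_ac)
      qed
      hence "Q ^ k * (iQ ^ (2 * k) * Q ^ (j - r)) = Q ^ (j - r) * iQ ^ k"
        by (simp only: Q_iQ mult_1_left mult.commute)
      moreover have "poly [: - u, w :] z = z * w - u" for u w z :: complex by simp
      ultimately show "Q ^ (j - r) * iQ ^ k - iQ ^ (j - r) * Q ^ k = Q ^ k * poly [: - (iQ ^ (j - r)), Q ^ (j - r) :] (iQ ^ (2 * k))"
        by (simp only: right_diff_distrib mult.commute[of "iQ ^ (j - r)"])
    qed
    also have "\<dots> = (Q ^ k) ^ (b - 1) * poly R (iQ ^ (2 * k))"
      by (simp only: prod.distrib R_def poly_prod prod_constant card_atLeastLessThan)
    also have "(Q ^ k) ^ (b - 1) = Q ^ (k * b) * iQ ^ k"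
    proof -
      have "Q ^ (k * b) = (Q ^ k) ^ (b - 1) * Q ^ k"
        using b by (cases b) (simp_all add: power_mult[symmetric] power_add mult_ac)
      thus ?thesis by (simp only: mult.assoc Q_iQ mult_1_right)
    qed
    finally show ?thesis .
  qed
  have nz: "brf k \<noteq> 0" if "k \<le> j" for k using that j by (intro brf_nz) auto
  have "brf b * (\<Sum>k\<in>{k. k \<le> b \<and> k \<le> j - b \<and> k < j}. (- 1) ^ k * brf (j - 1 - k) / (brf k * brf (b - k) * brf (j - k - b)))
     = (\<Sum>k\<in>{k. k \<le> b \<and> k \<le> j - b \<and> k < j}. (- 1) ^ k * qb b k * E k)"
    unfolding sum_distrib_left
  proof (rule sum.cong[OF refl])
    fix k assume "k \<in> {k. k \<le> b \<and> k \<le> j - b \<and> k < j}"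
    hence k: "k \<le> b" "k \<le> j - b" "k < j" by auto
    show "brf b * ((- 1) ^ k * brf (j - 1 - k) / (brf k * brf (b - k) * brf (j - k - b))) = (- 1) ^ k * qb b k * E k"
      unfolding E1[OF k(2)] qb_def using nz[of "j - k - b"] by simp
  qed
  also have "\<dots> = (\<Sum>k\<le>b. (- 1) ^ k * qb b k * E k)"
    by (rule sum.mono_neutral_left) (use b E0 in auto)
  also have "\<dots> = 0"
    using alternating_q_binomial_sum[of b R] dR b j unfolding ER by (simp only: mult_ac less_trans)
  finally show ?thesis using nz[of b] b by simp
qed

subsection \<open>The polynomial of the pseudotrace\<close>

text \<open>The derivative is what the nilpotent part of the Casimir element contributes on the
  modules of the pseudotrace, where its eigenvalue is \<open>csum Q\<close>.\<close>

definition dnewton :: "nat \<Rightarrow> complex \<Rightarrow> complex" where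
  "dnewton m w = poly (pderiv (newton (\<lambda>l. csum (w * iQ ^ (2 * l))) m)) (csum Q)"

text \<open>Here y is x / Q for a vector of weight x (see \<open>chi_sum\<close>). The sum over N
  runs over the p weights of the two modules in the pseudotrace.\<close>

definition chi_coeff :: "complex \<Rightarrow> nat \<Rightarrow> complex" where
  "chi_coeff y m = h * Q ^ (m ^ 2) / (y ^ m * brf m ^ 2) *
     (\<Sum>N<p. y ^ (2 * N) * iQ ^ (2 * N * m) * dnewton m (Q ^ (2 * N) * iQ))"

definition chi_poly :: "complex \<Rightarrow> complex poly" where
  "chi_poly y = (\<Sum>m<p. smult (chi_coeff y m) (newton (\<lambda>l. csum (y * iQ ^ (2 * l))) m))"

lemma sum_cyclic_shift:
  fixes f :: "nat \<Rightarrow> complex"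
  assumes "f p = f 0"
  shows "(\<Sum>N<p. f (Suc N)) = (\<Sum>N<p. f N)"
proof -
  have "(\<Sum>N<Suc p. f N) = f 0 + (\<Sum>N<p. f (Suc N))" by (rule sum.lessThan_Suc_shift)
  with assms show ?thesis by simp
qed

text \<open>Passing from w to w Q^2 adds a node in front and drops the last one; the m common nodes
  factor out of the difference.\<close>

lemma dnewton_diff:
  "dnewton (Suc m) w - dnewton (Suc m) (w * Q ^ 2) = (csum (w * Q ^ 2) - csum (w * iQ ^ (2 * m))) * dnewton m w"
proof -
  have n: "(\<lambda>l. csum (w * Q ^ 2 * iQ ^ (2 * Suc l))) = (\<lambda>l. csum (w * iQ ^ (2 * l)))"
  proof
    fix l
    have "w * Q ^ 2 * iQ ^ (2 * Suc l) = w * iQ ^ (2 * l) * (Q ^ 2 * iQ ^ 2)"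
    proof -
      have "2 * Suc l = 2 * l + 2" by simp
      thus ?thesis by (simp only: power_add mult_ac)
    qed
    thus "csum (w * Q ^ 2 * iQ ^ (2 * Suc l)) = csum (w * iQ ^ (2 * l))" by (simp only: Q_iQ mult_1_right)
  qed
  have "newton (\<lambda>l. csum (w * iQ ^ (2 * l))) (Suc m) - newton (\<lambda>l. csum (w * Q ^ 2 * iQ ^ (2 * l))) (Suc m)
     = smult (csum (w * Q ^ 2) - csum (w * iQ ^ (2 * m))) (newton (\<lambda>l. csum (w * iQ ^ (2 * l))) m)"
    unfolding newton_shift[of "\<lambda>l. csum (w * Q ^ 2 * iQ ^ (2 * l))"] n
    by (simp add: newton_Suc smult_diff_left algebra_simps)
  from arg_cong[OF this, of "\<lambda>P. poly (pderiv P) (csum Q)"] show ?thesis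
    by (simp add: dnewton_def pderiv_diff pderiv_smult)
qed

text \<open>Summation by parts over the cyclic index N. The boundary terms agree because y^(2N) and
  Q^(2N) both have period p in N.\<close>

lemma chi_coeff_recursion:
  assumes y: "y \<noteq> 0" "y ^ (2 * p) = 1" and m: "Suc m < p"
  shows "chi_coeff (y * iQ ^ 2) m - chi_coeff y m = (csum (y * iQ ^ (2 * Suc m)) - csum y) * chi_coeff y (Suc m)"
proof -
  define w where "w N = Q ^ (2 * N) * iQ" for N
  have w0: "w N \<noteq> 0" for N by (simp add: w_def)
  have wp: "w p = w 0" by (simp add: w_def Q_root)
  have wS: "w (Suc N) = w N * Q ^ 2" for N by (simp add: w_def power2_eq_square mult_ac)
  have Qp: "iQ ^ (2 * p * k) = 1" for k by (simp add: power_mult power_inverse Q_root[unfolded power_mult])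
  have nz: "brf m \<noteq> 0" "br (Suc m) \<noteq> 0" using brf_nz[of m] br_nz[of "Suc m"] m by auto
  define T where "T m N = y ^ (2 * N) * iQ ^ (2 * N * m) * dnewton m (w N)" for m N
  let ?u = "(1 - Q ^ (2 * Suc m) * inverse (y ^ 2))"
  let ?b = "\<lambda>N. (1 - Q ^ (2 * m) * iQ ^ (4 * N))"
  let ?B = "\<lambda>N. iQ ^ m * br (Suc m) * (?b N) * T m N"
  let ?d = "\<lambda>N. (dnewton (Suc m) (w N) - dnewton (Suc m) (w (Suc N)))"
  let ?e = "\<lambda>N. y ^ (2 * N) * iQ ^ (2 * N * Suc m)"
  have c: "chi_coeff y k = h * Q ^ (k ^ 2) / (y ^ k * brf k ^ 2) * (\<Sum>N<p. T k N)" for k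
    unfolding chi_coeff_def T_def w_def ..
  have cS: "chi_coeff (y * iQ ^ 2) m = h * Q ^ (m ^ 2) / (y ^ m * brf m ^ 2) * (\<Sum>N<p. Q ^ (2 * m) * iQ ^ (4 * N) * T m N)"
  proof -
    have "(y * iQ ^ 2) ^ (2 * N) = y ^ (2 * N) * iQ ^ (4 * N)" for N
      by (simp only: power_mult_distrib power_mult[symmetric]) (simp only: mult.assoc[symmetric], simp)
    moreover have "(y * iQ ^ 2) ^ m = y ^ m / Q ^ (2 * m)"
      by (simp add: power_mult_distrib power_mult power_inverse divide_inverse)
    ultimately show ?thesis
      by (simp add: chi_coeff_def T_def w_def sum_distrib_left mult_ac del: power_inverse)
  qed
  \<comment> \<open>The part of \<open>?u * T (Suc m) N\<close> subtracted in \<open>?u\<close>.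
    Shifting N by one gives it the same prefactor as the other part, so that only a difference of
    two \<open>dnewton\<close> values remains.\<close>
  let ?f = "\<lambda>N. Q ^ (2 * Suc m) * inverse (y ^ 2) * T (Suc m) N"
  have fS: "?f (Suc N) = ?e N * dnewton (Suc m) (w (Suc N))" for N
  proof -
    have a: "y ^ (2 * Suc N) = y ^ (2 * N) * y ^ 2" by (simp add: power2_eq_square mult_ac)
    have b: "iQ ^ (2 * Suc N * Suc m) = iQ ^ (2 * N * Suc m) * iQ ^ (2 * Suc m)"
    proof -
      have "2 * Suc N * Suc m = 2 * N * Suc m + 2 * Suc m" by simp
      thus ?thesis by (simp only: power_add)
    qed
    have "?f (Suc N) = (Q ^ (2 * Suc m) * iQ ^ (2 * Suc m)) * (y ^ 2 * inverse (y ^ 2)) * (?e N * dnewton (Suc m) (w (Suc N)))"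
      unfolding T_def a b by (simp only: mult_ac)
    thus ?thesis using y by (simp only: Q_iQ) simp
  qed
  have fp: "?f p = ?f 0"
    by (simp add: T_def wp y Qp del: power_Suc mult_Suc_right power_inverse)
  have key: "(\<Sum>N<p. ?u * T (Suc m) N)
     = (\<Sum>N<p. ?B N)"
  proof -
    have "(\<Sum>N<p. ?u * T (Suc m) N) = (\<Sum>N<p. T (Suc m) N) - (\<Sum>N<p. ?f N)"
      unfolding sum_subtractf[symmetric] by (rule sum.cong[OF refl]) (simp only: left_diff_distrib mult_1_left)
    also have "\<dots> = (\<Sum>N<p. T (Suc m) N) - (\<Sum>N<p. ?f (Suc N))"
      using sum_cyclic_shift[of ?f, OF fp] by simp
    also have "\<dots> = (\<Sum>N<p. ?e N * (?d N))"
      unfolding sum_subtractf[symmetric] fS by (rule sum.cong[OF refl]) (simp only: T_def right_diff_distrib)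
    also have "\<dots> = (\<Sum>N<p. ?B N)"
    proof (rule sum.cong[OF refl])
      fix N
      have "csum (w N * Q ^ 2) - csum (w N * iQ ^ (2 * m)) =
          (w N * Q ^ 2 - w N * iQ ^ (2 * m)) * (1 - inverse (w N * Q ^ 2 * (w N * iQ ^ (2 * m))))"
        by (rule csum_diff) (use w0 in auto)
      also have "w N * Q ^ 2 - w N * iQ ^ (2 * m) = Q ^ (2 * N) * iQ ^ m * br (Suc m)"
      proof -
        have "iQ * Q ^ 2 = iQ ^ m * Q ^ Suc m"
        proof -
          have "iQ ^ m * Q ^ Suc m = Q * (Q ^ m * iQ ^ m)" by (simp only: power_Suc mult_ac)
          thus ?thesis by (simp only: Q_iQ) (simp add: power2_eq_square)
        qed
        moreover have "iQ * iQ ^ (2 * m) = iQ ^ m * iQ ^ Suc m"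
        proof -
          have "iQ ^ (2 * m) = iQ ^ m * iQ ^ m" by (simp only: mult_2 power_add)
          thus ?thesis by (simp only: power_Suc mult_ac)
        qed
        ultimately show ?thesis
          by (simp only: w_def br_def right_diff_distrib mult.assoc)
      qed
      also have "inverse (w N * Q ^ 2 * (w N * iQ ^ (2 * m))) = Q ^ (2 * m) * iQ ^ (4 * N)"
      proof -
        have "w N * Q ^ 2 * (w N * iQ ^ (2 * m)) * (Q ^ (2 * m) * iQ ^ (4 * N)) =
          (Q ^ (2 * N) * Q ^ (2 * N) * iQ ^ (4 * N)) * (iQ * iQ * Q ^ 2) * (Q ^ (2 * m) * iQ ^ (2 * m))"
          unfolding w_def by (simp only: mult_ac)
        also have "Q ^ (2 * N) * Q ^ (2 * N) = Q ^ (4 * N)" by (simp only: power_add[symmetric]) simp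
        also have "iQ * iQ * Q ^ 2 = 1"
        proof -
          have "iQ * iQ * Q ^ 2 = (iQ * Q) * (iQ * Q)" by (simp only: power2_eq_square mult_ac)
          thus ?thesis by simp
        qed
        finally have "w N * Q ^ 2 * (w N * iQ ^ (2 * m)) * (Q ^ (2 * m) * iQ ^ (4 * N)) = 1"
          by (simp only: Q_iQ mult_1_right)
        thus ?thesis by (rule inverse_unique)
      qed
      finally have e: "dnewton (Suc m) (w N) - dnewton (Suc m) (w (Suc N)) =
          Q ^ (2 * N) * iQ ^ m * br (Suc m) * (?b N) * dnewton m (w N)"
        unfolding wS dnewton_diff by (simp only: mult.assoc)
      have q: "iQ ^ (2 * N * Suc m) * Q ^ (2 * N) = iQ ^ (2 * N * m)"
      proof -
        have "2 * N * Suc m = 2 * N * m + 2 * N" by simp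
        thus ?thesis by (simp only: power_add mult.assoc Q_iQ mult_1_right)
      qed
      have "?e N * (?d N) =
        iQ ^ m * br (Suc m) * (?b N) * (y ^ (2 * N) * (iQ ^ (2 * N * Suc m) * Q ^ (2 * N)) * dnewton m (w N))"
        unfolding e by (simp only: mult_ac)
      thus "?e N * (?d N) =
        ?B N"
        unfolding q T_def .
    qed
    finally show ?thesis by simp
  qed
  have d: "csum (y * iQ ^ (2 * Suc m)) - csum y = - (y * iQ ^ Suc m * br (Suc m)) * ?u"
  proof -
    have "csum (y * iQ ^ (2 * Suc m)) - csum y = (y * iQ ^ (2 * Suc m) - y) * (1 - inverse (y * iQ ^ (2 * Suc m) * y))"
      by (rule csum_diff) (use y in auto)
    also have "y * iQ ^ (2 * Suc m) - y = - (y * iQ ^ Suc m * br (Suc m))"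
    proof -
      have "y * iQ ^ (2 * Suc m) - y = y * (iQ ^ (2 * Suc m) - 1)" by (simp only: right_diff_distrib mult_1_right)
      thus ?thesis unfolding iQ_square_minus_1 by (simp only: mult_minus_right mult.assoc)
    qed
    also have "inverse (y * iQ ^ (2 * Suc m) * y) = Q ^ (2 * Suc m) * inverse (y ^ 2)"
    proof (rule inverse_unique)
      have "y * iQ ^ (2 * Suc m) * y * (Q ^ (2 * Suc m) * inverse (y ^ 2)) = (iQ ^ (2 * Suc m) * Q ^ (2 * Suc m)) * (y ^ 2 * inverse (y ^ 2))"
        by (simp only: power2_eq_square[of y] mult_ac)
      thus "y * iQ ^ (2 * Suc m) * y * (Q ^ (2 * Suc m) * inverse (y ^ 2)) = 1" using y by (simp only: Q_iQ) simp
    qed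
    finally show ?thesis .
  qed
  define S where "S = (\<Sum>N<p. (?b N) * T m N)"
  have key': "?u * (\<Sum>N<p. T (Suc m) N) = iQ ^ m * br (Suc m) * S"
    using key unfolding S_def sum_distrib_left by (simp add: mult.assoc del: power_Suc mult_Suc_right power_inverse)
  have "(csum (y * iQ ^ (2 * Suc m)) - csum y) * chi_coeff y (Suc m) =
     - (y * iQ ^ Suc m * br (Suc m)) * (h * Q ^ ((Suc m) ^ 2) / (y ^ Suc m * brf (Suc m) ^ 2)) *
     (?u * (\<Sum>N<p. T (Suc m) N))"
    unfolding c d by (simp only: mult_ac)
  also have "\<dots> = - (h * (Q ^ ((Suc m) ^ 2) * iQ ^ Suc m * iQ ^ m) / (y ^ m * brf m ^ 2)) * S"
    unfolding key' using nz y by (simp add: brf_Suc power2_eq_square del: power_inverse)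
  also have "Q ^ ((Suc m) ^ 2) * iQ ^ Suc m * iQ ^ m = Q ^ (m ^ 2)"
  proof -
    have "(Suc m) ^ 2 = m ^ 2 + m + Suc m" by (simp add: power2_eq_square)
    hence "Q ^ ((Suc m) ^ 2) * iQ ^ Suc m * iQ ^ m = Q ^ (m ^ 2) * (Q ^ m * iQ ^ m) * (Q ^ Suc m * iQ ^ Suc m)"
      by (simp only: power_add) (simp only: mult_ac)
    thus ?thesis by (simp only: Q_iQ mult_1_right)
  qed
  also have "- (h * Q ^ (m ^ 2) / (y ^ m * brf m ^ 2)) * S = chi_coeff (y * iQ ^ 2) m - chi_coeff y m"
  proof -
    have "S = (\<Sum>N<p. T m N) - (\<Sum>N<p. Q ^ (2 * m) * iQ ^ (4 * N) * T m N)"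
      unfolding S_def by (simp only: left_diff_distrib sum_subtractf mult_1_left)
    thus ?thesis unfolding c cS by (simp only: mult_minus_left right_diff_distrib minus_diff_eq) simp
  qed
  finally show ?thesis by simp
qed

text \<open>At \<open>csum Z\<close> the Newton product splits into two q-binomial products, one in
  w / Z and one in 1 / (w Z). After both are expanded, the sum over N runs over p-th roots of unity
  and keeps only the exponents with c = a + k.\<close>

lemma sum_newton_fourier:
  assumes Z: "Z \<noteq> 0" and km: "k + m < p"
  shows "(\<Sum>N<p. Q ^ (2 * N * k) * poly (newton (\<lambda>l. csum (Q ^ (2 * N) * iQ * iQ ^ (2 * l))) m) (csum Z)) =
    of_nat p * (\<Sum>a\<in>{a. a + k \<le> m}. (- 1) ^ k * Q ^ (k * m) * (Z ^ m * inverse Z ^ (2 * a + k)) * qb m a * qb m (a + k))"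
proof -
  let ?w = "\<lambda>N. Q ^ (2 * N) * iQ" and ?iw = "\<lambda>N. iQ ^ (2 * N) * Q"
  have wi: "?w N * ?iw N = 1" for N
  proof -
    have "?w N * ?iw N = (Q ^ (2 * N) * iQ ^ (2 * N)) * (iQ * Q)" by (simp only: mult_ac)
    thus ?thesis by (simp only: Q_iQ) simp
  qed
  have m: "m < p" using km by simp
  let ?d = "\<lambda>a c. Q ^ (2 * (k + a)) * iQ ^ (2 * c)"
  let ?C = "\<lambda>a c. (- 1) ^ (a + c) * (Z ^ m * inverse Z ^ (a + c)) * (qb m a * qb m c) *
      ((iQ ^ (a * m) * Q ^ a) * (Q ^ (c * m) * iQ ^ c) * (iQ ^ a * Q ^ c))"
  have N: "poly (newton (\<lambda>l. csum (?w N * iQ ^ (2 * l))) m) (csum Z) =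
      (\<Sum>a\<le>m. \<Sum>c\<le>m. ?C a c * ((Q ^ (2 * N)) ^ a * (iQ ^ (2 * N)) ^ c))" for N
  proof -
    have f: "csum Z - csum (?w N * iQ ^ (2 * l)) =
        Z * ((1 + - (?w N * inverse Z) * iQ ^ (2 * l)) * (1 + - (?iw N * inverse Z) * Q ^ (2 * l)))" for l
    proof -
      have "csum Z - csum (?w N * iQ ^ (2 * l)) = (Z - ?w N * iQ ^ (2 * l)) * (1 - inverse (Z * (?w N * iQ ^ (2 * l))))"
        by (rule csum_diff) (use Z in auto)
      also have "inverse (Z * (?w N * iQ ^ (2 * l))) = ?iw N * inverse Z * Q ^ (2 * l)"
      proof (rule inverse_unique)
        have "Z * (?w N * iQ ^ (2 * l)) * (?iw N * inverse Z * Q ^ (2 * l)) =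
          (Z * inverse Z) * (?w N * ?iw N) * (iQ ^ (2 * l) * Q ^ (2 * l))" by (simp only: mult_ac)
        thus "Z * (?w N * iQ ^ (2 * l)) * (?iw N * inverse Z * Q ^ (2 * l)) = 1"
          using Z by (simp only: wi Q_iQ) simp
      qed
      also have "Z - ?w N * iQ ^ (2 * l) = Z * (1 + - (?w N * inverse Z) * iQ ^ (2 * l))"
      proof -
        have "Z * (?w N * inverse Z * iQ ^ (2 * l)) = (Z * inverse Z) * (?w N * iQ ^ (2 * l))" by (simp only: mult_ac)
        hence "Z * (?w N * inverse Z * iQ ^ (2 * l)) = ?w N * iQ ^ (2 * l)" using Z by simp
        moreover have "Z * (1 + - u * v) = Z - Z * (u * v)" for u v by (simp add: algebra_simps)
        ultimately show ?thesis by (simp only:)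
      qed
      finally show ?thesis by (simp add: mult_ac del: power_inverse)
    qed
    have "poly (newton (\<lambda>l. csum (?w N * iQ ^ (2 * l))) m) (csum Z) =
      Z ^ m * ((\<Prod>l<m. 1 + - (?w N * inverse Z) * iQ ^ (2 * l)) * (\<Prod>l<m. 1 + - (?iw N * inverse Z) * Q ^ (2 * l)))"
      unfolding poly_newton f by (simp only: prod.distrib prod_constant card_lessThan)
    also have "\<dots> = Z ^ m * ((\<Sum>a\<le>m. qb m a * iQ ^ (a * m) * Q ^ a * (- (?w N * inverse Z)) ^ a) *
        (\<Sum>c\<le>m. qb m c * Q ^ (c * m) * iQ ^ c * (- (?iw N * inverse Z)) ^ c))"
      unfolding q_binomial[OF m] q_binomial_inverse[OF m] ..
    also have "\<dots> = (\<Sum>a\<le>m. \<Sum>c\<le>m. Z ^ m * (qb m a * iQ ^ (a * m) * Q ^ a * (- (?w N * inverse Z)) ^ a *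
        (qb m c * Q ^ (c * m) * iQ ^ c * (- (?iw N * inverse Z)) ^ c)))"
      unfolding sum_product by (simp only: sum_distrib_left)
    also have "\<dots> = (\<Sum>a\<le>m. \<Sum>c\<le>m. ?C a c * ((Q ^ (2 * N)) ^ a * (iQ ^ (2 * N)) ^ c))"
    proof (intro sum.cong refl)
      fix a c
      have "(- (?w N * inverse Z)) ^ a = (- 1) ^ a * ((Q ^ (2 * N)) ^ a * iQ ^ a * inverse Z ^ a)"
        "(- (?iw N * inverse Z)) ^ c = (- 1) ^ c * ((iQ ^ (2 * N)) ^ c * Q ^ c * inverse Z ^ c)"
        by (simp_all only: power_minus[of "?w N * inverse Z"] power_minus[of "?iw N * inverse Z"] power_mult_distrib)
      thus "Z ^ m * (qb m a * iQ ^ (a * m) * Q ^ a * (- (?w N * inverse Z)) ^ a *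
        (qb m c * Q ^ (c * m) * iQ ^ c * (- (?iw N * inverse Z)) ^ c)) = ?C a c * ((Q ^ (2 * N)) ^ a * (iQ ^ (2 * N)) ^ c)"
        by (simp only: power_add mult_ac)
    qed
    finally show ?thesis .
  qed
  \<comment> \<open>The bound k + m < p keeps k + a - c below p in absolute value, so the ratio is 1
    only for c = a + k.\<close>
  have geo: "(\<Sum>N<p. ?d a c ^ N) = (if c = a + k then of_nat p else 0)" if "a \<le> m" "c \<le> m" for a c
  proof (cases "c = a + k")
    case True
    hence "?d a c = 1" by (simp only: add.commute[of k] Q_iQ)
    with True show ?thesis by simp
  next
    case False
    have "?d a c \<noteq> 1"
    proof
      assume d: "?d a c = 1"
      show False
      proof (cases "c < a + k")
        case True
        define r where "r = k + a - c"
        have "2 * (k + a) = 2 * r + 2 * c" using True by (simp add: r_def)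
        hence "?d a c = Q ^ (2 * r)" by (simp only: power_add mult.assoc Q_iQ mult_1_right)
        moreover have "0 < r" "r < p" using True that km by (auto simp: r_def)
        ultimately show False using Q_primitive d by auto
      next
        case F: False
        define r where "r = c - (k + a)"
        have "2 * c = 2 * (k + a) + 2 * r" using F by (simp add: r_def)
        hence "?d a c = iQ ^ (2 * r)" by (simp only: power_add mult.assoc[symmetric] Q_iQ mult_1_left)
        hence "Q ^ (2 * r) = 1" using d by (metis Q_iQ(1) mult_1_right)
        moreover have "0 < r" "r < p" using F False that m by (auto simp: r_def)
        ultimately show False using Q_primitive by auto
      qed
    qed
    moreover have "?d a c ^ p = 1"
    proof -
      have "(Q ^ (2 * n)) ^ p = 1" for n
        by (metis Q_root mult.commute mult.assoc power_mult power_one)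
      from this[of "k + a"] this[of c] show ?thesis by (simp add: power_mult_distrib power_inverse)
    qed
    ultimately show ?thesis using False by (simp add: geometric_sum)
  qed
  have "(\<Sum>N<p. Q ^ (2 * N * k) * poly (newton (\<lambda>l. csum (?w N * iQ ^ (2 * l))) m) (csum Z)) =
      (\<Sum>N<p. \<Sum>a\<le>m. \<Sum>c\<le>m. ?C a c * ?d a c ^ N)"
  proof (rule sum.cong[OF refl])
    fix N
    have "Q ^ (2 * N * k) * ((Q ^ (2 * N)) ^ a * (iQ ^ (2 * N)) ^ c) = ?d a c ^ N" for a c
    proof -
      have "2 * (k + a) * N = 2 * N * k + 2 * N * a" by (simp add: algebra_simps)
      moreover have "2 * c * N = 2 * N * c" by simp
      ultimately show ?thesis
        by (simp only: power_mult_distrib power_mult[symmetric] power_add mult.assoc)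
    qed
    hence e: "Q ^ (2 * N * k) * (z * ((Q ^ (2 * N)) ^ a * (iQ ^ (2 * N)) ^ c)) = z * ?d a c ^ N" for a c z
      by (metis mult.left_commute)
    show "Q ^ (2 * N * k) * poly (newton (\<lambda>l. csum (?w N * iQ ^ (2 * l))) m) (csum Z) = (\<Sum>a\<le>m. \<Sum>c\<le>m. ?C a c * ?d a c ^ N)"
      unfolding N sum_distrib_left e ..
  qed
  also have "\<dots> = (\<Sum>a\<le>m. \<Sum>N<p. \<Sum>c\<le>m. ?C a c * ?d a c ^ N)" by (rule sum.swap)
  also have "\<dots> = (\<Sum>a\<le>m. \<Sum>c\<le>m. \<Sum>N<p. ?C a c * ?d a c ^ N)"
    by (rule sum.cong[OF refl]) (rule sum.swap)
  also have "\<dots> = (\<Sum>a\<le>m. \<Sum>c\<le>m. if c = a + k then ?C a c * of_nat p else 0)"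
  proof (intro sum.cong refl)
    fix a c assume "a \<in> {..m}" "c \<in> {..m}"
    hence "(\<Sum>N<p. ?d a c ^ N) = (if c = a + k then of_nat p else 0)" by (intro geo) auto
    thus "(\<Sum>N<p. ?C a c * ?d a c ^ N) = (if c = a + k then ?C a c * of_nat p else 0)"
      by (simp only: sum_distrib_left[symmetric] if_distrib[of "(*) _"] mult_zero_right)
  qed
  also have "\<dots> = (\<Sum>a\<le>m. if a + k \<le> m then ?C a (a + k) * of_nat p else 0)"
    by (intro sum.cong refl) (simp del: power_inverse)
  also have "\<dots> = (\<Sum>a\<in>{a. a + k \<le> m}. ?C a (a + k) * of_nat p)"
    by (rule sum.mono_neutral_cong_right) auto
  also have "\<dots> = of_nat p * (\<Sum>a\<in>{a. a + k \<le> m}. (- 1) ^ k * Q ^ (k * m) * (Z ^ m * inverse Z ^ (2 * a + k)) * qb m a * qb m (a + k))"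
    unfolding sum_distrib_left
  proof (rule sum.cong[OF refl])
    fix a
    have "(iQ ^ (a * m) * Q ^ a) * (Q ^ ((a + k) * m) * iQ ^ (a + k)) * (iQ ^ a * Q ^ (a + k)) =
      Q ^ (k * m) * (Q ^ (a * m) * iQ ^ (a * m)) * (Q ^ a * iQ ^ a) * (Q ^ (a + k) * iQ ^ (a + k))"
      by (simp only: distrib_right power_add) (simp only: mult_ac)
    hence e: "(iQ ^ (a * m) * Q ^ a) * (Q ^ ((a + k) * m) * iQ ^ (a + k)) * (iQ ^ a * Q ^ (a + k)) = Q ^ (k * m)"
      by (simp only: Q_iQ mult_1_right)
    have s: "(- 1) ^ (a + (a + k)) = ((- 1) ^ k :: complex)" by (simp add: power_add mult.assoc[symmetric] flip: power_mult_distrib)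
    have "a + (a + k) = 2 * a + k" by simp
    thus "?C a (a + k) * of_nat p = of_nat p * ((- 1) ^ k * Q ^ (k * m) * (Z ^ m * inverse Z ^ (2 * a + k)) * qb m a * qb m (a + k))"
      unfolding e s by (simp only: mult_ac)
  qed
  finally show ?thesis .
qed

text \<open>After the Fourier sums are evaluated, the terms with 0 < b < j cancel by
  \<open>inner_sum_vanishes\<close>, and b = 0, b = j leave Z^j and Z^(-j). Z stays free because the
  identity is going to be differentiated.\<close>

lemma weighted_newton_sum:
  assumes Z: "Z \<noteq> 0" and j: "0 < j" "j < p"
  shows "(\<Sum>m=1..j. Q ^ (m ^ 2) * iQ ^ (j * m) * brf (m - 1) / (brf m ^ 2 * brf (j - m)) *
      (\<Sum>N<p. Q ^ (2 * N * (j - m)) * poly (newton (\<lambda>l. csum (Q ^ (2 * N) * iQ * iQ ^ (2 * l))) m) (csum Z)))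
    = of_nat p / (brf (j - 1) * br j ^ 2) * (Z ^ j + inverse Z ^ j)"
proof -
  let ?N = "\<lambda>m. (\<Sum>N<p. Q ^ (2 * N * (j - m)) * poly (newton (\<lambda>l. csum (Q ^ (2 * N) * iQ * iQ ^ (2 * l))) m) (csum Z))"
  let ?c = "\<lambda>m. Q ^ (m ^ 2) * iQ ^ (j * m) * brf (m - 1)"
  let ?K = "\<lambda>b. {k. k \<le> b \<and> k \<le> j - b \<and> k < j}"
  have nz: "brf k \<noteq> 0" if "k \<le> j" for k using that j by (intro brf_nz) auto
  let ?g = "\<lambda>b k. (- 1) ^ k * brf (j - 1 - k) / (brf k * brf (b - k) * brf (j - k - b))"
  let ?h = "\<lambda>b. Z ^ j * inverse Z ^ (2 * b) / (brf (j - b) * brf b)"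
  have "(\<Sum>m=1..j. ?c m / (brf m ^ 2 * brf (j - m)) *
      (?N m))
    = (\<Sum>m=1..j. \<Sum>a\<in>{a. a + (j - m) \<le> m}. of_nat p * (?h (a + (j - m)) * ?g (a + (j - m)) (j - m)))"
  proof (rule sum.cong[OF refl])
    fix m assume "m \<in> {1..j}"
    hence m: "1 \<le> m" "m \<le> j" by auto
    define k where "k = j - m"
    have jk: "j = m + k" "j - m = k" using m by (auto simp: k_def)
    have fo: "(?N m) =
       of_nat p * (\<Sum>a\<in>{a. a + k \<le> m}. (- 1) ^ k * Q ^ (k * m) * (Z ^ m * inverse Z ^ (2 * a + k)) * qb m a * qb m (a + k))"
      unfolding jk(2) by (rule sum_newton_fourier[OF Z]) (use jk j in simp)
    show "?c m / (brf m ^ 2 * brf (j - m)) *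
      (?N m) =
      (\<Sum>a\<in>{a. a + (j - m) \<le> m}. of_nat p * (?h (a + (j - m)) * ?g (a + (j - m)) (j - m)))"
      unfolding fo unfolding jk(2) sum_distrib_left
    proof (rule sum.cong[OF refl])
      fix a assume "a \<in> {a. a + k \<le> m}"
      hence a: "a + k \<le> m" by simp
      have q: "Q ^ (m ^ 2) * iQ ^ (j * m) * Q ^ (k * m) = 1"
      proof -
        have "j * m = m ^ 2 + k * m" by (simp add: jk(1) power2_eq_square algebra_simps)
        hence "Q ^ (m ^ 2) * iQ ^ (j * m) * Q ^ (k * m) = (Q ^ (m ^ 2) * iQ ^ (m ^ 2)) * (iQ ^ (k * m) * Q ^ (k * m))"
          by (simp only: power_add mult_ac)
        thus ?thesis by (simp only: Q_iQ mult_1_right)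
      qed
      have x: "Z ^ m * inverse Z ^ (2 * a + k) = Z ^ j * inverse Z ^ (2 * (a + k))"
      proof -
        have "2 * (a + k) = (2 * a + k) + k" by simp
        hence "Z ^ j * inverse Z ^ (2 * (a + k)) = Z ^ m * inverse Z ^ (2 * a + k) * (Z ^ k * inverse Z ^ k)"
          by (simp only: jk(1) power_add mult_ac)
        moreover have "Z ^ k * inverse Z ^ k = 1" using Z by (simp flip: power_mult_distrib)
        ultimately show ?thesis by simp
      qed
      have i: "j - (a + k) = m - a" "j - 1 - k = m - 1" "a + k - k = a" "j - k - (a + k) = m - (a + k)"
        using a m jk by auto
      have n: "brf m \<noteq> 0" using nz m by simp
      have bb: "brf (m - 1) / (brf m ^ 2 * brf k) * (qb m a * qb m (a + k)) =
          1 / (brf (m - a) * brf (a + k)) * (brf (m - 1) / (brf k * brf a * brf (m - (a + k))))"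
        unfolding qb_def using n by (simp add: power2_eq_square)
      have "?c m / (brf m ^ 2 * brf k) *
          (of_nat p * ((- 1) ^ k * Q ^ (k * m) * (Z ^ m * inverse Z ^ (2 * a + k)) * qb m a * qb m (a + k))) =
         of_nat p * (Q ^ (m ^ 2) * iQ ^ (j * m) * Q ^ (k * m)) * (- 1) ^ k * (Z ^ m * inverse Z ^ (2 * a + k)) *
          (brf (m - 1) / (brf m ^ 2 * brf k) * (qb m a * qb m (a + k)))"
        by (simp only: times_divide_eq_left times_divide_eq_right mult_ac)
      also have "\<dots> = of_nat p * (?h (a + k) * ?g (a + k) k)"
        unfolding q x bb i by (simp only: times_divide_eq_left times_divide_eq_right divide_divide_eq_left mult_ac mult_1_left mult_1_right)
      finally show "?c m / (brf m ^ 2 * brf k) *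
          (of_nat p * ((- 1) ^ k * Q ^ (k * m) * (Z ^ m * inverse Z ^ (2 * a + k)) * qb m a * qb m (a + k))) =
          of_nat p * (?h (a + k) * ?g (a + k) k)" .
    qed
  qed
  also have "\<dots> = (\<Sum>(m, a)\<in>(SIGMA m:{1..j}. {a. a + (j - m) \<le> m}). of_nat p * (?h (a + (j - m)) * ?g (a + (j - m)) (j - m)))"
  proof (rule sum.Sigma)
    show "\<forall>m\<in>{1..j}. finite {a. a + (j - m) \<le> m}"
    proof
      fix m
      have "{a. a + (j - m) \<le> m} \<subseteq> {..m}" by auto
      thus "finite {a. a + (j - m) \<le> m}" by (rule finite_subset) simp
    qed
  qed simp
  \<comment> \<open>New indices b = a + (j - m) and k = j - m; the power of Z then depends on b
    alone.\<close>
  also have "\<dots> = (\<Sum>(b, k)\<in>(SIGMA b:{..j}. ?K b). of_nat p * (?h b * ?g b k))"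
  proof (rule sum.reindex_bij_witness[of _ "\<lambda>(b, k). (j - k, b - k)" "\<lambda>(m, a). (a + (j - m), j - m)"], goal_cases)
    case (5 z)
    thus ?case by (cases z) (simp only: prod.case)
  qed auto
  also have "\<dots> = (\<Sum>b\<le>j. \<Sum>k\<in>?K b. of_nat p * (?h b * ?g b k))"
    by (rule sum.Sigma[symmetric]) auto
  also have "\<dots> = (\<Sum>b\<le>j. of_nat p * ?h b * (\<Sum>k\<in>?K b. ?g b k))"
    by (simp only: sum_distrib_left mult.assoc)
  also have "\<dots> = (\<Sum>b\<in>{0, j}. of_nat p * ?h b * (\<Sum>k\<in>?K b. ?g b k))"
  proof (rule sum.mono_neutral_right)
    show "\<forall>b\<in>{..j} - {0, j}. of_nat p * ?h b * (\<Sum>k\<in>?K b. ?g b k) = 0"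
    proof
      fix b assume "b \<in> {..j} - {0, j}"
      hence "0 < b" "b < j" by auto
      thus "of_nat p * ?h b * (\<Sum>k\<in>?K b. ?g b k) = 0"
        by (simp only: inner_sum_vanishes[OF _ _ j(2)] mult_zero_right)
    qed
  qed auto
  also have "\<dots> = of_nat p / (brf (j - 1) * br j ^ 2) * (Z ^ j + inverse Z ^ j)"
  proof -
    have s0: "{k. k \<le> 0 \<and> k \<le> j - 0 \<and> k < j} = {0}" and sj: "{k. k \<le> j \<and> k \<le> j - j \<and> k < j} = {0}"
      using j by auto
    obtain i where i: "j = Suc i" using j by (cases j) auto
    have bj: "brf j = brf (j - 1) * br j" using i by (simp add: brf_Suc)
    have n: "brf (j - 1) \<noteq> 0" "br j \<noteq> 0" using nz j br_nz by auto
    have xx: "Z ^ j * inverse Z ^ (2 * j) = inverse Z ^ j"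
    proof -
      have "Z ^ j * inverse Z ^ (2 * j) = (Z ^ j * inverse Z ^ j) * inverse Z ^ j"
        by (simp only: mult_2 power_add mult.assoc)
      thus ?thesis using Z by (simp flip: power_mult_distrib)
    qed
    have "(\<Sum>b\<in>{0, j}. of_nat p * ?h b * (\<Sum>k\<in>?K b. ?g b k)) =
      of_nat p * (Z ^ j / brf j) * (brf (j - 1) / brf j) + of_nat p * (Z ^ j * inverse Z ^ (2 * j) / brf j) * (brf (j - 1) / brf j)"
      using j by (simp add: s0[simplified] sj[simplified])
    also have "\<dots> = of_nat p / (brf (j - 1) * br j ^ 2) * (Z ^ j + inverse Z ^ j)"
      unfolding xx bj using n by (simp add: power2_eq_square distrib_left add_divide_distrib mult_ac del: power_inverse)
    finally show ?thesis .
  qed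
  finally show ?thesis .
qed

text \<open>The derivative of \<open>weighted_newton_sum\<close> at Z = Q. The chain rule gives a
  factor 1 - Q^(-2) on the left, which is h / Q and hence nonzero; on the right the derivative of
  Z^j + Z^(-j), multiplied by Q, is j \<open>br j\<close>.\<close>

lemma weighted_dnewton_sum:
  assumes j: "0 < j" "j < p"
  shows "(\<Sum>m=1..j. Q ^ (m ^ 2) * iQ ^ (j * m) * brf (m - 1) / (brf m ^ 2 * brf (j - m)) *
      (\<Sum>N<p. Q ^ (2 * N * (j - m)) * dnewton m (Q ^ (2 * N) * iQ)))
    = of_nat p * of_nat j / (brf (j - 1) * br j * h)"
proof -
  let ?v = "(of_nat j * Q ^ (j - 1) - of_nat j * iQ ^ (j + 1))"
  let ?c = "\<lambda>m. Q ^ (m ^ 2) * iQ ^ (j * m) * brf (m - 1) / (brf m ^ 2 * brf (j - m))"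
  let ?n = "\<lambda>m N. newton (\<lambda>l. csum (Q ^ (2 * N) * iQ * iQ ^ (2 * l))) m"
  let ?K = "of_nat p / (brf (j - 1) * br j ^ 2)"
  let ?S = "(\<Sum>m=1..j. ?c m * (\<Sum>N<p. Q ^ (2 * N * (j - m)) * dnewton m (Q ^ (2 * N) * iQ)))"
  have c: "(csum has_field_derivative (1 - iQ ^ 2)) (at Q)"
    unfolding csum_def[abs_def] by (auto intro!: derivative_eq_intros simp: power2_eq_square)
  have pd: "((\<lambda>z. poly P (csum z)) has_field_derivative (poly (pderiv P) (csum Q) * (1 - iQ ^ 2))) (at Q)" for P
    by (rule DERIV_chain2[OF poly_DERIV c])
  have d1: "((\<lambda>z. \<Sum>m=1..j. ?c m * (\<Sum>N<p. Q ^ (2 * N * (j - m)) * poly (?n m N) (csum z))) has_field_derivative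
      (\<Sum>m=1..j. ?c m * (\<Sum>N<p. Q ^ (2 * N * (j - m)) * (poly (pderiv (?n m N)) (csum Q) * (1 - iQ ^ 2))))) (at Q)"
    by (intro DERIV_sum DERIV_cmult pd)
  have d2: "(\<Sum>m=1..j. ?c m * (\<Sum>N<p. Q ^ (2 * N * (j - m)) * (poly (pderiv (?n m N)) (csum Q) * (1 - iQ ^ 2)))) = ?S * (1 - iQ ^ 2)"
    by (simp add: dnewton_def sum_distrib_left sum_distrib_right mult_ac del: power_inverse)
  have d3: "((\<lambda>z. \<Sum>m=1..j. ?c m * (\<Sum>N<p. Q ^ (2 * N * (j - m)) * poly (?n m N) (csum z))) has_field_derivative
      ?K * ?v) (at Q)"
  proof -
    have "((\<lambda>z. z ^ j + inverse z ^ j) has_field_derivative ?v) (at Q)"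
    proof -
      have e: "iQ ^ (j - 1) * (iQ * iQ) = iQ ^ (j + 1)" using j by (cases j) simp_all
      have "((\<lambda>z. z ^ j) has_field_derivative of_nat j * Q ^ (j - 1)) (at Q)"
        by (auto intro!: derivative_eq_intros)
      moreover have "((\<lambda>z. inverse z ^ j) has_field_derivative (of_nat j * iQ ^ (j - 1)) * - (iQ * iQ)) (at Q)"
        using DERIV_power[where n = j, OF DERIV_inverse[OF Q_nz, of UNIV]] by (simp add: mult_ac)
      ultimately have "((\<lambda>z. z ^ j + inverse z ^ j) has_field_derivative of_nat j * Q ^ (j - 1) + (of_nat j * iQ ^ (j - 1)) * - (iQ * iQ)) (at Q)"
        by (rule DERIV_add)
      moreover have "of_nat j * Q ^ (j - 1) + (of_nat j * iQ ^ (j - 1)) * - (iQ * iQ) = of_nat j * Q ^ (j - 1) - of_nat j * iQ ^ (j + 1)"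
        by (simp only: mult_minus_right mult.assoc e) simp
      ultimately show ?thesis by (simp only:)
    qed
    hence "((\<lambda>z. ?K * (z ^ j + inverse z ^ j)) has_field_derivative ?K * ?v) (at Q)"
      by (rule DERIV_cmult)
    \<comment> \<open>The closed form holds at every nonzero argument, hence near Q, which permits
      differentiating it there.\<close>
    moreover have "eventually (\<lambda>z. (\<Sum>m=1..j. ?c m * (\<Sum>N<p. Q ^ (2 * N * (j - m)) * poly (?n m N) (csum z))) = ?K * (z ^ j + inverse z ^ j)) (nhds Q)"
    proof -
      have "eventually (\<lambda>z. z \<noteq> 0) (nhds Q)" by (rule t1_space_nhds) simp
      thus ?thesis by eventually_elim (rule weighted_newton_sum[OF _ j])
    qed
    ultimately show ?thesis by (subst DERIV_cong_ev[OF refl _ refl]) 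
  qed
  have "?S * (1 - iQ ^ 2) = ?K * ?v"
    using DERIV_unique[OF d1 d3] unfolding d2 .
  hence "?S * (1 - iQ ^ 2) * Q = ?K * ?v * Q"
    by (rule arg_cong)
  hence "?S * ((1 - iQ ^ 2) * Q) = ?K * of_nat j * (Q ^ (j - 1) * Q - iQ ^ (j + 1) * Q)"
    by (simp only: mult.assoc left_diff_distrib right_diff_distrib)
  also have "(1 - iQ ^ 2) * Q = h" by (simp add: h_def power2_eq_square left_diff_distrib)
  also have "Q ^ (j - 1) * Q - iQ ^ (j + 1) * Q = br j"
  proof -
    have "Q ^ (j - 1) * Q = Q ^ j" using j by (cases j) simp_all
    moreover have "iQ ^ (j + 1) * Q = iQ ^ j * (iQ * Q)" by (simp only: power_add power_one_right mult.assoc)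
    ultimately show ?thesis by (simp add: br_def)
  qed
  finally have "?S * h = ?K * of_nat j * br j" .
  hence "?S = ?K * of_nat j * br j / h" by (simp only: nonzero_eq_divide_eq[OF h_nz])
  also have "\<dots> = of_nat p * of_nat j / (brf (j - 1) * br j * h)"
    using br_nz[OF j] by (simp add: power2_eq_square)
  finally show ?thesis .
qed

lemma chi_coeff_0: "chi_coeff y 0 = 0"
  by (simp add: chi_coeff_def dnewton_def)

lemma chi_poly_first_node: "poly (chi_poly y) (csum y) = 0"
  unfolding chi_poly_def poly_sum
proof (rule sum.neutral, rule ballI)
  fix m
  show "poly (smult (chi_coeff y m) (newton (\<lambda>l. csum (y * iQ ^ (2 * l))) m)) (csum y) = 0"
    using newton_root[of 0 m "\<lambda>l. csum (y * iQ ^ (2 * l))"] by (cases "m = 0") (auto simp: chi_coeff_0)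
qed

text \<open>From y^2 = Q^(2j) the factors y^(2N) Q^(-2Nm) become Q^(2N(j-m)), and the products of
  node differences turn into \<open>brf\<close> factors (\<open>pr\<close>); what remains is
  \<open>weighted_dnewton_sum\<close>.\<close>

lemma chi_poly_deriv_first_node:
  assumes y: "y \<noteq> 0" "y ^ 2 * iQ ^ (2 * j) = 1" and j: "0 < j" "j < p"
  shows "poly (pderiv (chi_poly y)) (csum y) = of_nat p * (of_nat j / (y - inverse y))"
proof -
  let ?D = "\<lambda>m. (\<Sum>N<p. Q ^ (2 * N * (j - m)) * dnewton m (Q ^ (2 * N) * iQ))"
  let ?n = "\<lambda>l. csum (y * iQ ^ (2 * l))"
  let ?p = "\<lambda>m. (\<Prod>l=1..<m. ?n 0 - ?n l)"
  have nz: "brf k \<noteq> 0" if "k \<le> j" for k using that j by (intro brf_nz) auto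
  have y2: "y ^ 2 = Q ^ (2 * j)"
  proof -
    have "y ^ 2 = y ^ 2 * (iQ ^ (2 * j) * Q ^ (2 * j))" by (simp only: Q_iQ mult_1_right)
    thus ?thesis by (simp only: mult.assoc[symmetric] y(2) mult_1_left)
  qed
  have n0: "?n j = ?n 0"
    using csum_eq_iff[of "y * iQ ^ (2 * j)" y] y by (simp add: power2_eq_square mult_ac)
  have pr: "(?p m) = (y * iQ ^ j) ^ (m - 1) * (brf (m - 1) * brf (j - 1) / brf (j - m))"
    if "1 \<le> m" "m \<le> j" for m
    using that
  proof (induction m rule: dec_induct)
    case base thus ?case using nz by simp
  next
    case (step m)
    have d: "?n 0 - ?n m = y * iQ ^ j * (br m * br (j - m))"
    proof -
      have "csum y - ?n m = (y - y * iQ ^ (2 * m)) * (1 - inverse (y * (y * iQ ^ (2 * m))))"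
        by (rule csum_diff) (use y in auto)
      also have "y - y * iQ ^ (2 * m) = y * (iQ ^ m * br m)"
      proof -
        have "y - y * iQ ^ (2 * m) = - (y * (iQ ^ (2 * m) - 1))" by (simp only: right_diff_distrib minus_diff_eq mult_1_right)
        thus ?thesis unfolding iQ_square_minus_1 by (simp only: mult_minus_right minus_minus)
      qed
      also have "inverse (y * (y * iQ ^ (2 * m))) = iQ ^ (2 * (j - m))"
      proof (rule inverse_unique)
        have "2 * j = 2 * m + 2 * (j - m)" using step by simp
        hence "y * (y * iQ ^ (2 * m)) * iQ ^ (2 * (j - m)) = y ^ 2 * iQ ^ (2 * j)"
          by (simp only: power_add power2_eq_square mult.assoc)
        with y show "y * (y * iQ ^ (2 * m)) * iQ ^ (2 * (j - m)) = 1" by simp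
      qed
      also have "1 - iQ ^ (2 * (j - m)) = iQ ^ (j - m) * br (j - m)"
        using iQ_square_minus_1[of "j - m"] by (simp add: algebra_simps del: power_inverse)
      also have "y * (iQ ^ m * br m) * (iQ ^ (j - m) * br (j - m)) = y * (iQ ^ m * iQ ^ (j - m)) * (br m * br (j - m))"
        by (simp only: mult_ac)
      also have "iQ ^ m * iQ ^ (j - m) = iQ ^ j" using step by (simp only: power_add[symmetric]) simp
      finally show ?thesis by simp
    qed
    obtain r where r: "m = Suc r" using step by (cases m) auto
    obtain i where i: "j - m = Suc i" using step by (cases "j - m") auto
    have im: "j - Suc m = i" using i by simp
    have IH: "(?p m) = (y * iQ ^ j) ^ (m - 1) * (brf (m - 1) * brf (j - 1) / brf (j - m))"
      using step by simp
    have bm: "brf m = brf (m - 1) * br m" by (simp add: r brf_Suc)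
    have bi: "brf (j - m) = brf i * br (j - m)" unfolding i by (rule brf_Suc)
    have n: "brf i \<noteq> 0" "br (j - m) \<noteq> 0" using nz[of "j - m"] unfolding bi by auto
    have "(\<Prod>l=1..<Suc m. ?n 0 - ?n l) = (?p m) * (?n 0 - ?n m)"
      using step(1) by simp
    also have "\<dots> = ((y * iQ ^ j) ^ (m - 1) * (y * iQ ^ j)) * ((brf (m - 1) * br m) * brf (j - 1) * (br (j - m) / brf (j - m)))"
      unfolding IH d by (simp only: times_divide_eq_left times_divide_eq_right mult_ac)
    also have "(y * iQ ^ j) ^ (m - 1) * (y * iQ ^ j) = (y * iQ ^ j) ^ (Suc m - 1)" by (simp add: r del: power_inverse)
    also have "(brf (m - 1) * br m) * brf (j - 1) * (br (j - m) / brf (j - m)) = brf (Suc m - 1) * brf (j - 1) / brf (j - Suc m)"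
      unfolding bm[symmetric] im unfolding bi using n by simp
    finally show ?case .
  qed
  have "poly (pderiv (chi_poly y)) (csum y) = (\<Sum>m=1..j. chi_coeff y m * (?p m))"
    using newton_sum_first_node(2)[of p j ?n "chi_coeff y"] j n0 unfolding chi_poly_def by simp
  also have "\<dots> = (\<Sum>m=1..j. (h * (Q ^ j / y) * brf (j - 1)) * (Q ^ (m ^ 2) * iQ ^ (j * m) * brf (m - 1) / (brf m ^ 2 * brf (j - m)) *
      (?D m)))"
  proof (rule sum.cong[OF refl])
    fix m assume "m \<in> {1..j}"
    hence m: "1 \<le> m" "m \<le> j" by auto
    obtain r where r: "m = Suc r" using m by (cases m) auto
    have s: "(\<Sum>N<p. y ^ (2 * N) * iQ ^ (2 * N * m) * dnewton m (Q ^ (2 * N) * iQ)) =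
       (?D m)"
    proof (rule sum.cong[OF refl])
      fix N
      have "y ^ (2 * N) = Q ^ (2 * N * (j - m)) * Q ^ (2 * N * m)"
      proof -
        have "2 * j * N = 2 * N * (j - m) + 2 * N * m" using m by (simp add: diff_mult_distrib2)
        moreover have "y ^ (2 * N) = Q ^ (2 * j * N)" by (simp only: power_mult y2)
        ultimately show ?thesis by (simp only: power_add)
      qed
      thus "y ^ (2 * N) * iQ ^ (2 * N * m) * dnewton m (Q ^ (2 * N) * iQ) = Q ^ (2 * N * (j - m)) * dnewton m (Q ^ (2 * N) * iQ)"
        by (simp only: mult.assoc Q_iQ) (simp only: mult.assoc[symmetric] Q_iQ mult_1_right mult_1_left)
    qed
    have yy: "(y * iQ ^ j) ^ (m - 1) / y ^ m = iQ ^ (j * m) * (Q ^ j / y)"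
    proof -
      have "iQ ^ (j * m) = iQ ^ (j * r) * iQ ^ j" by (simp only: r mult_Suc_right power_add mult.commute)
      hence "iQ ^ (j * m) * Q ^ j = iQ ^ (j * r)" by (simp only: mult.assoc Q_iQ mult_1_right)
      thus ?thesis using y(1)
        by (simp add: r power_mult_distrib del: power_inverse) (simp add: power_mult del: power_inverse)
    qed
    have "chi_coeff y m * (?p m) =
       h * brf (j - 1) * ((y * iQ ^ j) ^ (m - 1) / y ^ m) * (Q ^ (m ^ 2) * brf (m - 1) / (brf m ^ 2 * brf (j - m)) *
       (?D m))"
      unfolding pr[OF m] chi_coeff_def s by (simp add: mult_ac del: power_inverse)
    thus "chi_coeff y m * (?p m) = (h * (Q ^ j / y) * brf (j - 1)) * (Q ^ (m ^ 2) * iQ ^ (j * m) * brf (m - 1) / (brf m ^ 2 * brf (j - m)) *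
      (?D m))"
      unfolding yy by (simp add: mult_ac del: power_inverse)
  qed
  also have "\<dots> = (h * (Q ^ j / y) * brf (j - 1)) * (of_nat p * of_nat j / (brf (j - 1) * br j * h))"
    unfolding sum_distrib_left[symmetric] weighted_dnewton_sum[OF j] ..
  also have "\<dots> = of_nat p * (of_nat j * (Q ^ j / (y * br j)))"
    using nz[of "j - 1"] br_nz[OF j] by simp
  also have "Q ^ j / (y * br j) = 1 / (y - inverse y)"
  proof -
    have "y - inverse y = inverse y * (y ^ 2 - 1)" using y by (simp add: right_diff_distrib power2_eq_square)
    also have "y ^ 2 - 1 = Q ^ j * br j" unfolding y2 by (rule Q_square_minus_1)
    finally have a: "y - inverse y = Q ^ j * br j / y" by (simp add: field_simps)
    have "Q ^ j * Q ^ j = y * y" using y2 by (simp only: mult_2 power_add power2_eq_square)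
    thus ?thesis unfolding a using y br_nz[OF j] by (simp add: divide_simps)
  qed
  finally show ?thesis by simp
qed

text \<open>In contrast to \<open>rib_recursion\<close> no scalar factor appears, so values and
  derivatives are carried from node to node unchanged.\<close>

lemma chi_recursion:
  assumes y: "y \<noteq> 0" "y ^ (2 * p) = 1"
  obtains k where "[:- csum y, 1:] * (chi_poly (y * iQ ^ 2) - chi_poly y)
    = smult k (newton (\<lambda>l. csum (y * iQ ^ (2 * l))) p)"
proof -
  let ?n = "\<lambda>l. csum (y * iQ ^ (2 * l))"
  have p: "0 < p" using p_ge_2 by simp
  have n1: "(\<lambda>l. ?n (Suc l)) = (\<lambda>l. csum (y * iQ ^ 2 * iQ ^ (2 * l)))"
  proof
    fix l
    have "2 * Suc l = 2 + 2 * l" by simp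
    thus "?n (Suc l) = csum (y * iQ ^ 2 * iQ ^ (2 * l))" by (simp only: power_add mult.assoc)
  qed
  have rec: "chi_coeff (y * iQ ^ 2) m - chi_coeff y m = (?n (Suc m) - ?n 0) * chi_coeff y (Suc m)" if "Suc m < p" for m
    using chi_coeff_recursion[OF y that] by simp
  have "[:- csum y, 1:] * (chi_poly (y * iQ ^ 2) - chi_poly y)
    = smult (chi_coeff (y * iQ ^ 2) (p - 1) - chi_coeff y (p - 1)) (newton ?n p)"
    using newton_recursion[of p "chi_coeff (y * iQ ^ 2)" "chi_coeff y" ?n, OF p rec]
    unfolding chi_poly_def n1 by simp
  thus thesis by (rule that)
qed

lemma node_ne_first':
  assumes y: "y \<noteq> 0" "y ^ 2 * iQ ^ (2 * (i + j)) = 1" and ij: "0 < i" "i \<le> j" "j < p"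
  shows "csum (y * iQ ^ (2 * i)) \<noteq> csum y"
proof -
  have "inverse y * Q ^ (2 * i) = inverse (y * iQ ^ (2 * i))" by (simp add: power_inverse)
  moreover have "inverse y ^ 2 * Q ^ (2 * (i + j)) = inverse (y ^ 2 * iQ ^ (2 * (i + j)))" by (simp add: power_inverse)
  ultimately show ?thesis
    using node_ne_first[of "inverse y" i j] y ij by (metis csum_inverse inverse_1 nonzero_imp_inverse_nonzero)
qed

text \<open>The induction of \<open>rib_poly_jet\<close> with Q replaced by its inverse. The value
  stays 0, and the derivative sees the pair only through j - i and the node.\<close>

lemma chi_poly_jet:
  assumes "y \<noteq> 0" "y ^ (2 * p) = 1" "y ^ 2 * iQ ^ (2 * (i + j)) = 1" "i \<le> j" "j < p"
  shows "poly (chi_poly y) (csum (y * iQ ^ (2 * i))) = 0 \<and>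
    (i < j \<longrightarrow> poly (pderiv (chi_poly y)) (csum (y * iQ ^ (2 * i))) =
      of_nat p * (of_nat (j - i) / (y * iQ ^ (2 * i) - inverse (y * iQ ^ (2 * i)))))"
  using assms
proof (induction i arbitrary: y j)
  case 0
  thus ?case using chi_poly_first_node[of y] chi_poly_deriv_first_node[of y j] by auto
next
  case (Suc i)
  let ?y = "y * iQ ^ 2"
  let ?n = "\<lambda>l. csum (y * iQ ^ (2 * l))"
  let ?H = "chi_poly ?y - chi_poly y"
  obtain r where r: "j = Suc r" using Suc.prems by (cases j) auto
  have e: "?y ^ 2 * iQ ^ (2 * (i + r)) = 1"
  proof -
    have "2 * (Suc i + j) = 2 * 2 + 2 * (i + r)" by (simp add: r)
    hence "?y ^ 2 * iQ ^ (2 * (i + r)) = y ^ 2 * iQ ^ (2 * (Suc i + j))"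
      by (simp only: power_add power_mult_distrib power_mult mult.assoc)
    with Suc.prems show ?thesis by simp
  qed
  have yp: "?y ^ (2 * p) = 1"
  proof -
    have "(iQ ^ 2) ^ (2 * p) = inverse ((Q ^ (2 * p)) ^ 2)" by (simp only: power_inverse power_mult[symmetric] mult.commute)
    thus ?thesis using Suc.prems by (simp add: power_mult_distrib Q_root del: power_inverse)
  qed
  have node: "?y * iQ ^ (2 * i) = y * iQ ^ (2 * Suc i)"
  proof -
    have "2 * Suc i = 2 + 2 * i" by simp
    thus ?thesis by (simp only: power_add mult.assoc)
  qed
  have IH: "poly (chi_poly ?y) (?n (Suc i)) = 0"
    "i < r \<Longrightarrow> poly (pderiv (chi_poly ?y)) (?n (Suc i)) =
      of_nat p * (of_nat (r - i) / (y * iQ ^ (2 * Suc i) - inverse (y * iQ ^ (2 * Suc i))))"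
    using Suc.IH[of ?y r] e yp Suc.prems r unfolding node by auto
  obtain k where k: "[:- ?n 0, 1:] * ?H = smult k (newton ?n p)"
    using chi_recursion[of y] Suc.prems by auto
  have ne: "?n (Suc i) \<noteq> ?n 0"
    using node_ne_first'[of y "Suc i" j] Suc.prems by simp
  have H0: "poly ?H (?n (Suc i)) = 0"
    using newton_recursion_jets(1)[OF k _ ne] Suc.prems by simp
  have nj: "?n (Suc i) = ?n j"
  proof -
    have "2 * (Suc i + j) = 2 * Suc i + 2 * j" by simp
    hence "y * iQ ^ (2 * Suc i) * (y * iQ ^ (2 * j)) = 1"
      using Suc.prems(3) by (simp only: power_add power2_eq_square mult_ac)
    thus ?thesis using csum_eq_iff[of "y * iQ ^ (2 * Suc i)" "y * iQ ^ (2 * j)"] Suc.prems by auto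
  qed
  have H1: "poly (pderiv ?H) (?n (Suc i)) = 0" if "Suc i < j"
    using newton_recursion_jets(2)[OF k _ ne that _ nj] Suc.prems by simp
  have val: "poly (chi_poly y) (?n (Suc i)) = 0"
    using H0 IH(1) by simp
  have der: "poly (pderiv (chi_poly y)) (?n (Suc i)) =
      of_nat p * (of_nat (j - Suc i) / (y * iQ ^ (2 * Suc i) - inverse (y * iQ ^ (2 * Suc i))))" if ij: "Suc i < j"
  proof -
    have ir: "i < r" "r - i = j - Suc i" using ij r by auto
    have "poly (pderiv (chi_poly y)) (?n (Suc i)) = poly (pderiv (chi_poly ?y)) (?n (Suc i))"
      using H1[OF ij] by (simp add: pderiv_diff)
    thus ?thesis by (simp only: IH(2)[OF ir(1), unfolded ir(2)])
  qed
  show ?case using val der by blast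
qed

text \<open>The shifts of \<open>x\<close> match the nodes arising from \<open>f\<^sup>m e\<^sup>m\<close> and \<open>e\<^sup>m f\<^sup>m\<close> on a vector of weight \<open>x\<close>.\<close>

lemma exists_partner:
  assumes x: "x ^ (2 * p) = 1" and i: "i < p"
  obtains j where "j < p" "(x * Q) ^ 2 * Q ^ (2 * (i + j)) = 1"
proof -
  have xn: "x \<noteq> 0" using x p_ge_2 by (intro notI) (simp add: power_0_left)
  \<comment> \<open>These are p distinct p-th roots of unity, hence all of them, so the value 1 is
    attained.\<close>
  let ?f = "\<lambda>j. (x * Q) ^ 2 * Q ^ (2 * (i + j))"
  have inj: "inj_on ?f {..<p}"
  proof (rule linorder_inj_onI)
    fix j k assume jk: "j < k" "j \<in> {..<p}" "k \<in> {..<p}"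
    have "2 * (i + k) = 2 * (i + j) + 2 * (k - j)" using jk by simp
    hence "?f k = ?f j * Q ^ (2 * (k - j))" by (simp only: power_add mult.assoc)
    moreover have "Q ^ (2 * (k - j)) \<noteq> 1" using Q_primitive[of "k - j"] jk by auto
    ultimately show "?f j \<noteq> ?f k" using xn by auto
  qed auto
  have "?f ` {..<p} \<subseteq> {z. z ^ p = 1}"
  proof safe
    fix j
    have "?f j ^ p = x ^ (2 * p) * (Q ^ (2 * p)) ^ (1 + i + j)"
      by (simp only: power_mult_distrib power_mult[symmetric] power_add mult.assoc) (simp add: algebra_simps power_add power_mult)
    thus "?f j ^ p = 1" using x by (simp add: Q_root)
  qed
  moreover have "card {z::complex. z ^ p = 1} \<le> card (?f ` {..<p})"
    using inj card_roots_unity[of p, where 'a = complex] p_ge_2 by (simp add: card_image)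
  moreover have "finite {z::complex. z ^ p = 1}" using finite_roots_unity[of p] p_ge_2 by simp
  ultimately have "?f ` {..<p} = {z. z ^ p = 1}" by (intro card_subset_eq) (auto simp: card_mono antisym)
  hence "1 \<in> ?f ` {..<p}" by auto
  thus thesis using that by auto
qed

text \<open>Both derivatives are j - i over the same difference, multiplied by the value of the
  ribbon polynomial in one case and by p in the other; hence the factor 1/p in front of
  \<open>chi_poly\<close>. For i = j only the values are compared.\<close>

lemma ribbon_chi_jet:
  assumes x: "x ^ (2 * p) = 1" and ij: "i \<le> j" "j < p" and e: "(x * Q) ^ 2 * Q ^ (2 * (i + j)) = 1"
  defines "c \<equiv> csum (x * Q ^ (2 * i + 1))"
  shows "[:- c, 1:] ^ (if i < j then 2 else 1) dvd
    rib_poly (x * Q) - smult ((x * Q) ^ (2 * i) * Q ^ (2 * i ^ 2)) (1 + smult (1 / of_nat p) (chi_poly (x * iQ)))"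
proof -
  let ?v = "(x * Q) ^ (2 * i) * Q ^ (2 * i ^ 2)"
  let ?H = "rib_poly (x * Q) - smult ?v (1 + smult (1 / of_nat p) (chi_poly (x * iQ)))"
  have xn: "x \<noteq> 0" using x p_ge_2 by (intro notI) (simp add: power_0_left)
  \<comment> \<open>The ribbon nodes climb from x Q and the pseudotrace nodes descend from x / Q.
    Since Q^(2p) = 1, index l in one list is index p - 1 - l in the other.\<close>
  define i' j' where "i' = p - 1 - j" and "j' = p - 1 - i"
  have ij': "i' \<le> j'" "j' < p" "j' - i' = j - i" using ij by (auto simp: i'_def j'_def)
  have c1: "c = csum (x * Q * Q ^ (2 * i))" by (simp add: c_def mult_ac)
  have c2: "c = csum (x * Q * Q ^ (2 * j))"
  proof -
    have "x * Q * Q ^ (2 * i) * (x * Q * Q ^ (2 * j)) = 1"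
      using e by (simp add: power2_eq_square power_add distrib_left mult_ac)
    thus ?thesis unfolding c1 by (subst csum_eq_iff) (use xn in auto)
  qed
  have n: "x * iQ * iQ ^ (2 * i') = x * Q * Q ^ (2 * j)"
  proof -
    have "Q * Q ^ (2 * j) = iQ * iQ ^ (2 * i') * Q ^ (2 * p)"
    proof -
      have "2 * p = Suc (2 * i') + Suc (2 * j)" using ij p_ge_2 by (simp add: i'_def)
      hence "iQ * iQ ^ (2 * i') * Q ^ (2 * p) = (iQ ^ Suc (2 * i') * Q ^ Suc (2 * i')) * Q ^ Suc (2 * j)"
        by (simp only: power_add power_Suc mult.assoc)
      thus ?thesis by (simp only: Q_iQ) simp
    qed
    thus ?thesis by (simp add: Q_root mult.assoc del: power_inverse)
  qed
  have yp: "(x * iQ) ^ (2 * p) = 1"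
    using x Q_root by (simp add: power_mult_distrib power_inverse)
  have e': "(x * iQ) ^ 2 * iQ ^ (2 * (i' + j')) = 1"
  proof -
    have "2 * p + 2 * p = 2 + 2 * (i' + j') + (2 + 2 * (i + j))" using ij p_ge_2 by (simp add: i'_def j'_def)
    hence "Q ^ (2 * p) * Q ^ (2 * p) = Q ^ 2 * Q ^ (2 * (i' + j')) * (Q ^ 2 * Q ^ (2 * (i + j)))"
      by (simp only: power_add[symmetric])
    hence "Q ^ 2 * Q ^ (2 * (i + j)) = iQ ^ 2 * iQ ^ (2 * (i' + j'))"
      using Q_root by (simp add: field_simps)
    hence "(x * iQ) ^ 2 * iQ ^ (2 * (i' + j')) = (x * Q) ^ 2 * Q ^ (2 * (i + j))"
      by (simp only: power_mult_distrib mult.assoc)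
    with e show ?thesis by simp
  qed
  have R: "poly (rib_poly (x * Q)) c = ?v"
    "i < j \<Longrightarrow> poly (pderiv (rib_poly (x * Q))) c = ?v * (of_nat (j - i) / (x * Q * Q ^ (2 * j) - inverse (x * Q * Q ^ (2 * j))))"
    using rib_poly_jet[of "x * Q" i j] xn e ij unfolding c1 by auto
  have "i' < j' \<longleftrightarrow> i < j" using ij' ij by auto
  hence C: "poly (chi_poly (x * iQ)) c = 0"
    "i < j \<Longrightarrow> poly (pderiv (chi_poly (x * iQ))) c = of_nat p * (of_nat (j - i) / (x * Q * Q ^ (2 * j) - inverse (x * Q * Q ^ (2 * j))))"
    using chi_poly_jet[of "x * iQ" i' j'] xn e' yp ij' unfolding n c2[symmetric] by auto
  have H0: "poly ?H c = 0" using R C by simp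
  show ?thesis
  proof (cases "i < j")
    case True
    have "poly (pderiv ?H) c = 0"
      using R(2)[OF True] C(2)[OF True] p_ge_2
      by (simp add: pderiv_diff pderiv_smult pderiv_add del: power_inverse inverse_mult_distrib)
    with H0 True show ?thesis by (simp only: if_True linear_square_dvd_iff simp_thms)
  next
    case False
    with H0 show ?thesis by (simp only: if_False poly_eq_0_iff_dvd power_one_right)
  qed
qed

end

section \<open>Homomorphisms and antihomomorphisms on free algebras\<close>

locale complex_algebra = complex_vs scale for scale :: "complex \<Rightarrow> 'v::ring_1 \<Rightarrow> 'v" +
  assumes scale_mult_left: "scale c x * y = scale c (x * y)"
    and scale_mult_right: "x * scale c y = scale c (x * y)"
begin

lemma lext_mult:
  fixes \<phi> :: "'m::monoid_add \<Rightarrow> 'v"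
  assumes "\<And>a b. \<phi> (a + b) = \<phi> a * \<phi> b"
  shows "lext scale \<phi> (x * y) = lext scale \<phi> x * lext scale \<phi> y"
proof -
  have "lext scale \<phi> (vec a * y) = \<phi> a * lext scale \<phi> y" for a y
    by (rule linear_ext_eq[where F = "\<lambda>y. lext scale \<phi> (vec a * y)"])
      (simp_all add: distrib_left lext_add lext_scl scl_mult_right vec_mult assms scale_mult_right)
  thus ?thesis
    by (intro linear_ext_eq[where F = "\<lambda>x. lext scale \<phi> (x * y)" and x = x])
      (simp_all add: distrib_right lext_add lext_scl scl_mult_left scale_mult_left)
qed

lemma lext_antimult:
  fixes \<phi> :: "'m::monoid_add \<Rightarrow> 'v"
  assumes "\<And>a b. \<phi> (a + b) = \<phi> b * \<phi> a"
  shows "lext scale \<phi> (x * y) = lext scale \<phi> y * lext scale \<phi> x"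
proof -
  have "lext scale \<phi> (vec a * y) = lext scale \<phi> y * \<phi> a" for a y
    by (rule linear_ext_eq[where F = "\<lambda>y. lext scale \<phi> (vec a * y)"])
      (simp_all add: distrib_left distrib_right lext_add lext_scl scl_mult_right vec_mult assms scale_mult_left)
  thus ?thesis
    by (intro linear_ext_eq[where F = "\<lambda>x. lext scale \<phi> (x * y)" and x = x])
      (simp_all add: distrib_left distrib_right lext_add lext_scl scl_mult_left scale_mult_right)
qed

definition hom_ext :: "('g \<Rightarrow> 'v) \<Rightarrow> 'g free_alg \<Rightarrow> 'v" where
  "hom_ext f = lext scale (\<lambda>w. prod_list (map f w))"

definition antihom_ext :: "('g \<Rightarrow> 'v) \<Rightarrow> 'g free_alg \<Rightarrow> 'v" where
  "antihom_ext f = lext scale (\<lambda>w. prod_list (map f (rev w)))"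

lemma ext_mult:
  shows hom_ext_mult: "hom_ext f (x * y) = hom_ext f x * hom_ext f y"
    and antihom_ext_mult: "antihom_ext f (x * y) = antihom_ext f y * antihom_ext f x"
  unfolding hom_ext_def antihom_ext_def
  by (rule lext_mult lext_antimult; simp add: plus_list_def)+

lemma ext_linear:
  "hom_ext f (x + y) = hom_ext f x + hom_ext f y" "hom_ext f (x - y) = hom_ext f x - hom_ext f y"
  "hom_ext f (- x) = - hom_ext f x" "hom_ext f (scl c x) = scale c (hom_ext f x)" "hom_ext f 0 = 0"
  "antihom_ext f (x + y) = antihom_ext f x + antihom_ext f y"
  "antihom_ext f (x - y) = antihom_ext f x - antihom_ext f y"
  "antihom_ext f (- x) = - antihom_ext f x"
  "antihom_ext f (scl c x) = scale c (antihom_ext f x)" "antihom_ext f 0 = 0"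
  by (simp_all add: hom_ext_def antihom_ext_def lext_add lext_diff lext_uminus lext_scl)

lemma ext_one: "hom_ext f 1 = 1" "antihom_ext f 1 = 1"
  unfolding hom_ext_def antihom_ext_def by (simp_all add: zero_list_def flip: single_one)

lemma ext_gen: "hom_ext f (gen g) = f g" "antihom_ext f (gen g) = f g"
  unfolding hom_ext_def antihom_ext_def by simp_all

lemma ext_power: "hom_ext f (x ^ n) = hom_ext f x ^ n" "antihom_ext f (x ^ n) = antihom_ext f x ^ n"
  by (induction n) (simp_all add: ext_one ext_mult power_commutes)

lemmas ext_simps = ext_mult ext_linear ext_one ext_gen ext_power

lemma lext_lin_ext: "lext scale f (lin_ext g x) = lext scale (\<lambda>a. lext scale f (g a)) x"
  by (rule linear_ext_eq) (simp_all add: lin_ext_eq_lext scl.lext_add scl.lext_scl lext_add lext_scl)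

end

interpretation cmult: complex_algebra "(*) :: complex \<Rightarrow> complex \<Rightarrow> complex"
  by unfold_locales auto

interpretation sca: complex_algebra "(*s) :: complex \<Rightarrow> 'm::presented_monoid alg \<Rightarrow> 'm alg"
  by unfold_locales auto

subsection \<open>Generators and relations\<close>

text \<open>Relations are attached to the type of generators, so that words over it become an
  instance of \<open>presented_monoid\<close>; pairs of words, that is tensor squares, then follow
  from a general product instance.\<close>

class presenting =
  fixes grels :: "'a free_alg set" and gaug :: "'a \<Rightarrow> complex"
  assumes gaug_grels: "r \<in> grels \<Longrightarrow> cmult.hom_ext gaug r = 0"

instantiation list :: (presenting) presented_monoid
begin

definition rels_list :: "'a free_alg set" where "rels_list = grels"
definition aug_list :: "'a list \<Rightarrow> complex" where "aug_list w = prod_list (map gaug w)"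

instance
proof
  show "lext (*) aug r = 0" if "r \<in> rels" for r :: "'a free_alg"
    using gaug_grels[of r] that by (simp add: rels_list_def aug_list_def[abs_def] cmult.hom_ext_def)
qed (simp_all add: aug_list_def zero_list_def plus_list_def)

end

subsection \<open>Tensor products\<close>

lemma tens_linear [simp]:
  "(x + x') \<otimes>\<^sub>v y = x \<otimes>\<^sub>v y + x' \<otimes>\<^sub>v y" "x \<otimes>\<^sub>v (y + y') = x \<otimes>\<^sub>v y + x \<otimes>\<^sub>v y'"
  "scl c x \<otimes>\<^sub>v y = scl c (x \<otimes>\<^sub>v y)" "x \<otimes>\<^sub>v scl c y = scl c (x \<otimes>\<^sub>v y)"
  "0 \<otimes>\<^sub>v y = 0" "x \<otimes>\<^sub>v 0 = 0"
proof -
  show "(x + x') \<otimes>\<^sub>v y = x \<otimes>\<^sub>v y + x' \<otimes>\<^sub>v y" "scl c x \<otimes>\<^sub>v y = scl c (x \<otimes>\<^sub>v y)" "0 \<otimes>\<^sub>v y = 0"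
    by (simp_all add: tens_def lin_ext_eq_lext scl.lext_add scl.lext_scl)
  show "x \<otimes>\<^sub>v (y + y') = x \<otimes>\<^sub>v y + x \<otimes>\<^sub>v y'" "x \<otimes>\<^sub>v scl c y = scl c (x \<otimes>\<^sub>v y)" "x \<otimes>\<^sub>v 0 = 0"
    by (simp_all add: tens_def lin_ext_eq_lext lext_def[of scl _ x] scl.lext_add scl.lext_scl
        scl.scale_right_distrib sum.distrib scl.scale_sum_right scl.scale_left_commute[of c] mult.commute)
qed

lemma tens_vec [simp]: "vec a \<otimes>\<^sub>v vec b = vec (a, b)"
  by (simp add: tens_def lin_ext_eq_lext)

lemma tens_uminus: "(- x) \<otimes>\<^sub>v y = - (x \<otimes>\<^sub>v y)" "x \<otimes>\<^sub>v (- y) = - (x \<otimes>\<^sub>v y)"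
  using tens_linear(1)[of x "- x" y] tens_linear(2)[of x y "- y"]
  by (simp_all add: eq_neg_iff_add_eq_0 add.commute)

lemma tens_diff: "(x - x') \<otimes>\<^sub>v y = x \<otimes>\<^sub>v y - x' \<otimes>\<^sub>v y" "x \<otimes>\<^sub>v (y - y') = x \<otimes>\<^sub>v y - x \<otimes>\<^sub>v y'"
  using tens_linear(1)[of x "- x'" y] tens_linear(2)[of x y "- y'"] by (simp_all add: tens_uminus)

lemma (in complex_vs) bilinear_ext_eq:
  assumes "\<And>x x' y. F (x + x') y = F x y + F x' y" "\<And>c x y. F (scl c x) y = scale c (F x y)"
    and "\<And>x y y'. F x (y + y') = F x y + F x y'" "\<And>c x y. F x (scl c y) = scale c (F x y)"
    and "\<And>x x' y. G (x + x') y = G x y + G x' y" "\<And>c x y. G (scl c x) y = scale c (G x y)"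
    and "\<And>x y y'. G x (y + y') = G x y + G x y'" "\<And>c x y. G x (scl c y) = scale c (G x y)"
    and "\<And>a b. F (vec a) (vec b) = G (vec a) (vec b)"
  shows "F x y = G x y"
proof -
  have "F (vec a) y = G (vec a) y" for a
    by (rule linear_ext_eq) (use assms in auto)
  thus ?thesis
    by (intro linear_ext_eq[where F = "\<lambda>x. F x y" and x = x]) (use assms in auto)
qed

lemma tens_mult: "(x \<otimes>\<^sub>v y) * (z \<otimes>\<^sub>v w) = (x * z) \<otimes>\<^sub>v (y * w :: 'n::monoid_add vect)"
  for x z :: "'m::monoid_add vect"
proof -
  have "(vec a \<otimes>\<^sub>v vec b) * (z \<otimes>\<^sub>v w) = (vec a * z) \<otimes>\<^sub>v (vec b * w)" for a :: 'm and b :: 'n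
    by (rule scl.bilinear_ext_eq[where F = "\<lambda>z w. (vec a \<otimes>\<^sub>v vec b) * (z \<otimes>\<^sub>v w)"])
      (simp_all add: distrib_left scl_mult_right vec_mult plus_prod_def del: tens_vec,
       simp_all add: vec_mult plus_prod_def)
  thus ?thesis
    by (intro scl.bilinear_ext_eq[where F = "\<lambda>x y. (x \<otimes>\<^sub>v y) * (z \<otimes>\<^sub>v w)" and x = x and y = y])
      (simp_all add: distrib_right scl_mult_left)
qed

instantiation prod :: (presented_monoid, presented_monoid) presented_monoid
begin

definition rels_prod :: "('a \<times> 'b) vect set" where "rels_prod = tensor_rels rels rels"
definition aug_prod :: "'a \<times> 'b \<Rightarrow> complex" where "aug_prod = (\<lambda>(a, b). aug a * aug b)"

instance
proof
  show "lext (*) aug r = 0" if "r \<in> rels" for r :: "('a \<times> 'b) vect"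
  proof -
    have "lext (*) aug (x \<otimes>\<^sub>v y) = lext (*) aug x * lext (*) aug y"
      for x :: "'a vect" and y :: "'b vect"
      by (rule cmult.bilinear_ext_eq[where F = "\<lambda>x y. lext (*) aug (x \<otimes>\<^sub>v y)"])
        (simp_all add: cmult.lext_add cmult.lext_scl distrib_left distrib_right aug_prod_def)
    with that show ?thesis by (auto simp: rels_prod_def tensor_rels_def aug_rels)
  qed
qed (simp_all add: aug_prod_def zero_prod_def aug_zero split: prod.splits, simp add: aug_add)

end

lemma rel_ideal_tens_left: "x \<in> rel_ideal \<Longrightarrow> pr (x \<otimes>\<^sub>v y) = 0"
proof (rule ideal_kill[where \<phi> = "\<lambda>x. pr (x \<otimes>\<^sub>v y)"])
  fix r a b :: "'a vect" assume "r \<in> rels"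
  hence "pr (r \<otimes>\<^sub>v (1 :: 'b vect)) = 0" by (intro pr_rel) (auto simp: rels_prod_def tensor_rels_def)
  moreover have "(a * r * b) \<otimes>\<^sub>v y = (a \<otimes>\<^sub>v y) * (r \<otimes>\<^sub>v 1) * (b \<otimes>\<^sub>v 1)" by (simp add: tens_mult)
  ultimately show "pr ((a * r * b) \<otimes>\<^sub>v y) = 0" by simp
qed simp_all

lemma rel_ideal_tens_right:
  fixes x :: "'a::presented_monoid vect" and y :: "'b::presented_monoid vect"
  shows "y \<in> rel_ideal \<Longrightarrow> pr (x \<otimes>\<^sub>v y) = 0"
proof (rule ideal_kill[where \<phi> = "\<lambda>y. pr (x \<otimes>\<^sub>v y)"])
  fix r a b :: "'b vect" assume "r \<in> rels"
  hence "pr ((1 :: 'a vect) \<otimes>\<^sub>v r) = 0" by (intro pr_rel) (auto simp: rels_prod_def tensor_rels_def)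
  moreover have "x \<otimes>\<^sub>v (a * r * b) = (x \<otimes>\<^sub>v a) * (1 \<otimes>\<^sub>v r) * (1 \<otimes>\<^sub>v b)" by (simp add: tens_mult)
  ultimately show "pr (x \<otimes>\<^sub>v (a * r * b)) = 0" by simp
qed simp_all

lift_definition tn :: "'m::presented_monoid alg \<Rightarrow> 'n::presented_monoid alg \<Rightarrow> ('m \<times> 'n) alg" is tens
proof -
  fix x x' :: "'m vect" and y y' :: "'n vect"
  assume "x - x' \<in> rel_ideal" "y - y' \<in> rel_ideal"
  hence "pr ((x - x') \<otimes>\<^sub>v y) = 0" "pr (x' \<otimes>\<^sub>v (y - y')) = 0"
    by (simp_all add: rel_ideal_tens_left rel_ideal_tens_right)
  thus "x \<otimes>\<^sub>v y - x' \<otimes>\<^sub>v y' \<in> rel_ideal" by (simp add: tens_diff pr_eq_0_iff[symmetric])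
qed

lemma pr_tens [simp]: "pr (x \<otimes>\<^sub>v y) = tn (pr x) (pr y)"
  by (simp add: tn.abs_eq)

definition bilin :: "('m::presented_monoid alg \<Rightarrow> 'n::presented_monoid alg \<Rightarrow> 'k::presented_monoid alg) \<Rightarrow> bool" where
  "bilin B \<longleftrightarrow> (\<forall>x x' y. B (x + x') y = B x y + B x' y) \<and> (\<forall>x y y'. B x (y + y') = B x y + B x y') \<and>
     (\<forall>c x y. B (c *s x) y = c *s B x y) \<and> (\<forall>c x y. B x (c *s y) = c *s B x y)"

lemma bilinD:
  assumes "bilin B"
  shows "B (x + x') y = B x y + B x' y" "B x (y + y') = B x y + B x y'"
    "B (c *s x) y = c *s B x y" "B x (c *s y) = c *s B x y" "B 0 y = 0" "B x 0 = 0"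
    "B (sum f A) y = (\<Sum>i\<in>A. B (f i) y)" "B x (sum g A) = (\<Sum>i\<in>A. B x (g i))"
    "B (- x) y = - B x y" "B x (- y) = - B x y" "B (x - x') y = B x y - B x' y"
proof -
  note a = assms[unfolded bilin_def]
  show 1: "B (x + x') y = B x y + B x' y" "B x (y + y') = B x y + B x y'"
    "B (c *s x) y = c *s B x y" "B x (c *s y) = c *s B x y" for x x' y y'
    using a by blast+
  show z: "B 0 y = 0" "B x 0 = 0" for x y using 1(1)[of 0 0 y] 1(2)[of x 0 0] by simp_all
  show "B (sum f A) y = (\<Sum>i\<in>A. B (f i) y)" "B x (sum g A) = (\<Sum>i\<in>A. B x (g i))"
    by (induction A rule: infinite_finite_induct) (simp_all add: 1 z)
  show n: "B (- x) y = - B x y" "B x (- y) = - B x y" for x y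
    using 1(1)[of x "- x" y] 1(2)[of x y "- y"] z by (simp_all add: eq_neg_iff_add_eq_0 add.commute)
  show "B (x - x') y = B x y - B x' y"
    using 1(1)[of x "- x'" y] by (simp add: n)
qed

lemma bilin_tn: "bilin tn"
  unfolding bilin_def by (intro conjI allI; transfer; simp add: rel_ideal_0)

lemmas tn_simps = bilinD[OF bilin_tn]

lemma tn_mult: "tn x y * tn z w = tn (x * z) (y * w)"
  by transfer (simp add: tens_mult rel_ideal_0)

definition tlift ::
    "('m::presented_monoid alg \<Rightarrow> 'n::presented_monoid alg \<Rightarrow> 'k::presented_monoid alg) \<Rightarrow> ('m \<times> 'n) vect \<Rightarrow> 'k alg" where
  "tlift B t = lext (*s) (\<lambda>(a, b). B (pr (vec a)) (pr (vec b))) t"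

lemma tlift_linear [simp]:
  "tlift B (s + t) = tlift B s + tlift B t" "tlift B (scl c t) = c *s tlift B t" "tlift B (s - t) = tlift B s - tlift B t"
  "tlift B (sum f A) = (\<Sum>i\<in>A. tlift B (f i))"
  by (simp_all add: tlift_def sca.lext_add sca.lext_scl sca.lext_diff sca.lext_sum)

lemma tlift_tens:
  assumes "bilin B"
  shows "tlift B (x \<otimes>\<^sub>v y) = B (pr x) (pr y)"
  by (rule sca.bilinear_ext_eq[where F = "\<lambda>x y. tlift B (x \<otimes>\<^sub>v y)"])
    (simp_all add: bilinD[OF assms] tlift_def sca.lext_add sca.lext_scl)

text \<open>The universal property of the tensor product of two presented algebras, for bilinear
  maps that need not be multiplicative. A relation r tensor 1 framed by words is again a pure tensor
  with one factor in the ideal, so bilinearity kills it.\<close>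

lemma tlift_cong:
  assumes B: "bilin B" and eq: "pr s = pr t"
  shows "tlift B s = tlift B t"
proof -
  have "tlift B x = 0" if "x \<in> rel_ideal" for x
    unfolding tlift_def
  proof (rule sca.ideal_kill_linear[OF that], fold tlift_def, goal_cases)
    case (1 r a b)
    obtain a1 a2 b1 b2 where [simp]: "a = (a1, a2)" "b = (b1, b2)" by (cases a, cases b) auto
    from 1 consider s where "s \<in> rels" "r = s \<otimes>\<^sub>v 1" | s where "s \<in> rels" "r = 1 \<otimes>\<^sub>v s"
      by (auto simp: rels_prod_def tensor_rels_def)
    thus ?case
    proof cases
      case 1
      hence "vec a * r * vec b = (vec a1 * s * vec b1) \<otimes>\<^sub>v (vec a2 * vec b2)"
        by (simp add: tens_mult flip: tens_vec)
      with 1 B show ?thesis by (simp add: tlift_tens pr_rel bilinD)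
    next
      case 2
      hence "vec a * r * vec b = (vec a1 * vec b1) \<otimes>\<^sub>v (vec a2 * s * vec b2)"
        by (simp add: tens_mult flip: tens_vec)
      with 2 B show ?thesis by (simp add: tlift_tens pr_rel bilinD)
    qed
  qed
  from this[of "s - t"] eq show ?thesis by (simp add: pr_eq_iff)
qed

subsection \<open>A fixed pair of parameters\<close>

definition ribbon_formula :: "nat \<Rightarrow> nat \<Rightarrow> bool" where
  "ribbon_formula pp pm \<longleftrightarrow> (\<forall>e. block_idempotents pp pm e \<longrightarrow> ribbon pp pm =
    (\<Oplus>\<^bsub>g_alg pp pm\<^esub>i\<in>index_set pp pm.
        scalar_mult (g_rels pp pm) (exp (2 * \<i> * of_real pi * conf_dim pp pm i)) (e i))
    \<otimes>\<^bsub>g_alg pp pm\<^esub>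
    ((\<one>\<^bsub>g_alg pp pm\<^esub> \<oplus>\<^bsub>g_alg pp pm\<^esub> scalar_mult (g_rels pp pm) (1 / of_nat pp) (chi_NW pp pm))
     \<otimes>\<^bsub>g_alg pp pm\<^esub>
     (\<one>\<^bsub>g_alg pp pm\<^esub> \<oplus>\<^bsub>g_alg pp pm\<^esub> scalar_mult (g_rels pp pm) (1 / of_nat pm) (chi_NE pp pm))))"

definition admissible :: "nat \<Rightarrow> nat \<Rightarrow> bool" where
  "admissible pp pm \<longleftrightarrow> 2 \<le> pp \<and> 2 \<le> pm \<and> coprime pp pm"

text \<open>
  A quotient type cannot depend on parameters. So the parameters are fixed as constants: a
  counterexample to the theorem if there is one, and an arbitrary admissible pair otherwise. Only
  admissibility is ever used of them, and then the theorem for these constants excludes any counterexample.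
\<close>

definition params :: "nat \<times> nat" where
  "params = (SOME x. admissible (fst x) (snd x) \<and>
     ((\<exists>a b. admissible a b \<and> \<not> ribbon_formula a b) \<longrightarrow> \<not> ribbon_formula (fst x) (snd x)))"

definition PP :: nat where "PP = fst params"
definition PM :: nat where "PM = snd params"

abbreviation Qp :: complex where "Qp \<equiv> Qpar PP PM"
abbreviation Qm :: complex where "Qm \<equiv> Qpar PM PP"

lemma params:
  shows admissible_params: "admissible PP PM"
    and params_counterexample: "admissible a b \<Longrightarrow> \<not> ribbon_formula a b \<Longrightarrow> \<not> ribbon_formula PP PM"
proof -
  have "\<exists>x. admissible (fst x) (snd x) \<and>
     ((\<exists>a b. admissible a b \<and> \<not> ribbon_formula a b) \<longrightarrow> \<not> ribbon_formula (fst x) (snd x))"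
  proof (cases "\<exists>a b. admissible a b \<and> \<not> ribbon_formula a b")
    case True thus ?thesis by auto
  next
    case False
    \<comment> \<open>Without a counterexample any admissible pair will do, but the choice needs one
      to exist.\<close>
    have "admissible 2 3" by (simp add: admissible_def)
    with False show ?thesis by (intro exI[of _ "(2, 3)"]) auto
  qed
  from someI_ex[OF this]
  show "admissible PP PM" "admissible a b \<Longrightarrow> \<not> ribbon_formula a b \<Longrightarrow> \<not> ribbon_formula PP PM"
    unfolding PP_def PM_def params_def by blast+
qed

lemma PP_ge_2: "2 \<le> PP" and PM_ge_2: "2 \<le> PM" and coprime_PP_PM: "coprime PP PM"
  using admissible_params by (auto simp: admissible_def)

lemma PP_pos [simp]: "0 < PP" and PM_pos [simp]: "0 < PM"
  using PP_ge_2 PM_ge_2 by auto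

instantiation ggen :: presenting
begin

definition grels_ggen :: "ggen free_alg set" where "grels_ggen = g_rels PP PM"
text \<open>The counit of the Hopf algebra; it serves as the augmentation.\<close>

definition gaug_ggen :: "ggen \<Rightarrow> complex" where "gaug_ggen g = (if g = Kg then 1 else 0)"

instance
  by standard (auto simp: grels_ggen_def g_rels_def cmult.ext_simps gaug_ggen_def Kpow_def)

end

instantiation dgen :: presenting
begin

definition grels_dgen :: "dgen free_alg set" where "grels_dgen = d_rels PP PM"
fun gaug_dgen :: "dgen \<Rightarrow> complex" where "gaug_dgen (Gen g) = gaug g" | "gaug_dgen Kroot = 1"

lemma hom_ext_gaug_emb: "cmult.hom_ext gaug (emb x) = cmult.hom_ext gaug x"
  unfolding cmult.hom_ext_def emb_def cmult.lext_lin_ext by (simp add: o_def)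

instance
proof
  fix r :: "dgen free_alg" assume "r \<in> grels"
  moreover have "cmult.hom_ext gaug (emb x) = 0" if "x \<in> g_rels PP PM" for x
    using gaug_grels[of x] that by (simp add: hom_ext_gaug_emb grels_ggen_def)
  ultimately show "cmult.hom_ext gaug r = 0"
    by (auto simp: grels_dgen_def d_rels_def cmult.ext_simps kpow_def gaug_ggen_def)
qed

end

type_synonym gA = "ggen list alg"
type_synonym dA = "dgen list alg"

lemma rels_g: "(rels :: ggen free_alg set) = g_rels PP PM"
  by (simp add: rels_list_def grels_ggen_def)

lemma rels_d: "(rels :: dgen free_alg set) = d_rels PP PM"
  by (simp add: rels_list_def grels_dgen_def)

lemma rels_gg: "(rels :: (ggen list \<times> ggen list) vect set) = gg_rels PP PM"
  by (simp add: rels_prod_def gg_rels_def rels_g)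

lemma rels_dd: "(rels :: (dgen list \<times> dgen list) vect set) = dd_rels PP PM"
  by (simp add: rels_prod_def dd_rels_def rels_d)

section \<open>Evaluating polynomials in an algebra\<close>

text \<open>Coefficients are scalars and only powers of one element occur, so evaluation is
  multiplicative (\<open>peval_mult\<close>) although the algebra is not commutative.\<close>

definition peval :: "complex poly \<Rightarrow> 'm::presented_monoid alg \<Rightarrow> 'm alg" where
  "peval P c = (\<Sum>i\<le>degree P. coeff P i *s c ^ i)"

lemma peval_0 [simp]: "peval 0 c = 0"
  by (simp add: peval_def)

lemma peval_pCons [simp]: "peval (pCons a P) c = a *s 1 + c * peval P c"
proof (cases "P = 0")
  case False
  hence "peval (pCons a P) c = (\<Sum>i\<le>Suc (degree P). coeff (pCons a P) i *s c ^ i)"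
    by (simp add: peval_def)
  also have "\<dots> = a *s 1 + (\<Sum>i\<le>degree P. coeff P i *s c ^ Suc i)"
    by (subst sum.atMost_Suc_shift) simp
  finally show ?thesis by (simp add: peval_def sum_distrib_left)
qed (simp add: peval_def)

lemma peval_1 [simp]: "peval 1 c = 1"
  by (simp add: one_pCons)

lemma peval_add: "peval (P + R) c = peval P c + peval R c"
  by (induction P R rule: poly_induct2) (simp_all add: sca.scale_left_distrib distrib_left)

lemma peval_smult: "peval (smult a P) c = a *s peval P c"
  by (induction P) (simp_all add: sca.scale_right_distrib)

lemma peval_diff: "peval (P - R) c = peval P c - peval R c"
  using peval_add[of P "- R" c] peval_smult[of "- 1" R c] by simp

lemma peval_sum: "peval (sum g A) c = (\<Sum>i\<in>A. peval (g i) c)"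
  by (induction A rule: infinite_finite_induct) (simp_all add: peval_add)

lemma peval_mult: "peval (P * R) c = peval P c * peval R c"
  by (induction P) (simp_all add: peval_add peval_smult distrib_right mult.assoc)

lemma peval_commute:
  assumes "c * z = z * c"
  shows "peval P c * z = z * peval P c"
proof (induction P)
  case (pCons a P)
  have "c * peval P c * z = z * (c * peval P c)"
    by (metis assms mult.assoc pCons.IH(1) pCons.hyps pCons)
  thus ?case by (simp add: distrib_left distrib_right)
qed simp

lemma power_commute:
  fixes a b :: "'m::presented_monoid alg"
  assumes "a * b = \<omega> *s (b * a)"
  shows "a ^ m * b ^ n = \<omega> ^ (m * n) *s (b ^ n * a ^ m)"
proof -
  have 1: "a * b ^ n = \<omega> ^ n *s (b ^ n * a)" for n
  proof (induction n)
    case (Suc n)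
    have "a * b ^ Suc n = (a * b) * b ^ n" by (simp add: mult.assoc)
    also have "\<dots> = \<omega> *s (b * (a * b ^ n))" by (simp add: assms mult.assoc)
    finally show ?case by (simp add: Suc mult.assoc)
  qed simp
  show ?thesis
  proof (induction m)
    case (Suc m)
    have "a ^ Suc m * b ^ n = a * (a ^ m * b ^ n)" by (simp add: mult.assoc)
    also have "\<dots> = \<omega> ^ (m * n) *s (a * b ^ n * a ^ m)" by (simp add: Suc mult.assoc)
    finally show ?case by (simp add: 1 power_add mult.assoc mult.commute)
  qed simp
qed

section \<open>The algebra generated by one pair \<open>e, f\<close>\<close>

text \<open>One copy of the restricted quantum group of sl(2) inside an arbitrary presented
  algebra.\<close>

locale sector = qroot +
  fixes e f k ki :: "'m::presented_monoid alg"
  assumes k_ki: "k * ki = 1" "ki * k = 1"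
    and k_e: "k * e = Q ^ 2 *s (e * k)" and k_f: "k * f = iQ ^ 2 *s (f * k)"
    and e_f: "e * f - f * e = inverse h *s (k - ki)"
    and e_nilp: "e ^ p = 0" and f_nilp: "f ^ p = 0"
begin

lemma ki_commute:
  assumes "k * a = \<omega> *s (a * k)" "\<omega> \<noteq> 0"
  shows "ki * a = inverse \<omega> *s (a * ki)"
proof -
  have "a * ki = ki * (k * a) * ki" by (simp add: k_ki mult.assoc[symmetric])
  also have "\<dots> = \<omega> *s (ki * a * (k * ki))" by (simp add: assms mult.assoc)
  also have "\<dots> = \<omega> *s (ki * a)" by (simp add: k_ki)
  finally show ?thesis using assms by simp
qed

lemma ki_e: "ki * e = iQ ^ 2 *s (e * ki)" and ki_f: "ki * f = Q ^ 2 *s (f * ki)"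
  using ki_commute[OF k_e] ki_commute[OF k_f] by (simp_all add: power_inverse)

text \<open>The quantum Casimir element, scaled by h^2 so that its eigenvalues are values of
  \<open>csum\<close>.\<close>

definition Cas :: "'m alg" where
  "Cas = h ^ 2 *s (f * e) + Q *s k + iQ *s ki"

lemma ef_eq: "e * f = f * e + inverse h *s (k - ki)"
  using e_f by (simp add: algebra_simps)

lemma Cas_ef: "Cas = h ^ 2 *s (e * f) + iQ *s k + Q *s ki"
proof -
  have "h ^ 2 *s (e * f) = h ^ 2 *s (f * e) + h *s (k - ki)"
    unfolding ef_eq by (simp add: sca.scale_right_distrib power2_eq_square)
  thus ?thesis
    by (simp add: Cas_def h_def sca.scale_left_diff_distrib sca.scale_right_diff_distrib algebra_simps)
qed

lemma Q_cancel: "iQ * (Q * Q) = Q" "Q * (iQ * iQ) = iQ"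
  by (simp_all add: mult.assoc[symmetric])

lemma Cas_e: "Cas * e = e * Cas"
proof -
  have "e * Cas = h ^ 2 *s (e * f * e) + Q *s (e * k) + iQ *s (e * ki)"
    by (simp add: Cas_def distrib_left mult.assoc)
  moreover have "Cas * e = h ^ 2 *s (e * f * e) + iQ *s (k * e) + Q *s (ki * e)"
    by (simp add: Cas_ef distrib_right mult.assoc)
  ultimately show ?thesis by (simp add: k_e ki_e power2_eq_square Q_cancel)
qed

lemma Cas_f: "Cas * f = f * Cas"
proof -
  have "f * Cas = h ^ 2 *s (f * e * f) + iQ *s (f * k) + Q *s (f * ki)"
    by (simp add: Cas_ef distrib_left mult.assoc)
  moreover have "Cas * f = h ^ 2 *s (f * e * f) + Q *s (k * f) + iQ *s (ki * f)"
    by (simp add: Cas_def distrib_right mult.assoc)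
  ultimately show ?thesis by (simp add: k_f ki_f power2_eq_square Q_cancel)
qed

text \<open>Weight vectors are elements of the algebra itself under left multiplication; the typical
  ones are multiples of a spectral projection.\<close>

definition wt :: "complex \<Rightarrow> 'm alg \<Rightarrow> bool" where
  "wt x z \<longleftrightarrow> x \<noteq> 0 \<and> k * z = x *s z"

lemma wt_ki: "wt x z \<Longrightarrow> ki * z = inverse x *s z"
proof -
  assume w: "wt x z"
  have "z = ki * (k * z)" by (simp add: k_ki mult.assoc[symmetric])
  also have "\<dots> = x *s (ki * z)" using w by (simp add: wt_def)
  finally have "inverse x *s z = inverse x *s (x *s (ki * z))" by simp
  thus ?thesis using w by (simp add: wt_def)
qed

lemma wt_e: "wt x z \<Longrightarrow> wt (x * Q ^ 2) (e * z)"
  and wt_f: "wt x z \<Longrightarrow> wt (x * iQ ^ 2) (f * z)"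
proof -
  have "k * (e * z) = Q ^ 2 *s (e * (k * z))" "k * (f * z) = iQ ^ 2 *s (f * (k * z))"
    by (simp_all add: mult.assoc[symmetric] k_e k_f)
  thus "wt x z \<Longrightarrow> wt (x * Q ^ 2) (e * z)" "wt x z \<Longrightarrow> wt (x * iQ ^ 2) (f * z)"
    by (simp_all add: wt_def mult.commute)
qed

lemma wt_e_power: "wt x z \<Longrightarrow> wt (x * Q ^ (2 * m)) (e ^ m * z)"
proof (induction m)
  case (Suc m)
  from wt_e[OF Suc.IH[OF Suc.prems]] show ?case by (simp add: mult.assoc power2_eq_square mult_ac)
qed simp

lemma wt_f_power: "wt x z \<Longrightarrow> wt (x * iQ ^ (2 * m)) (f ^ m * z)"
proof (induction m)
  case (Suc m)
  from wt_f[OF Suc.IH[OF Suc.prems]] show ?case by (simp add: mult.assoc power2_eq_square mult_ac)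
qed simp

lemma fe_wt:
  assumes "wt x z"
  shows "f * (e * z) = (1 / h ^ 2) *s ((Cas - csum (x * Q) *s 1) * z)"
proof -
  have "(Cas - csum (x * Q) *s 1) * z = h ^ 2 *s (f * (e * z)) + (Q *s (k * z) + iQ *s (ki * z) - csum (x * Q) *s z)"
    by (simp add: Cas_def left_diff_distrib distrib_right mult.assoc)
  also have "Q *s (k * z) + iQ *s (ki * z) - csum (x * Q) *s z = 0"
    using assms wt_ki[OF assms]
    by (simp add: wt_def csum_def sca.scale_left_distrib[symmetric] sca.scale_left_diff_distrib[symmetric] mult.commute)
  finally show ?thesis by simp
qed

lemma ef_wt:
  assumes "wt x z"
  shows "e * (f * z) = (1 / h ^ 2) *s ((Cas - csum (x * iQ) *s 1) * z)"
proof -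
  have "(Cas - csum (x * iQ) *s 1) * z = h ^ 2 *s (e * (f * z)) + (iQ *s (k * z) + Q *s (ki * z) - csum (x * iQ) *s z)"
    by (simp add: Cas_ef left_diff_distrib distrib_right mult.assoc)
  also have "iQ *s (k * z) + Q *s (ki * z) - csum (x * iQ) *s z = 0"
    using assms wt_ki[OF assms]
    by (simp add: wt_def csum_def sca.scale_left_distrib[symmetric] sca.scale_left_diff_distrib[symmetric] mult.commute)
  finally show ?thesis by simp
qed

lemma Cas_power_commute: "Cas * e ^ m = e ^ m * Cas" "Cas * f ^ m = f ^ m * Cas"
  using power_commute[of Cas e 1 1 m] power_commute[of Cas f 1 1 m] Cas_e Cas_f by simp_all

text \<open>The vector e^m z has weight x Q^(2m), so the innermost f e acts on it as
  \<open>Cas\<close> minus the node of index m, up to 1 / h^2. This factor commutes with e^m and f^m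
  and is collected in front.\<close>

lemma fe_power:
  assumes w: "wt x z"
  shows "f ^ m * (e ^ m * z) = (1 / h ^ (2 * m)) *s (peval (newton (\<lambda>l. csum (x * Q * Q ^ (2 * l))) m) Cas * z)"
proof (induction m)
  case (Suc m)
  let ?c = "csum (x * Q * Q ^ (2 * m))"
  have cm: "(Cas - ?c *s 1) * e ^ m = e ^ m * (Cas - ?c *s 1)" "(Cas - ?c *s 1) * f ^ m = f ^ m * (Cas - ?c *s 1)"
    by (simp_all add: left_diff_distrib right_diff_distrib Cas_power_commute)
  have cm': "e ^ m * ((Cas - ?c *s 1) * w) = (Cas - ?c *s 1) * (e ^ m * w)"
    "f ^ m * ((Cas - ?c *s 1) * w) = (Cas - ?c *s 1) * (f ^ m * w)" for w
    by (simp_all only: mult.assoc[symmetric] cm)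
  have xx: "x * Q ^ (2 * m) * Q = x * Q * Q ^ (2 * m)" by simp
  have "f ^ Suc m * (e ^ Suc m * z) = f ^ m * (f * (e * (e ^ m * z)))"
    by (simp only: power_Suc2[of f] power_Suc[of e] mult.assoc)
  also have "f * (e * (e ^ m * z)) = (1 / h ^ 2) *s ((Cas - ?c *s 1) * (e ^ m * z))"
    using fe_wt[OF wt_e_power[OF w, of m]] unfolding xx .
  also have "(Cas - ?c *s 1) * (e ^ m * z) = e ^ m * ((Cas - ?c *s 1) * z)"
    by (simp only: cm')
  also have "f ^ m * ((1 / h ^ 2) *s (e ^ m * ((Cas - ?c *s 1) * z))) = (1 / h ^ 2) *s ((Cas - ?c *s 1) * (f ^ m * (e ^ m * z)))"
    by (simp only: sca_mult_right cm')
  also have "\<dots> = (1 / h ^ (2 * Suc m)) *s ((Cas - ?c *s 1) * peval (newton (\<lambda>l. csum (x * Q * Q ^ (2 * l))) m) Cas * z)"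
    unfolding Suc by (simp add: mult.assoc power2_eq_square)
  also have "(Cas - ?c *s 1) = peval [:- ?c, 1:] Cas" by simp
  finally show ?case by (simp only: newton_Suc peval_mult peval_commute[OF peval_commute[OF refl, symmetric]])
qed simp

lemma ef_power:
  assumes w: "wt x z"
  shows "e ^ m * (f ^ m * z) = (1 / h ^ (2 * m)) *s (peval (newton (\<lambda>l. csum (x * iQ * iQ ^ (2 * l))) m) Cas * z)"
proof (induction m)
  case (Suc m)
  let ?c = "csum (x * iQ * iQ ^ (2 * m))"
  have cm: "(Cas - ?c *s 1) * e ^ m = e ^ m * (Cas - ?c *s 1)" "(Cas - ?c *s 1) * f ^ m = f ^ m * (Cas - ?c *s 1)"
    by (simp_all add: left_diff_distrib right_diff_distrib Cas_power_commute)
  have cm': "e ^ m * ((Cas - ?c *s 1) * w) = (Cas - ?c *s 1) * (e ^ m * w)"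
    "f ^ m * ((Cas - ?c *s 1) * w) = (Cas - ?c *s 1) * (f ^ m * w)" for w
    by (simp_all only: mult.assoc[symmetric] cm)
  have xx: "x * iQ ^ (2 * m) * iQ = x * iQ * iQ ^ (2 * m)" by (simp add: mult.commute mult.left_commute)
  have "e ^ Suc m * (f ^ Suc m * z) = e ^ m * (e * (f * (f ^ m * z)))"
    by (simp only: power_Suc2[of e] power_Suc[of f] mult.assoc)
  also have "e * (f * (f ^ m * z)) = (1 / h ^ 2) *s ((Cas - ?c *s 1) * (f ^ m * z))"
    using ef_wt[OF wt_f_power[OF w, of m]] unfolding xx .
  also have "(Cas - ?c *s 1) * (f ^ m * z) = f ^ m * ((Cas - ?c *s 1) * z)"
    by (simp only: cm')
  also have "e ^ m * ((1 / h ^ 2) *s (f ^ m * ((Cas - ?c *s 1) * z))) = (1 / h ^ 2) *s ((Cas - ?c *s 1) * (e ^ m * (f ^ m * z)))"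
    by (simp only: sca_mult_right cm')
  also have "\<dots> = (1 / h ^ (2 * Suc m)) *s ((Cas - ?c *s 1) * peval (newton (\<lambda>l. csum (x * iQ * iQ ^ (2 * l))) m) Cas * z)"
    unfolding Suc by (simp add: mult.assoc power2_eq_square)
  also have "(Cas - ?c *s 1) = peval [:- ?c, 1:] Cas" by simp
  finally show ?case by (simp only: newton_Suc peval_mult peval_commute[OF peval_commute[OF refl, symmetric]])
qed simp

text \<open>Since e^p = 0, \<open>fe_power\<close> at m = p becomes a polynomial equation for
  \<open>Cas\<close> with the p nodes as roots.\<close>

lemma Cas_relation:
  assumes "wt x z"
  shows "peval (newton (\<lambda>l. csum (x * Q * Q ^ (2 * l))) p) Cas * z = 0"
  using fe_power[OF assms, of p] by (simp add: f_nilp)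

text \<open>The share of one sector in the coefficients of R: because \<open>brf m\<close> is h^m
  [m]!, this is (-1)^m h^m Q^(-m(m-1)/2) / [m]!.\<close>

definition rcoeff :: "nat \<Rightarrow> complex" where
  "rcoeff m = (- 1) ^ m * h ^ (2 * m) * iQ ^ (m * (m - 1) div 2) / brf m"

lemma fk_power:
  assumes "wt x z"
  shows "(f * k) ^ m * z = (x ^ m * iQ ^ (m * (m - 1))) *s (f ^ m * z)"
proof (induction m)
  case (Suc m)
  have "(f * k) ^ Suc m * z = f * (k * ((f * k) ^ m * z))" by (simp add: mult.assoc)
  also have "\<dots> = (x ^ m * iQ ^ (m * (m - 1))) *s (f * (k * (f ^ m * z)))" by (simp add: Suc)
  also have "k * (f ^ m * z) = (x * iQ ^ (2 * m)) *s (f ^ m * z)"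
    using wt_f_power[OF assms, of m] by (simp add: wt_def)
  also have "(x ^ m * iQ ^ (m * (m - 1))) *s (f * ((x * iQ ^ (2 * m)) *s (f ^ m * z))) =
      (x ^ Suc m * (iQ ^ (m * (m - 1)) * iQ ^ (2 * m))) *s (f ^ Suc m * z)"
    by (simp add: mult_ac del: power_inverse)
  also have "iQ ^ (m * (m - 1)) * iQ ^ (2 * m) = iQ ^ (Suc m * (Suc m - 1))"
  proof -
    have "Suc m * (Suc m - 1) = m * (m - 1) + 2 * m" by (cases m) (simp_all add: algebra_simps)
    thus ?thesis by (simp only: power_add)
  qed
  finally show ?case .
qed simp

text \<open>In either sector \<open>- (f * k)\<close> is the antipode of f. Each summand is a scalar
  times f^m e^m on a weight vector, hence a Newton polynomial in \<open>Cas\<close>, and the powers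
  of Q combine to \<open>rib_coeff\<close>.\<close>

lemma ribbon_sum:
  assumes w: "wt x z"
  shows "(\<Sum>m<p. rcoeff m *s ((- (f * k)) ^ m * (e ^ m * z))) = peval (rib_poly (x * Q)) Cas * z"
proof -
  have "rcoeff m *s ((- (f * k)) ^ m * (e ^ m * z)) =
      peval (smult (rib_coeff (x * Q) m) (newton (\<lambda>l. csum (x * Q * Q ^ (2 * l))) m)) Cas * z" if m: "m < p" for m
  proof -
    have "(- (f * k)) ^ m = (- 1) ^ m *s (f * k) ^ m"
      using sca_power[of "- 1" "f * k" m] by simp
    hence "rcoeff m *s ((- (f * k)) ^ m * (e ^ m * z)) = (rcoeff m * (- 1) ^ m) *s ((f * k) ^ m * (e ^ m * z))"
      by simp
    also have "\<dots> = (rcoeff m * (- 1) ^ m * ((x * Q ^ (2 * m)) ^ m * iQ ^ (m * (m - 1)) * (1 / h ^ (2 * m)))) *s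
        (peval (newton (\<lambda>l. csum (x * Q * Q ^ (2 * l))) m) Cas * z)"
      unfolding fk_power[OF wt_e_power[OF w, of m]] fe_power[OF w] by (simp add: mult.assoc)
    also have "rcoeff m * (- 1) ^ m * ((x * Q ^ (2 * m)) ^ m * iQ ^ (m * (m - 1)) * (1 / h ^ (2 * m))) = rib_coeff (x * Q) m"
    proof -
      \<comment> \<open>All exponents of Q are quadratic in m; expressed through the integer t they
        can be added without division.\<close>
      define t where "t = m * (m - 1) div 2"
      have "even (m * (m - 1))" by (cases m) auto
      hence t: "m * (m - 1) = 2 * t" by (simp add: t_def)
      have t1: "m * (m + 1) div 2 = t + m" and t2: "2 * m * m = 3 * t + (t + m + m)"
      proof -
        have "m * (m + 1) = 2 * (t + m)" using t by (cases m) (simp_all add: algebra_simps)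
        thus "m * (m + 1) div 2 = t + m" by simp
        show "2 * m * m = 3 * t + (t + m + m)" using t by (cases m) (simp_all add: algebra_simps)
      qed
      have rc: "rcoeff m = (- 1) ^ m * h ^ (2 * m) * iQ ^ t / brf m" by (simp add: rcoeff_def t_def)
      have s: "(- 1) ^ m * ((- 1) ^ m :: complex) = 1" by (simp flip: power_mult_distrib)
      have "rcoeff m * (- 1) ^ m * ((x * Q ^ (2 * m)) ^ m * iQ ^ (m * (m - 1)) * (1 / h ^ (2 * m))) =
        ((- 1) ^ m * (- 1) ^ m) * (h ^ (2 * m) * (1 / h ^ (2 * m))) * (x ^ m * (Q ^ (2 * m * m) * (iQ ^ t * iQ ^ (2 * t)))) / brf m"
        unfolding rc t by (simp only: power_mult_distrib power_mult[symmetric] divide_inverse mult_ac)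
      also have "Q ^ (2 * m * m) * (iQ ^ t * iQ ^ (2 * t)) = Q ^ (t + m + m)"
      proof -
        have "iQ ^ t * iQ ^ (2 * t) = iQ ^ (3 * t)" by (simp only: power_add[symmetric]) simp
        thus ?thesis unfolding t2 power_add by (simp only: mult_ac) (simp only: mult.assoc[symmetric] Q_iQ mult_1_left mult_1_right)
      qed
      also have "((- 1) ^ m * (- 1) ^ m) * (h ^ (2 * m) * (1 / h ^ (2 * m))) * (x ^ m * Q ^ (t + m + m)) / brf m = rib_coeff (x * Q) m"
        unfolding s rib_coeff_def t1 by (simp add: power_add power_mult_distrib)
      finally show ?thesis .
    qed
    finally show ?thesis by (simp add: peval_smult)
  qed
  thus ?thesis by (simp add: rib_poly_def peval_sum sum_distrib_right)
qed

end

section \<open>Cyclic group elements and their spectral projections\<close>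

text \<open>Used for K with N = \<open>LL\<close> and for its root k with N = \<open>NN\<close>. By
  \<open>zeta_root\<close> the number \<zeta> is a primitive N-th root of unity, so
  \<open>pj a\<close>, a Fourier transform of the powers of k, projects onto the eigenvalue
  \<zeta>^a.\<close>

locale cyclic_element =
  fixes \<zeta> :: complex and N :: nat and k :: "'m::presented_monoid alg"
  assumes N_pos: "0 < N" and zeta_root: "\<And>n::int. \<zeta> powi n = 1 \<longleftrightarrow> int N dvd n"
    and zeta_nz: "\<zeta> \<noteq> 0" and k_power: "k ^ N = 1"
begin

definition kp :: "int \<Rightarrow> 'm alg" where
  "kp n = k ^ nat (n mod int N)"

definition pj :: "int \<Rightarrow> 'm alg" where
  "pj a = (1 / of_nat N) *s (\<Sum>s<N. \<zeta> powi (- (a * int s)) *s kp (int s))"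

lemma zeta_cong: "int N dvd a - b \<Longrightarrow> \<zeta> powi a = \<zeta> powi b"
  using zeta_root[of "a - b"] zeta_nz by (simp add: power_int_diff)

lemma kp_mod: "kp (n mod int N) = kp n"
  by (simp add: kp_def)

lemma kp_cong: "int N dvd a - b \<Longrightarrow> kp a = kp b"
  by (simp add: kp_def mod_eq_dvd_iff[symmetric])

lemma k_power_mod: "k ^ (n mod N) = k ^ n"
proof -
  have "k ^ n = k ^ (N * (n div N) + n mod N)" by simp
  also have "\<dots> = k ^ (n mod N)" by (simp only: power_add power_mult k_power power_one mult_1_left)
  finally show ?thesis by simp
qed

lemma kp_nat: "kp (int n) = k ^ n"
  by (simp add: kp_def nat_mod_distrib k_power_mod flip: of_nat_mod)

lemma kp_0 [simp]: "kp 0 = 1"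
  by (simp add: kp_def)

lemma kp_add: "kp a * kp b = kp (a + b)"
proof -
  define m n where "m = nat (a mod int N)" and "n = nat (b mod int N)"
  have "int m = a mod int N" "int n = b mod int N" using N_pos by (simp_all add: m_def n_def)
  hence "int (m + n) mod int N = (a + b) mod int N" by (simp add: mod_simps)
  hence "kp (a + b) = kp (int (m + n))" by (metis kp_mod)
  thus ?thesis by (simp only: kp_nat power_add) (simp add: kp_def m_def n_def)
qed

lemma kp_minus: "kp a * kp (- a) = 1" "kp (- a) * kp a = 1"
  by (simp_all add: kp_add)

lemma kp_power: "kp a ^ n = kp (a * int n)"
  by (induction n) (simp_all add: kp_add algebra_simps)

lemma kp_commute:
  assumes "k * x = \<zeta> powi w *s (x * k)"
  shows "kp n * x = \<zeta> powi (w * n) *s (x * kp n)"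
proof -
  have "k ^ m * x = (\<zeta> powi w) ^ m *s (x * k ^ m)" for m
    using power_commute[OF assms, of m 1] by simp
  hence "kp n * x = (\<zeta> powi w) ^ nat (n mod int N) *s (x * kp n)" by (simp add: kp_def)
  also have "(\<zeta> powi w) ^ nat (n mod int N) = \<zeta> powi (w * (n mod int N))"
  proof -
    have "y ^ nat i = y powi i" if "0 \<le> i" for y :: complex and i
      using that by (simp add: power_int_def)
    thus ?thesis using N_pos by (simp add: power_int_mult)
  qed
  also have "\<dots> = \<zeta> powi (w * n)"
    by (rule zeta_cong) (simp add: right_diff_distrib[symmetric] minus_mod_eq_mult_div[symmetric] mod_eq_dvd_iff[symmetric])
  finally show ?thesis .
qed

lemma sum_periodic_shift:
  fixes F :: "int \<Rightarrow> 'v::comm_monoid_add"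
  assumes "\<And>a b. int N dvd a - b \<Longrightarrow> F a = F b"
  shows "(\<Sum>s<N. F (int s + n)) = (\<Sum>s<N. F (int s))"
proof (rule sum.reindex_bij_witness[of _ "\<lambda>s. nat ((int s - n) mod int N)" "\<lambda>s. nat ((int s + n) mod int N)"], goal_cases)
  case (5 s)
  have "F (int (nat ((int s + n) mod int N))) = F (int s + n)"
    by (rule assms) (use N_pos in \<open>simp add: mod_eq_dvd_iff[symmetric]\<close>)
  thus ?case .
qed (use N_pos in \<open>auto simp: mod_simps nat_less_iff\<close>)

lemma zeta_sum: "(\<Sum>s<N. \<zeta> powi (a * int s)) = (if int N dvd a then of_nat N else 0)"
proof -
  have e: "\<zeta> powi (a * int s) = (\<zeta> powi a) ^ s" for s
    by (simp add: power_int_mult)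
  show ?thesis
  proof (cases "int N dvd a")
    case True
    thus ?thesis by (simp add: e zeta_root[symmetric])
  next
    case False
    hence "\<zeta> powi a \<noteq> 1" by (simp add: zeta_root)
    moreover have "(\<zeta> powi a) ^ N = 1" by (simp add: e[symmetric] zeta_root)
    ultimately show ?thesis using False by (simp add: e geometric_sum)
  qed
qed

lemma zeta_sum': "(\<Sum>s<N. \<zeta> powi (int s * a)) = (if int N dvd a then of_nat N else 0)"
  using zeta_sum[of a] by (simp add: mult.commute)

lemma kp_pj: "kp n * pj a = \<zeta> powi (a * n) *s pj a"
proof -
  let ?F = "\<lambda>s. \<zeta> powi (- (a * s)) *s kp s"
  have F: "?F s = ?F t" if "int N dvd s - t" for s t
  proof -
    have "int N dvd - (a * s) - - (a * t)" using that by (metis dvd_minus_iff dvd_mult minus_diff_minus right_diff_distrib)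
    with that show ?thesis by (simp only: zeta_cong kp_cong)
  qed
  have "kp n * (\<Sum>s<N. ?F (int s)) = (\<Sum>s<N. \<zeta> powi (a * n) *s ?F (int s + n))"
    unfolding sum_distrib_left
  proof (rule sum.cong[OF refl])
    fix s
    have "- (a * int s) = a * n + - (a * (int s + n))" by (simp add: algebra_simps)
    hence "\<zeta> powi (- (a * int s)) = \<zeta> powi (a * n) * \<zeta> powi (- (a * (int s + n)))"
      by (simp only: power_int_add[OF disjI1[OF zeta_nz]])
    thus "kp n * ?F (int s) = \<zeta> powi (a * n) *s ?F (int s + n)" by (simp add: kp_add add.commute)
  qed
  also have "\<dots> = \<zeta> powi (a * n) *s (\<Sum>s<N. ?F (int s))"
    unfolding sca.scale_sum_right[symmetric] by (subst sum_periodic_shift[of ?F, OF F]) auto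
  finally show ?thesis by (simp add: pj_def)
qed

lemma pj_cong: "int N dvd a - b \<Longrightarrow> pj a = pj b"
proof -
  assume d: "int N dvd a - b"
  have "\<zeta> powi (- (a * int s)) = \<zeta> powi (- (b * int s))" for s
  proof (rule zeta_cong)
    have "- (a * int s) - - (b * int s) = - ((a - b) * int s)" by (simp add: algebra_simps)
    with d show "int N dvd - (a * int s) - - (b * int s)" by (simp only: dvd_minus_iff dvd_mult2)
  qed
  thus ?thesis by (simp add: pj_def)
qed

lemma pj_mult: "pj a * pj b = (if int N dvd a - b then pj a else 0)"
proof -
  have "pj a * pj b = (1 / of_nat N) *s (\<Sum>s<N. (\<zeta> powi (- (a * int s)) * \<zeta> powi (b * int s)) *s pj b)"
    by (simp add: pj_def[of a] sum_distrib_right kp_pj)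
  also have "(\<Sum>s<N. (\<zeta> powi (- (a * int s)) * \<zeta> powi (b * int s)) *s pj b) = (\<Sum>s<N. \<zeta> powi ((b - a) * int s)) *s pj b"
    using zeta_nz by (simp add: sca.scale_sum_left power_int_add[symmetric] algebra_simps)
  also have "(\<Sum>s<N. \<zeta> powi ((b - a) * int s)) = (if int N dvd a - b then of_nat N else 0)"
    unfolding zeta_sum by (simp add: dvd_diff_commute)
  finally show ?thesis using N_pos pj_cong[of a b] by auto
qed

lemma pj_sum: "(\<Sum>a<N. pj (int a)) = 1"
proof -
  have "(\<Sum>a<N. pj (int a)) = (1 / of_nat N) *s (\<Sum>a<N. \<Sum>s<N. \<zeta> powi (int a * (- int s)) *s kp (int s))"
    by (simp add: pj_def sca.scale_sum_right)
  also have "(\<Sum>a<N. \<Sum>s<N. \<zeta> powi (int a * (- int s)) *s kp (int s)) = (\<Sum>s<N. (\<Sum>a<N. \<zeta> powi (int a * (- int s))) *s kp (int s))"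
    by (subst sum.swap) (simp add: sca.scale_sum_left)
  also have "\<dots> = (\<Sum>s<N. if s = 0 then of_nat N *s 1 else 0)"
    unfolding zeta_sum' by (intro sum.cong) (auto dest: zdvd_imp_le)
  also have "\<dots> = of_nat N *s 1" using N_pos by simp
  finally show ?thesis using N_pos by simp
qed

lemma gen_pj:
  assumes "k * x = \<zeta> powi w *s (x * k)"
  shows "x * pj a = pj (a + w) * x"
proof -
  have "\<zeta> powi (- ((a + w) * int s)) * \<zeta> powi (w * int s) = \<zeta> powi (- (a * int s))" for s
    using zeta_nz by (simp add: power_int_add[symmetric] algebra_simps)
  thus ?thesis
    by (simp add: pj_def sum_distrib_left sum_distrib_right kp_commute[OF assms])
qed

lemma kp_eq_sum: "kp n = (\<Sum>a<N. \<zeta> powi (int a * n) *s pj (int a))"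
proof -
  have "kp n = kp n * (\<Sum>a<N. pj (int a))" by (simp add: pj_sum)
  thus ?thesis by (simp only: sum_distrib_left kp_pj)
qed

lemma weight_mult:
  assumes "k * x = \<zeta> powi v *s (x * k)" "k * y = \<zeta> powi w *s (y * k)"
  shows "k * (x * y) = \<zeta> powi (v + w) *s (x * y * k)"
proof -
  have "k * (x * y) = (k * x) * y" by (simp add: mult.assoc)
  also have "\<dots> = \<zeta> powi v *s (x * (k * y))" by (simp add: assms mult.assoc)
  finally show ?thesis using zeta_nz by (simp add: assms power_int_add mult.assoc)
qed

lemma weight_power:
  assumes "k * x = \<zeta> powi v *s (x * k)"
  shows "k * x ^ n = \<zeta> powi (v * int n) *s (x ^ n * k)"
proof (induction n)
  case (Suc n)
  from weight_mult[OF assms Suc] show ?case by (simp add: algebra_simps)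
qed simp

end

section \<open>The quantum group\<close>

subsection \<open>Roots of unity\<close>

lemma qpar_nz [simp]: "qpar n \<noteq> 0"
  by (simp add: qpar_def)

lemma qpar_power: "qpar n ^ m = exp (\<i> * of_real (pi * real m / real n))"
  by (simp add: qpar_def exp_of_nat_mult[symmetric] mult_ac)

lemma exp_ii_eq_1: "exp (\<i> * of_real t) = 1 \<longleftrightarrow> (\<exists>n::int. t = of_int n * 2 * pi)"
proof -
  have "exp (\<i> * of_real t) = 1 \<longleftrightarrow> cos t = 1"
    using cos_one_sin_zero[of t] by (auto simp: cis_conv_exp[symmetric] complex_eq_iff)
  thus ?thesis by (simp add: cos_one_2pi_int)
qed

lemma qpar_powi_eq_1:
  assumes "0 < n"
  shows "qpar n powi m = 1 \<longleftrightarrow> 2 * int n dvd m"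
proof -
  have 1: "qpar n ^ k = 1 \<longleftrightarrow> 2 * int n dvd int k" for k
  proof -
    have "qpar n ^ k = 1 \<longleftrightarrow> (\<exists>j::int. pi * real k / real n = of_int (2 * j) * pi)"
      unfolding qpar_power exp_ii_eq_1 by (simp add: mult_ac)
    also have "\<dots> \<longleftrightarrow> (\<exists>j::int. int k = 2 * int n * j)"
    proof (rule ex_cong1)
      fix j :: int
      have "pi * real k / real n = of_int (2 * j) * pi \<longleftrightarrow> real k = of_int (2 * j) * real n"
        using assms by (auto simp: field_simps)
      also have "\<dots> \<longleftrightarrow> (of_int (int k) :: real) = of_int (2 * int n * j)" by (simp add: mult_ac)
      finally show "pi * real k / real n = of_int (2 * j) * pi \<longleftrightarrow> int k = 2 * int n * j"
        by (simp only: of_int_eq_iff)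
    qed
    finally show ?thesis by (auto simp: dvd_def)
  qed
  show ?thesis
  proof (cases "0 \<le> m")
    case True
    then obtain k where "m = int k" using nonneg_int_cases by blast
    thus ?thesis using 1[of k] by simp
  next
    case False
    then obtain k where "m = - int k" by (metis nonneg_int_cases minus_minus neg_0_le_iff_le linear)
    thus ?thesis using 1[of k] by (simp add: power_int_minus)
  qed
qed

text \<open>The roots of unity \<open>qpar PP\<close>, \<open>qpar PM\<close>, \<open>Qp\<close> and
  \<open>Qm\<close> are all integer powers of this root of order 4 p_+ p_-, so that identities
  between them become congruences of exponents (\<open>qq_cong\<close>).\<close>

definition qq :: complex where "qq = qpar (2 * PP * PM)"

lemma qq_nz [simp]: "qq \<noteq> 0" by (simp add: qq_def)

lemma qq_powi_eq_1: "qq powi m = 1 \<longleftrightarrow> 4 * int PP * int PM dvd m"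
  unfolding qq_def by (subst qpar_powi_eq_1) (simp_all add: mult.assoc)

lemma qq_cong: "4 * int PP * int PM dvd a - b \<Longrightarrow> qq powi a = qq powi b"
  using qq_powi_eq_1[of "a - b"] by (simp add: power_int_diff)

lemma qpar_qq: "qpar PP = qq powi (2 * int PM)" "qpar PM = qq powi (2 * int PP)"
proof -
  have "qq ^ (2 * PM) = qpar PP" "qq ^ (2 * PP) = qpar PM"
    unfolding qq_def qpar_power using PP_pos PM_pos by (simp_all add: qpar_def field_simps del: PP_pos PM_pos)
  moreover have "qq powi (2 * int PM) = qq ^ (2 * PM)" "qq powi (2 * int PP) = qq ^ (2 * PP)"
    using power_int_of_nat[of qq "2 * PM"] power_int_of_nat[of qq "2 * PP"] by simp_all
  ultimately show "qpar PP = qq powi (2 * int PM)" "qpar PM = qq powi (2 * int PP)" by simp_all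
qed

lemma Qpar_qq: "Qp = qq powi (2 * int PM * int PM)" "Qm = qq powi (2 * int PP * int PP)"
  by (simp_all add: Qpar_def qpar_qq power_int_mult)

text \<open>Q^(2n) = 1 means that 2a divides 2bn, which by coprimality means that a divides
  n.\<close>

lemma qroot_Qpar:
  assumes "coprime a b" "2 \<le> a" "0 < b"
  shows "qroot (Qpar a b) a"
proof
  have p: "Qpar a b ^ n = qpar a powi (int b * int n)" for n
    by (simp add: Qpar_def power_int_mult)
  show "2 \<le> a" by fact
  show "Qpar a b ^ (2 * a) = 1"
    unfolding p using assms by (subst qpar_powi_eq_1) auto
  show "Qpar a b ^ (2 * n) \<noteq> 1" if "0 < n" "n < a" for n
  proof
    assume "Qpar a b ^ (2 * n) = 1"
    hence "2 * int a dvd int b * int (2 * n)"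
      unfolding p using assms by (subst (asm) qpar_powi_eq_1) auto
    hence "2 * int a dvd 2 * int (b * n)" by (simp add: mult.left_commute)
    hence "int a dvd int (b * n)" by (subst (asm) dvd_mult_cancel_left) simp
    hence "a dvd b * n" by (simp only: int_dvd_int_iff)
    with assms have "a dvd n" by (simp add: coprime_dvd_mult_right_iff)
    with that show False by (auto dest: dvd_imp_le)
  qed
qed

interpretation qp: qroot "Qp" PP
  by (rule qroot_Qpar) (use coprime_PP_PM PP_ge_2 in auto)

interpretation qm: qroot "Qm" PM
  by (rule qroot_Qpar) (use coprime_PP_PM PM_ge_2 in \<open>auto simp: coprime_commute\<close>)

subsection \<open>Commutation relations\<close>

definition G :: "ggen \<Rightarrow> gA" where "G g = pr (gen g)"

text \<open>The exponent of \<open>k\<close>-weights: $k x k^{-1} = \mathfrak q^{w(x)} x$.\<close>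

fun kw :: "ggen \<Rightarrow> int" where
  "kw Kg = 0" | "kw Ep = 2 * int PM" | "kw Fp = - 2 * int PM" | "kw Em = 2 * int PP" | "kw Fm = - 2 * int PP"

lemma G_rel: "r \<in> g_rels PP PM \<Longrightarrow> pr r = 0"
  using pr_rel[of r] by (simp add: rels_g)

lemma pr_diff_eq_0: "pr (x - y) = 0 \<Longrightarrow> pr x = pr y"
  by simp

lemma G_K_power: "G Kg ^ (2 * PP * PM) = 1"
  using G_rel[of "gen Kg ^ (2 * PP * PM) - 1"] by (simp add: g_rels_def G_def)

text \<open>The exponent in the relation for K; \<open>qz\<close> is a primitive root of unity of
  this order, and K acts on the image of \<open>P1 a\<close> by \<open>qz\<close> to the power
  a.\<close>

definition LL :: nat where "LL = 2 * PP * PM"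
definition qz :: complex where "qz = qq\<^sup>2"

lemma qz_powi: "qz powi n = qq powi (2 * n)"
  by (simp add: qz_def power_int_mult)

lemma int_LL: "int LL = 2 * int PP * int PM" by (simp add: LL_def)

interpretation gK: cyclic_element qz LL "G Kg"
proof
  fix n :: int
  have "4 * int PP * int PM dvd 2 * n \<longleftrightarrow> 2 * (2 * int PP * int PM) dvd 2 * n" by (simp add: mult.assoc)
  also have "\<dots> \<longleftrightarrow> 2 * int PP * int PM dvd n" by (subst dvd_mult_cancel_left) simp
  finally show "(qz powi n = 1) = (int LL dvd n)"
    by (simp only: qz_powi qq_powi_eq_1 int_LL)
qed (simp_all add: G_K_power LL_def qz_def)

abbreviation KK :: "int \<Rightarrow> gA" where "KK \<equiv> gK.kp"
abbreviation P1 :: "int \<Rightarrow> gA" where "P1 \<equiv> gK.pj"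

lemma pr_Kpow: "pr (Kpow PP PM n) = KK n"
  unfolding Kpow_def gK.kp_def by (simp add: G_def LL_def)

lemma KK_1: "KK 1 = G Kg"
  using gK.kp_nat[of 1] by simp

lemma powi_simps:
  "(qpar PP)\<^sup>2 = qz powi (2 * int PM)" "(qpar PM)\<^sup>2 = qz powi (2 * int PP)"
  "qpar PP powi 2 = qz powi (2 * int PM)" "qpar PM powi 2 = qz powi (2 * int PP)"
  "qpar PP powi (- 2) = qz powi (- 2 * int PM)" "qpar PM powi (- 2) = qz powi (- 2 * int PP)"
proof -
  have e: "x ^ 2 = x powi 2" for x :: complex by simp
  show "qpar PP powi 2 = qz powi (2 * int PM)" "qpar PM powi 2 = qz powi (2 * int PP)"
    "qpar PP powi (- 2) = qz powi (- 2 * int PM)" "qpar PM powi (- 2) = qz powi (- 2 * int PP)"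
    unfolding qpar_qq qz_powi by (simp_all only: power_int_mult[symmetric]) (simp_all add: mult_ac)
  thus "(qpar PP)\<^sup>2 = qz powi (2 * int PM)" "(qpar PM)\<^sup>2 = qz powi (2 * int PP)"
    by (simp_all only: e)
qed

lemma G_K_commute: "G Kg * G g = qz powi (kw g) *s (G g * G Kg)"
proof (cases "g = Kg")
  case False
  have "pr (gen Kg * gen g * Kpow PP PM (- 1)) = pr (scl (qz powi (kw g)) (gen g))"
    by (rule pr_diff_eq_0, rule G_rel)
       (use False in \<open>cases g, auto simp: g_rels_def powi_simps\<close>)
  hence "G Kg * G g * KK (- 1) * G Kg = qz powi (kw g) *s (G g * G Kg)"
    by (simp add: pr_Kpow G_def)
  moreover have "KK (- 1) * G Kg = 1" using gK.kp_minus(2)[of 1] by (simp add: KK_1)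
  ultimately show ?thesis by (simp add: mult.assoc)
qed simp

lemma KK_G: "KK n * G g = qz powi (kw g * n) *s (G g * KK n)"
  by (rule gK.kp_commute[OF G_K_commute])

lemma G_pm_commute: "x \<in> {Ep, Fp} \<Longrightarrow> y \<in> {Em, Fm} \<Longrightarrow> G x * G y = G y * G x"
  using pr_diff_eq_0[OF G_rel[of "gen x * gen y - gen y * gen x"]] by (auto simp: g_rels_def G_def)

lemma G_nilp: "G Ep ^ PP = 0" "G Fp ^ PP = 0" "G Em ^ PM = 0" "G Fm ^ PM = 0"
  using G_rel[of "gen Ep ^ PP"] G_rel[of "gen Fp ^ PP"] G_rel[of "gen Em ^ PM"] G_rel[of "gen Fm ^ PM"]
  by (simp_all add: g_rels_def G_def)

lemma G_ef:
  "G Ep * G Fp - G Fp * G Ep = inverse qp.h *s (KK (int PM) - KK (- int PM))"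
  "G Em * G Fm - G Fm * G Em = inverse qm.h *s (KK (int PP) - KK (- int PP))"
proof -
  have "pr (gen Ep * gen Fp - gen Fp * gen Ep) =
      pr (scl (1 / (Qp - inverse Qp)) (Kpow PP PM (int PM) - Kpow PP PM (- int PM)))"
    by (rule pr_diff_eq_0, rule G_rel) (simp add: g_rels_def)
  thus "G Ep * G Fp - G Fp * G Ep = inverse qp.h *s (KK (int PM) - KK (- int PM))"
    by (simp add: G_def pr_Kpow qp.h_def divide_inverse)
  have "pr (gen Em * gen Fm - gen Fm * gen Em) =
      pr (scl (1 / (Qm - inverse Qm)) (Kpow PP PM (int PP) - Kpow PP PM (- int PP)))"
    by (rule pr_diff_eq_0, rule G_rel) (simp add: g_rels_def)
  thus "G Em * G Fm - G Fm * G Em = inverse qm.h *s (KK (int PP) - KK (- int PP))"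
    by (simp add: G_def pr_Kpow qm.h_def divide_inverse)
qed

lemma qq_inverse_powi: "inverse (qq powi n) = qq powi (- n)"
  by (simp add: power_int_minus)

lemma qq_powi_power: "(qq powi n) ^ m = qq powi (n * int m)"
  by (simp add: power_int_mult)

text \<open>
  The two sectors satisfy the same relations once \<open>e\<^sub>-\<close> and \<open>f\<^sub>-\<close> are exchanged and $K_-$ is inverted.
\<close>

interpretation sp: sector "Qp" PP "G Ep" "G Fp" "KK (int PM)" "KK (- int PM)"
proof
  show "KK (int PM) * KK (- int PM) = 1" "KK (- int PM) * KK (int PM) = 1" by (simp_all add: gK.kp_minus)
  show "KK (int PM) * G Ep = Qp\<^sup>2 *s (G Ep * KK (int PM))"
    "KK (int PM) * G Fp = (inverse Qp)\<^sup>2 *s (G Fp * KK (int PM))"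
    by (simp_all add: KK_G Qpar_qq qz_powi qq_inverse_powi qq_powi_power mult_ac)
qed (simp_all add: G_ef G_nilp)

interpretation sm: sector "Qm" PM "G Fm" "G Em" "KK (- int PP)" "KK (int PP)"
proof
  show "KK (- int PP) * KK (int PP) = 1" "KK (int PP) * KK (- int PP) = 1" by (simp_all add: gK.kp_minus)
  show "KK (- int PP) * G Fm = Qm\<^sup>2 *s (G Fm * KK (- int PP))"
    "KK (- int PP) * G Em = (inverse Qm)\<^sup>2 *s (G Em * KK (- int PP))"
    by (simp_all add: KK_G Qpar_qq qz_powi qq_inverse_powi qq_powi_power mult_ac)
  have "G Fm * G Em - G Em * G Fm = - (G Em * G Fm - G Fm * G Em)" by simp
  also have "\<dots> = inverse qm.h *s (KK (- int PP) - KK (int PP))"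
    unfolding G_ef by (simp add: sca.scale_minus_right[symmetric])
  finally show "G Fm * G Em - G Em * G Fm = inverse qm.h *s (KK (- int PP) - KK (int PP))" .
qed (simp_all add: G_nilp)

lemma wt_P1:
  shows "sp.wt (qq powi (2 * int PM * a)) (P1 a)" "sm.wt (qq powi (- 2 * int PP * a)) (P1 a)"
  by (simp_all add: sp.wt_def sm.wt_def gK.kp_pj qz_powi mult_ac)

section \<open>Modules\<close>

lemma lin_ext_linear [simp]:
  "lin_ext F (x + y) = lin_ext F x + lin_ext F y" "lin_ext F (scl c x) = scl c (lin_ext F x)" "lin_ext F 0 = 0"
  "lin_ext F (vec b) = F b" "lin_ext F (x - y) = lin_ext F x - lin_ext F y" "lin_ext F (sum g A) = (\<Sum>i\<in>A. lin_ext F (g i))"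
  by (simp_all add: lin_ext_eq_lext scl.lext_add scl.lext_scl scl.lext_diff scl.lext_sum)

lemma linear_expand:
  assumes "\<And>x y. F (x + y) = F x + F y" "\<And>c x. F (scl c x) = scl c (F x)"
  shows "F x = (\<Sum>a\<in>keys x. scl (lookup x a) (F (vec a)))"
  using scl.linear_eq_lext[of F x] assms by (simp add: lext_def)

lemma linear_eq_on_keys:
  assumes "\<And>x y. F (x + y) = F x + F y" "\<And>c x. F (scl c x) = scl c (F x)"
    and "\<And>x y. H (x + y) = H x + H y" "\<And>c x. H (scl c x) = scl c (H x)"
    and "\<And>a. a \<in> keys x \<Longrightarrow> F (vec a) = H (vec a)"
  shows "F x = H x"
  using linear_expand[of F x] linear_expand[of H x] assms by simp

lemma keys_lin_ext: "keys (lin_ext F x) \<subseteq> (\<Union>a\<in>keys x. keys (F a))"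
proof
  fix b assume "b \<in> keys (lin_ext F x)"
  hence "(\<Sum>a\<in>keys x. lookup x a * lookup (F a) b) \<noteq> 0"
    by (simp add: lin_ext_def in_keys_iff lookup_sum)
  then obtain a where "a \<in> keys x" "lookup (F a) b \<noteq> 0"
    by (metis (no_types, lifting) mult_zero_right sum.neutral)
  thus "b \<in> (\<Union>a\<in>keys x. keys (F a))" by (auto simp: in_keys_iff)
qed

lemma keys_tens: "keys (x \<otimes>\<^sub>v y) \<subseteq> keys x \<times> keys y"
proof -
  have "keys (lin_ext (\<lambda>b. vec (a, b)) y) \<subseteq> {a} \<times> keys y" for a :: 'a
    using keys_lin_ext[of "\<lambda>b. vec (a, b)" y] by auto
  thus ?thesis using keys_lin_ext[of "\<lambda>a. lin_ext (\<lambda>b. vec (a, b)) y" x] by (fastforce simp: tens_def)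
qed

lemma free_act_eq_lext: "free_act V x v = lext scl (\<lambda>w. foldr (\<lambda>g. lin_ext (gen_act V g)) w v) x"
  by (simp add: free_act_def lext_def)

lemma foldr_linear [simp]:
  "foldr (\<lambda>g. lin_ext (A g)) w (x + y) = foldr (\<lambda>g. lin_ext (A g)) w x + foldr (\<lambda>g. lin_ext (A g)) w y"
  "foldr (\<lambda>g. lin_ext (A g)) w (scl c x) = scl c (foldr (\<lambda>g. lin_ext (A g)) w x)"
  by (induction w) simp_all

lemma free_act_linear [simp]:
  "free_act V (x + y) v = free_act V x v + free_act V y v" "free_act V (x - y) v = free_act V x v - free_act V y v"
  "free_act V (scl c x) v = scl c (free_act V x v)" "free_act V 0 v = 0" "free_act V (- x) v = - free_act V x v"
  "free_act V (sum g A) v = (\<Sum>i\<in>A. free_act V (g i) v)"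
  "free_act V x (u + v) = free_act V x u + free_act V x v" "free_act V x (scl c v) = scl c (free_act V x v)"
proof -
  show "free_act V (x + y) v = free_act V x v + free_act V y v" "free_act V (x - y) v = free_act V x v - free_act V y v"
    "free_act V (scl c x) v = scl c (free_act V x v)" "free_act V 0 v = 0" "free_act V (- x) v = - free_act V x v"
    "free_act V (sum g A) v = (\<Sum>i\<in>A. free_act V (g i) v)"
    by (simp_all add: free_act_eq_lext scl.lext_add scl.lext_scl scl.lext_diff scl.lext_uminus scl.lext_sum)
  show "free_act V x (u + v) = free_act V x u + free_act V x v" "free_act V x (scl c v) = scl c (free_act V x v)"
    by (simp_all add: free_act_def scl.scale_right_distrib sum.distrib scl.scale_sum_right mult.commute)
qed

lemma free_act_0 [simp]: "free_act V x 0 = 0"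
  using free_act_linear(8)[of V x 0 0] by simp

lemma free_act_gen [simp]: "free_act V (gen g) v = lin_ext (gen_act V g) v"
  by (simp add: free_act_eq_lext)

lemma free_act_one [simp]: "free_act V 1 v = v"
  using scl.lext_vec[of "\<lambda>w. foldr (\<lambda>g. lin_ext (gen_act V g)) w v" "[]"]
  by (simp add: free_act_eq_lext zero_list_def flip: single_one)

lemma free_act_mult: "free_act V (x * y) v = free_act V x (free_act V y v)"
proof -
  have "free_act V (vec a * y) v = free_act V (vec a) (free_act V y v)" for a
    by (rule scl.linear_ext_eq[where F = "\<lambda>y. free_act V (vec a * y) v"])
      (simp_all add: distrib_left scl_mult_right vec_mult plus_list_def, simp add: free_act_eq_lext)
  thus ?thesis
    by (intro scl.linear_ext_eq[where F = "\<lambda>x. free_act V (x * y) v" and x = x])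
      (simp_all add: distrib_right scl_mult_left)
qed

lemma free_act_power: "free_act V (x ^ n) v = ((free_act V x) ^^ n) v"
  by (induction n) (simp_all add: free_act_mult)

text \<open>The relations are checked on basis vectors only; \<open>free_act_ideal\<close> extends
  this to the ideal they generate, which makes the action of cosets well defined.\<close>

definition is_mod :: "'b g_module \<Rightarrow> bool" where
  "is_mod V \<longleftrightarrow> (\<forall>g. \<forall>b\<in>basis V. gen_act V g b \<in> mspace V) \<and>
     (\<forall>r\<in>g_rels PP PM. \<forall>b\<in>basis V. free_act V r (vec b) = 0)"

lemma mspace_closed:
  "0 \<in> mspace V" "x \<in> mspace V \<Longrightarrow> y \<in> mspace V \<Longrightarrow> x + y \<in> mspace V" "x \<in> mspace V \<Longrightarrow> scl c x \<in> mspace V"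
  "b \<in> basis V \<Longrightarrow> vec b \<in> mspace V"
  using keys_add[of x y] keys_scl_subset[of c x] by (auto simp: mspace_def)

lemma mspace_sum: "(\<And>i. i \<in> A \<Longrightarrow> f i \<in> mspace V) \<Longrightarrow> sum f A \<in> mspace V"
  by (induction A rule: infinite_finite_induct) (auto simp: mspace_closed)

lemma free_act_mspace:
  assumes V: "is_mod V" and v: "v \<in> mspace V"
  shows "free_act V x v \<in> mspace V"
proof -
  have "foldr (\<lambda>g. lin_ext (gen_act V g)) w v \<in> mspace V" for w
  proof (induction w)
    case (Cons g w)
    thus ?case using V keys_lin_ext[of "gen_act V g" "foldr (\<lambda>g. lin_ext (gen_act V g)) w v"]
      by (fastforce simp: is_mod_def mspace_def)
  qed (simp add: v)
  thus ?thesis unfolding free_act_def by (intro mspace_sum mspace_closed)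
qed

lemma free_act_ideal:
  assumes V: "is_mod V" and v: "v \<in> mspace V" and x: "x \<in> rel_ideal"
  shows "free_act V x v = 0"
  using x
proof (rule ideal_kill)
  fix r a b :: "ggen free_alg" assume r: "r \<in> rels"
  have "free_act V r u = 0" if "u \<in> mspace V" for u
    by (rule linear_eq_on_keys[where F = "free_act V r" and H = "\<lambda>_. 0"])
      (use V r that in \<open>auto simp: is_mod_def rels_g mspace_def\<close>)
  thus "free_act V (a * r * b) v = 0"
    using free_act_mspace[OF V v] by (simp add: free_act_mult)
qed simp

definition ga :: "'b g_module \<Rightarrow> gA \<Rightarrow> 'b vect \<Rightarrow> 'b vect" where
  "ga V z v = act V (coset z) v"

lemma ga_pr:
  assumes "is_mod V" "v \<in> mspace V"
  shows "ga V (pr x) v = free_act V x v"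
  unfolding ga_def act_def
proof (rule quot_map_coset)
  fix x y :: "ggen free_alg" assume "pr x = pr y"
  hence "free_act V (x - y) v = 0" using assms by (intro free_act_ideal) (simp_all add: pr_eq_iff)
  thus "free_act V x v = free_act V y v" by simp
qed

lemma ga_simps:
  assumes V: "is_mod V" and v: "v \<in> mspace V"
  shows "ga V (y * z) v = ga V y (ga V z v)" "ga V (y + z) v = ga V y v + ga V z v" "ga V (y - z) v = ga V y v - ga V z v"
    "ga V (c *s z) v = scl c (ga V z v)" "ga V 0 v = 0" "ga V 1 v = v"
    "ga V (G g) v = lin_ext (gen_act V g) v" "ga V (sum F A) v = (\<Sum>i\<in>A. ga V (F i) v)"
    "ga V z v \<in> mspace V" "u \<in> mspace V \<Longrightarrow> ga V z (u + v) = ga V z u + ga V z v" "ga V z (scl c v) = scl c (ga V z v)"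
proof -
  note [simp] = ga_pr[OF V]
  obtain x x' where x: "y = pr x" "z = pr x'" using pr_surj by metis
  have m: "free_act V x v \<in> mspace V" for x using free_act_mspace[OF V v] .
  show "ga V (y * z) v = ga V y (ga V z v)" using v m by (simp add: x free_act_mult flip: pr_mult)
  show add: "ga V (y + z) v = ga V y v + ga V z v" for y z
    using v pr_surj[of y] pr_surj[of z] by (auto simp flip: pr_add)
  show "ga V (y - z) v = ga V y v - ga V z v" using v by (simp add: x flip: pr_diff)
  show "ga V (c *s z) v = scl c (ga V z v)" using v by (simp add: x flip: pr_scl)
  show z: "ga V 0 v = 0" using v by (simp flip: pr_0)
  show "ga V 1 v = v" using v by (simp flip: pr_1)
  show "ga V (G g) v = lin_ext (gen_act V g) v" using v by (simp add: G_def)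
  show "ga V (sum F A) v = (\<Sum>i\<in>A. ga V (F i) v)"
    by (induction A rule: infinite_finite_induct) (simp_all add: z add)
  show "ga V z v \<in> mspace V" using v m by (simp add: x)
  show "u \<in> mspace V \<Longrightarrow> ga V z (u + v) = ga V z u + ga V z v" using v by (simp add: x mspace_closed)
  show "ga V z (scl c v) = scl c (ga V z v)" using v by (simp add: x mspace_closed)
qed

subsection \<open>Tensor products of modules over the two sectors\<close>

lemma funpow_linear:
  fixes e :: "'b \<Rightarrow> 'b vect"
  shows
  "((lin_ext e) ^^ m) (x + y) = ((lin_ext e) ^^ m) x + ((lin_ext e) ^^ m) y"
  "((lin_ext e) ^^ m) (scl c x) = scl c (((lin_ext e) ^^ m) x)"
  by (induct m) simp_all

text \<open>A height that drops strictly forces nilpotency. It is applied to e and f with heights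
  below p.\<close>

lemma funpow_lin_ext_eq_0:
  fixes e :: "'b \<Rightarrow> 'b vect" and ht :: "'b \<Rightarrow> nat"
  assumes "\<And>b b'. b \<in> B \<Longrightarrow> b' \<in> keys (e b) \<Longrightarrow> b' \<in> B \<and> ht b' < ht b"
  shows "b \<in> B \<Longrightarrow> ht b < m \<Longrightarrow> ((lin_ext e) ^^ m) (vec b) = 0"
proof (induction m arbitrary: b)
  case (Suc m)
  have "((lin_ext e) ^^ Suc m) (vec b) = ((lin_ext e) ^^ m) (e b)"
    by (simp add: funpow_swap1)
  also have "\<dots> = 0"
  proof (rule linear_eq_on_keys[where F = "(lin_ext e) ^^ m" and H = "\<lambda>_. 0"])
    fix b' assume "b' \<in> keys (e b)"
    with assms Suc.prems have "b' \<in> B" "ht b' < m" by fastforce+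
    thus "((lin_ext e) ^^ m) (vec b') = 0" by (rule Suc.IH)
  qed (simp_all add: funpow_linear)
  finally show ?case .
qed simp

text \<open>A module over one sector in terms of a weight basis: \<open>w b\<close> is the
  eigenvalue of K_+ or K_-, not of K. The modules of the full algebra are assembled from one such
  factor per sector.\<close>

locale sl2_module = qroot +
  fixes B :: "'b set" and w :: "'b \<Rightarrow> complex" and e f :: "'b \<Rightarrow> 'b vect"
  assumes finite_B: "finite B"
    and e_keys: "\<And>b b'. b \<in> B \<Longrightarrow> b' \<in> keys (e b) \<Longrightarrow> b' \<in> B \<and> w b' = Q ^ 2 * w b"
    and f_keys: "\<And>b b'. b \<in> B \<Longrightarrow> b' \<in> keys (f b) \<Longrightarrow> b' \<in> B \<and> w b' = iQ ^ 2 * w b"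
    and w_root: "\<And>b. b \<in> B \<Longrightarrow> w b ^ (2 * p) = 1"
    and ef_rel: "\<And>b. b \<in> B \<Longrightarrow> lin_ext e (f b) - lin_ext f (e b) = scl ((w b - inverse (w b)) / h) (vec b)"
    and e_nil: "\<And>b. b \<in> B \<Longrightarrow> ((lin_ext e) ^^ p) (vec b) = 0"
    and f_nil: "\<And>b. b \<in> B \<Longrightarrow> ((lin_ext f) ^^ p) (vec b) = 0"
begin

lemma w_nz: "b \<in> B \<Longrightarrow> w b \<noteq> 0"
  using w_root[of b] p_ge_2 by (intro notI) (simp add: power_0_left)

end

text \<open>By Bezout a nonzero number is a product of integer powers of its a-th and b-th
  powers.\<close>

lemma coprime_power_eq:
  fixes x y :: complex
  assumes "coprime a b" "x \<noteq> 0" "y \<noteq> 0" "x ^ a = y ^ a" "x ^ b = y ^ b"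
  shows "x = y"
proof -
  obtain s t :: int where st: "s * int a + t * int b = 1"
    using assms(1) by (metis bezout_int coprime_imp_gcd_eq_1 coprime_int_iff)
  have "z = (z ^ a) powi s * (z ^ b) powi t" if "z \<noteq> 0" for z :: complex
  proof -
    have "(z ^ a) powi s * (z ^ b) powi t = z powi (int a * s) * z powi (int b * t)"
      by (simp add: power_int_mult)
    also have "\<dots> = z powi (int a * s + int b * t)" using that by (simp add: power_int_add)
    also have "int a * s + int b * t = 1" using st by (simp add: mult.commute)
    finally show ?thesis by simp
  qed
  from this[OF assms(2)] this[OF assms(3)] assms(4,5) show ?thesis by metis
qed

text \<open>The eigenvalue \<open>kk\<close> of K is constrained only through its powers, the
  eigenvalues of K_+ and K_-. Coprimality of the exponents makes this sufficient
  (\<open>kk_scale\<close>), and irreducible and projective modules are treated together.\<close>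

locale tensor_module =
  M1: sl2_module "Qp" PP B1 w1 e1 f1 + M2: sl2_module "Qm" PM B2 w2 e2 f2
  for B1 :: "'a set" and w1 e1 f1 and B2 :: "'b set" and w2 e2 f2 +
  fixes V :: "('a \<times> 'b) g_module" and kk :: "'a \<Rightarrow> 'b \<Rightarrow> complex"
  assumes basis_V: "basis V = B1 \<times> B2"
    and gen_act_V: "\<And>b b'. b \<in> B1 \<Longrightarrow> b' \<in> B2 \<Longrightarrow> gen_act V Ep (b, b') = e1 b \<otimes>\<^sub>v vec b'"
      "\<And>b b'. b \<in> B1 \<Longrightarrow> b' \<in> B2 \<Longrightarrow> gen_act V Fp (b, b') = f1 b \<otimes>\<^sub>v vec b'"
      "\<And>b b'. b \<in> B1 \<Longrightarrow> b' \<in> B2 \<Longrightarrow> gen_act V Em (b, b') = vec b \<otimes>\<^sub>v e2 b'"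
      "\<And>b b'. b \<in> B1 \<Longrightarrow> b' \<in> B2 \<Longrightarrow> gen_act V Fm (b, b') = vec b \<otimes>\<^sub>v f2 b'"
      "\<And>b b'. b \<in> B1 \<Longrightarrow> b' \<in> B2 \<Longrightarrow> gen_act V Kg (b, b') = scl (kk b b') (vec (b, b'))"
    and kk_powers: "\<And>b b'. b \<in> B1 \<Longrightarrow> b' \<in> B2 \<Longrightarrow> kk b b' ^ PM = w1 b"
      "\<And>b b'. b \<in> B1 \<Longrightarrow> b' \<in> B2 \<Longrightarrow> kk b b' ^ PP = w2 b'"
begin

lemma gen_tens:
  assumes "keys x \<subseteq> B1" "keys y \<subseteq> B2"
  shows "lin_ext (gen_act V Ep) (x \<otimes>\<^sub>v y) = lin_ext e1 x \<otimes>\<^sub>v y"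
    "lin_ext (gen_act V Fp) (x \<otimes>\<^sub>v y) = lin_ext f1 x \<otimes>\<^sub>v y"
    "lin_ext (gen_act V Em) (x \<otimes>\<^sub>v y) = x \<otimes>\<^sub>v lin_ext e2 y"
    "lin_ext (gen_act V Fm) (x \<otimes>\<^sub>v y) = x \<otimes>\<^sub>v lin_ext f2 y"
proof -
  have bi: "F (x \<otimes>\<^sub>v y) = H x y"
    if "\<And>x y. F (x + y) = F x + F y" "\<And>c x. F (scl c x) = scl c (F x)"
      "\<And>x x' y. H (x + x') y = H x y + H x' y" "\<And>c x y. H (scl c x) y = scl c (H x y)"
      "\<And>x y y'. H x (y + y') = H x y + H x y'" "\<And>c x y. H x (scl c y) = scl c (H x y)"
      "\<And>b b'. b \<in> B1 \<Longrightarrow> b' \<in> B2 \<Longrightarrow> F (vec (b, b')) = H (vec b) (vec b')"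
    for F :: "('a \<times> 'b) vect \<Rightarrow> ('a \<times> 'b) vect" and H
  proof (rule linear_eq_on_keys[where F = "\<lambda>x. F (x \<otimes>\<^sub>v y)" and H = "\<lambda>x. H x y"])
    fix a assume "a \<in> keys x"
    hence a: "a \<in> B1" using assms by auto
    show "F (vec a \<otimes>\<^sub>v y) = H (vec a) y"
      by (rule linear_eq_on_keys[where F = "\<lambda>y. F (vec a \<otimes>\<^sub>v y)" and H = "H (vec a)"])
        (use assms a in \<open>auto simp: that\<close>)
  qed (simp_all add: that)
  show "lin_ext (gen_act V Ep) (x \<otimes>\<^sub>v y) = lin_ext e1 x \<otimes>\<^sub>v y"
    by (rule bi) (simp_all add: gen_act_V)
  show "lin_ext (gen_act V Fp) (x \<otimes>\<^sub>v y) = lin_ext f1 x \<otimes>\<^sub>v y"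
    by (rule bi) (simp_all add: gen_act_V)
  show "lin_ext (gen_act V Em) (x \<otimes>\<^sub>v y) = x \<otimes>\<^sub>v lin_ext e2 y"
    by (rule bi) (simp_all add: gen_act_V)
  show "lin_ext (gen_act V Fm) (x \<otimes>\<^sub>v y) = x \<otimes>\<^sub>v lin_ext f2 y"
    by (rule bi) (simp_all add: gen_act_V)
qed

lemma kk_nz: "b \<in> B1 \<Longrightarrow> b' \<in> B2 \<Longrightarrow> kk b b' \<noteq> 0"
  by (metis PM_pos zero_power M1.w_nz kk_powers(1))

lemma kk_root: "b \<in> B1 \<Longrightarrow> b' \<in> B2 \<Longrightarrow> kk b b' ^ LL = 1"
proof -
  assume b: "b \<in> B1" "b' \<in> B2"
  have "kk b b' ^ LL = (kk b b' ^ PM) ^ (2 * PP)" by (simp add: LL_def mult_ac flip: power_mult)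
  thus ?thesis using b by (simp add: kk_powers M1.w_root)
qed

lemma kk_powi_mod:
  assumes b: "b \<in> B1" "b' \<in> B2"
  shows "kk b b' ^ nat (n mod int LL) = kk b b' powi n"
proof -
  have L: "0 < int LL" by (simp add: LL_def)
  have "kk b b' powi n = kk b b' powi (int LL * (n div int LL) + n mod int LL)" by simp
  also have "\<dots> = (kk b b' powi (int LL)) powi (n div int LL) * kk b b' powi (n mod int LL)"
    by (simp only: power_int_add[OF disjI1[OF kk_nz[OF b]]] power_int_mult)
  also have "\<dots> = kk b b' ^ nat (n mod int LL)" using L by (simp add: kk_root[OF b] power_int_def)
  finally show ?thesis ..
qed

lemma K_power_act:
  assumes b: "b \<in> B1" "b' \<in> B2"
  shows "((lin_ext (gen_act V Kg)) ^^ n) (vec (b, b')) = scl (kk b b' ^ n) (vec (b, b'))"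
  by (induction n) (simp_all add: gen_act_V b)

lemma Kpow_act:
  assumes b: "b \<in> B1" "b' \<in> B2"
  shows "free_act V (Kpow PP PM n) (vec (b, b')) = scl (kk b b' powi n) (vec (b, b'))"
  using kk_powi_mod[OF b, of n] K_power_act[OF b]
  by (simp add: Kpow_def free_act_power LL_def fun_eq_iff[symmetric]) (simp add: free_act_gen[abs_def])

lemma kk_scale:
  assumes b: "b \<in> B1" "b' \<in> B2" "c \<in> B1" "c' \<in> B2" and \<omega>: "\<omega> \<noteq> 0" "w1 c = \<omega> ^ PM * w1 b" "w2 c' = \<omega> ^ PP * w2 b'"
  shows "kk c c' = \<omega> * kk b b'"
proof (rule coprime_power_eq[OF coprime_PP_PM])
  show "kk c c' ^ PP = (\<omega> * kk b b') ^ PP" "kk c c' ^ PM = (\<omega> * kk b b') ^ PM"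
    using b by (simp_all only: power_mult_distrib kk_powers \<omega>)
qed (use b \<omega> kk_nz in auto)

text \<open>The square of \<open>qpar PP\<close> has PM-th power Qp^2 and PP-th power 1: it is the
  factor of K that moves the weight in the plus sector and fixes the one in the minus sector.
  Likewise for \<open>qpar PM\<close>.\<close>

lemma kk_shift:
  assumes b: "b \<in> B1" "b' \<in> B2"
  shows "c \<in> B1 \<Longrightarrow> w1 c = Qp ^ 2 * w1 b \<Longrightarrow> kk c b' = qpar PP powi 2 * kk b b'"
    "c \<in> B1 \<Longrightarrow> w1 c = (inverse Qp) ^ 2 * w1 b \<Longrightarrow> kk c b' = qpar PP powi (- 2) * kk b b'"
    "c' \<in> B2 \<Longrightarrow> w2 c' = Qm ^ 2 * w2 b' \<Longrightarrow> kk b c' = qpar PM powi 2 * kk b b'"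
    "c' \<in> B2 \<Longrightarrow> w2 c' = (inverse Qm) ^ 2 * w2 b' \<Longrightarrow> kk b c' = qpar PM powi (- 2) * kk b b'"
proof -
  have e0: "(x powi 2) ^ m = (x ^ m) ^ 2" "(x powi (- 2)) ^ m = (inverse (x ^ m)) ^ 2" for x :: complex and m
    by (simp_all add: power_int_minus power_inverse power_mult[symmetric] mult.commute)
  have o0: "(qpar n powi 2) ^ n = 1" "(qpar n powi (- 2)) ^ n = 1" if "0 < n" for n
    unfolding power_int_power' using that by (simp_all only: qpar_powi_eq_1) simp_all
  note e = e0[of "qpar PP" PM, folded Qpar_def] e0[of "qpar PM" PP, folded Qpar_def]
  note o = o0[OF PP_pos] o0[OF PM_pos]
  show "c \<in> B1 \<Longrightarrow> w1 c = Qp ^ 2 * w1 b \<Longrightarrow> kk c b' = qpar PP powi 2 * kk b b'"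
    using kk_scale[OF b _ b(2), of c "qpar PP powi 2"] unfolding e o by simp
  show "c \<in> B1 \<Longrightarrow> w1 c = (inverse Qp) ^ 2 * w1 b \<Longrightarrow> kk c b' = qpar PP powi (- 2) * kk b b'"
    using kk_scale[OF b _ b(2), of c "qpar PP powi (- 2)"] unfolding e o by simp
  show "c' \<in> B2 \<Longrightarrow> w2 c' = Qm ^ 2 * w2 b' \<Longrightarrow> kk b c' = qpar PM powi 2 * kk b b'"
    using kk_scale[OF b b(1), of c' "qpar PM powi 2"] unfolding e o by simp
  show "c' \<in> B2 \<Longrightarrow> w2 c' = (inverse Qm) ^ 2 * w2 b' \<Longrightarrow> kk b c' = qpar PM powi (- 2) * kk b b'"
    using kk_scale[OF b b(1), of c' "qpar PM powi (- 2)"] unfolding e o by simp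
qed

lemma K_act_scalar:
  assumes "\<And>b b'. (b, b') \<in> keys v \<Longrightarrow> b \<in> B1 \<and> b' \<in> B2 \<and> kk b b' = c"
  shows "lin_ext (gen_act V Kg) v = scl c v"
proof (rule linear_eq_on_keys[where F = "lin_ext (gen_act V Kg)"])
  fix a assume "a \<in> keys v"
  with assms show "lin_ext (gen_act V Kg) (vec a) = scl c (vec a)" by (cases a) (auto simp: gen_act_V)
qed (simp_all add: scl.scale_right_distrib mult.commute)

lemma K_gen_relation:
  assumes b: "b \<in> B1" "b' \<in> B2"
    and keys: "\<And>c c'. (c, c') \<in> keys (gen_act V g (b, b')) \<Longrightarrow> c \<in> B1 \<and> c' \<in> B2 \<and> kk c c' = \<omega> * kk b b'"
  shows "free_act V (gen Kg * gen g * Kpow PP PM (- 1) - scl \<omega> (gen g)) (vec (b, b')) = 0"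
proof -
  have "lin_ext (gen_act V Kg) (gen_act V g (b, b')) = scl (\<omega> * kk b b') (gen_act V g (b, b'))"
    by (rule K_act_scalar) (use keys in auto)
  thus ?thesis using kk_nz[OF b]
    by (simp add: free_act_mult Kpow_act[OF b] power_int_minus del: scl.scale_scale) (simp add: mult.left_commute)
qed

lemma is_mod_V: "is_mod V"
  unfolding is_mod_def basis_V
proof (intro conjI allI ballI)
  fix g and a assume "a \<in> B1 \<times> B2"
  then obtain b b' where a: "a = (b, b')" and b: "b \<in> B1" "b' \<in> B2" by auto
  have k: "keys (x \<otimes>\<^sub>v y) \<subseteq> B1 \<times> B2" if "keys x \<subseteq> B1" "keys y \<subseteq> B2" for x y
    using keys_tens[of x y] that by blast
  have kv: "keys (vec b) \<subseteq> B1" "keys (vec b') \<subseteq> B2" using b by auto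
  have ke: "keys (e1 b) \<subseteq> B1" "keys (f1 b) \<subseteq> B1"
    "keys (e2 b') \<subseteq> B2" "keys (f2 b') \<subseteq> B2"
    using M1.e_keys M1.f_keys M2.e_keys M2.f_keys b by blast+
  have "scl (kk b b') (vec (b, b')) \<in> mspace V" using b by (intro mspace_closed) (simp add: basis_V)
  thus "gen_act V g a \<in> mspace V"
    using k[OF ke(1) kv(2)] k[OF ke(2) kv(2)] k[OF kv(1) ke(3)] k[OF kv(1) ke(4)]
    by (cases g) (simp_all add: a gen_act_V b mspace_def basis_V)
next
  fix r and a assume r: "r \<in> g_rels PP PM" and "a \<in> B1 \<times> B2"
  then obtain b b' where a: "a = (b, b')" and b: "b \<in> B1" "b' \<in> B2" by auto
  have t: "vec (b, b') = vec b \<otimes>\<^sub>v vec b'" by simp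
  have kv: "keys (vec b) \<subseteq> B1" "keys (vec b') \<subseteq> B2" using b by auto
  have ke: "keys (e1 b) \<subseteq> B1" "keys (f1 b) \<subseteq> B1"
    "keys (e2 b') \<subseteq> B2" "keys (f2 b') \<subseteq> B2"
    using M1.e_keys M1.f_keys M2.e_keys M2.f_keys b by blast+
  have k: "keys (lin_ext e1 x) \<subseteq> B1 \<and> keys (lin_ext f1 x) \<subseteq> B1" if "keys x \<subseteq> B1" for x
    using that keys_lin_ext[of e1 x] keys_lin_ext[of f1 x] M1.e_keys M1.f_keys by blast
  have k': "keys (lin_ext e2 x) \<subseteq> B2 \<and> keys (lin_ext f2 x) \<subseteq> B2" if "keys x \<subseteq> B2" for x
    using that keys_lin_ext[of e2 x] keys_lin_ext[of f2 x] M2.e_keys M2.f_keys by blast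
  have "((lin_ext (gen_act V g)) ^^ n) (vec (b, b')) = ((lin_ext F) ^^ n) (vec b) \<otimes>\<^sub>v vec b' \<and>
      keys (((lin_ext F) ^^ n) (vec b)) \<subseteq> B1" if "(g, F) \<in> {(Ep, e1), (Fp, f1)}" for g F n
    by (induction n) (use that kv k in \<open>auto simp: gen_tens\<close>)
  moreover have "((lin_ext (gen_act V g)) ^^ n) (vec (b, b')) = vec b \<otimes>\<^sub>v ((lin_ext F) ^^ n) (vec b') \<and>
      keys (((lin_ext F) ^^ n) (vec b')) \<subseteq> B2" if "(g, F) \<in> {(Em, e2), (Fm, f2)}" for g F n
    by (induction n) (use that kv k' in \<open>auto simp: gen_tens\<close>)
  ultimately have pow: "((lin_ext (gen_act V Ep)) ^^ n) (vec (b, b')) = ((lin_ext e1) ^^ n) (vec b) \<otimes>\<^sub>v vec b'"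
    "((lin_ext (gen_act V Fp)) ^^ n) (vec (b, b')) = ((lin_ext f1) ^^ n) (vec b) \<otimes>\<^sub>v vec b'"
    "((lin_ext (gen_act V Em)) ^^ n) (vec (b, b')) = vec b \<otimes>\<^sub>v ((lin_ext e2) ^^ n) (vec b')"
    "((lin_ext (gen_act V Fm)) ^^ n) (vec (b, b')) = vec b \<otimes>\<^sub>v ((lin_ext f2) ^^ n) (vec b')" for n
    by blast+
  have fg: "free_act V (gen g) = lin_ext (gen_act V g)" for g by (rule ext) simp
  have nil: "free_act V (gen Ep ^ PP) (vec (b, b')) = 0" "free_act V (gen Fp ^ PP) (vec (b, b')) = 0"
    "free_act V (gen Em ^ PM) (vec (b, b')) = 0" "free_act V (gen Fm ^ PM) (vec (b, b')) = 0"
    using pow[of PP] pow[of PM] b by (simp_all add: free_act_power fg M1.e_nil M1.f_nil M2.e_nil M2.f_nil)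
  have K1: "free_act V (gen Kg ^ (2 * PP * PM) - 1) (vec (b, b')) = 0"
    using K_power_act[OF b, of LL] kk_root[OF b] by (simp add: free_act_power fg LL_def)
  have kk: "free_act V (gen Kg * gen Ep * Kpow PP PM (- 1) - scl (qpar PP powi 2) (gen Ep)) (vec (b, b')) = 0"
    "free_act V (gen Kg * gen Fp * Kpow PP PM (- 1) - scl (qpar PP powi (- 2)) (gen Fp)) (vec (b, b')) = 0"
    "free_act V (gen Kg * gen Em * Kpow PP PM (- 1) - scl (qpar PM powi 2) (gen Em)) (vec (b, b')) = 0"
    "free_act V (gen Kg * gen Fm * Kpow PP PM (- 1) - scl (qpar PM powi (- 2)) (gen Fm)) (vec (b, b')) = 0"
  proof (rule_tac [!] K_gen_relation[OF b])
    show "(c, c') \<in> keys (gen_act V Ep (b, b')) \<Longrightarrow> c \<in> B1 \<and> c' \<in> B2 \<and> kk c c' = qpar PP powi 2 * kk b b'" for c c'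
      using keys_tens[of "e1 b" "vec b'"] M1.e_keys[OF b(1)] kk_shift(1)[OF b] b by (auto simp: gen_act_V simp del: power_int_numeral)
    show "(c, c') \<in> keys (gen_act V Fp (b, b')) \<Longrightarrow> c \<in> B1 \<and> c' \<in> B2 \<and> kk c c' = qpar PP powi (- 2) * kk b b'" for c c'
      using keys_tens[of "f1 b" "vec b'"] M1.f_keys[OF b(1)] kk_shift(2)[OF b] b by (auto simp: gen_act_V)
    show "(c, c') \<in> keys (gen_act V Em (b, b')) \<Longrightarrow> c \<in> B1 \<and> c' \<in> B2 \<and> kk c c' = qpar PM powi 2 * kk b b'" for c c'
      using keys_tens[of "vec b" "e2 b'"] M2.e_keys[OF b(2)] kk_shift(3)[OF b] b by (auto simp: gen_act_V simp del: power_int_numeral)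
    show "(c, c') \<in> keys (gen_act V Fm (b, b')) \<Longrightarrow> c \<in> B1 \<and> c' \<in> B2 \<and> kk c c' = qpar PM powi (- 2) * kk b b'" for c c'
      using keys_tens[of "vec b" "f2 b'"] M2.f_keys[OF b(2)] kk_shift(4)[OF b] b by (auto simp: gen_act_V)
  qed
  have cm: "free_act V (gen x * gen y - gen y * gen x) (vec (b, b')) = 0" if "x \<in> {Ep, Fp}" "y \<in> {Em, Fm}" for x y
    using that b kv ke by (auto simp: free_act_mult gen_act_V gen_tens)
  have ef: "free_act V (gen Ep * gen Fp - gen Fp * gen Ep -
        scl (1 / (Qp - inverse Qp)) (Kpow PP PM (int PM) - Kpow PP PM (- int PM))) (vec (b, b')) = 0"
    "free_act V (gen Em * gen Fm - gen Fm * gen Em -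
        scl (1 / (Qm - inverse Qm)) (Kpow PP PM (int PP) - Kpow PP PM (- int PP))) (vec (b, b')) = 0"
  proof -
    have K: "kk b b' powi int PM = w1 b" "kk b b' powi (- int PM) = inverse (w1 b)"
      "kk b b' powi int PP = w2 b'" "kk b b' powi (- int PP) = inverse (w2 b')"
      using b by (simp_all add: power_int_minus kk_powers)
    have "free_act V (gen Ep * gen Fp - gen Fp * gen Ep) (vec (b, b')) = (lin_ext e1 (f1 b) - lin_ext f1 (e1 b)) \<otimes>\<^sub>v vec b'"
      using b kv ke by (simp add: free_act_mult gen_act_V gen_tens tens_diff)
    also have "\<dots> = scl ((w1 b - inverse (w1 b)) / qp.h) (vec (b, b'))" using b by (simp add: M1.ef_rel)
    finally show "free_act V (gen Ep * gen Fp - gen Fp * gen Ep -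
        scl (1 / (Qp - inverse Qp)) (Kpow PP PM (int PM) - Kpow PP PM (- int PM))) (vec (b, b')) = 0"
      using b by (simp add: Kpow_act K kk_powers qp.h_def scl.scale_left_diff_distrib[symmetric])
    have "free_act V (gen Em * gen Fm - gen Fm * gen Em) (vec (b, b')) = vec b \<otimes>\<^sub>v (lin_ext e2 (f2 b') - lin_ext f2 (e2 b'))"
      using b kv ke by (simp add: free_act_mult gen_act_V gen_tens tens_diff)
    also have "\<dots> = scl ((w2 b' - inverse (w2 b')) / qm.h) (vec (b, b'))" using b by (simp add: M2.ef_rel)
    finally show "free_act V (gen Em * gen Fm - gen Fm * gen Em -
        scl (1 / (Qm - inverse Qm)) (Kpow PP PM (int PP) - Kpow PP PM (- int PP))) (vec (b, b')) = 0"
      using b by (simp add: Kpow_act K kk_powers qm.h_def scl.scale_left_diff_distrib[symmetric])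
  qed
  show "free_act V r (vec a) = 0"
    using r nil K1 kk cm ef unfolding g_rels_def a by blast
qed

lemma KK_act:
  assumes b: "b \<in> B1" "b' \<in> B2"
  shows "ga V (KK n) (vec (b, b')) = scl (kk b b' powi n) (vec (b, b'))"
  using ga_pr[OF is_mod_V, of "vec (b, b')" "Kpow PP PM n"] b
  by (simp add: pr_Kpow Kpow_act mspace_closed basis_V)

lemma Cas_act:
  assumes b: "b \<in> B1" "b' \<in> B2"
  shows "ga V sp.Cas (vec (b, b')) =
      (scl (qp.h ^ 2) (lin_ext f1 (e1 b)) + scl (csum (Qp * w1 b)) (vec b)) \<otimes>\<^sub>v vec b'"
    "ga V sm.Cas (vec (b, b')) =
      vec b \<otimes>\<^sub>v (scl (qm.h ^ 2) (lin_ext e2 (f2 b')) + scl (csum (inverse Qm * w2 b')) (vec b'))"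
proof -
  have v: "vec (b, b') \<in> mspace V" using b by (intro mspace_closed) (simp add: basis_V)
  have kv: "keys (vec b) \<subseteq> B1" "keys (vec b') \<subseteq> B2" using b by auto
  have ke: "keys (e1 b) \<subseteq> B1" "keys (f2 b') \<subseteq> B2"
    using M1.e_keys M2.f_keys b by blast+
  have m: "ga V (G g) (vec (b, b')) \<in> mspace V" for g using ga_simps(9)[OF is_mod_V v] .
  have K: "kk b b' powi int PM = w1 b" "kk b b' powi (- int PM) = inverse (w1 b)"
    "kk b b' powi int PP = w2 b'" "kk b b' powi (- int PP) = inverse (w2 b')"
    using b by (simp_all add: power_int_minus kk_powers)
  have "ga V (G Fp * G Ep) (vec (b, b')) = lin_ext f1 (e1 b) \<otimes>\<^sub>v vec b'"
    using m[of Ep] b kv ke by (simp add: ga_simps[OF is_mod_V] v gen_act_V gen_tens)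
  thus "ga V sp.Cas (vec (b, b')) =
      (scl (qp.h ^ 2) (lin_ext f1 (e1 b)) + scl (csum (Qp * w1 b)) (vec b)) \<otimes>\<^sub>v vec b'"
    unfolding sp.Cas_def using b
    by (simp add: ga_simps[OF is_mod_V] v KK_act K kk_powers csum_def scl.scale_left_distrib mult.commute)
  have "ga V (G Em * G Fm) (vec (b, b')) = vec b \<otimes>\<^sub>v lin_ext e2 (f2 b')"
    using m[of Fm] b kv ke by (simp add: ga_simps[OF is_mod_V] v gen_act_V gen_tens)
  thus "ga V sm.Cas (vec (b, b')) =
      vec b \<otimes>\<^sub>v (scl (qm.h ^ 2) (lin_ext e2 (f2 b')) + scl (csum (inverse Qm * w2 b')) (vec b'))"
    unfolding sm.Cas_def using b
    by (simp add: ga_simps[OF is_mod_V] v KK_act K kk_powers csum_def scl.scale_left_distrib mult.commute add_ac)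
qed

end

context qroot
begin

lemma qint_br: "qint Q n = br n / h"
  by (simp add: qint_def br_def h_def power_int_minus power_inverse)

lemma qint_0 [simp]: "qint Q 0 = 0"
  by (simp add: qint_br)

text \<open>W is the weight at position a in a string of length m with sign E. The first identity is
  the commutator relation there; the other two evaluate the two forms of the Casimir element to a
  number that does not depend on a.\<close>

lemma weight_identity:
  assumes E: "E ^ 2 = 1" and a: "a < m"
  defines "W \<equiv> E * Q powi (int m - 1 - 2 * int a)"
  shows "E * qint Q (a + 1) * qint Q (m - (a + 1)) - E * qint Q a * qint Q (m - a) = (W - inverse W) / h"
    and "h ^ 2 * (E * qint Q a * qint Q (m - a)) + csum (Q * W) = csum (E * Q ^ m)"
    and "h ^ 2 * (E * qint Q (a + 1) * qint Q (m - (a + 1))) + csum (iQ * W) = csum (E * Q ^ m)"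
proof -
  obtain s where s: "m = a + 1 + s" using a less_eqE[of "a + 1" m] by auto
  have iE: "inverse E = E" using E by (intro inverse_unique) (simp add: power2_eq_square)
  have ms: "m - (a + 1) = s" "m - a = Suc s" using s by auto
  have W: "W = E * (Q ^ s * iQ ^ a)"
  proof -
    have "int m - 1 - 2 * int a = int s + - int a" using s by simp
    thus ?thesis
      by (simp only: W_def power_int_add[OF disjI1[OF Q_nz]] power_int_minus power_int_of_nat power_inverse)
  qed
  have iW: "inverse W = E * (Q ^ a * iQ ^ s)" unfolding W by (simp add: iE power_inverse mult_ac)
  have "br (a + 1) * br s - br a * br (Suc s) = h * (Q ^ s * iQ ^ a - Q ^ a * iQ ^ s)"
    by (simp add: br_def h_def algebra_simps del: power_inverse)
  hence "(E * (br (a + 1) * br s - br a * br (Suc s))) / h ^ 2 = (W - inverse W) / h"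
  proof -
    assume e: "br (a + 1) * br s - br a * br (Suc s) = h * (Q ^ s * iQ ^ a - Q ^ a * iQ ^ s)"
    have "W - inverse W = E * (Q ^ s * iQ ^ a - Q ^ a * iQ ^ s)"
      unfolding iW unfolding W by (simp only: right_diff_distrib)
    thus ?thesis unfolding e by (simp add: power2_eq_square)
  qed
  thus "E * qint Q (a + 1) * qint Q (m - (a + 1)) - E * qint Q a * qint Q (m - a) = (W - inverse W) / h"
    unfolding ms qint_br by (simp add: power2_eq_square right_diff_distrib diff_divide_distrib mult.assoc)
  have i: "inverse (E * Q ^ m) = E * iQ ^ m" by (simp add: iE power_inverse)
  have iqw: "csum (Q * W) = Q * W + iQ * inverse W" "csum (iQ * W) = iQ * W + Q * inverse W" by (simp_all add: csum_def)
  have Qp: "Q ^ Suc s * iQ ^ a = Q * (Q ^ s * iQ ^ a)" by simp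
  show "h ^ 2 * (E * qint Q a * qint Q (m - a)) + csum (Q * W) = csum (E * Q ^ m)"
  proof -
    have "br a * br (Suc s) + Q * (Q ^ s * iQ ^ a) + iQ * (Q ^ a * iQ ^ s) = Q ^ m + iQ ^ m"
      unfolding s br_def by (simp add: algebra_simps power_add del: power_inverse)
    from arg_cong[OF this, of "\<lambda>t. E * t"] show ?thesis
      unfolding iqw unfolding iW csum_def i unfolding W ms qint_br
      by (simp add: power2_eq_square distrib_left mult_ac add_ac del: power_inverse)
  qed
  show "h ^ 2 * (E * qint Q (a + 1) * qint Q (m - (a + 1))) + csum (iQ * W) = csum (E * Q ^ m)"
  proof -
    have c1: "iQ * (Q ^ s * iQ ^ a) = Q ^ s * iQ ^ (a + 1)" "Q * (Q ^ a * iQ ^ s) = Q ^ (a + 1) * iQ ^ s" by simp_all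
    have "br (a + 1) * br s + Q ^ s * iQ ^ (a + 1) + Q ^ (a + 1) * iQ ^ s = Q ^ m + iQ ^ m"
      unfolding s br_def power_add by (simp only: left_diff_distrib right_diff_distrib mult_ac) simp
    hence "br (a + 1) * br s + iQ * (Q ^ s * iQ ^ a) + Q * (Q ^ a * iQ ^ s) = Q ^ m + iQ ^ m"
      unfolding c1 .
    from arg_cong[OF this, of "\<lambda>t. E * t"] show ?thesis
      unfolding iqw unfolding iW csum_def i unfolding W ms qint_br
      by (simp add: power2_eq_square distrib_left mult_ac add_ac del: power_inverse)
  qed
qed

lemma Q_powi_root: "(Q powi n) ^ (2 * p) = 1"
proof -
  have "(Q powi n) ^ (2 * p) = (Q ^ (2 * p)) powi n"
    unfolding power_int_power' power_int_power by (simp add: mult.commute)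
  thus ?thesis by (simp add: Q_root)
qed

lemma weight_root: "E ^ 2 = 1 \<Longrightarrow> (E * Q powi n) ^ (2 * p) = 1"
  by (simp add: power_mult_distrib Q_powi_root) (simp add: power_mult)

lemma Q_powi_shift: "Q powi (n + 2) = Q ^ 2 * Q powi n" "Q powi (n - 2) = iQ ^ 2 * Q powi n"
  using power_int_add[of Q n 2] power_int_diff[of Q n 2] by (simp_all add: power_inverse divide_inverse mult_ac)

definition irr_w :: "nat \<Rightarrow> complex \<Rightarrow> nat \<Rightarrow> complex" where
  "irr_w r \<sigma> n = \<sigma> * Q powi (int r - 1 - 2 * int n)"

definition irr_e :: "nat \<Rightarrow> complex \<Rightarrow> nat \<Rightarrow> nat vect" where
  "irr_e r \<sigma> n = scl (\<sigma> * qint Q n * qint Q (r - n)) (vec (n - 1))"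

definition irr_f :: "nat \<Rightarrow> nat \<Rightarrow> nat vect" where
  "irr_f r n = (if n + 1 < r then vec (n + 1) else 0)"

lemma irr_ef:
  assumes "n < r"
  shows "lin_ext (irr_e r \<sigma>) (irr_f r n) = scl (\<sigma> * qint Q (n + 1) * qint Q (r - (n + 1))) (vec n)"
    and "lin_ext (irr_f r) (irr_e r \<sigma> n) = scl (\<sigma> * qint Q n * qint Q (r - n)) (vec n)"
proof -
  show "lin_ext (irr_e r \<sigma>) (irr_f r n) = scl (\<sigma> * qint Q (n + 1) * qint Q (r - (n + 1))) (vec n)"
  proof (cases "n + 1 < r")
    case False
    hence "r - (n + 1) = 0" by simp
    thus ?thesis using False by (simp only: irr_f_def if_False qint_0) simp
  qed (simp add: irr_e_def irr_f_def)
  show "lin_ext (irr_f r) (irr_e r \<sigma> n) = scl (\<sigma> * qint Q n * qint Q (r - n)) (vec n)"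
    using assms by (cases n) (simp_all add: irr_e_def irr_f_def)
qed

lemma keys_scl_vec: "keys (scl c (vec b)) = (if c = 0 then {} else {b})"
  by (auto simp: in_keys_iff lookup_single when_def split: if_splits)

lemma sl2_module_irr:
  assumes r: "1 \<le> r" "r \<le> p" and \<sigma>: "\<sigma> ^ 2 = 1"
  shows "sl2_module Q p {..<r} (irr_w r \<sigma>) (irr_e r \<sigma>) (irr_f r)"
proof
  show "finite {..<r}" by simp
  fix n assume n: "n \<in> {..<r}"
  show ek: "n' \<in> {..<r} \<and> irr_w r \<sigma> n' = Q ^ 2 * irr_w r \<sigma> n" if "n' \<in> keys (irr_e r \<sigma> n)" for n'
  proof -
    from that have "n' = n - 1" "n \<noteq> 0" by (cases n; auto simp: irr_e_def keys_scl_vec split: if_splits)+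
    moreover from this have "int r - 1 - 2 * int n' = (int r - 1 - 2 * int n) + 2" by simp
    ultimately show ?thesis using n unfolding irr_w_def by (simp only: Q_powi_shift) auto
  qed
  show fk: "n' \<in> {..<r} \<and> irr_w r \<sigma> n' = iQ ^ 2 * irr_w r \<sigma> n" if "n' \<in> keys (irr_f r n)" for n'
  proof -
    from that have n': "n' = n + 1" "n + 1 < r" by (auto simp: irr_f_def split: if_splits)
    hence "int r - 1 - 2 * int n' = (int r - 1 - 2 * int n) - 2" by simp
    with n' show ?thesis unfolding irr_w_def by (simp only: Q_powi_shift) auto
  qed
  show "irr_w r \<sigma> n ^ (2 * p) = 1" unfolding irr_w_def by (rule weight_root[OF \<sigma>])
  show "lin_ext (irr_e r \<sigma>) (irr_f r n) - lin_ext (irr_f r) (irr_e r \<sigma> n) =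
      scl ((irr_w r \<sigma> n - inverse (irr_w r \<sigma> n)) / h) (vec n)"
    using n weight_identity(1)[OF \<sigma>, of n r] by (simp add: irr_ef irr_w_def scl.scale_left_diff_distrib[symmetric])
  show "((lin_ext (irr_e r \<sigma>)) ^^ p) (vec n) = 0"
    by (rule funpow_lin_ext_eq_0[where ht = "\<lambda>n. n" and B = "{..<r}"])
      (use r n in \<open>auto simp: irr_e_def keys_scl_vec gr0_conv_Suc split: if_splits intro: gr0I\<close>, metis diff_Suc_less gr0I qint_0)
  show "((lin_ext (irr_f r)) ^^ p) (vec n) = 0"
    by (rule funpow_lin_ext_eq_0[where ht = "\<lambda>n. r - 1 - n" and B = "{..<r}"])
      (use r n in \<open>auto simp: irr_f_def split: if_splits\<close>)
qed

subsection \<open>The indecomposable modules \<open>P\<^sub>r\<close>\<close>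

text \<open>The products f e and e f have this nilpotent part in common. It cancels in the
  commutator but survives in the Casimir element, where a pseudotrace detects it.\<close>

fun nil_part :: "tbasis \<Rightarrow> tbasis vect" where
  "nil_part (Up n) = vec (Dn n)"
| "nil_part _ = 0"

fun fe_val :: "nat \<Rightarrow> complex \<Rightarrow> tbasis \<Rightarrow> complex" where
  "fe_val r \<epsilon> (Up n) = \<epsilon> * qint Q n * qint Q (r - n)"
| "fe_val r \<epsilon> (Dn n) = \<epsilon> * qint Q n * qint Q (r - n)"
| "fe_val r \<epsilon> (Lf n) = eps' p Q \<epsilon> * qint Q n * qint Q (p - r - n)"
| "fe_val r \<epsilon> (Rt n) = eps' p Q \<epsilon> * qint Q n * qint Q (p - r - n)"

fun ef_val :: "nat \<Rightarrow> complex \<Rightarrow> tbasis \<Rightarrow> complex" where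
  "ef_val r \<epsilon> (Up n) = \<epsilon> * qint Q (n + 1) * qint Q (r - (n + 1))"
| "ef_val r \<epsilon> (Dn n) = \<epsilon> * qint Q (n + 1) * qint Q (r - (n + 1))"
| "ef_val r \<epsilon> (Lf n) = eps' p Q \<epsilon> * qint Q (n + 1) * qint Q (p - r - (n + 1))"
| "ef_val r \<epsilon> (Rt n) = eps' p Q \<epsilon> * qint Q (n + 1) * qint Q (p - r - (n + 1))"

lemma proj_fe:
  assumes r: "1 \<le> r" "r < p" and b: "b \<in> proj_basis p r"
  shows "lin_ext (proj_f p r) (proj_e p Q r \<epsilon> b) = scl (fe_val r \<epsilon> b) (vec b) + nil_part b"
proof (cases b)
  case (Up n)
  thus ?thesis using b r by (cases n) (auto simp: proj_basis_def)
next
  case (Dn n)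
  thus ?thesis using b r by (cases n) (auto simp: proj_basis_def)
next
  case (Lf n)
  thus ?thesis using b r by (cases n) (auto simp: proj_basis_def)
next
  case (Rt n)
  thus ?thesis using b r by (cases n) (auto simp: proj_basis_def)
qed

lemma proj_ef:
  assumes r: "1 \<le> r" "r < p" and b: "b \<in> proj_basis p r"
  shows "lin_ext (proj_e p Q r \<epsilon>) (proj_f p r b) = scl (ef_val r \<epsilon> b) (vec b) + nil_part b"
proof (cases b)
  case (Up n)
  thus ?thesis using b r by (cases "n = r - 1") (auto simp: proj_basis_def)
next
  case (Dn n)
  thus ?thesis using b r by (cases "n = r - 1") (auto simp: proj_basis_def)
next
  case (Lf n)
  thus ?thesis using b r by (cases "n = p - r - 1") (auto simp: proj_basis_def)
next
  case (Rt n)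
  thus ?thesis using b r by (cases "n = p - r - 1") (auto simp: proj_basis_def)
qed

lemma Qp_sq: "Q ^ p * Q ^ p = 1"
  using Q_root by (simp add: mult_2 power_add)

lemma eps'_sq: "\<epsilon> ^ 2 = 1 \<Longrightarrow> eps' p Q \<epsilon> ^ 2 = 1"
proof -
  assume "\<epsilon> ^ 2 = 1"
  moreover have "eps' p Q \<epsilon> ^ 2 = \<epsilon> ^ 2 * (Q ^ p * Q ^ p)"
    by (simp only: eps'_def power2_eq_square mult_ac)
  ultimately show ?thesis by (simp only: Qp_sq mult_1_right)
qed

lemma proj_weight_identities:
  assumes r: "1 \<le> r" "r < p" and \<epsilon>: "\<epsilon> ^ 2 = 1" and b: "b \<in> proj_basis p r"
  shows "ef_val r \<epsilon> b - fe_val r \<epsilon> b = (proj_K p Q r \<epsilon> b - inverse (proj_K p Q r \<epsilon> b)) / h"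
proof (cases b)
  case (Up n)
  thus ?thesis using b weight_identity(1)[OF \<epsilon>, of n r] by (auto simp: proj_basis_def)
next
  case (Dn n)
  thus ?thesis using b weight_identity(1)[OF \<epsilon>, of n r] by (auto simp: proj_basis_def)
next
  case (Lf n)
  thus ?thesis using b r weight_identity(1)[OF eps'_sq[OF \<epsilon>], of n "p - r"] by (auto simp: proj_basis_def of_nat_diff)
next
  case (Rt n)
  thus ?thesis using b r weight_identity(1)[OF eps'_sq[OF \<epsilon>], of n "p - r"] by (auto simp: proj_basis_def of_nat_diff)
qed

text \<open>Exponents of Q on one scale for all four families: the sign Q^p in \<open>eps'\<close>
  is counted as +p for \<open>Lf\<close> and as -p for \<open>Rt\<close>, so that e raises the
  exponent by exactly 2 and f lowers it by 2. The discrepancy of 2p is invisible to Q.\<close>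

fun log_wt :: "nat \<Rightarrow> tbasis \<Rightarrow> int" where
  "log_wt r (Up n) = int r - 1 - 2 * int n"
| "log_wt r (Dn n) = int r - 1 - 2 * int n"
| "log_wt r (Lf n) = 2 * int p - int r - 1 - 2 * int n"
| "log_wt r (Rt n) = - int r - 1 - 2 * int n"

lemma proj_K_log:
  assumes "\<epsilon> ^ 2 = 1"
  shows "proj_K p Q r \<epsilon> b = \<epsilon> * Q powi (log_wt r b)"
proof -
  have a: "Q ^ p * Q powi (int p - int r - 1 - 2 * int n) = Q powi (2 * int p - int r - 1 - 2 * int n)" for n
  proof -
    have "2 * int p - int r - 1 - 2 * int n = int p + (int p - int r - 1 - 2 * int n)" by simp
    thus ?thesis by (simp only: power_int_add[OF disjI1[OF Q_nz]] power_int_of_nat)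
  qed
  have b: "Q powi (2 * int p - int r - 1 - 2 * int n) = Q powi (- int r - 1 - 2 * int n)" for n
  proof -
    have "2 * int p - int r - 1 - 2 * int n = int (2 * p) + (- int r - 1 - 2 * int n)" by simp
    thus ?thesis by (simp only: power_int_add[OF disjI1[OF Q_nz]] power_int_of_nat Q_root mult_1_left)
  qed
  show ?thesis by (cases b) (simp_all add: eps'_def mult.assoc a b)
qed

lemma proj_e_keys:
  assumes r: "1 \<le> r" "r < p" and b: "b \<in> proj_basis p r" and b': "b' \<in> keys (proj_e p Q r \<epsilon> b)"
  shows "b' \<in> proj_basis p r \<and> (log_wt r b' = log_wt r b + 2)"
proof (cases b)
  case (Up n)
  thus ?thesis using b b' r
    keys_add[of "scl (\<epsilon> * qint Q n * qint Q (r - n)) (vec (Up (n - 1)))" "vec (Dn (n - 1))"]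
    by (auto simp: proj_basis_def keys_scl_vec of_nat_diff split: if_splits dest!: subsetD)
next
  case (Dn n)
  thus ?thesis using b b' r by (auto simp: proj_basis_def keys_scl_vec of_nat_diff split: if_splits)
next
  case (Lf n)
  thus ?thesis using b b' r by (auto simp: proj_basis_def keys_scl_vec of_nat_diff split: if_splits)
next
  case (Rt n)
  thus ?thesis using b b' r by (auto simp: proj_basis_def keys_scl_vec of_nat_diff split: if_splits)
qed

lemma proj_f_keys:
  assumes r: "1 \<le> r" "r < p" and b: "b \<in> proj_basis p r" and b': "b' \<in> keys (proj_f p r b)"
  shows "b' \<in> proj_basis p r \<and> (log_wt r b' = log_wt r b - 2)"
  using assms by (cases b) (auto simp: proj_basis_def of_nat_diff split: if_splits)

lemma sl2_module_proj:
  assumes r: "1 \<le> r" "r < p" and \<epsilon>: "\<epsilon> ^ 2 = 1"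
  shows "sl2_module Q p (proj_basis p r) (proj_K p Q r \<epsilon>) (proj_e p Q r \<epsilon>) (proj_f p r)"
proof
  show "finite (proj_basis p r)" by (simp add: proj_basis_def)
  fix b assume b: "b \<in> proj_basis p r"
  show "b' \<in> proj_basis p r \<and> proj_K p Q r \<epsilon> b' = Q ^ 2 * proj_K p Q r \<epsilon> b" if "b' \<in> keys (proj_e p Q r \<epsilon> b)" for b'
    using proj_e_keys[OF r b that] by (simp add: proj_K_log[OF \<epsilon>] Q_powi_shift)
  show "b' \<in> proj_basis p r \<and> proj_K p Q r \<epsilon> b' = iQ ^ 2 * proj_K p Q r \<epsilon> b" if "b' \<in> keys (proj_f p r b)" for b'
    using proj_f_keys[OF r b that] by (simp add: proj_K_log[OF \<epsilon>] Q_powi_shift)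
  show "proj_K p Q r \<epsilon> b ^ (2 * p) = 1" unfolding proj_K_log[OF \<epsilon>] by (rule weight_root[OF \<epsilon>])
  show "lin_ext (proj_e p Q r \<epsilon>) (proj_f p r b) - lin_ext (proj_f p r) (proj_e p Q r \<epsilon> b) =
      scl ((proj_K p Q r \<epsilon> b - inverse (proj_K p Q r \<epsilon> b)) / h) (vec b)"
    unfolding proj_weight_identities[OF r \<epsilon> b, symmetric]
    by (simp add: proj_fe[OF r b] proj_ef[OF r b] scl.scale_left_diff_distrib)
  \<comment> \<open>Heights that drop along e and f respectively; being at most p - 1 they give e^p
    = f^p = 0.\<close>
  let ?he = "\<lambda>b. case b of Up n \<Rightarrow> n + (p - r) | Dn n \<Rightarrow> n | Lf n \<Rightarrow> n | Rt n \<Rightarrow> n + r"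
  let ?hf = "\<lambda>b. case b of Up n \<Rightarrow> r - 1 - n + (p - r) | Dn n \<Rightarrow> r - 1 - n | Lf n \<Rightarrow> p - r - 1 - n + r | Rt n \<Rightarrow> p - r - 1 - n"
  have he: "?he b' < ?he b" if b: "b \<in> proj_basis p r" and b': "b' \<in> keys (proj_e p Q r \<epsilon> b)" for b b'
  proof (cases b)
    case (Up n)
    thus ?thesis using b b' r
      keys_add[of "scl (\<epsilon> * qint Q n * qint Q (r - n)) (vec (Up (n - 1)))" "vec (Dn (n - 1))"]
      by (auto simp: proj_basis_def keys_scl_vec split: if_splits dest!: subsetD)
  next
    case (Dn n)
    thus ?thesis using b b' r by (auto simp: proj_basis_def keys_scl_vec split: if_splits)
  next
    case (Lf n)
    thus ?thesis using b b' r by (auto simp: proj_basis_def keys_scl_vec split: if_splits)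
  next
    case (Rt n)
    thus ?thesis using b b' r by (auto simp: proj_basis_def keys_scl_vec split: if_splits)
  qed
  have hf: "?hf b' < ?hf b" if b: "b \<in> proj_basis p r" and b': "b' \<in> keys (proj_f p r b)" for b b'
    using b b' r by (cases b) (auto simp: proj_basis_def split: if_splits)
  show "((lin_ext (proj_e p Q r \<epsilon>)) ^^ p) (vec b) = 0"
  proof (rule funpow_lin_ext_eq_0[where ht = ?he and B = "proj_basis p r"])
    show "b'' \<in> proj_basis p r \<and> ?he b'' < ?he b'"
      if "b' \<in> proj_basis p r" "b'' \<in> keys (proj_e p Q r \<epsilon> b')" for b' b''
      using he[OF that] proj_e_keys[OF r that] by blast
    show "?he b < p" using b r by (cases b) (auto simp: proj_basis_def)
  qed (rule b)
  show "((lin_ext (proj_f p r)) ^^ p) (vec b) = 0"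
  proof (rule funpow_lin_ext_eq_0[where ht = ?hf and B = "proj_basis p r"])
    show "b'' \<in> proj_basis p r \<and> ?hf b'' < ?hf b'"
      if "b' \<in> proj_basis p r" "b'' \<in> keys (proj_f p r b')" for b' b''
      using hf[OF that] proj_f_keys[OF r that] by blast
    show "?hf b < p" using b r by (cases b) (auto simp: proj_basis_def)
  qed (rule b)
qed

end

subsection \<open>The modules of the quantum group\<close>

lemma sign_power_sq: "\<alpha> ^ 2 = 1 \<Longrightarrow> (\<alpha> ^ n * (- 1) ^ m) ^ 2 = (1 :: complex)"
proof -
  assume "\<alpha> ^ 2 = 1"
  hence "(\<alpha> ^ n) ^ 2 = 1" by (metis power_mult mult.commute power_one)
  thus ?thesis using power_even_eq[of "- 1 :: complex" m] by (simp add: power_mult_distrib)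
qed

lemma qpar_self_power: "0 < n \<Longrightarrow> qpar n ^ n = - 1"
  unfolding qpar_power by (simp add: exp_pi_i' mult.commute)

lemma minus_one_powi: "(- 1) powi (n - 2 * k) = ((- 1) powi n :: complex)"
  by (simp add: power_int_diff power_int_mult)

lemma tensor_module_irr:
  assumes r: "1 \<le> r" "r \<le> PP" "1 \<le> r'" "r' \<le> PM" and \<alpha>: "\<alpha> ^ 2 = 1"
  defines "\<sigma> \<equiv> \<alpha> ^ PM * (- 1) ^ (r' - 1)" and "\<sigma>' \<equiv> \<alpha> ^ PP * (- 1) ^ (r - 1)"
  shows "tensor_module {..<r} (qp.irr_w r \<sigma>) (qp.irr_e r \<sigma>) (qp.irr_f r)
    {..<r'} (qm.irr_w r' \<sigma>') (qm.irr_e r' \<sigma>') (qm.irr_f r') (irr_mod PP PM \<alpha> r r')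
    (\<lambda>n n'. \<alpha> * qpar PP powi (int r - 1 - 2 * int n) * qpar PM powi (int r' - 1 - 2 * int n'))"
proof (intro tensor_module.intro tensor_module_axioms.intro)
  show "sl2_module Qp PP {..<r} (qp.irr_w r \<sigma>) (qp.irr_e r \<sigma>) (qp.irr_f r)"
    by (rule qp.sl2_module_irr) (use r \<alpha> in \<open>simp_all add: \<sigma>_def sign_power_sq\<close>)
  show "sl2_module Qm PM {..<r'} (qm.irr_w r' \<sigma>') (qm.irr_e r' \<sigma>') (qm.irr_f r')"
    by (rule qm.sl2_module_irr) (use r \<alpha> in \<open>simp_all add: \<sigma>'_def sign_power_sq\<close>)
  let ?V = "irr_mod PP PM \<alpha> r r'"
  show "basis ?V = {..<r} \<times> {..<r'}" by (simp add: irr_mod_def)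
  fix n n' assume n: "n \<in> {..<r}" "n' \<in> {..<r'}"
  have n1: "n - 1 < r" "n' - 1 < r'" using n by auto
  show "gen_act ?V Ep (n, n') = qp.irr_e r \<sigma> n \<otimes>\<^sub>v vec n'" "gen_act ?V Em (n, n') = vec n \<otimes>\<^sub>v qm.irr_e r' \<sigma>' n'"
    "gen_act ?V Fp (n, n') = qp.irr_f r n \<otimes>\<^sub>v vec n'" "gen_act ?V Fm (n, n') = vec n \<otimes>\<^sub>v qm.irr_f r' n'"
    using n n1 by (auto simp: irr_mod_def qp.irr_e_def qm.irr_e_def qp.irr_f_def qm.irr_f_def ket_def \<sigma>_def \<sigma>'_def)
  show "gen_act ?V Kg (n, n') = scl (\<alpha> * qpar PP powi (int r - 1 - 2 * int n) * qpar PM powi (int r' - 1 - 2 * int n')) (vec (n, n'))"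
    using n by (simp add: irr_mod_def ket_def)
  have sg: "(- 1) powi (int r - 1 - 2 * k) = ((- 1) ^ (r - 1) :: complex)" "(- 1) powi (int r' - 1 - 2 * k) = ((- 1) ^ (r' - 1) :: complex)" for k
    using r unfolding minus_one_powi by (simp_all add: power_int_def nat_diff_distrib)
  \<comment> \<open>The n-th power of \<open>qpar n\<close> is -1; this produces the signs in the
    action of e_+ and e_- on the irreducible modules.\<close>
  have e: "(qpar n powi i) ^ n = (- 1) powi i" if "0 < n" for n i
    using qpar_self_power[OF that] by (metis power_int_power power_int_power' mult.commute)
  have e': "(qpar n powi i) ^ m = (Qpar n m) powi i" for n m i
    unfolding Qpar_def by (metis power_int_power power_int_power' mult.commute)
  show "(\<alpha> * qpar PP powi (int r - 1 - 2 * int n) * qpar PM powi (int r' - 1 - 2 * int n')) ^ PM = qp.irr_w r \<sigma> n"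
    by (simp add: power_mult_distrib e[OF PP_pos] e[OF PM_pos] e'[of PP _ PM] e'[of PM _ PP] sg qp.irr_w_def \<sigma>_def)
  show "(\<alpha> * qpar PP powi (int r - 1 - 2 * int n) * qpar PM powi (int r' - 1 - 2 * int n')) ^ PP = qm.irr_w r' \<sigma>' n'"
    by (simp add: power_mult_distrib e[OF PP_pos] e[OF PM_pos] e'[of PP _ PM] e'[of PM _ PP] sg qm.irr_w_def \<sigma>'_def)
qed

definition proj_k :: "complex \<Rightarrow> nat \<Rightarrow> nat \<Rightarrow> tbasis \<Rightarrow> tbasis \<Rightarrow> complex" where
  "proj_k \<alpha> r r' b b' =
     (let (a, a') = bezout_coefficients (int PM) (int PP)
      in proj_K PP Qp r (\<alpha> ^ PM * (- 1) ^ (r' - 1)) b powi a *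
         proj_K PM Qm r' (\<alpha> ^ PP * (- 1) ^ (r - 1)) b' powi a')"

text \<open>The action of K is built from those of K_+ and K_- with Bezout coefficients. To recover
  K_+ and K_- as its powers one needs x^PP = y^PM for their eigenvalues x and y, both being the
  eigenvalue of K^(PP PM); this is \<open>xy\<close>.\<close>

lemma tensor_module_proj:
  assumes r: "1 \<le> r" "r < PP" "1 \<le> r'" "r' < PM" and \<alpha>: "\<alpha> ^ 2 = 1"
  defines "\<epsilon> \<equiv> \<alpha> ^ PM * (- 1) ^ (r' - 1)" and "\<epsilon>' \<equiv> \<alpha> ^ PP * (- 1) ^ (r - 1)"
  shows "tensor_module (proj_basis PP r) (proj_K PP Qp r \<epsilon>) (proj_e PP Qp r \<epsilon>) (proj_f PP r)
    (proj_basis PM r') (proj_K PM Qm r' \<epsilon>') (proj_e PM Qm r' \<epsilon>') (proj_f PM r')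
    (proj_mod PP PM \<alpha> r r') (proj_k \<alpha> r r')"
proof (intro tensor_module.intro tensor_module_axioms.intro)
  have eps: "\<epsilon> ^ 2 = 1" "\<epsilon>' ^ 2 = 1" using \<alpha> by (simp_all add: \<epsilon>_def \<epsilon>'_def sign_power_sq)
  show "sl2_module Qp PP (proj_basis PP r) (proj_K PP Qp r \<epsilon>) (proj_e PP Qp r \<epsilon>) (proj_f PP r)"
    by (rule qp.sl2_module_proj) (use r eps in simp_all)
  show "sl2_module Qm PM (proj_basis PM r') (proj_K PM Qm r' \<epsilon>') (proj_e PM Qm r' \<epsilon>') (proj_f PM r')"
    by (rule qm.sl2_module_proj) (use r eps in simp_all)
  let ?V = "proj_mod PP PM \<alpha> r r'"
  obtain a a' where aa: "bezout_coefficients (int PM) (int PP) = (a, a')" by (cases "bezout_coefficients (int PM) (int PP)") auto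
  show "basis ?V = proj_basis PP r \<times> proj_basis PM r'" by (simp add: proj_mod_def aa Let_def)
  have bez: "a * int PM + a' * int PP = 1"
    using bezout_coefficients_fst_snd[of "int PM" "int PP"] coprime_PP_PM
    by (simp add: aa coprime_commute)
  fix b b'
  show "gen_act ?V Ep (b, b') = proj_e PP Qp r \<epsilon> b \<otimes>\<^sub>v vec b'" "gen_act ?V Em (b, b') = vec b \<otimes>\<^sub>v proj_e PM Qm r' \<epsilon>' b'"
    "gen_act ?V Fp (b, b') = proj_f PP r b \<otimes>\<^sub>v vec b'" "gen_act ?V Fm (b, b') = vec b \<otimes>\<^sub>v proj_f PM r' b'"
    "gen_act ?V Kg (b, b') = scl (proj_k \<alpha> r r' b b') (vec (b, b'))"
    by (simp_all add: proj_mod_def aa Let_def \<epsilon>_def \<epsilon>'_def proj_k_def)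
  let ?x = "proj_K PP Qp r \<epsilon> b" and ?y = "proj_K PM Qm r' \<epsilon>' b'"
  have nz: "\<epsilon> \<noteq> 0" "\<epsilon>' \<noteq> 0" using eps by auto
  have xy0: "?x \<noteq> 0" "?y \<noteq> 0" using nz by (simp_all add: qp.proj_K_log[OF eps(1)] qm.proj_K_log[OF eps(2)])
  have k: "proj_k \<alpha> r r' b b' = ?x powi a * ?y powi a'" by (simp add: proj_k_def aa \<epsilon>_def \<epsilon>'_def)
  have Qs: "(Qpar n m powi i) ^ n = ((- 1) ^ m) powi i" if "0 < n" for n m i
  proof -
    have "(Qpar n m powi i) ^ n = (Qpar n m ^ n) powi i" by (metis power_int_power power_int_power' mult.commute)
    also have "Qpar n m ^ n = (qpar n ^ n) ^ m" by (simp add: Qpar_def flip: power_mult) (simp add: mult.commute)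
    finally show ?thesis using qpar_self_power[OF that] by simp
  qed
  \<comment> \<open>Only the parity of the logarithmic weight matters, and it is that of r -
    1.\<close>
  have par: "((- 1) ^ m) powi (log) = ((- 1) ^ (m * (s - 1)) :: complex)" if "1 \<le> s" "log = int s - 1 + 2 * i" for m s log i
  proof -
    have "((- 1) ^ m) powi log = ((- 1 :: complex) ^ m) powi int (s - 1) * ((- 1) ^ m) powi (2 * i)"
      unfolding that(2) using that(1) by (simp add: power_int_add of_nat_diff)
    also have "((- 1 :: complex) ^ m) powi (2 * i) = 1"
      by (simp add: power_int_mult power_mult[symmetric])
    finally show ?thesis by (simp add: power_mult)
  qed
  have lp: "\<exists>i. qp.log_wt r b = int r - 1 + 2 * i" 
    by (cases b) (auto simp: exI[of _ "- int _"] intro: exI[of _ "- int n" for n] exI[of _ "int PP - int r - int n" for n] exI[of _ "- int r - int n" for n])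
  have lm: "\<exists>i. qm.log_wt r' b' = int r' - 1 + 2 * i"
    by (cases b') (auto intro: exI[of _ "- int n" for n] exI[of _ "int PM - int r' - int n" for n] exI[of _ "- int r' - int n" for n])
  have xp: "?x ^ PP = \<epsilon> ^ PP * (- 1) ^ (PM * (r - 1))" "?y ^ PM = \<epsilon>' ^ PM * (- 1) ^ (PP * (r' - 1))"
    unfolding qp.proj_K_log[OF eps(1)] qm.proj_K_log[OF eps(2)]
    using lp lm r by (auto simp: power_mult_distrib Qs par)
  have xy: "?x ^ PP = ?y ^ PM"
    unfolding xp unfolding \<epsilon>_def \<epsilon>'_def by (simp add: power_mult_distrib mult_ac flip: power_mult)
  have sw: "(z powi i) ^ n = (z ^ n) powi i" for z :: complex and i n
    by (metis power_int_power power_int_power' mult.commute)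
  have "proj_k \<alpha> r r' b b' ^ PM = (?x ^ PM) powi a * (?y ^ PM) powi a'"
    unfolding k power_mult_distrib sw ..
  also have "\<dots> = ?x powi (int PM * a) * ?x powi (int PP * a')"
    unfolding xy[symmetric] by (simp only: power_int_power)
  also have "\<dots> = ?x powi (int PM * a + int PP * a')" using xy0 by (simp add: power_int_add)
  also have "int PM * a + int PP * a' = 1" using bez by (simp add: mult.commute)
  finally show "proj_k \<alpha> r r' b b' ^ PM = ?x" by simp
  have "proj_k \<alpha> r r' b b' ^ PP = (?x ^ PP) powi a * (?y ^ PP) powi a'"
    unfolding k power_mult_distrib sw ..
  also have "\<dots> = ?y powi (int PM * a) * ?y powi (int PP * a')"
    unfolding xy by (simp only: power_int_power)
  also have "\<dots> = ?y powi (int PM * a + int PP * a')" using xy0 by (simp add: power_int_add)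
  also have "int PM * a + int PP * a' = 1" using bez by (simp add: mult.commute)
  finally show "proj_k \<alpha> r r' b b' ^ PP = ?y" by simp
qed

section \<open>Linear maps on tensor products\<close>

text \<open>An arbitrary representative is used; for bilinear B the choice is immaterial by
  \<open>tlift_cong\<close>.\<close>

definition tl :: "('m::presented_monoid alg \<Rightarrow> 'n::presented_monoid alg \<Rightarrow> 'k::presented_monoid alg) \<Rightarrow> ('m \<times> 'n) alg \<Rightarrow> 'k alg" where
  "tl B z = tlift B (rep_alg z)"

lemma pr_rep [simp]: "pr (rep_alg z) = z"
  by (metis Quotient3_alg Quotient3_abs_rep)

lemma tl_pr: "bilin B \<Longrightarrow> tl B (pr t) = tlift B t"
  unfolding tl_def by (rule tlift_cong) simp_all

lemma tl_linear:
  assumes "bilin B"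
  shows "tl B (x + y) = tl B x + tl B y" "tl B (c *s x) = c *s tl B x" "tl B (sum f A) = (\<Sum>i\<in>A. tl B (f i))"
    "tl B (tn u v) = B u v"
proof -
  obtain s t a b where st: "x = pr s" "y = pr t" "u = pr a" "v = pr b" using pr_surj by metis
  show add: "tl B (x + y) = tl B x + tl B y" for x y
    using pr_surj[of x] pr_surj[of y] assms by (auto simp: tl_pr simp flip: pr_add)
  show "tl B (c *s x) = c *s tl B x" using assms by (simp add: st tl_pr flip: pr_scl)
  have "tl B 0 = 0" using add[of 0 0] by simp
  thus "tl B (sum f A) = (\<Sum>i\<in>A. tl B (f i))"
    by (induction A rule: infinite_finite_induct) (simp_all add: add)
  show "tl B (tn u v) = B u v" using assms by (simp add: st tl_pr tlift_tens flip: pr_tens)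
qed

lemma tlift_eq_pr_lin_ext:
  assumes "\<And>a b. pr (g a b) = B (pr (vec a)) (pr (vec b))"
  shows "pr (lin_ext (\<lambda>(a, b). g a b) t) = tlift B t"
  unfolding lin_ext_eq_lext tlift_def pr_lext by (rule arg_cong[where f = "\<lambda>f. lext _ f t"]) (auto simp: assms)

text \<open>Turns the definitions given on representatives of tensors, such as
  \<open>R21_matrix\<close>, \<open>u_elem\<close> and \<open>drinfeld_map\<close>, into linear maps
  between quotient types.\<close>

lemma quot_map_tl:
  assumes B: "bilin B" and g: "\<And>a b. pr (g a b) = B (pr (vec a)) (pr (vec b))"
  shows "quot_map (\<lambda>t. cls rels (lin_ext (\<lambda>(a, b). g a b) t)) (coset z) = coset (tl B z)"
proof -
  obtain t where t: "z = pr t" using pr_surj by metis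
  have "quot_map (\<lambda>t. cls rels (lin_ext (\<lambda>(a, b). g a b) t)) (coset (pr t)) = cls rels (lin_ext (\<lambda>(a, b). g a b) t)"
    by (rule quot_map_coset) (simp only: cls_conv_coset tlift_eq_pr_lin_ext[of g B, OF g], metis tlift_cong[OF B])
  thus ?thesis by (simp add: t cls_conv_coset tlift_eq_pr_lin_ext[of g B, OF g] tl_pr[OF B])
qed

section \<open>The extended algebra\<close>

subsection \<open>Inclusion\<close>

lemma emb_simps [simp]:
  "emb (x + y) = emb x + emb y" "emb (scl c x) = scl c (emb x)" "emb (gen g) = gen (Gen g)" "emb (vec w) = vec (map Gen w)"
  by (simp_all add: emb_def)

lemma emb_1 [simp]: "emb 1 = 1"
proof -
  have "emb (vec (0 :: ggen list)) = vec (0 :: dgen list)" unfolding zero_list_def emb_simps by simp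
  thus ?thesis by simp
qed

lemma emb_mult [simp]: "emb (x * y) = emb x * emb y"
proof -
  have "emb (vec a * y) = emb (vec a) * emb y" for a
    by (rule scl.linear_ext_eq[where F = "\<lambda>y. emb (vec a * y)"])
      (simp_all add: distrib_left scl_mult_right vec_mult plus_list_def del: emb_simps(3))
  thus ?thesis
    by (intro scl.linear_ext_eq[where F = "\<lambda>x. emb (x * y)" and x = x])
      (simp_all add: distrib_right scl_mult_left)
qed

definition Dg :: "ggen \<Rightarrow> dA" where "Dg g = pr (gen (Gen g))"
definition kr :: dA where "kr = pr (gen Kroot)"

lemma D_rel: "r \<in> d_rels PP PM \<Longrightarrow> pr r = 0"
  using pr_rel[of r] by (simp add: rels_d)

lemma pr_emb_ideal: "x \<in> rel_ideal \<Longrightarrow> pr (emb x) = 0"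
proof (rule ideal_kill[where \<phi> = "\<lambda>x. pr (emb x)"])
  fix r a b :: "ggen free_alg" assume "r \<in> rels"
  hence "pr (emb r) = 0" by (intro D_rel) (simp add: rels_g d_rels_def)
  thus "pr (emb (a * r * b)) = 0" by simp
qed simp_all

lemma emb_diff: "emb (x - y) = emb x - emb y"
  using emb_simps(1)[of x "- y"] emb_simps(2)[of "- 1" y] by simp

definition inc :: "gA \<Rightarrow> dA" where "inc z = pr (emb (rep_alg z))"

lemma inc_pr: "inc (pr x) = pr (emb x)"
proof -
  have "pr (emb (rep_alg (pr x) - x)) = 0" by (rule pr_emb_ideal) (simp flip: pr_eq_iff)
  thus ?thesis by (simp add: inc_def emb_diff)
qed

lemma inc_simps [simp]:
  "inc (x + y) = inc x + inc y" "inc (c *s x) = c *s inc x" "inc (x * y) = inc x * inc y" "inc (G g) = Dg g" "inc 1 = 1"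
proof -
  obtain s t where st: "x = pr s" "y = pr t" using pr_surj by metis
  show "inc (x + y) = inc x + inc y" "inc (c *s x) = c *s inc x" "inc (x * y) = inc x * inc y"
    by (simp_all only: st inc_pr pr_add[symmetric] pr_scl[symmetric] pr_mult[symmetric] emb_simps emb_mult)
  show "inc (G g) = Dg g" by (simp add: G_def Dg_def inc_pr)
  have "inc (pr (vec 0)) = pr (vec 0)" unfolding inc_pr emb_simps by (simp add: zero_list_def)
  thus "inc 1 = 1" by simp
qed

lemma inc_0 [simp]: "inc 0 = 0" and inc_uminus [simp]: "inc (- x) = - inc x" and inc_power [simp]: "inc (x ^ n) = inc x ^ n"
  and inc_sum [simp]: "inc (sum f A) = (\<Sum>i\<in>A. inc (f i))"
proof -
  show z: "inc 0 = 0" using inc_simps(1)[of 0 0] by simp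
  show "inc (- x) = - inc x" using inc_simps(2)[of "- 1" x] by simp
  show "inc (x ^ n) = inc x ^ n" by (induction n) simp_all
  show "inc (sum f A) = (\<Sum>i\<in>A. inc (f i))" by (induction A rule: infinite_finite_induct) (simp_all add: z)
qed

lemma incl_coset: "incl PP PM (coset z) = coset (inc z)"
proof -
  obtain x where x: "z = pr x" using pr_surj by metis
  have "quot_map (\<lambda>x. cls (rels :: dgen free_alg set) (emb x)) (coset (pr x)) = cls rels (emb x)"
    by (rule quot_map_coset) (simp add: cls_conv_coset inc_pr[symmetric])
  thus ?thesis by (simp add: incl_def x rels_d[symmetric] cls_conv_coset inc_pr)
qed

lemma kr_square: "kr ^ 2 = Dg Kg"
  using D_rel[of "gen Kroot ^ 2 - gen (Gen Kg)"] by (simp add: d_rels_def kr_def Dg_def)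

definition NN :: nat where "NN = 2 * LL"

lemma NN_eq: "NN = 4 * PP * PM" and int_NN: "int NN = 4 * int PP * int PM"
  by (simp_all add: NN_def LL_def)

lemma kr_power: "kr ^ NN = 1"
  using D_rel[of "gen Kroot ^ (4 * PP * PM) - 1"] by (simp add: d_rels_def kr_def NN_eq mult.assoc)

lemma NN_pos: "0 < NN" by (simp add: NN_eq)

interpretation dK: cyclic_element qq NN kr
proof
  show "(qq powi n = 1) = (int NN dvd n)" for n by (simp only: qq_powi_eq_1 int_NN)
qed (simp_all add: kr_power NN_pos)

lemma pr_kpow: "pr (kpow PP PM n) = dK.kp n"
  unfolding kpow_def dK.kp_def by (simp add: kr_def NN_eq)

lemma kr_Dg: "kr * Dg g = qq powi (kw g) *s (Dg g * kr)"
proof (cases "g = Kg")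
  case True
  thus ?thesis by (simp add: kr_square[symmetric] power_commutes)
next
  case False
  have "pr (gen Kroot * gen (Gen g) * kpow PP PM (- 1)) = pr (scl (qq powi (kw g)) (gen (Gen g)))"
    by (rule pr_diff_eq_0, rule D_rel)
       (use False in \<open>cases g, auto simp: d_rels_def qpar_qq qq_inverse_powi\<close>)
  hence "kr * Dg g * dK.kp (- 1) * kr = qq powi (kw g) *s (Dg g * kr)"
    by (simp add: pr_kpow kr_def Dg_def)
  moreover have "dK.kp (- 1) * kr = 1" using dK.kp_minus(2)[of 1] dK.kp_nat[of 1] by simp
  ultimately show ?thesis by (simp add: mult.assoc)
qed

lemma inc_KK: "inc (KK n) = dK.kp (2 * n)"
proof -
  have "inc (KK n) = kr ^ (2 * nat (n mod int LL))"
    by (simp add: gK.kp_def kr_square[symmetric] power_mult)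
  also have "\<dots> = dK.kp (int (2 * nat (n mod int LL)))" by (rule dK.kp_nat[symmetric])
  also have "\<dots> = dK.kp (2 * n)"
  proof (rule dK.kp_cong)
    have "int (2 * nat (n mod int LL)) - 2 * n = 2 * (n mod int LL - n)" by (simp add: LL_def)
    also have "int NN dvd \<dots>" unfolding NN_def by (simp add: mod_eq_dvd_iff[symmetric])
    finally show "int NN dvd int (2 * nat (n mod int LL)) - 2 * n" .
  qed
  finally show ?thesis .
qed

text \<open>The eigenvalue q^(2a) of K = k^2 comes from the eigenvalues q^a and q^(a + LL) = - q^a
  of k; in the sum of their projections the odd powers of k cancel.\<close>

lemma inc_P1: "inc (P1 a) = dK.pj a + dK.pj (a + int LL)"
proof -
  let ?t = "\<lambda>a s. qq powi (- (a * int s)) *s dK.kp (int s)"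
  have L: "qq powi (int LL) = - 1"
  proof -
    have "(qq powi (int LL)) ^ 2 = 1" using qq_powi_eq_1[of "int LL * 2"] by (simp only: power_int_power') (simp add: int_LL)
    moreover have "qq powi (int LL) \<noteq> 1"
    proof
      assume "qq powi (int LL) = 1"
      hence "int NN dvd int LL" by (simp only: qq_powi_eq_1 int_NN)
      hence "NN dvd LL" by (simp only: int_dvd_int_iff)
      thus False using dvd_imp_le[of NN LL] PP_pos PM_pos by (simp add: NN_def LL_def del: PP_pos PM_pos)
    qed
    ultimately show ?thesis by (simp add: power2_eq_1_iff)
  qed
  have s: "?t a s + ?t (a + int LL) s = (if even s then (2 * qq powi (- (a * int s))) *s dK.kp (int s) else 0)" for s
  proof -
    have "qq powi (- ((a + int LL) * int s)) = qq powi (- (a * int s)) * (- 1) ^ s"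
    proof -
      have "- ((a + int LL) * int s) = - (a * int s) + int LL * (- int s)" by (simp add: algebra_simps)
      hence "qq powi (- ((a + int LL) * int s)) = qq powi (- (a * int s)) * (qq powi (int LL)) powi (- int s)"
        by (simp only: power_int_add[OF disjI1[OF qq_nz]] power_int_mult)
      thus ?thesis unfolding L by (simp add: power_int_minus power_inverse[symmetric])
    qed
    thus ?thesis by (simp add: sca.scale_left_distrib[symmetric])
  qed
  have "dK.pj a + dK.pj (a + int LL) = (1 / of_nat NN) *s (\<Sum>s<NN. ?t a s + ?t (a + int LL) s)"
    by (simp add: dK.pj_def sum.distrib sca.scale_right_distrib)
  also have "(\<Sum>s<NN. ?t a s + ?t (a + int LL) s) = (\<Sum>s | s < NN \<and> even s. (2 * qq powi (- (a * int s))) *s dK.kp (int s))"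
    unfolding s by (rule sum.mono_neutral_cong_right) auto
  also have "\<dots> = (\<Sum>s<LL. (2 * qq powi (- (a * int (2 * s)))) *s dK.kp (int (2 * s)))"
    by (rule sum.reindex_bij_witness[of _ "\<lambda>s. 2 * s" "\<lambda>s. s div 2"]) (auto simp: NN_def)
  also have "(1 / of_nat NN) *s \<dots> = (1 / of_nat LL) *s (\<Sum>s<LL. (qq powi (- (a * int (2 * s)))) *s dK.kp (int (2 * s)))"
    by (simp add: NN_def sca.scale_sum_right)
  also have "\<dots> = inc (P1 a)"
    by (simp add: gK.pj_def inc_KK qz_powi mult_ac)
  finally show ?thesis ..
qed

subsection \<open>Injectivity of the inclusions\<close>

text \<open>
  \<open>D = G \<oplus> G k\<close>: the element $a + bk$ is represented by \<open>(a, b)\<close>, and conjugation by \<open>k\<close> is the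
  automorphism \<open>csig\<close> of \<open>G\<close>.
\<close>

definition csig :: "gA \<Rightarrow> gA" where
  "csig z = sca.hom_ext (\<lambda>g. qq powi (kw g) *s G g) (rep_alg z)"

lemma G_KGK: "G Kg * G g * KK (- 1) = qz powi (kw g) *s G g"
proof -
  have "G Kg * KK (- 1) = 1" using gK.kp_minus(1)[of 1] by (simp add: KK_1)
  thus ?thesis by (simp add: G_K_commute mult.assoc)
qed

lemma csig_pr: "csig (pr x) = sca.hom_ext (\<lambda>g. qq powi (kw g) *s G g) x"
proof -
  let ?f = "\<lambda>g. qq powi (kw g) *s G g"
  have K: "sca.hom_ext ?f (Kpow PP PM n) = KK n" for n
    unfolding Kpow_def gK.kp_def by (simp add: sca.ext_simps LL_def)
  have c: "qq powi (kw x) *s G x * qq powi (kw y) *s G y = (qq powi (kw x) * qq powi (kw y)) *s (G x * G y)" for x y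
    by simp
  have r: "sca.hom_ext ?f r = 0" if "r \<in> g_rels PP PM" for r
  proof -
    have [simp]: "qpar PP powi 2 = qz powi kw Ep" "qpar PM powi 2 = qz powi kw Em"
      "qpar PP powi (- 2) = qz powi kw Fp" "qpar PM powi (- 2) = qz powi kw Fm"
      "(qpar PP)\<^sup>2 = qz powi kw Ep" "(qpar PM)\<^sup>2 = qz powi kw Em"
      by (simp_all add: powi_simps)
    have inv: "qq powi (kw Ep) * qq powi (kw Fp) = 1" "qq powi (kw Em) * qq powi (kw Fm) = 1"
      "qq powi (kw Fp) * qq powi (kw Ep) = 1" "qq powi (kw Fm) * qq powi (kw Em) = 1"
      by (simp_all add: power_int_minus)
    from that consider "r \<in> {gen Ep ^ PP, gen Fp ^ PP, gen Em ^ PM, gen Fm ^ PM, gen Kg ^ (2 * PP * PM) - 1}"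
      | g where "r = gen Kg * gen g * Kpow PP PM (- 1) - scl (qz powi kw g) (gen g)"
      | x y where "x \<in> {Ep, Fp}" "y \<in> {Em, Fm}" "r = gen x * gen y - gen y * gen x"
      | "r = gen Ep * gen Fp - gen Fp * gen Ep - scl (1 / (Qp - inverse Qp)) (Kpow PP PM (int PM) - Kpow PP PM (- int PM))"
      | "r = gen Em * gen Fm - gen Fm * gen Em - scl (1 / (Qm - inverse Qm)) (Kpow PP PM (int PP) - Kpow PP PM (- int PP))"
      unfolding g_rels_def by (auto simp del: kw.simps)
    thus ?thesis
    proof cases
      case 1
      thus ?thesis by (auto simp: sca.ext_simps sca_power G_nilp G_K_power)
    next
      case (2 g)
      thus ?thesis
        by (simp add: sca.ext_simps K G_KGK mult.commute)
    next
      case (3 x y)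
      thus ?thesis using G_pm_commute[of x y] by (simp add: sca.ext_simps mult.commute)
    next
      case 4
      have "sca.hom_ext ?f r = (G Ep * G Fp - G Fp * G Ep) - inverse qp.h *s (KK (int PM) - KK (- int PM))"
        by (simp only: 4 sca.ext_simps K sca_mult_left sca_mult_right sca.scale_scale inv sca.scale_one qp.h_def) (simp add: divide_inverse)
      thus ?thesis by (simp add: G_ef)
    next
      case 5
      have "sca.hom_ext ?f r = (G Em * G Fm - G Fm * G Em) - inverse qm.h *s (KK (int PP) - KK (- int PP))"
        by (simp only: 5 sca.ext_simps K sca_mult_left sca_mult_right sca.scale_scale inv sca.scale_one qm.h_def) (simp add: divide_inverse)
      thus ?thesis by (simp add: G_ef)
    qed
  qed
  have "sca.hom_ext ?f (rep_alg (pr x) - x) = 0"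
    by (rule ideal_kill[of "rep_alg (pr x) - x"])
      (simp_all add: sca.ext_simps r rels_g flip: pr_eq_iff)
  thus ?thesis by (simp add: csig_def sca.ext_simps)
qed

lemma csig_simps [simp]:
  "csig (x + y) = csig x + csig y" "csig (c *s x) = c *s csig x" "csig (x * y) = csig x * csig y"
  "csig (G g) = qq powi (kw g) *s G g" "csig 0 = 0"
proof -
  obtain s t where st: "x = pr s" "y = pr t" using pr_surj by metis
  show "csig (x + y) = csig x + csig y" "csig (c *s x) = c *s csig x" "csig (x * y) = csig x * csig y"
    by (simp_all only: st csig_pr pr_add[symmetric] pr_scl[symmetric] pr_mult[symmetric] sca.ext_simps)
  show "csig (G g) = qq powi (kw g) *s G g" by (simp add: G_def csig_pr sca.ext_simps)
  show "csig 0 = 0" using csig_pr[of 0] by (simp add: sca.ext_simps)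
qed

text \<open>Since k^2 = K, applying \<open>csig\<close> twice is conjugation by K; K is moved to the
  right so that no inverse appears.\<close>

lemma csig_csig: "csig (csig z) * G Kg = G Kg * z"
proof -
  obtain x where x: "z = pr x" using pr_surj by metis
  have w: "csig (csig (pr (vec w))) * G Kg = G Kg * pr (vec w)" for w
  proof (induction w)
    case Nil
    have "csig (1 :: gA) = 1" using csig_pr[of 1] by (simp add: sca.ext_simps)
    thus ?case using single_one by (simp add: zero_list_def[symmetric] single_one)
  next
    case (Cons g w)
    have v: "pr (vec (g # w)) = G g * pr (vec w)" by (simp add: G_def vec_mult plus_list_def flip: pr_mult)
    have "csig (csig (pr (vec (g # w)))) * G Kg = qz powi (kw g) *s (G g * (csig (csig (pr (vec w))) * G Kg))"
    proof -
      have "qz powi (kw g) = qq powi (kw g) * qq powi (kw g)"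
        by (simp only: qz_powi mult_2 power_int_add[OF disjI1[OF qq_nz]])
      thus ?thesis unfolding v by (simp add: mult.assoc)
    qed
    thus ?case unfolding Cons v by (simp add: mult.assoc[symmetric] G_K_commute)
  qed
  show ?thesis unfolding x
    by (rule sca.linear_ext_eq[where F = "\<lambda>x. csig (csig (pr x)) * G Kg" and x = x])
      (simp_all add: distrib_left distrib_right w)
qed

definition pscale :: "complex \<Rightarrow> gA \<times> gA \<Rightarrow> gA \<times> gA" where
  "pscale c v = (c *s fst v, c *s snd v)"

interpretation pscale: complex_vs pscale
  by (standard) (auto simp: pscale_def sca.scale_right_distrib sca.scale_left_distrib)

text \<open>Left multiplication on a + b k. The root sends this to (k b k^(-1)) K + (k a k^(-1))
  k.\<close>

fun dop :: "dgen \<Rightarrow> gA \<times> gA \<Rightarrow> gA \<times> gA" where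
  "dop (Gen g) v = (G g * fst v, G g * snd v)"
| "dop Kroot v = (csig (snd v) * G Kg, csig (fst v))"

lemma dop_linear: "dop d (u + v) = dop d u + dop d v" "dop d (pscale c v) = pscale c (dop d v)"
  by (cases d; simp add: pscale_def distrib_left distrib_right plus_prod_def)+

lemma foldr_dop_linear: "foldr dop w (u + v) = foldr dop w u + foldr dop w v" "foldr dop w (pscale c v) = pscale c (foldr dop w v)"
  by (induction w) (simp_all add: dop_linear)

definition dact :: "dgen free_alg \<Rightarrow> gA \<times> gA \<Rightarrow> gA \<times> gA" where
  "dact x v = lext pscale (\<lambda>w. foldr dop w v) x"

lemma dact_linear:
  "dact (x + y) v = dact x v + dact y v" "dact (x - y) v = dact x v - dact y v" "dact (scl c x) v = pscale c (dact x v)"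
  "dact x (u + v) = dact x u + dact x v" "dact x (pscale c v) = pscale c (dact x v)"
proof -
  show "dact (x + y) v = dact x v + dact y v" "dact (x - y) v = dact x v - dact y v" "dact (scl c x) v = pscale c (dact x v)"
    by (simp_all add: dact_def pscale.lext_add pscale.lext_diff pscale.lext_scl)
  show "dact x (u + v) = dact x u + dact x v" "dact x (pscale c v) = pscale c (dact x v)"
    by (simp_all add: dact_def lext_def foldr_dop_linear pscale.scale_right_distrib sum.distrib pscale.scale_sum_right mult.commute)
qed

lemma dact_0 [simp]: "dact x 0 = 0"
  using dact_linear(4)[of x 0 0] by simp

lemma dact_gen [simp]: "dact (gen d) v = dop d v"
  by (simp add: dact_def)

lemma dact_1 [simp]: "dact 1 v = v"
  using pscale.lext_vec[of "\<lambda>w. foldr dop w v" "[]"] by (simp add: dact_def zero_list_def flip: single_one)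

lemma dact_mult: "dact (x * y) v = dact x (dact y v)"
proof -
  have "dact (vec a * y) v = dact (vec a) (dact y v)" for a
    by (rule pscale.linear_ext_eq[where F = "\<lambda>y. dact (vec a * y) v"])
      (simp_all add: distrib_left dact_linear scl_mult_right vec_mult plus_list_def, simp add: dact_def)
  thus ?thesis
    by (intro pscale.linear_ext_eq[where F = "\<lambda>x. dact (x * y) v" and x = x])
      (simp_all add: distrib_right scl_mult_left dact_linear)
qed

lemma dact_emb: "dact (emb x) v = (pr x * fst v, pr x * snd v)"
proof (rule pscale.linear_ext_eq[where F = "\<lambda>x. dact (emb x) v" and x = x])
  fix w
  show "dact (emb (vec w)) v = (pr (vec w) * fst v, pr (vec w) * snd v)"
  proof (induction w)
    case Nil thus ?case using dact_1[of v] by (simp add: zero_list_def[symmetric] single_one)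
  next
    case (Cons g w)
    have v: "vec (g # w) = gen g * vec w" by (simp add: vec_mult plus_list_def)
    show ?case unfolding v emb_mult dact_mult Cons by (simp add: G_def mult.assoc)
  qed
qed (simp_all add: dact_linear distrib_left distrib_right plus_prod_def pscale_def)

lemma dact_rels:
  assumes "r \<in> d_rels PP PM"
  shows "dact r v = 0"
proof -
  have k2: "dact (gen Kroot ^ 2) v = dact (gen (Gen Kg)) v" for v
  proof -
    have "csig (csig (snd v) * G Kg) = csig (csig (snd v)) * G Kg" by simp
    thus ?thesis by (simp add: power2_eq_square dact_mult csig_csig)
  qed
  have kN: "dact (gen Kroot ^ NN) v = v" for v
  proof -
    have "dact ((gen Kroot ^ 2) ^ n) v = dact (gen (Gen Kg) ^ n) v" for n
      by (induction n) (simp_all add: dact_mult k2)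
    hence "dact (gen Kroot ^ NN) v = dact (emb (gen Kg) ^ LL) v" by (simp add: NN_def power_mult)
    also have "emb (gen Kg) ^ LL = emb (gen Kg ^ LL)"
    proof -
      have "emb (x ^ n) = emb x ^ n" for x n
        by (induction n) simp_all
      thus ?thesis by simp
    qed
    also have "dact (emb (gen Kg ^ LL)) v = v" unfolding dact_emb using G_K_power by (simp add: G_def LL_def)
    finally show ?thesis .
  qed
  have kx: "dact (gen Kroot * gen (Gen g) * kpow PP PM (- 1) - scl (qq powi (kw g)) (gen (Gen g))) v = 0" for g
  proof -
    define u where "u = dact (kpow PP PM (- 1)) v"
    have "gen Kroot * kpow PP PM (- 1) = gen Kroot ^ NN"
    proof -
      have n: "nat (- 1 mod int NN) = NN - 1" "NN = Suc (NN - 1)"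
        using NN_pos by (simp_all add: zmod_minus1 nat_diff_distrib')
      show ?thesis unfolding kpow_def NN_eq[symmetric] n(1) by (subst (2) n(2)) simp
    qed
    hence ku: "dop Kroot u = v" unfolding u_def dact_gen[symmetric] dact_mult[symmetric] by (simp add: kN)
    have "dop Kroot (dop (Gen g) u) = pscale (qq powi (kw g)) (dop (Gen g) (dop Kroot u))"
      by (simp add: pscale_def mult.assoc)
    thus ?thesis unfolding ku by (simp add: dact_linear dact_mult u_def[symmetric])
  qed
  have i: "inverse (qq powi kw Ep) = qq powi kw Fp" "inverse (qq powi kw Em) = qq powi kw Fm"
    "qpar PP = qq powi kw Ep" "qpar PM = qq powi kw Em"
    by (simp_all add: qpar_qq power_int_minus)
  from assms consider x where "x \<in> g_rels PP PM" "r = emb x" | "r = gen Kroot ^ 2 - gen (Gen Kg)" | "r = gen Kroot ^ NN - 1"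
    | g where "r = gen Kroot * gen (Gen g) * kpow PP PM (- 1) - scl (qq powi (kw g)) (gen (Gen g))"
    unfolding d_rels_def NN_eq i by blast
  thus ?thesis
  proof cases
    case 1 thus ?thesis by (simp add: dact_emb G_rel zero_prod_def)
  next
    case (4 g) thus ?thesis using kx by (simp only:)
  qed (simp_all add: dact_linear k2 kN)
qed

text \<open>Acting on the pair (1, 0), which stands for the unit, and taking the first component
  undoes \<open>inc\<close>. The map is linear but not multiplicative; linearity lets it be applied
  in both tensor factors in \<open>inc2_inject\<close>.\<close>

definition retr :: "dA \<Rightarrow> gA" where "retr z = fst (dact (rep_alg z) (1, 0))"

lemma retr_pr: "retr (pr x) = fst (dact x (1, 0))"
proof -
  have "dact (rep_alg (pr x) - x) (1, 0) = 0"
    by (rule ideal_kill[of "rep_alg (pr x) - x"])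
      (simp_all add: dact_linear dact_mult dact_rels rels_d flip: pr_eq_iff)
  thus ?thesis by (simp add: retr_def dact_linear)
qed

lemma retr_linear: "retr (x + y) = retr x + retr y" "retr (c *s x) = c *s retr x"
proof -
  obtain s t where st: "x = pr s" "y = pr t" using pr_surj by metis
  show "retr (x + y) = retr x + retr y" "retr (c *s x) = c *s retr x"
    by (simp_all only: st retr_pr pr_add[symmetric] pr_scl[symmetric] dact_linear) (simp_all add: pscale_def)
qed

lemma retr_inc [simp]: "retr (inc z) = z"
proof -
  obtain x where x: "z = pr x" using pr_surj by metis
  show ?thesis by (simp add: x inc_pr retr_pr dact_emb)
qed

lemma inc_inject: "inc x = inc y \<longleftrightarrow> x = y"
  by (metis retr_inc)

lemma bilin_simple:
  assumes "\<And>x y. F (x + y) = F x + F y" "\<And>c x. F (c *s x) = c *s F x"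
    and "\<And>x y. H (x + y) = H x + H y" "\<And>c x. H (c *s x) = c *s H x"
  shows "bilin (\<lambda>x y. tn (F x) (H y))"
  by (simp add: bilin_def assms tn_simps)

definition inc2 :: "(ggen list \<times> ggen list) alg \<Rightarrow> (dgen list \<times> dgen list) alg" where
  "inc2 = tl (\<lambda>x y. tn (inc x) (inc y))"

lemma bilin_inc: "bilin (\<lambda>x y. tn (inc x) (inc y))"
  by (rule bilin_simple) simp_all

lemma incl2_coset: "incl2 PP PM (coset z) = coset (inc2 z)"
  unfolding incl2_def inc2_def rels_dd[symmetric]
  by (rule quot_map_tl[OF bilin_inc]) (simp add: inc_pr flip: tens_vec)

lemma inc2_inject:
  assumes "inc2 x = inc2 y"
  shows "x = y"
proof -
  have B: "bilin (\<lambda>x y. tn (retr x) (retr y))" by (rule bilin_simple) (simp_all add: retr_linear)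
  have "tl (\<lambda>x y. tn (retr x) (retr y)) (inc2 (pr t)) = pr t" for t
    by (rule sca.linear_ext_eq[where F = "\<lambda>t. tl (\<lambda>x y. tn (retr x) (retr y)) (inc2 (pr t))"])
      (auto simp: inc2_def tl_linear[OF B] tl_linear[OF bilin_inc] simp flip: tens_vec)
  thus ?thesis using assms pr_surj[of x] pr_surj[of y] by metis
qed

subsection \<open>Antipode\<close>

lemma sp_Cas_KK: "sp.Cas * KK n = KK n * sp.Cas" and sm_Cas_KK: "sm.Cas * KK n = KK n * sm.Cas"
proof -
  have "KK n * (G Fp * G Ep) = (G Fp * G Ep) * KK n"
  proof -
    have "KK n * (G Fp * G Ep) = KK n * G Fp * G Ep" by (simp add: mult.assoc)
    also have "\<dots> = qz powi (kw Fp * n) *s (G Fp * (KK n * G Ep))" by (simp only: KK_G sca_mult_left mult.assoc)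
    also have "\<dots> = (qz powi (kw Fp * n) * qz powi (kw Ep * n)) *s (G Fp * G Ep * KK n)"
      by (simp only: KK_G sca_mult_right sca.scale_scale mult.assoc)
    also have "qz powi (kw Fp * n) * qz powi (kw Ep * n) = 1" using gK.zeta_nz by (simp flip: power_int_add)
    finally show ?thesis by simp
  qed
  thus "sp.Cas * KK n = KK n * sp.Cas"
    by (simp add: sp.Cas_def distrib_left distrib_right gK.kp_add add.commute)
  have "KK n * (G Em * G Fm) = (G Em * G Fm) * KK n"
  proof -
    have "KK n * (G Em * G Fm) = KK n * G Em * G Fm" by (simp add: mult.assoc)
    also have "\<dots> = qz powi (kw Em * n) *s (G Em * (KK n * G Fm))" by (simp only: KK_G sca_mult_left mult.assoc)
    also have "\<dots> = (qz powi (kw Em * n) * qz powi (kw Fm * n)) *s (G Em * G Fm * KK n)"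
      by (simp only: KK_G sca_mult_right sca.scale_scale mult.assoc)
    also have "qz powi (kw Em * n) * qz powi (kw Fm * n) = 1" using gK.zeta_nz by (simp flip: power_int_add)
    finally show ?thesis by simp
  qed
  thus "sm.Cas * KK n = KK n * sm.Cas"
    by (simp add: sm.Cas_def distrib_left distrib_right gK.kp_add add.commute)
qed

text \<open>Conjugation by K_+ multiplies e_- and f_- by powers of q^(4 p_+ p_-) = 1, and
  symmetrically for K_-.\<close>

lemma KK_PM_commute: "g \<in> {Em, Fm} \<Longrightarrow> KK (int PM * n) * G g = G g * KK (int PM * n)"
  and KK_PP_commute: "g \<in> {Ep, Fp} \<Longrightarrow> KK (int PP * n) * G g = G g * KK (int PP * n)"
proof -
  have 1: "qz powi (2 * int PM * (int PP * n)) = 1" "qz powi (2 * int PP * (int PM * n)) = 1"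
    "qz powi (- 2 * int PM * (int PP * n)) = 1" "qz powi (- 2 * int PP * (int PM * n)) = 1"
    unfolding gK.zeta_root int_LL by (auto simp: dvd_def algebra_simps intro: exI[of _ n] exI[of _ "- n"])
  show "g \<in> {Em, Fm} \<Longrightarrow> KK (int PM * n) * G g = G g * KK (int PM * n)"
    "g \<in> {Ep, Fp} \<Longrightarrow> KK (int PP * n) * G g = G g * KK (int PP * n)"
    using 1 by (auto simp: KK_G)
qed

lemma KK_PM_commute':
  "g \<in> {Em, Fm} \<Longrightarrow> KK (int PM) * G g = G g * KK (int PM)" "g \<in> {Em, Fm} \<Longrightarrow> KK (- int PM) * G g = G g * KK (- int PM)"
  "g \<in> {Ep, Fp} \<Longrightarrow> KK (int PP) * G g = G g * KK (int PP)" "g \<in> {Ep, Fp} \<Longrightarrow> KK (- int PP) * G g = G g * KK (- int PP)"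
  using KK_PM_commute[of g 1] KK_PM_commute[of g "- 1"] KK_PP_commute[of g 1] KK_PP_commute[of g "- 1"] by simp_all

lemma commute_prod:
  fixes c x y :: "'a::semigroup_mult"
  shows "c * x = x * c \<Longrightarrow> c * y = y * c \<Longrightarrow> c * (x * y) = (x * y) * c"
  by (metis mult.assoc)

lemma Cas_G: "sp.Cas * G g = G g * sp.Cas" "sm.Cas * G g = G g * sm.Cas"
proof -
  have 1: "G g * sp.Cas = sp.Cas * G g" if "g \<in> {Em, Fm}"
    unfolding sp.Cas_def using commute_prod[of "G g" "G Fp" "G Ep"] G_pm_commute[of _ g] KK_PM_commute'[of g] that
    by (simp add: distrib_left distrib_right mult.assoc)
  have 2: "G g * sm.Cas = sm.Cas * G g" if "g \<in> {Ep, Fp}"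
    unfolding sm.Cas_def using commute_prod[of "G g" "G Em" "G Fm"] G_pm_commute[of g] KK_PM_commute'[of g] that
    by (simp add: distrib_left distrib_right mult.assoc)
  show "sp.Cas * G g = G g * sp.Cas" "sm.Cas * G g = G g * sm.Cas"
    using 1 2 sp.Cas_e sp.Cas_f sm.Cas_e sm.Cas_f sp_Cas_KK[of 1] sm_Cas_KK[of 1] by (cases g; simp add: KK_1)+
qed

lemma central_of_gens:
  assumes "\<And>g. c * G g = G g * c"
  shows "c * z = z * c"
proof -
  obtain x where x: "z = pr x" using pr_surj by metis
  have w: "c * pr (vec w) = pr (vec w) * c" for w
  proof (induction w)
    case Nil
    have "pr (vec ([] :: ggen list)) = 1" unfolding zero_list_def[symmetric] by simp
    thus ?case by simp
  next
    case (Cons g w)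
    have v: "pr (vec (g # w)) = G g * pr (vec w)" by (simp add: G_def vec_mult plus_list_def flip: pr_mult)
    show ?case unfolding v using assms Cons by (rule commute_prod)
  qed
  show ?thesis unfolding x
    by (rule sca.linear_ext_eq[where F = "\<lambda>x. c * pr x" and x = x]) (simp_all add: distrib_left distrib_right w)
qed

lemma Cas_central: "sp.Cas * z = z * sp.Cas" "sm.Cas * z = z * sm.Cas"
  by (rule central_of_gens, rule Cas_G)+

lemma peval_Cas_central: "peval P sp.Cas * z = z * peval P sp.Cas" "peval P sm.Cas * z = z * peval P sm.Cas"
  by (rule peval_commute, rule Cas_central)+

section \<open>The antipode on generators and its compatibility with the relations\<close>

definition sg :: "ggen \<Rightarrow> gA" where "sg g = pr (antipode_gen PP PM g)"

lemma sg_simps: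
  "sg Kg = KK (- 1)" "sg Ep = - (KK (- int PM) * G Ep)" "sg Fm = - (KK (int PP) * G Fm)"
  "sg Fp = - (G Fp * KK (int PM))" "sg Em = - (G Em * KK (- int PP))"
  by (simp_all add: sg_def pr_Kpow G_def)

lemma KK_sg: "KK n * sg g = qz powi (kw g * n) *s (sg g * KK n)"
proof -
  have "KK n * (KK a * G g) = qz powi (kw g * n) *s (KK a * G g * KK n)" for a
  proof -
    have "KK n * (KK a * G g) = KK a * (KK n * G g)" by (simp only: mult.assoc[symmetric] gK.kp_add add.commute)
    thus ?thesis by (simp only: KK_G[of n] sca_mult_right mult.assoc)
  qed
  moreover have "KK n * (G g * KK a) = qz powi (kw g * n) *s (G g * KK a * KK n)" for a
  proof -
    have "KK n * (G g * KK a) = (KK n * G g) * KK a" by (simp only: mult.assoc)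
    thus ?thesis by (simp only: KK_G[of n] sca_mult_left mult.assoc gK.kp_add add.commute)
  qed
  ultimately show ?thesis by (cases g; simp add: sg_simps gK.kp_add add.commute)
qed

lemma power_comm_scaled:
  fixes k x :: "'m::presented_monoid alg"
  assumes "k * x = \<omega> *s (x * k)"
  shows "\<exists>c. (k * x) ^ n = c *s (x ^ n * k ^ n)"
proof (induction n)
  case 0
  show ?case by (rule exI[of _ 1]) simp
next
  case (Suc n)
  then obtain c where c: "(k * x) ^ n = c *s (x ^ n * k ^ n)" ..
  have "(k * x) ^ Suc n = c *s ((k * (x * x ^ n)) * k ^ n)" by (simp add: c mult.assoc)
  also have "k * (x * x ^ n) = \<omega> ^ Suc n *s (x ^ Suc n * k)" using power_commute[OF assms, of 1 "Suc n"] by simp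
  finally have "(k * x) ^ Suc n = (c * \<omega> ^ Suc n) *s (x ^ Suc n * k ^ Suc n)" by (simp add: mult.assoc)
  thus ?case ..
qed

lemma nilp_scaled:
  fixes k x :: "'m::presented_monoid alg"
  assumes "k * x = \<omega> *s (x * k)" "\<omega> \<noteq> 0" "x ^ n = 0"
  shows "(- (k * x)) ^ n = 0" "(- (x * k)) ^ n = 0"
proof -
  have 1: "(k * x) ^ n = 0" using power_comm_scaled[OF assms(1), of n] assms(3) by auto
  have "x * k = inverse \<omega> *s (k * x)" using assms by simp
  hence 2: "(x * k) ^ n = 0" by (simp add: sca_power 1)
  show "(- (k * x)) ^ n = 0" "(- (x * k)) ^ n = 0"
    using 1 2 sca_power[of "- 1" "k * x" n] sca_power[of "- 1" "x * k" n] by simp_all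
qed

lemma qz_nz: "qz powi n \<noteq> 0" using gK.zeta_nz by simp

lemma sg_nilp: "sg Ep ^ PP = 0" "sg Fp ^ PP = 0" "sg Em ^ PM = 0" "sg Fm ^ PM = 0"
  unfolding sg_simps using nilp_scaled[OF KK_G qz_nz G_nilp(1)] nilp_scaled[OF KK_G qz_nz G_nilp(2)]
    nilp_scaled[OF KK_G qz_nz G_nilp(3)] nilp_scaled[OF KK_G qz_nz G_nilp(4)] by simp_all

lemma sg_pm_commute:
  assumes "x \<in> {Ep, Fp}" "y \<in> {Em, Fm}"
  shows "sg x * sg y = sg y * sg x"
proof -
  have k: "KK a * KK b = KK b * KK a" for a b by (simp add: gK.kp_add add.commute)
  note c = commute_prod
  have 1: "KK a * (KK b * G z) = KK b * G z * KK a" "KK a * (G z * KK b) = G z * KK b * KK a" if "KK a * G z = G z * KK a" for a b z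
    using c[OF k that] c[OF that k] by simp_all
  have 2: "G x * (KK b * G y) = KK b * G y * G x" "G x * (G y * KK b) = G y * KK b * G x" if "KK b * G x = G x * KK b" for b
    using c[OF that[symmetric] G_pm_commute[OF assms]] c[OF G_pm_commute[OF assms] that[symmetric]] by simp_all
  have "sg y * G x = G x * sg y"
    using assms 2[of "- int PP"] 2[of "int PP"] KK_PM_commute'(3,4)[of x] by (auto simp: sg_simps)
  moreover have "sg y * KK (- int PM) = KK (- int PM) * sg y" "sg y * KK (int PM) = KK (int PM) * sg y"
    using assms KK_PM_commute'[of y] by (auto simp: sg_simps 1)
  ultimately show ?thesis using assms c[of "sg y" "KK (- int PM)" "G x"] c[of "sg y" "G x" "KK (int PM)"]
    by (auto simp: sg_simps(2,4))
qed

lemma sg_ef: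
  "sg Fp * sg Ep - sg Ep * sg Fp = inverse qp.h *s (KK (- int PM) - KK (int PM))"
  "sg Fm * sg Em - sg Em * sg Fm = inverse qm.h *s (KK (- int PP) - KK (int PP))"
proof -
  have c: "KK a * (G x * (G y * KK (- a))) = G x * G y" if "kw x + kw y = 0" for a x y
  proof -
    have "KK a * (G x * (G y * KK (- a))) = (KK a * G x) * G y * KK (- a)" by (simp only: mult.assoc)
    also have "\<dots> = qz powi (kw x * a) *s (G x * (KK a * G y) * KK (- a))" by (simp only: KK_G sca_mult_left mult.assoc)
    also have "\<dots> = (qz powi (kw x * a) * qz powi (kw y * a)) *s (G x * G y * (KK a * KK (- a)))"
      by (simp only: KK_G sca_mult_left sca_mult_right sca.scale_scale mult.assoc)
    also have "qz powi (kw x * a) * qz powi (kw y * a) = 1"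
      using gK.zeta_nz that by (simp flip: power_int_add distrib_right)
    finally show ?thesis by (simp add: gK.kp_minus)
  qed
  have d: "G x * (KK a * (KK (- a) * G y)) = G x * G y" for a x y
    by (simp add: mult.assoc[symmetric]) (simp add: mult.assoc gK.kp_minus)
  have "sg Fp * sg Ep - sg Ep * sg Fp = - (G Ep * G Fp - G Fp * G Ep)"
    using c[of Ep Fp "- int PM"] d[of Fp "int PM" Ep] by (simp add: sg_simps mult.assoc)
  also have "\<dots> = inverse qp.h *s (KK (- int PM) - KK (int PM))"
    by (simp add: G_ef sca.scale_right_diff_distrib)
  finally show "sg Fp * sg Ep - sg Ep * sg Fp = inverse qp.h *s (KK (- int PM) - KK (int PM))" .
  have "sg Fm * sg Em - sg Em * sg Fm = - (G Em * G Fm - G Fm * G Em)"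
    using c[of Fm Em "int PP"] d[of Em "- int PP" Fm] by (simp add: sg_simps mult.assoc)
  also have "\<dots> = inverse qm.h *s (KK (- int PP) - KK (int PP))"
    by (simp add: G_ef sca.scale_right_diff_distrib)
  finally show "sg Fm * sg Em - sg Em * sg Fm = inverse qm.h *s (KK (- int PP) - KK (int PP))" .
qed

lemma antihom_Kpow: "sca.antihom_ext sg (Kpow PP PM n) = KK (- n)"
proof -
  have "sca.antihom_ext sg (Kpow PP PM n) = KK (- 1) ^ nat (n mod int LL)"
    unfolding Kpow_def LL_def[symmetric] by (simp add: sca.ext_simps sg_simps)
  also have "\<dots> = KK (- (n mod int LL))" using gK.N_pos by (simp add: gK.kp_power)
  also have "\<dots> = KK (- n)" by (rule gK.kp_cong) (simp add: mod_eq_dvd_iff[symmetric])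
  finally show ?thesis .
qed

text \<open>The definition of u applies the antipode to representatives, so it has to respect the
  relations before u can be computed.\<close>

lemma antihom_g_rels:
  assumes "r \<in> g_rels PP PM"
  shows "sca.antihom_ext sg r = 0"
proof -
  from assms consider "r \<in> {gen Ep ^ PP, gen Fp ^ PP, gen Em ^ PM, gen Fm ^ PM}" | "r = gen Kg ^ (2 * PP * PM) - 1"
    | g where "r = gen Kg * gen g * Kpow PP PM (- 1) - scl (qz powi (kw g)) (gen g)"
    | x y where "x \<in> {Ep, Fp}" "y \<in> {Em, Fm}" "r = gen x * gen y - gen y * gen x"
    | "r = gen Ep * gen Fp - gen Fp * gen Ep - scl (1 / (Qp - inverse Qp)) (Kpow PP PM (int PM) - Kpow PP PM (- int PM))"
    | "r = gen Em * gen Fm - gen Fm * gen Em - scl (1 / (Qm - inverse Qm)) (Kpow PP PM (int PP) - Kpow PP PM (- int PP))"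
  proof -
    have "(qpar PP) powi 2 = qz powi kw Ep" "(qpar PM) powi 2 = qz powi kw Em"
      "qpar PP powi (- 2) = qz powi kw Fp" "qpar PM powi (- 2) = qz powi kw Fm"
      by (simp_all add: powi_simps)
    thus ?thesis using assms that unfolding g_rels_def by (auto simp del: kw.simps power_int_numeral)
  qed
  thus ?thesis
  proof cases
    case 1
    thus ?thesis by (auto simp: sca.ext_simps sg_nilp)
  next
    case 2
    have "KK (- 1) ^ LL = KK (- int LL)" by (simp add: gK.kp_power)
    also have "\<dots> = KK 0" by (rule gK.kp_cong) simp
    finally show ?thesis unfolding 2 LL_def[symmetric] by (simp add: sca.ext_simps sg_simps)
  next
    case (3 g)
    have "KK 1 * (sg g * KK (- 1)) = qz powi kw g *s sg g"
      using KK_sg[of 1 g] by (simp add: mult.assoc[symmetric]) (simp add: mult.assoc gK.kp_minus)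
    thus ?thesis by (simp add: 3 sca.ext_simps antihom_Kpow sg_simps mult.assoc del: gK.kp_add)
  next
    case (4 x y)
    thus ?thesis using sg_pm_commute[of x y] by (simp add: sca.ext_simps)
  next
    case 5
    thus ?thesis using sg_ef(1) by (simp add: sca.ext_simps antihom_Kpow qp.h_def divide_inverse)
  next
    case 6
    thus ?thesis using sg_ef(2) by (simp add: sca.ext_simps antihom_Kpow qm.h_def divide_inverse)
  qed
qed

definition sd :: "dgen \<Rightarrow> dA" where "sd d = pr (d_antipode_gen PP PM d)"

lemma sd_simps: "sd (Gen g) = inc (sg g)" "sd Kroot = dK.kp (- 1)"
  by (simp_all add: sd_def sg_def inc_pr pr_kpow)

lemma antihom_emb: "sca.antihom_ext sd (emb x) = inc (sca.antihom_ext sg x)"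
  unfolding sca.antihom_ext_def emb_def sca.lext_lin_ext
proof (rule sca.linear_ext_eq[where F = "lext (*s) _"])
  fix a
  have "inc (prod_list xs) = prod_list (map inc xs)" for xs by (induction xs) simp_all
  thus "lext (*s) (\<lambda>a. lext (*s) (\<lambda>w. prod_list (map sd (rev w))) (vec (map Gen a))) (vec a) =
      inc (lext (*s) (\<lambda>w. prod_list (map sg (rev w))) (vec a))"
    by (simp add: rev_map o_def sd_simps)
qed (simp_all add: sca.lext_add sca.lext_scl)

lemma kr_sg: "dK.kp n * inc (sg g) = qq powi (kw g * n) *s (inc (sg g) * dK.kp n)"
proof (rule dK.kp_commute)
  have k: "kr * dK.kp a = dK.kp a * kr" for a using dK.kp_add[of 1 a] dK.kp_add[of a 1] dK.kp_nat[of 1] by (simp add: add.commute)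
  have 1: "kr * (dK.kp a * Dg g) = qq powi kw g *s (dK.kp a * Dg g * kr)" for a
  proof -
    have "kr * (dK.kp a * Dg g) = dK.kp a * (kr * Dg g)" by (simp only: mult.assoc[symmetric] k)
    thus ?thesis by (simp only: kr_Dg sca_mult_right mult.assoc)
  qed
  have 2: "kr * (Dg g * dK.kp a) = qq powi kw g *s (Dg g * dK.kp a * kr)" for a
    by (simp only: mult.assoc[symmetric] kr_Dg sca_mult_left) (simp only: mult.assoc k)
  show "kr * inc (sg g) = qq powi kw g *s (inc (sg g) * kr)"
    using 1 2 k by (cases g; simp add: sg_simps inc_KK)
qed

lemma antihom_kpow: "sca.antihom_ext sd (kpow PP PM n) = dK.kp (- n)"
proof -
  have "sca.antihom_ext sd (kpow PP PM n) = dK.kp (- 1) ^ nat (n mod int NN)"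
    by (simp add: kpow_def sca.ext_simps sd_simps NN_eq)
  also have "\<dots> = dK.kp (- (n mod int NN))" using NN_pos by (simp add: dK.kp_power)
  also have "\<dots> = dK.kp (- n)" by (rule dK.kp_cong) (simp add: mod_eq_dvd_iff[symmetric])
  finally show ?thesis .
qed

lemma d_rels_cases:
  assumes "r \<in> d_rels PP PM"
  obtains x where "x \<in> g_rels PP PM" "r = emb x" | "r = gen Kroot ^ 2 - gen (Gen Kg)" | "r = gen Kroot ^ NN - 1"
    | g where "r = gen Kroot * gen (Gen g) * kpow PP PM (- 1) - scl (qq powi (kw g)) (gen (Gen g))"
proof -
  have i: "inverse (qq powi kw Ep) = qq powi kw Fp" "inverse (qq powi kw Em) = qq powi kw Fm"
    "qpar PP = qq powi kw Ep" "qpar PM = qq powi kw Em"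
    by (simp_all add: qpar_qq power_int_minus)
  show ?thesis using assms that unfolding d_rels_def NN_eq i by blast
qed

lemma antihom_d_rels:
  assumes "r \<in> d_rels PP PM"
  shows "sca.antihom_ext sd r = 0"
  using assms
proof (cases rule: d_rels_cases)
  case (1 x)
  thus ?thesis by (simp add: antihom_emb antihom_g_rels)
next
  case 2
  thus ?thesis by (simp add: sca.ext_simps sd_simps sg_simps inc_KK dK.kp_power)
next
  case 3
  have "dK.kp (- 1) ^ NN = dK.kp (- int NN)" by (simp add: dK.kp_power)
  also have "\<dots> = dK.kp 0" by (rule dK.kp_cong) simp
  finally show ?thesis by (simp add: 3 sca.ext_simps sd_simps)
next
  case (4 g)
  have "dK.kp 1 * (inc (sg g) * dK.kp (- 1)) = qq powi kw g *s inc (sg g)"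
    using kr_sg[of 1 g] by (simp add: mult.assoc[symmetric]) (simp add: mult.assoc dK.kp_minus)
  thus ?thesis by (simp add: 4 sca.ext_simps antihom_kpow sd_simps mult.assoc)
qed

definition SD :: "dA \<Rightarrow> dA" where "SD z = sca.antihom_ext sd (rep_alg z)"

lemma SD_pr: "SD (pr x) = sca.antihom_ext sd x"
proof -
  have "sca.antihom_ext sd (rep_alg (pr x) - x) = 0"
    by (rule ideal_kill[of "rep_alg (pr x) - x"])
      (simp_all add: sca.ext_simps antihom_d_rels rels_d flip: pr_eq_iff)
  thus ?thesis by (simp add: SD_def sca.ext_simps)
qed

lemma SD_simps [simp]:
  "SD (x + y) = SD x + SD y" "SD (c *s x) = c *s SD x" "SD (x * y) = SD y * SD x" "SD (Dg g) = inc (sg g)"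
  "SD (dK.kp n) = dK.kp (- n)"
proof -
  obtain s t where st: "x = pr s" "y = pr t" using pr_surj by metis
  show "SD (x + y) = SD x + SD y" "SD (c *s x) = c *s SD x" "SD (x * y) = SD y * SD x"
    by (simp_all only: st SD_pr pr_add[symmetric] pr_scl[symmetric] pr_mult[symmetric] sca.ext_simps)
  show "SD (Dg g) = inc (sg g)" by (simp add: Dg_def SD_pr sca.ext_simps sd_simps)
  show "SD (dK.kp n) = dK.kp (- n)" unfolding pr_kpow[symmetric] SD_pr antihom_kpow ..
qed

lemma SD_power: "SD (x ^ n) = SD x ^ n"
proof (induction n)
  case 0
  show ?case using SD_pr[of 1] by (simp add: sca.ext_simps)
qed (simp add: power_commutes)

lemma pr_d_antipode: "pr (d_antipode PP PM x) = SD (pr x)"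
proof -
  have "pr (prod_list xs) = prod_list (map pr xs)" for xs :: "dgen free_alg list" by (induction xs) simp_all
  thus ?thesis
    unfolding d_antipode_def SD_pr sca.antihom_ext_def lin_ext_eq_lext pr_lext by (simp add: o_def sd_def[abs_def])
qed

subsection \<open>The universal R-matrix\<close>

lemma (in qroot) qfact_br: "qfact Q m = brf m / h ^ m"
  unfolding qfact_def brf_def qint_br by (simp add: prod_dividef)

text \<open>The exponent of q picked up by e_+^m f_-^n under conjugation by k; its partner f_+^m
  e_-^n has the opposite one.\<close>

definition wE :: "nat \<Rightarrow> nat \<Rightarrow> int" where "wE m n = 2 * int PM * int m - 2 * int PP * int n"
definition rr :: "nat \<Rightarrow> nat \<Rightarrow> complex" where "rr m n = sp.rcoeff m * sm.rcoeff n"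

lemma R_coeff_eq: "R_coeff PP PM m n j c = rr m n * (qq powi (- (wE m n * int j)) * qq powi (- (int c * int j)))"
proof -
  have p: "qpar PP powi (- int (m * j)) * qpar PM powi int (n * j) = qq powi (- (wE m n * int j))"
  proof -
    have "qpar PP powi (- int (m * j)) = qq powi (2 * int PM * (- int (m * j)))" "qpar PM powi int (n * j) = qq powi (2 * int PP * int (n * j))"
      by (simp_all only: qpar_qq power_int_mult)
    thus ?thesis by (simp add: power_int_add[symmetric] wE_def algebra_simps)
  qed
  have e: "z ^ (2 * k) = z ^ k * z ^ k" for z :: complex and k by (simp add: mult_2 power_add)
  have "R_coeff PP PM m n j c = rr m n * ((qpar PP powi (- int (m * j)) * qpar PM powi int (n * j)) * qq powi (- (int c * int j)))"
    by (simp add: R_coeff_def Let_def qp.qfact_br qm.qfact_br rr_def sp.rcoeff_def sm.rcoeff_def qp.h_def[symmetric]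
        qm.h_def[symmetric] qq_def[symmetric] power_int_minus power_inverse e power_add power_mult_distrib)
  thus ?thesis unfolding p .
qed

abbreviation Efm :: "nat \<Rightarrow> nat \<Rightarrow> dA" where "Efm m n \<equiv> Dg Ep ^ m * Dg Fm ^ n"
abbreviation Fem :: "nat \<Rightarrow> nat \<Rightarrow> dA" where "Fem m n \<equiv> Dg Fp ^ m * Dg Em ^ n"

lemma kr_EF: "kr * Efm m n = qq powi wE m n *s (Efm m n * kr)" "kr * Fem m n = qq powi (- wE m n) *s (Fem m n * kr)"
  using dK.weight_mult[OF dK.weight_power[OF kr_Dg, of Ep m] dK.weight_power[OF kr_Dg, of Fm n]]
    dK.weight_mult[OF dK.weight_power[OF kr_Dg, of Fp m] dK.weight_power[OF kr_Dg, of Em n]]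
  by (simp_all add: wE_def)

text \<open>R with the sum over j carried out: moving k^j to the right of e_+^m f_-^n cancels the
  powers with exponents mj and nj in the coefficient, and what is left is a spectral projection of
  k.\<close>

definition Rel :: "(dgen list \<times> dgen list) alg" where
  "Rel = (\<Sum>m<PP. \<Sum>n<PM. rr m n *s (\<Sum>c<NN. tn (Efm m n * dK.pj (int c)) (Fem m n * dK.kp (- int c))))"

lemma R_matrix_coset: "R_matrix PP PM = coset Rel"
proof -
  have "(1 / of_nat NN) *s (\<Sum>j<NN. \<Sum>c<NN. R_coeff PP PM m n j c *s
      tn (dK.kp (int j) * Dg Ep ^ m * Dg Fm ^ n) (Fem m n * dK.kp (- int c))) =
    rr m n *s (\<Sum>c<NN. tn (Efm m n * dK.pj (int c)) (Fem m n * dK.kp (- int c)))" (is "?l = ?r") for m n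
  proof -
    let ?t = "\<lambda>j c. tn (Efm m n * dK.kp (int j)) (Fem m n * dK.kp (- int c))"
    have 1: "R_coeff PP PM m n j c *s tn (dK.kp (int j) * Dg Ep ^ m * Dg Fm ^ n) (Fem m n * dK.kp (- int c)) =
        rr m n *s (qq powi (- (int c * int j)) *s ?t j c)" for j c
    proof -
      have k: "dK.kp (int j) * Dg Ep ^ m * Dg Fm ^ n = qq powi (wE m n * int j) *s (Efm m n * dK.kp (int j))"
        using dK.kp_commute[OF kr_EF(1)] by (simp only: mult.assoc)
      have "qq powi (- (wE m n * int j)) * qq powi (wE m n * int j) = 1" by (simp flip: power_int_add)
      hence "R_coeff PP PM m n j c * qq powi (wE m n * int j) = rr m n * qq powi (- (int c * int j))"
        unfolding R_coeff_eq by (simp add: mult_ac)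
      thus ?thesis unfolding k by (simp only: tn_simps sca.scale_scale)
    qed
    have 2: "tn (Efm m n * dK.pj (int c)) (Fem m n * dK.kp (- int c)) = (1 / of_nat NN) *s (\<Sum>j<NN. qq powi (- (int c * int j)) *s ?t j c)" for c
      by (simp add: dK.pj_def sum_distrib_left tn_simps)
    have "?l = (1 / of_nat NN) *s (\<Sum>j<NN. \<Sum>c<NN. rr m n *s (qq powi (- (int c * int j)) *s ?t j c))"
      by (simp only: 1)
    also have "\<dots> = ?r" unfolding 2
      by (subst sum.swap) (simp add: sca.scale_sum_right mult_ac)
    finally show ?thesis .
  qed
  thus ?thesis
    unfolding R_matrix_def rels_dd[symmetric] cls_conv_coset NN_eq[symmetric] Rel_def
    by (simp add: pr_kpow sca.scale_sum_right[symmetric] flip: Dg_def del: sca.scale_scale) (simp only: sca.scale_sum_right)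
qed

text \<open>Expanding k^(-c) in projections turns both sides into a double sum with kernel q^(-ac),
  which is symmetric in a and c.\<close>

lemma swap_kp_pj:
  "(\<Sum>c<NN. tn (x * dK.kp (- int c)) (y * dK.pj (int c))) = (\<Sum>c<NN. tn (x * dK.pj (int c)) (y * dK.kp (- int c)))"
proof -
  have "(\<Sum>c<NN. tn (x * dK.kp (- int c)) (y * dK.pj (int c))) =
      (\<Sum>c<NN. \<Sum>a<NN. qq powi (- (int a * int c)) *s tn (x * dK.pj (int a)) (y * dK.pj (int c)))"
    by (subst dK.kp_eq_sum) (simp add: sum_distrib_left tn_simps)
  also have "\<dots> = (\<Sum>c<NN. \<Sum>a<NN. qq powi (- (int c * int a)) *s tn (x * dK.pj (int c)) (y * dK.pj (int a)))"
    by (rule sum.swap)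
  also have "\<dots> = (\<Sum>c<NN. tn (x * dK.pj (int c)) (y * dK.kp (- int c)))"
    by (subst dK.kp_eq_sum) (simp add: sum_distrib_left tn_simps mult.commute)
  finally show ?thesis .
qed

definition R21 :: "(dgen list \<times> dgen list) alg" where
  "R21 = (\<Sum>m<PP. \<Sum>n<PM. rr m n *s (\<Sum>c<NN. tn (Fem m n * dK.pj (int c)) (Efm m n * dK.kp (- int c))))"

lemma R21_alt: "R21 = (\<Sum>m<PP. \<Sum>n<PM. rr m n *s (\<Sum>c<NN. tn (Fem m n * dK.kp (- int c)) (Efm m n * dK.pj (int c))))"
  unfolding R21_def swap_kp_pj ..

lemma R21_coset: "R21_matrix PP PM = coset R21"
proof -
  have B: "bilin (\<lambda>x y. tn y x)" by (simp add: bilin_def tn_simps)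
  have "R21_matrix PP PM = coset (tl (\<lambda>x y. tn y x) Rel)"
    unfolding R21_matrix_def R_matrix_coset rels_dd[symmetric]
    by (rule quot_map_tl[OF B]) (simp flip: tens_vec)
  also have "tl (\<lambda>x y. tn y x) Rel = R21" by (simp add: Rel_def R21_alt tl_linear[OF B])
  finally show ?thesis .
qed

subsection \<open>The ribbon element\<close>

definition wuu :: "nat \<Rightarrow> nat \<Rightarrow> gA" where
  "wuu m n = sg Em ^ n * sg Fp ^ m * (G Ep ^ m * G Fm ^ n)"

text \<open>The contribution of the Cartan part of R to u. Since q^(c^2) does not change under c ->
  c + \<open>LL\<close>, the sum over projections of k descends to projections of K
  (\<open>inc_Gauss\<close>), and so u lies in the smaller algebra.\<close>

definition Gauss :: gA where "Gauss = (\<Sum>c<LL. qq powi (int c ^ 2) *s P1 (int c))"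

definition uu :: gA where
  "uu = (\<Sum>m<PP. \<Sum>n<PM. rr m n *s (wuu m n * Gauss))"

lemma sum_NN_LL: "(\<Sum>c<NN. F c) = (\<Sum>c<LL. F c + F (c + LL))" for F :: "nat \<Rightarrow> 'a::comm_monoid_add"
proof -
  have "(\<Sum>c<NN. F c) = (\<Sum>c<LL. F c) + (\<Sum>c=LL..<LL + LL. F c)"
    using sum.atLeastLessThan_concat[of 0 LL "LL + LL" F] by (simp add: NN_def mult_2 lessThan_atLeast0)
  also have "(\<Sum>c=LL..<LL + LL. F c) = (\<Sum>c<LL. F (c + LL))"
    using sum.shift_bounds_nat_ivl[of F 0 LL LL] by (simp add: lessThan_atLeast0)
  finally show ?thesis by (simp add: sum.distrib)
qed

lemma inc_Gauss: "inc Gauss = (\<Sum>c<NN. qq powi (int c ^ 2) *s dK.pj (int c))"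
proof -
  have "qq powi (int (c + LL) ^ 2) = qq powi (int c ^ 2)" for c
  proof (rule qq_cong)
    have "int (c + LL) ^ 2 - int c ^ 2 = 4 * int PP * int PM * (int c + int PP * int PM)"
      by (simp add: int_LL power2_eq_square algebra_simps)
    thus "4 * int PP * int PM dvd int (c + LL) ^ 2 - int c ^ 2" by simp
  qed
  thus ?thesis unfolding sum_NN_LL by (simp add: Gauss_def inc_P1 sca.scale_right_distrib)
qed

text \<open>In the form \<open>R21_alt\<close> the antipode turns k^(-c) into k^c and puts it on the
  left. The factor between k^c and the projection has weight zero, so k^c passes through it and
  becomes q^(c^2) on the projection.\<close>

lemma u_elem_coset: "u_elem PP PM = coset (inc uu)"
proof -
  have B1: "bilin (\<lambda>x y. tn (SD x) y)" by (simp add: bilin_def tn_simps)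
  have B2: "bilin ((*) :: dA \<Rightarrow> dA \<Rightarrow> dA)" by (simp add: bilin_def distrib_left distrib_right)
  have "u_elem PP PM = coset (tl (*) (tl (\<lambda>x y. tn (SD x) y) R21))"
  proof -
    have "quot_map (\<lambda>t. cls (dd_rels PP PM) (lin_ext (\<lambda>(a, b). d_antipode PP PM (vec a) \<otimes>\<^sub>v vec b) t)) (R21_matrix PP PM) =
        coset (tl (\<lambda>x y. tn (SD x) y) R21)"
      unfolding R21_coset rels_dd[symmetric] by (rule quot_map_tl[OF B1]) (simp add: pr_d_antipode)
    moreover have "quot_map (\<lambda>t. cls (d_rels PP PM) (lin_ext (\<lambda>(a, b). vec a * vec b) t)) (coset z) = coset (tl (*) z)" for z
      unfolding rels_d[symmetric] by (rule quot_map_tl[OF B2]) simp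
    ultimately show ?thesis unfolding u_elem_def by simp
  qed
  also have "tl (*) (tl (\<lambda>x y. tn (SD x) y) R21) =
      (\<Sum>m<PP. \<Sum>n<PM. rr m n *s (\<Sum>c<NN. dK.kp (int c) * (SD (Fem m n) * (Efm m n * dK.pj (int c)))))"
    by (simp add: R21_alt tl_linear[OF B1] tl_linear[OF B2] mult.assoc)
  also have "\<dots> = inc uu"
  proof -
    have "dK.kp (int c) * (SD (Fem m n) * (Efm m n * dK.pj (int c))) = inc (wuu m n) * (qq powi (int c ^ 2) *s dK.pj (int c))" for m n c
    proof -
      have w: "SD (Fem m n) * Efm m n = inc (wuu m n)" by (simp add: wuu_def SD_power mult.assoc)
      have s: "kr * inc (sg g) = qq powi kw g *s (inc (sg g) * kr)" for g
        using kr_sg[of 1 g] dK.kp_nat[of 1] by simp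
      have "SD (Fem m n) = inc (sg Em) ^ n * inc (sg Fp) ^ m" by (simp add: SD_power)
      hence "kr * SD (Fem m n) = qq powi (- wE m n) *s (SD (Fem m n) * kr)"
        using dK.weight_mult[OF dK.weight_power[OF s, of Em n] dK.weight_power[OF s, of Fp m]] by (simp add: wE_def)
      from dK.weight_mult[OF this kr_EF(1)[of m n]] have "kr * inc (wuu m n) = qq powi 0 *s (inc (wuu m n) * kr)"
        unfolding w by (simp del: SD_simps)
      from dK.kp_commute[OF this, of "int c"] have "dK.kp (int c) * inc (wuu m n) = inc (wuu m n) * dK.kp (int c)" by simp
      thus ?thesis unfolding w[symmetric] mult.assoc[symmetric]
        by (simp add: mult.assoc dK.kp_pj power2_eq_square)
    qed
    thus ?thesis by (simp add: uu_def inc_Gauss sum_distrib_left)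
  qed
  finally show ?thesis .
qed

definition vv :: gA where "vv = uu * KK (int PM - int PP)"

lemma carrier_G: "carrier (g_alg PP PM) = range (coset :: gA \<Rightarrow> _)"
  unfolding g_alg_def rels_g[symmetric] by (rule presented_carrier)

lemma inv_balancing: "inv\<^bsub>g_alg PP PM\<^esub> (balancing PP PM) = coset (KK (int PM - int PP))"
  unfolding g_alg_def balancing_def rels_g[symmetric] cls_conv_coset pr_Kpow
  by (rule inv_coset) (simp_all add: gK.kp_add)

text \<open>The definite description is resolved by exhibiting \<open>vv\<close> and using that
  \<open>inc\<close> is injective.\<close>

lemma ribbon_coset: "ribbon PP PM = coset vv"
  unfolding ribbon_def
proof (rule the_equality)
  have r: "u_elem PP PM \<otimes>\<^bsub>d_alg PP PM\<^esub> incl PP PM (inv\<^bsub>g_alg PP PM\<^esub> (balancing PP PM)) = coset (inc vv)"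
    unfolding u_elem_coset inv_balancing incl_coset d_alg_def rels_d[symmetric] by (simp add: vv_def)
  show "coset vv \<in> carrier (g_alg PP PM) \<and> incl PP PM (coset vv) =
      u_elem PP PM \<otimes>\<^bsub>d_alg PP PM\<^esub> incl PP PM (inv\<^bsub>g_alg PP PM\<^esub> (balancing PP PM))"
    by (simp add: r incl_coset carrier_G)
  show "v = coset vv" if "v \<in> carrier (g_alg PP PM) \<and> incl PP PM v =
      u_elem PP PM \<otimes>\<^bsub>d_alg PP PM\<^esub> incl PP PM (inv\<^bsub>g_alg PP PM\<^esub> (balancing PP PM))" for v
    using that by (auto simp: r incl_coset carrier_G inc_inject)
qed

text \<open>The weight of the image of \<open>P1 a\<close> in each sector. In the minus sector the
  role of k is played by the inverse of K_-, hence the negative exponent in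
  \<open>xm\<close>.\<close>

abbreviation xp :: "nat \<Rightarrow> complex" where "xp a \<equiv> qq powi (2 * int PM * int a)"
abbreviation xm :: "nat \<Rightarrow> complex" where "xm a \<equiv> qq powi (- 2 * int PP * int a)"

lemma Gauss_P1:
  assumes "a < LL"
  shows "Gauss * P1 (int a) = qq powi (int a ^ 2) *s P1 (int a)"
proof -
  have "int LL dvd int c - int a \<longleftrightarrow> c = a" if "c < LL" for c
    using that assms by (auto simp: mod_eq_dvd_iff[symmetric])
  hence "Gauss * P1 (int a) = (\<Sum>c<LL. if c = a then qq powi (int c ^ 2) *s P1 (int c) else 0)"
    unfolding Gauss_def sum_distrib_right by (intro sum.cong) (auto simp: gK.pj_mult)
  thus ?thesis using assms by simp
qed

lemma wt_pm:
  shows "sp.wt x z \<Longrightarrow> y \<in> {Em, Fm} \<Longrightarrow> sp.wt x (G y ^ n * z)" "sm.wt x z \<Longrightarrow> y \<in> {Ep, Fp} \<Longrightarrow> sm.wt x (G y ^ n * z)"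
proof -
  have "k * (g ^ n * z) = x *s (g ^ n * z)" if "k * z = x *s z" "k * g = g * k" for k g :: gA
  proof -
    have "k * g ^ n = g ^ n * k" using power_commuting_commutes[of g k n] that by metis
    hence "k * (g ^ n * z) = g ^ n * (k * z)" by (simp only: mult.assoc[symmetric])
    thus ?thesis by (simp only: that(1) sca_mult_right)
  qed
  thus "sp.wt x z \<Longrightarrow> y \<in> {Em, Fm} \<Longrightarrow> sp.wt x (G y ^ n * z)" "sm.wt x z \<Longrightarrow> y \<in> {Ep, Fp} \<Longrightarrow> sm.wt x (G y ^ n * z)"
    using KK_PM_commute'[of y] by (auto simp: sp.wt_def sm.wt_def)
qed

text \<open>The prefactor collects \<open>Gauss\<close> and the inverse balancing element. The plus
  sector is summed first: since K_+ commutes with the minus sector, f_-^n 1_a still has weight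
  \<open>xp a\<close>, and the resulting polynomial in the Casimir element is central and moves out
  of the second sum.\<close>

lemma vv_P1:
  assumes a: "a < LL"
  shows "vv * P1 (int a) = qq powi (int a ^ 2 + 2 * int a * (int PM - int PP)) *s
    (peval (qp.rib_poly (xp a * Qp)) sp.Cas * peval (qm.rib_poly (xm a * Qm)) sm.Cas * P1 (int a))"
proof -
  let ?p = "P1 (int a)"
  define Zp where "Zp = peval (qp.rib_poly (xp a * Qp)) sp.Cas"
  define Zm where "Zm = peval (qm.rib_poly (xm a * Qm)) sm.Cas"
  define \<kappa> where "\<kappa> = qq powi (int a ^ 2 + 2 * int a * (int PM - int PP))"
  have "vv * ?p = qz powi (int a * (int PM - int PP)) *s (uu * ?p)"
    by (simp add: vv_def mult.assoc gK.kp_pj)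
  also have "uu * ?p = qq powi (int a ^ 2) *s (\<Sum>m<PP. \<Sum>n<PM. rr m n *s (wuu m n * ?p))"
    by (simp add: uu_def sum_distrib_right mult.assoc Gauss_P1[OF a] sca.scale_sum_right mult.commute)
  also have "(\<Sum>m<PP. \<Sum>n<PM. rr m n *s (wuu m n * ?p)) =
     (\<Sum>n<PM. sm.rcoeff n *s (sg Em ^ n * (\<Sum>m<PP. sp.rcoeff m *s (sg Fp ^ m * (G Ep ^ m * (G Fm ^ n * ?p))))))"
    by (subst sum.swap) (simp add: rr_def wuu_def sum_distrib_left sca.scale_sum_right mult.assoc mult.commute)
  also have "\<dots> = (\<Sum>n<PM. sm.rcoeff n *s (sg Em ^ n * (Zp * (G Fm ^ n * ?p))))"
    unfolding sg_simps Zp_def using sp.ribbon_sum[OF wt_pm(1)[OF wt_P1(1)]] by simp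
  also have "\<dots> = Zp * (\<Sum>n<PM. sm.rcoeff n *s (sg Em ^ n * (G Fm ^ n * ?p)))"
  proof -
    have "sg Em ^ n * (Zp * w) = Zp * (sg Em ^ n * w)" for n w
      by (simp only: Zp_def mult.assoc[symmetric] peval_Cas_central(1)[of _ "sg Em ^ n"])
    thus ?thesis by (simp add: sum_distrib_left)
  qed
  also have "(\<Sum>n<PM. sm.rcoeff n *s (sg Em ^ n * (G Fm ^ n * ?p))) = Zm * ?p"
    unfolding sg_simps Zm_def by (rule sm.ribbon_sum[OF wt_P1(2)])
  finally have "vv * ?p = (qz powi (int a * (int PM - int PP)) * qq powi (int a ^ 2)) *s (Zp * Zm * ?p)"
    by (simp add: mult.assoc)
  also have "qz powi (int a * (int PM - int PP)) * qq powi (int a ^ 2) = \<kappa>"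
    unfolding qz_powi \<kappa>_def by (simp add: power_int_add[symmetric] add.commute mult.assoc)
  finally show ?thesis unfolding Zp_def Zm_def \<kappa>_def .
qed

subsection \<open>The monodromy element\<close>

abbreviation Gef :: "nat \<Rightarrow> nat \<Rightarrow> gA" where "Gef m n \<equiv> G Ep ^ m * G Fm ^ n"
abbreviation Gfe :: "nat \<Rightarrow> nat \<Rightarrow> gA" where "Gfe m n \<equiv> G Fp ^ m * G Em ^ n"

definition wh :: "nat \<Rightarrow> nat \<Rightarrow> int" where "wh m n = int PM * int m - int PP * int n"

lemma wE_wh: "wE m n = 2 * wh m n"
  by (simp add: wE_def wh_def algebra_simps)

definition Mel :: "(ggen list \<times> ggen list) alg" where
  "Mel = (\<Sum>m<PP. \<Sum>n<PM. \<Sum>m'<PP. \<Sum>n'<PM. (rr m n * rr m' n') *s (\<Sum>b<LL.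
     qq powi (wE m' n' * int b + wE m' n' ^ 2) *s
       tn (Gfe m n * (Gef m' n' * P1 (int b))) (Gef m n * (Gfe m' n' * KK (- int b - wh m' n')))))"

text \<open>Moving the projection of k past e_+^m f_-^n leaves for each d the single index c = d +
  \<open>wE m n\<close>. The surviving power of k is even, and d and d + \<open>LL\<close> give
  equal coefficients and powers, so their projections merge into one of K. This is why M-bar lies in
  the tensor square of the smaller algebra.\<close>

lemma mono_sum:
  "(\<Sum>c<NN. tn (F * dK.pj (int c)) (E * dK.kp (- int c))) * (\<Sum>d<NN. tn (Efm m n * dK.pj (int d)) (Fem m n * dK.kp (- int d))) =
   (\<Sum>b<LL. qq powi (wE m n * int b + wE m n ^ 2) *s
      tn (F * (Efm m n * inc (P1 (int b)))) (E * (Fem m n * inc (KK (- int b - wh m n)))))" (is "?A * ?B = ?C")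
proof -
  let ?s = "\<lambda>d. (\<Sum>c<NN. tn (F * dK.pj (int c)) (E * dK.kp (- int c)) * tn (Efm m n * dK.pj d) (Fem m n * dK.kp (- d)))"
  let ?w = "wE m n"
  let ?u = "\<lambda>d. qq powi (?w * d + ?w ^ 2) *s tn (F * (Efm m n * dK.pj d)) (E * (Fem m n * dK.kp (- ?w - 2 * d)))"
  have one: "(?s d) = ?u d" for d
  proof -
    let ?f = "\<lambda>c. tn (F * (Efm m n * (dK.pj (c - ?w) * dK.pj d))) (E * (dK.kp (- c) * (Fem m n * dK.kp (- d))))"
    have pE: "dK.pj c * Efm m n = Efm m n * dK.pj (c - ?w)" for c
      using dK.gen_pj[OF kr_EF(1), of m n "c - ?w"] by simp
    have "(?s d) = (\<Sum>c<NN. ?f (int c))"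
    proof (rule sum.cong[OF refl])
      fix c
      have "F * dK.pj (int c) * (Efm m n * dK.pj d) = F * ((dK.pj (int c) * Efm m n) * dK.pj d)" by (simp only: mult.assoc)
      thus "tn (F * dK.pj (int c)) (E * dK.kp (- int c)) * tn (Efm m n * dK.pj d) (Fem m n * dK.kp (- d)) = ?f (int c)"
        unfolding tn_mult pE by (simp only: mult.assoc)
    qed
    also have "\<dots> = (\<Sum>c<NN. ?f (int c + (?w + d)))"
    proof (rule dK.sum_periodic_shift[symmetric])
      fix a b assume d: "int NN dvd a - b"
      have "dK.pj (a - ?w) = dK.pj (b - ?w)" by (rule dK.pj_cong) (use d in simp)
      moreover have "dK.kp (- a) = dK.kp (- b)" by (rule dK.kp_cong) (use d in \<open>simp add: dvd_diff_commute\<close>)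
      ultimately show "?f a = ?f b" by simp
    qed
    also have "\<dots> = (\<Sum>c<NN. if c = 0 then ?f (?w + d) else 0)"
    proof (rule sum.cong[OF refl])
      fix c assume "c \<in> {..<NN}"
      hence z: "int NN dvd int c \<longleftrightarrow> c = 0" by (auto simp: int_dvd_int_iff dest: dvd_imp_le)
      show "?f (int c + (?w + d)) = (if c = 0 then ?f (?w + d) else 0)"
        using z by (auto simp: dK.pj_mult tn_simps)
    qed
    also have "\<dots> = ?f (?w + d)" using NN_pos by simp
    also have "?f (?w + d) = ?u d"
    proof -
      have "dK.kp (- (?w + d)) * (Fem m n * dK.kp (- d)) = (dK.kp (- (?w + d)) * Fem m n) * dK.kp (- d)" by (simp only: mult.assoc)
      also have "\<dots> = qq powi (- ?w * - (?w + d)) *s (Fem m n * (dK.kp (- (?w + d)) * dK.kp (- d)))"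
        by (simp only: dK.kp_commute[OF kr_EF(2)] sca_mult_left mult.assoc)
      also have "- ?w * - (?w + d) = ?w * d + ?w ^ 2" by (simp add: power2_eq_square algebra_simps)
      also have "dK.kp (- (?w + d)) * dK.kp (- d) = dK.kp (- ?w - 2 * d)"
          unfolding dK.kp_add by (rule arg_cong[where f = dK.kp]) simp
      finally show ?thesis by (simp add: dK.pj_mult tn_simps)
    qed
    finally show ?thesis .
  qed
  have "?A * ?B = (\<Sum>d<NN. ?u (int d))"
    unfolding sum_distrib_left sum_distrib_right one ..
  also have "\<dots> = (\<Sum>d<LL. ?u (int d) + ?u (int d + int LL))" unfolding sum_NN_LL by simp
  also have "\<dots> = ?C"
  proof (rule sum.cong[OF refl])
    fix b
    have "qq powi (?w * (int b + int LL) + ?w ^ 2) = qq powi (?w * int b + ?w ^ 2)"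
    proof (rule qq_cong)
      have "?w * (int b + int LL) + ?w ^ 2 - (?w * int b + ?w ^ 2) = 4 * int PP * int PM * wh m n"
        by (simp add: wE_wh int_LL algebra_simps)
      thus "4 * int PP * int PM dvd ?w * (int b + int LL) + ?w ^ 2 - (?w * int b + ?w ^ 2)" by simp
    qed
    moreover have "dK.kp (- ?w - 2 * (int b + int LL)) = dK.kp (- ?w - 2 * int b)"
      by (rule dK.kp_cong) (simp add: NN_def)
    moreover have "dK.kp (- ?w - 2 * int b) = inc (KK (- int b - wh m n))"
      unfolding inc_KK wE_wh by (rule arg_cong[where f = dK.kp]) simp
    ultimately show "?u (int b) + ?u (int b + int LL) = qq powi (?w * int b + ?w ^ 2) *s
      tn (F * (Efm m n * inc (P1 (int b)))) (E * (Fem m n * inc (KK (- int b - wh m n))))"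
      by (simp only: inc_P1 distrib_left tn_simps sca.scale_right_distrib)
  qed
  finally show ?thesis .
qed

lemma double_sum_mult:
  fixes A B :: "nat \<Rightarrow> nat \<Rightarrow> 'm::presented_monoid alg"
  shows "(\<Sum>m<M. \<Sum>n<N. r m n *s A m n) * (\<Sum>m<M. \<Sum>n<N. s m n *s B m n) =
    (\<Sum>m<M. \<Sum>n<N. \<Sum>m'<M. \<Sum>n'<N. (r m n * s m' n') *s (A m n * B m' n'))"
  unfolding sum_distrib_right by (simp add: sum_distrib_left sca.scale_sum_right mult.commute)

lemma inc2_Mel: "inc2 Mel = R21 * Rel"
proof -
  have "R21 * Rel = (\<Sum>m<PP. \<Sum>n<PM. \<Sum>m'<PP. \<Sum>n'<PM. (rr m n * rr m' n') *s
     ((\<Sum>c<NN. tn (Fem m n * dK.pj (int c)) (Efm m n * dK.kp (- int c))) *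
      (\<Sum>d<NN. tn (Efm m' n' * dK.pj (int d)) (Fem m' n' * dK.kp (- int d)))))"
    unfolding R21_def Rel_def by (rule double_sum_mult)
  also have "\<dots> = inc2 Mel"
    unfolding mono_sum by (simp add: Mel_def inc2_def tl_linear[OF bilin_inc])
  finally show ?thesis ..
qed

lemma M_bar_coset: "M_bar PP PM = coset Mel"
  unfolding M_bar_def
proof (rule the_equality)
  let ?M = "R21_matrix PP PM \<otimes>\<^bsub>presented (dd_rels PP PM)\<^esub> R_matrix PP PM"
  have c: "carrier (presented (gg_rels PP PM)) = range (coset :: (ggen list \<times> ggen list) alg \<Rightarrow> _)"
    unfolding rels_gg[symmetric] by (rule presented_carrier)
  have r: "?M = coset (R21 * Rel)"
    unfolding R21_coset R_matrix_coset rels_dd[symmetric] by simp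
  show "coset Mel \<in> carrier (presented (gg_rels PP PM)) \<and>
      incl2 PP PM (coset Mel) = ?M"
    by (simp add: c r incl2_coset inc2_Mel)
  show "M = coset Mel" if "M \<in> carrier (presented (gg_rels PP PM)) \<and>
      incl2 PP PM M = ?M" for M
    using that by (auto simp: r incl2_coset c inc2_Mel[symmetric] dest: inc2_inject)
qed

lemma drinfeld_map_coset:
  fixes \<gamma> :: "gA \<Rightarrow> complex"
  assumes \<gamma>: "\<And>z. \<beta> (coset z) = \<gamma> z"
    and lin: "\<And>x y. \<gamma> (x + y) = \<gamma> x + \<gamma> y" "\<And>c x. \<gamma> (c *s x) = c * \<gamma> x"
  shows "drinfeld_map PP PM \<beta> = coset (\<Sum>m<PP. \<Sum>n<PM. \<Sum>m'<PP. \<Sum>n'<PM. (rr m n * rr m' n') *s (\<Sum>b<LL.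
     (qq powi (wE m' n' * int b + wE m' n' ^ 2) * \<gamma> (Gfe m n * (Gef m' n' * P1 (int b)))) *s
       (Gef m n * (Gfe m' n' * KK (- int b - wh m' n')))))"
proof -
  have B: "bilin (\<lambda>x y. \<gamma> x *s y)"
    by (simp add: bilin_def lin sca.scale_left_distrib sca.scale_right_distrib mult.commute)
  have "drinfeld_map PP PM \<beta> = coset (tl (\<lambda>x y. \<gamma> x *s y) Mel)"
    unfolding drinfeld_map_def M_bar_coset rels_g[symmetric]
    by (rule quot_map_tl[OF B]) (simp add: cls_conv_coset \<gamma>)
  thus ?thesis by (simp add: Mel_def tl_linear[OF B])
qed

subsection \<open>Pseudotraces\<close>

context cyclic_element
begin

lemma sum_delta:
  fixes F :: "int \<Rightarrow> 'v::ab_group_add"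
  assumes "\<And>a b. int N dvd a - b \<Longrightarrow> F a = F b"
  shows "(\<Sum>b<N. if int N dvd t - int b then F (int b) else 0) = F t"
proof -
  define b0 where "b0 = nat (t mod int N)"
  have b0: "int b0 = t mod int N" "b0 < N" using N_pos by (simp_all add: b0_def nat_less_iff)
  have "(\<Sum>b<N. if int N dvd t - int b then F (int b) else 0) = (\<Sum>b<N. if b = b0 then F t else 0)"
  proof (rule sum.cong[OF refl])
    fix b assume "b \<in> {..<N}"
    hence "int N dvd t - int b \<longleftrightarrow> b = b0" using b0 by (auto simp: mod_eq_dvd_iff[symmetric])
    moreover have "F (int b) = F t" if "int N dvd t - int b" using assms[of t "int b"] that by simp
    ultimately show "(if int N dvd t - int b then F (int b) else 0) = (if b = b0 then F t else 0)" by auto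
  qed
  thus ?thesis using b0 by simp
qed

end

context tensor_module
begin

lemma kk_eq:
  assumes b: "b \<in> B1" "b' \<in> B2" and w: "w1 b = qq powi (2 * int PM * t)" "w2 b' = qq powi (2 * int PP * t)"
  shows "kk b b' = qz powi t"
proof (rule coprime_power_eq[OF coprime_PP_PM])
  have "(qz powi t) ^ n = qq powi (2 * int n * t)" for n by (simp add: qz_powi qq_powi_power mult_ac)
  thus "kk b b' ^ PP = (qz powi t) ^ PP" "kk b b' ^ PM = (qz powi t) ^ PM"
    using b w by (simp_all only: kk_powers)
qed (use b kk_nz in \<open>auto simp: gK.zeta_nz\<close>)

lemma lookup_act:
  assumes z: "\<And>b b'. b \<in> B1 \<Longrightarrow> b' \<in> B2 \<Longrightarrow> ga V z (vec (b, b')) = scl (F b b') (vec (b, b'))"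
    and y: "y \<in> mspace V" and b: "b \<in> B1" "b' \<in> B2"
  shows "lookup (ga V z y) (b, b') = F b b' * lookup y (b, b')"
proof -
  let ?s = "(\<Sum>a\<in>keys y. scl (lookup y a) (scl (case_prod F a) (vec a)))"
  obtain x where x: "z = pr x" using pr_surj by metis
  have "free_act V x y = (\<Sum>a\<in>keys y. scl (lookup y a) (free_act V x (vec a)))"
    by (rule linear_expand) simp_all
  also have "\<dots> = ?s"
  proof (rule sum.cong[OF refl])
    fix a assume "a \<in> keys y"
    then obtain c c' where a: "a = (c, c')" "c \<in> B1" "c' \<in> B2" using y by (auto simp: mspace_def basis_V)
    have "free_act V x (vec a) = ga V z (vec a)"
      unfolding x by (rule ga_pr[OF is_mod_V, symmetric]) (use a in \<open>simp add: mspace_closed basis_V\<close>)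
    thus "scl (lookup y a) (free_act V x (vec a)) = scl (lookup y a) (scl (case_prod F a) (vec a))"
      using z a by simp
  qed
  finally have "ga V z y = ?s"
    unfolding x using ga_pr[OF is_mod_V y] by simp
  thus ?thesis
    by (simp add: lookup_sum lookup_single when_def if_distrib[where f = "(*) _"] in_keys_iff cong: if_cong)
qed

lemma P1_act_sum:
  assumes b: "b \<in> B1" "b' \<in> B2"
  shows "ga V (P1 a) (vec (b, b')) =
    scl (1 / of_nat LL * (\<Sum>s<LL. qz powi (- (a * int s)) * kk b b' powi int s)) (vec (b, b'))"
proof -
  have v: "vec (b, b') \<in> mspace V" using b by (intro mspace_closed) (simp add: basis_V)
  have "ga V (P1 a) (vec (b, b')) = scl (1 / of_nat LL) (\<Sum>s<LL. scl (qz powi (- (a * int s)) * kk b b' powi int s) (vec (b, b')))"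
    unfolding gK.pj_def by (simp only: ga_simps[OF is_mod_V v] KK_act[OF b] scl.scale_scale)
  thus ?thesis by (simp only: scl.scale_sum_left[symmetric] scl.scale_scale)
qed

lemma P1_scalar:
  assumes t: "kk b b' = qz powi t"
  shows "1 / of_nat LL * (\<Sum>s<LL. qz powi (- (a * int s)) * kk b b' powi int s) = (if int LL dvd t - a then 1 else 0)"
proof -
  have "(\<Sum>s<LL. qz powi (- (a * int s)) * kk b b' powi int s) = (\<Sum>s<LL. qz powi ((t - a) * int s))"
  proof (rule sum.cong[OF refl])
    fix s
    have "qz powi (- (a * int s)) * kk b b' powi int s = qz powi (- (a * int s)) * qz powi (t * int s)"
      unfolding t by (simp only: power_int_mult)
    also have "\<dots> = qz powi (- (a * int s) + t * int s)" by (simp only: power_int_add[OF disjI1[OF gK.zeta_nz]])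
    finally show "qz powi (- (a * int s)) * kk b b' powi int s = qz powi ((t - a) * int s)" by (simp add: algebra_simps)
  qed
  also have "\<dots> = (if int LL dvd t - a then of_nat LL else 0)" by (rule gK.zeta_sum)
  finally show ?thesis using gK.N_pos by simp
qed

lemma P1_act:
  assumes "b \<in> B1" "b' \<in> B2" "kk b b' = qz powi t"
  shows "ga V (P1 a) (vec (b, b')) = scl (if int LL dvd t - a then 1 else 0) (vec (b, b'))"
  unfolding P1_act_sum[OF assms(1,2)] P1_scalar[OF assms(3)] ..

lemma P1_lookup:
  assumes "y \<in> mspace V" "b \<in> B1" "b' \<in> B2" "kk b b' = qz powi t"
  shows "lookup (ga V (P1 a) y) (b, b') = (if int LL dvd t - a then lookup y (b, b') else 0)"
  using lookup_act[where z = "P1 a" and F = "\<lambda>b b'. 1 / of_nat LL * (\<Sum>s<LL. qz powi (- (a * int s)) * kk b b' powi int s)",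
      OF P1_act_sum assms(1-3)]
  unfolding P1_scalar[OF assms(4)] by simp

end

text \<open>Polynomial calculus on a Jordan block of size two: the off-diagonal entry of P(C) is the
  derivative of P at the eigenvalue.\<close>

lemma peval_act_nilpotent:
  assumes V: "is_mod V" and m: "u \<in> mspace V" "v \<in> mspace V"
    and C: "ga V C v = scl c v + scl k u" "ga V C u = scl c u"
  shows "ga V (peval P C) v = scl (poly P c) v + scl (k * poly (pderiv P) c) u \<and> ga V (peval P C) u = scl (poly P c) u"
proof (induction P)
  case 0
  thus ?case by (simp add: ga_simps[OF V] m)
next
  case (pCons a P)
  have "ga V C (ga V (peval P C) v) = scl (poly P c) (ga V C v) + scl (k * poly (pderiv P) c) (ga V C u)"
    using pCons m by (simp add: ga_simps[OF V] mspace_closed)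
  moreover have "ga V C (ga V (peval P C) u) = scl (poly P c) (ga V C u)"
    using pCons m by (simp add: ga_simps[OF V] mspace_closed)
  ultimately show ?case
    by (simp add: ga_simps[OF V] m C pderiv_pCons scl.scale_right_distrib scl.scale_left_distrib algebra_simps)
qed

lemma (in tensor_module) pseudotrace_entry:
  assumes mem: "b \<in> B1" "b' \<in> B2" "c \<in> B1" "c' \<in> B2" "(b, b') \<noteq> (c, c')"
    and t: "kk b b' = qz powi t" "kk c c' = qz powi t"
    and z: "G Kg * z = qz powi d *s (z * G Kg)"
    and d: "int LL dvd d \<Longrightarrow> z * P1 t = peval P C * P1 t"
    and C: "ga V C (vec (b, b')) = scl c0 (vec (b, b')) + scl k0 (vec (c, c'))" "ga V C (vec (c, c')) = scl c0 (vec (c, c'))"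
  shows "lookup (ga V (KK s * (z * P1 a)) (vec (b, b'))) (c, c') =
    (if int LL dvd t - a \<and> int LL dvd d then qz powi (t * s) * (k0 * poly (pderiv P) c0) else 0)"
proof -
  have v: "vec (b, b') \<in> mspace V" "vec (c, c') \<in> mspace V" using mem by (auto intro!: mspace_closed simp: basis_V)
  have kk: "kk c c' powi s = qz powi (t * s)" by (simp only: t power_int_mult)
  have K: "lookup (ga V (KK s * y) w) (c, c') = qz powi (t * s) * lookup (ga V y w) (c, c')" if "w \<in> mspace V" for y w
    using that lookup_act[OF KK_act, of "ga V y w" c c' s] mem by (simp add: ga_simps[OF is_mod_V] kk)
  have P: "ga V (P1 a) (vec (b, b')) = scl (if int LL dvd t - a then 1 else 0) (vec (b, b'))" for a
    by (rule P1_act) (use mem t in auto)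
  have "ga V (z * P1 a) (vec (b, b')) = (if int LL dvd t - a then ga V (z * P1 t) (vec (b, b')) else 0)"
    using v by (simp add: ga_simps[OF is_mod_V] P)
  moreover have "lookup (ga V (z * P1 t) (vec (b, b'))) (c, c') =
      (if int LL dvd d then k0 * poly (pderiv P) c0 else 0)"
  proof (cases "int LL dvd d")
    case True
    have "ga V (z * P1 t) (vec (b, b')) = ga V (peval P C) (vec (b, b'))"
      unfolding d[OF True] using v by (simp add: ga_simps[OF is_mod_V] P)
    thus ?thesis using True mem peval_act_nilpotent[OF is_mod_V v(2,1) C, of P]
      by (auto simp: lookup_add lookup_single when_def)
  next
    case False
    have "z * P1 t = P1 (t + d) * z" by (rule gK.gen_pj[OF z])
    hence "lookup (ga V (z * P1 t) (vec (b, b'))) (c, c') =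
        lookup (ga V (P1 (t + d)) (ga V z (vec (b, b')))) (c, c')" using v by (simp add: ga_simps[OF is_mod_V])
    also have "\<dots> = 0"
      using P1_lookup[OF ga_simps(9)[OF is_mod_V v(1)] mem(3,4) t(2), of "t + d" z] False by simp
    finally show ?thesis using False by simp
  qed
  ultimately show ?thesis using K[OF v(1), of "z * P1 a"] by auto
qed

lemma LL_dvd_shift:
  assumes "m < PP" "m' < PP"
  shows "int LL dvd 2 * int PM * (int m' - int m) \<longleftrightarrow> m = m'"
proof -
  have "int LL dvd 2 * int PM * (int m' - int m) \<longleftrightarrow> (2 * int PM) * int PP dvd (2 * int PM) * (int m' - int m)"
    by (simp add: int_LL mult.assoc mult.left_commute mult.commute)
  also have "\<dots> \<longleftrightarrow> int PP dvd int m' - int m" by (subst dvd_mult_cancel_left) (use PM_ge_2 in auto)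
  also have "\<dots> \<longleftrightarrow> m = m'"
    using assms by (auto simp: mod_eq_dvd_iff[symmetric])
  finally show ?thesis .
qed

lemma LL_dvd_shift':
  assumes "n < PM" "n' < PM"
  shows "int LL dvd 2 * int PP * (int n - int n') \<longleftrightarrow> n = n'"
proof -
  have "int LL dvd 2 * int PP * (int n - int n') \<longleftrightarrow> (2 * int PP) * int PM dvd (2 * int PP) * (int n - int n')"
    by (simp add: int_LL mult.assoc)
  also have "\<dots> \<longleftrightarrow> int PM dvd int n - int n'" by (subst dvd_mult_cancel_left) (use PP_ge_2 in auto)
  also have "\<dots> \<longleftrightarrow> n = n'"
    using assms by (auto simp: mod_eq_dvd_iff[symmetric])
  finally show ?thesis .
qed

lemma pm_power_commute:
  assumes "x \<in> {Ep, Fp}" "y \<in> {Em, Fm}"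
  shows "G x ^ m * G y ^ n = G y ^ n * G x ^ m"
  using power_commute[of "G x" "G y" 1 m n] G_pm_commute[OF assms] by simp

text \<open>Two orders, so that in either case the sector that kills the vector can act
  first.\<close>

lemma pm_reorder:
  "Gfe m n * (Gef m' n' * w) = G Fp ^ m * (G Ep ^ m' * (G Em ^ n * (G Fm ^ n' * w)))"
  "Gfe m n * (Gef m' n' * w) = G Em ^ n * (G Fm ^ n' * (G Fp ^ m * (G Ep ^ m' * w)))"
proof -
  have c: "G y ^ n * (G x ^ m * w) = G x ^ m * (G y ^ n * w)" if "x \<in> {Ep, Fp}" "y \<in> {Em, Fm}" for x y m n w
    using pm_power_commute[OF that] by (simp only: mult.assoc[symmetric])
  have c1: "G Em ^ n * (G Ep ^ m * w) = G Ep ^ m * (G Em ^ n * w)" "G Em ^ n * (G Fp ^ m * w) = G Fp ^ m * (G Em ^ n * w)"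
    "G Fm ^ n * (G Ep ^ m * w) = G Ep ^ m * (G Fm ^ n * w)" "G Fm ^ n * (G Fp ^ m * w) = G Fp ^ m * (G Fm ^ n * w)" for m n w
    by (rule c; simp)+
  show "Gfe m n * (Gef m' n' * w) = G Fp ^ m * (G Ep ^ m' * (G Em ^ n * (G Fm ^ n' * w)))"
    "Gfe m n * (Gef m' n' * w) = G Em ^ n * (G Fm ^ n' * (G Fp ^ m * (G Ep ^ m' * w)))"
    by (simp_all only: mult.assoc c1)
qed

lemma ga_0 [simp]:
  assumes "is_mod V"
  shows "ga V z 0 = 0"
proof -
  obtain x where "z = pr x" using pr_surj by metis
  thus ?thesis using ga_pr[OF assms mspace_closed(1)] by simp
qed

lemma ga_power_kill:
  assumes "is_mod V" "v \<in> mspace V" "ga V g v = 0"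
  shows "ga V (g ^ n) v = (if n = 0 then v else 0)"
proof (cases n)
  case (Suc k)
  have "ga V (g ^ n) v = ga V (g ^ k) (ga V g v)" by (simp only: Suc power_Suc2 ga_simps[OF assms(1,2)])
  with Suc show ?thesis by (simp add: assms)
qed (simp add: ga_simps[OF assms(1,2)])

context tensor_module
begin

text \<open>The minus factor of the vector is killed by e_- and f_-, so only n = n' = 0 contributes.
  In the plus sector the weight forces m = m', and f^m e^m is a Newton polynomial in the Casimir
  element.\<close>

lemma pseudotrace_p:
  assumes mem: "b \<in> B1" "c \<in> B1" "b' \<in> B2" "b \<noteq> c" and kill: "e2 b' = 0" "f2 b' = 0"
    and t: "kk b b' = qz powi t" "kk c b' = qz powi t"
    and C: "ga V sp.Cas (vec (b, b')) = scl c0 (vec (b, b')) + scl k0 (vec (c, b'))" "ga V sp.Cas (vec (c, b')) = scl c0 (vec (c, b'))"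
    and m: "m < PP" "m' < PP"
  shows "lookup (ga V (KK s * (Gfe m n * (Gef m' n' * P1 a))) (vec (b, b'))) (c, b') =
    (if m = m' \<and> n = 0 \<and> n' = 0 then if int LL dvd t - a then qz powi (t * s) * (k0 / qp.h ^ (2 * m) *
      poly (pderiv (newton (\<lambda>l. csum (qq powi (2 * int PM * t) * Qp * Qp ^ (2 * l))) m)) c0) else 0 else 0)"
proof (cases "n = 0 \<and> n' = 0")
  case True
  let ?z = "G Fp ^ m * G Ep ^ m'"
  let ?P = "smult (1 / qp.h ^ (2 * m)) (newton (\<lambda>l. csum (qq powi (2 * int PM * t) * Qp * Qp ^ (2 * l))) m)"
  have z: "G Kg * ?z = qz powi (2 * int PM * (int m' - int m)) *s (?z * G Kg)"
    using gK.weight_mult[OF gK.weight_power[OF G_K_commute, of Fp m] gK.weight_power[OF G_K_commute, of Ep m']]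
    by (simp add: algebra_simps)
  have "?z * P1 t = peval ?P sp.Cas * P1 t" if "int LL dvd 2 * int PM * (int m' - int m)"
    using that sp.fe_power[OF wt_P1(1), of m t] LL_dvd_shift[OF m] by (simp add: mult.assoc peval_smult)
  from pseudotrace_entry[OF mem(1,3,2,3) _ t z this C, of s a] show ?thesis
    using True mem(4) LL_dvd_shift[OF m] by (simp add: mult.assoc pderiv_smult)
next
  case False
  have v: "vec (b, b') \<in> mspace V" using mem by (auto intro!: mspace_closed simp: basis_V)
  have k: "ga V (G Em) (vec (b, b')) = 0" "ga V (G Fm) (vec (b, b')) = 0"
    using mem kill by (simp_all add: ga_simps[OF is_mod_V v] gen_act_V)
  have v': "ga V z (vec (b, b')) \<in> mspace V" for z using ga_simps(9)[OF is_mod_V v] .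
  have "ga V (KK s * (Gfe m n * (Gef m' n' * P1 a))) (vec (b, b')) = 0"
    unfolding pm_reorder(1) using False v v'
    by (auto simp: ga_simps[OF is_mod_V] P1_act[OF mem(1,3) t(1)] ga_power_kill[OF is_mod_V v k(1)]
        ga_power_kill[OF is_mod_V v k(2)] is_mod_V mspace_closed)
  thus ?thesis using False by auto
qed

lemma pseudotrace_m:
  assumes mem: "b \<in> B1" "b' \<in> B2" "c' \<in> B2" "b' \<noteq> c'" and kill: "e1 b = 0" "f1 b = 0"
    and t: "kk b b' = qz powi t" "kk b c' = qz powi t"
    and C: "ga V sm.Cas (vec (b, b')) = scl c0 (vec (b, b')) + scl k0 (vec (b, c'))" "ga V sm.Cas (vec (b, c')) = scl c0 (vec (b, c'))"
    and n: "n < PM" "n' < PM"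
  shows "lookup (ga V (KK s * (Gfe m n * (Gef m' n' * P1 a))) (vec (b, b'))) (b, c') =
    (if n = n' \<and> m = 0 \<and> m' = 0 then if int LL dvd t - a then qz powi (t * s) * (k0 / qm.h ^ (2 * n) *
      poly (pderiv (newton (\<lambda>l. csum (qq powi (- 2 * int PP * t) * Qm * Qm ^ (2 * l))) n)) c0) else 0 else 0)"
proof (cases "m = 0 \<and> m' = 0")
  case True
  let ?z = "G Em ^ n * G Fm ^ n'"
  let ?P = "smult (1 / qm.h ^ (2 * n)) (newton (\<lambda>l. csum (qq powi (- 2 * int PP * t) * Qm * Qm ^ (2 * l))) n)"
  have z: "G Kg * ?z = qz powi (2 * int PP * (int n - int n')) *s (?z * G Kg)"
    using gK.weight_mult[OF gK.weight_power[OF G_K_commute, of Em n] gK.weight_power[OF G_K_commute, of Fm n']]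
    by (simp add: algebra_simps)
  have "?z * P1 t = peval ?P sm.Cas * P1 t" if "int LL dvd 2 * int PP * (int n - int n')"
    using that sm.fe_power[OF wt_P1(2), of n t] LL_dvd_shift'[OF n] by (simp add: mult.assoc peval_smult)
  from pseudotrace_entry[OF mem(1,2,1,3) _ t z this C, of s a] show ?thesis
    using True mem(4) LL_dvd_shift'[OF n] by (simp add: mult.assoc pderiv_smult)
next
  case False
  have v: "vec (b, b') \<in> mspace V" using mem by (auto intro!: mspace_closed simp: basis_V)
  have k: "ga V (G Ep) (vec (b, b')) = 0" "ga V (G Fp) (vec (b, b')) = 0"
    using mem kill by (simp_all add: ga_simps[OF is_mod_V v] gen_act_V)
  have v': "ga V z (vec (b, b')) \<in> mspace V" for z using ga_simps(9)[OF is_mod_V v] .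
  have "ga V (KK s * (Gfe m n * (Gef m' n' * P1 a))) (vec (b, b')) = 0"
    unfolding pm_reorder(2) using False v v'
    by (auto simp: ga_simps[OF is_mod_V] P1_act[OF mem(1,2) t(1)] ga_power_kill[OF is_mod_V v k(1)]
        ga_power_kill[OF is_mod_V v k(2)] is_mod_V mspace_closed)
  thus ?thesis using False by auto
qed

end

text \<open>The trace of x T for a map T that is nonzero only on pairs of down vectors and sends the
  pair with indices n, n' to \<open>u n n'\<close>. The power of K is the inverse balancing
  element.\<close>

definition ptr :: "(nat \<Rightarrow> nat \<Rightarrow> tbasis \<times> tbasis) \<Rightarrow> complex \<Rightarrow> nat \<Rightarrow> nat \<Rightarrow> gA \<Rightarrow> complex" where
  "ptr u \<alpha> r r' z = (\<Sum>n<r. \<Sum>n'<r'. lookup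
     (ga (proj_mod PP PM \<alpha> r r') (KK (int PM - int PP) * z) (vec (u n n'))) (Dn n, Dn n'))"

lemma twisted_trace_coset:
  "twisted_trace PP PM V T (coset z) =
    (\<Sum>b\<in>basis V. lookup (ga V (KK (int PM - int PP) * z) (T b)) b)"
proof -
  have "inv\<^bsub>g_alg PP PM\<^esub> (balancing PP PM) \<otimes>\<^bsub>g_alg PP PM\<^esub> coset z = coset (KK (int PM - int PP) * z)"
    unfolding inv_balancing unfolding g_alg_def rels_g[symmetric] by simp
  thus ?thesis by (simp add: twisted_trace_def trace_on_def ga_def)
qed

lemma proj_mod_props:
  assumes "1 \<le> r" "r < PP" "1 \<le> r'" "r' < PM" "\<alpha> ^ 2 = 1"
  shows "is_mod (proj_mod PP PM \<alpha> r r')" "basis (proj_mod PP PM \<alpha> r r') = proj_basis PP r \<times> proj_basis PM r'"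
  using tensor_module.is_mod_V[OF tensor_module_proj[OF assms]] tensor_module.basis_V[OF tensor_module_proj[OF assms]] .

lemma twisted_trace_ptr:
  assumes r: "1 \<le> r" "r < PP" "1 \<le> r'" "r' < PM" "\<alpha> ^ 2 = 1"
    and T: "\<And>n n'. T (Dn n, Dn n') = vec (u n n')" "\<And>b. b \<notin> range (\<lambda>(n, n'). (Dn n, Dn n')) \<Longrightarrow> T b = 0"
  shows "twisted_trace PP PM (proj_mod PP PM \<alpha> r r') T (coset z) = ptr u \<alpha> r r' z"
proof -
  let ?V = "proj_mod PP PM \<alpha> r r'" and ?d = "\<lambda>(n, n'). (Dn n, Dn n')"
  let ?f = "\<lambda>b. lookup (ga ?V (KK (int PM - int PP) * z) (T b)) b"
  note V = proj_mod_props[OF r]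
  have "(\<Sum>b\<in>basis ?V. ?f b) = (\<Sum>b\<in>?d ` ({..<r} \<times> {..<r'}). ?f b)"
  proof (rule sum.mono_neutral_right)
    show "finite (basis ?V)" "?d ` ({..<r} \<times> {..<r'}) \<subseteq> basis ?V" unfolding V(2) by (auto simp: proj_basis_def)
    show "\<forall>b\<in>basis ?V - ?d ` ({..<r} \<times> {..<r'}). ?f b = 0"
    proof
      fix b assume b: "b \<in> basis ?V - ?d ` ({..<r} \<times> {..<r'})"
      have "b \<notin> range ?d" using b unfolding V(2) by (auto simp: proj_basis_def)
      thus "?f b = 0" by (simp add: T(2) ga_0[OF V(1)])
    qed
  qed
  also have "\<dots> = (\<Sum>(n, n')\<in>{..<r} \<times> {..<r'}. ?f (Dn n, Dn n'))"
    by (subst sum.reindex) (auto simp: inj_on_def intro!: sum.cong)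
  finally show ?thesis by (simp add: twisted_trace_coset ptr_def T(1) sum.cartesian_product)
qed

lemma ptr_linear:
  assumes r: "1 \<le> r" "r < PP" "1 \<le> r'" "r' < PM" "\<alpha> ^ 2 = 1"
    and u: "\<And>n n'. n < r \<Longrightarrow> n' < r' \<Longrightarrow> u n n' \<in> proj_basis PP r \<times> proj_basis PM r'"
  shows "ptr u \<alpha> r r' (x + y) = ptr u \<alpha> r r' x + ptr u \<alpha> r r' y" "ptr u \<alpha> r r' (c *s x) = c * ptr u \<alpha> r r' x"
proof -
  have m: "vec (u n n') \<in> mspace (proj_mod PP PM \<alpha> r r')" if "n < r" "n' < r'" for n n'
    using u[OF that] by (intro mspace_closed) (simp add: proj_mod_props[OF r])
  show "ptr u \<alpha> r r' (x + y) = ptr u \<alpha> r r' x + ptr u \<alpha> r r' y" "ptr u \<alpha> r r' (c *s x) = c * ptr u \<alpha> r r' x"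
    using m by (simp_all add: ptr_def distrib_left ga_simps[OF proj_mod_props(1)[OF r]] lookup_add sum.distrib sum_distrib_left)
qed

abbreviation trNE :: "complex \<Rightarrow> nat \<Rightarrow> gA \<Rightarrow> complex" where "trNE \<alpha> r \<equiv> ptr (\<lambda>n n'. (Up n, Dn n')) \<alpha> r 1"
abbreviation trNW :: "complex \<Rightarrow> nat \<Rightarrow> gA \<Rightarrow> complex" where "trNW \<alpha> r \<equiv> ptr (\<lambda>n n'. (Dn n, Up n')) \<alpha> 1 r"

lemma one_less_P: "1 < PP" "1 < PM" using PP_ge_2 PM_ge_2 by auto

lemma twisted_trace_NE:
  "1 \<le> r \<Longrightarrow> r < PP \<Longrightarrow> \<alpha> ^ 2 = 1 \<Longrightarrow>
    twisted_trace PP PM (proj_mod PP PM \<alpha> r 1) (\<lambda>(b, b'). N_map b \<otimes>\<^sub>v E_map b') (coset z) = trNE \<alpha> r z"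
  and twisted_trace_NW:
  "1 \<le> r \<Longrightarrow> r < PM \<Longrightarrow> \<alpha> ^ 2 = 1 \<Longrightarrow>
    twisted_trace PP PM (proj_mod PP PM \<alpha> 1 r) (\<lambda>(b, b'). E_map b \<otimes>\<^sub>v N_map b') (coset z) = trNW \<alpha> r z"
proof -
  have *: "(case b of (b, b') \<Rightarrow> N_map b \<otimes>\<^sub>v E_map b') = 0" "(case b of (b, b') \<Rightarrow> E_map b \<otimes>\<^sub>v N_map b') = 0"
    if "b \<notin> range (\<lambda>(n, n'). (Dn n, Dn n'))" for b
  proof -
    obtain c c' where b: "b = (c, c')" by (cases b)
    show "(case b of (b, b') \<Rightarrow> N_map b \<otimes>\<^sub>v E_map b') = 0" "(case b of (b, b') \<Rightarrow> E_map b \<otimes>\<^sub>v N_map b') = 0"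
      using that unfolding b by (cases c; cases c'; force)+
  qed
  show "1 \<le> r \<Longrightarrow> r < PP \<Longrightarrow> \<alpha> ^ 2 = 1 \<Longrightarrow>
    twisted_trace PP PM (proj_mod PP PM \<alpha> r 1) (\<lambda>(b, b'). N_map b \<otimes>\<^sub>v E_map b') (coset z) = trNE \<alpha> r z"
    by (rule twisted_trace_ptr) (use one_less_P * in auto)
  show "1 \<le> r \<Longrightarrow> r < PM \<Longrightarrow> \<alpha> ^ 2 = 1 \<Longrightarrow>
    twisted_trace PP PM (proj_mod PP PM \<alpha> 1 r) (\<lambda>(b, b'). E_map b \<otimes>\<^sub>v N_map b') (coset z) = trNW \<alpha> r z"
    by (rule twisted_trace_ptr) (use one_less_P * in auto)
qed

section \<open>Drinfeld images of the pseudotraces, one sector at a time\<close>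

lemma iQ_power: "inverse Qp ^ n = qq powi (- 2 * int PM * int PM * int n)"
  "inverse Qm ^ n = qq powi (- 2 * int PP * int PP * int n)"
  by (simp_all add: Qpar_qq qq_inverse_powi qq_powi_power)

lemma Q_power: "Qp ^ n = qq powi (2 * int PM * int PM * int n)" "Qm ^ n = qq powi (2 * int PP * int PP * int n)"
  by (simp_all add: Qpar_qq qq_powi_power)

text \<open>The left side is the Drinfeld image on a weight vector once the sum over projections is
  done. Collecting powers of Q and x identifies the scalars as \<open>chi_coeff\<close> at y = x /
  Q, and e^m f^m supplies the Newton polynomials.\<close>

lemma (in sector) chi_sum:
  assumes w: "wt x z"
  shows "(\<Sum>m<p. (rcoeff m ^ 2 * (1 / h) * (\<Sum>N<p. iQ ^ (2 * m * N) * Q ^ (2 * m * m) * x ^ (2 * N) * inverse x ^ m * iQ ^ (2 * N) *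
      (h ^ 2 / h ^ (2 * m) * dnewton m (Q ^ (2 * N) * iQ)))) *s (e ^ m * (f ^ m * z))) = peval (chi_poly (x * iQ)) Cas * z"
proof -
  have "(rcoeff m ^ 2 * (1 / h) * (\<Sum>N<p. iQ ^ (2 * m * N) * Q ^ (2 * m * m) * x ^ (2 * N) * inverse x ^ m * iQ ^ (2 * N) *
      (h ^ 2 / h ^ (2 * m) * dnewton m (Q ^ (2 * N) * iQ)))) *s (e ^ m * (f ^ m * z)) =
    peval (smult (chi_coeff (x * iQ) m) (newton (\<lambda>l. csum (x * iQ * iQ ^ (2 * l))) m)) Cas * z" if m: "m < p" for m
  proof -
    define D where "D N = dnewton m (Q ^ (2 * N) * iQ)" for N
    define t where "t = m * (m - 1) div 2"
    have x: "x \<noteq> 0" using w by (simp add: wt_def)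
    have "even (m * (m - 1))" by (cases m) auto
    hence t: "2 * t + m = m ^ 2" by (cases m) (simp_all add: t_def power2_eq_square algebra_simps)
    have h0: "h \<noteq> 0" by (rule h_nz)
    have r2: "rcoeff m ^ 2 = h ^ (2 * m) * h ^ (2 * m) * iQ ^ (2 * t) / brf m ^ 2"
    proof -
      have "((- 1 :: complex) ^ m) ^ 2 = 1" by (simp flip: power_mult)
      thus ?thesis
        unfolding rcoeff_def t_def[symmetric] power_divide power_mult_distrib
        by (simp add: power2_eq_square[of "h ^ _"] power_mult mult.commute del: power_inverse) (simp add: power2_eq_square power_mult_distrib mult_ac del: power_inverse)
    qed
    have tm: "iQ ^ (2 * m * N) * Q ^ (2 * m * m) * x ^ (2 * N) * inverse x ^ m * iQ ^ (2 * N) * (h ^ 2 / h ^ (2 * m) * D N) =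
        Q ^ (2 * m * m) * inverse x ^ m * (h ^ 2 / h ^ (2 * m)) * ((x * iQ) ^ (2 * N) * iQ ^ (2 * N * m) * D N)" for N
      by (simp only: power_mult_distrib mult_ac)
    have "rcoeff m ^ 2 * (1 / h) * (\<Sum>N<p. iQ ^ (2 * m * N) * Q ^ (2 * m * m) * x ^ (2 * N) * inverse x ^ m * iQ ^ (2 * N) * (h ^ 2 / h ^ (2 * m) * D N)) =
        rcoeff m ^ 2 * (1 / h) * (Q ^ (2 * m * m) * inverse x ^ m * (h ^ 2 / h ^ (2 * m))) * (\<Sum>N<p. (x * iQ) ^ (2 * N) * iQ ^ (2 * N * m) * D N)"
      unfolding tm sum_distrib_left[symmetric] by (simp only: mult.assoc)
    also have "rcoeff m ^ 2 * (1 / h) * (Q ^ (2 * m * m) * inverse x ^ m * (h ^ 2 / h ^ (2 * m))) =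
        h ^ (2 * m) * (h * Q ^ (m ^ 2) / ((x * iQ) ^ m * brf m ^ 2))"
    proof -
      have q: "iQ ^ (2 * t) * Q ^ (2 * m * m) = Q ^ (m ^ 2) * Q ^ m"
      proof -
        have "2 * m * m = 2 * t + m + m ^ 2" using t by (simp add: power2_eq_square)
        hence "iQ ^ (2 * t) * Q ^ (2 * m * m) = (iQ ^ (2 * t) * Q ^ (2 * t)) * (Q ^ m * Q ^ (m ^ 2))" by (simp only: power_add mult.assoc)
        also have "iQ ^ (2 * t) * Q ^ (2 * t) = 1" by (simp add: power_inverse)
        finally show ?thesis by simp
      qed
      have "rcoeff m ^ 2 * (1 / h) * (Q ^ (2 * m * m) * inverse x ^ m * (h ^ 2 / h ^ (2 * m))) =
        h ^ (2 * m) * (h ^ (2 * m) / h ^ (2 * m)) * (h ^ 2 / h) * (iQ ^ (2 * t) * Q ^ (2 * m * m)) * inverse x ^ m / brf m ^ 2"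
        unfolding r2 by (simp only: divide_inverse mult_ac mult_1_left)
      also have "\<dots> = h ^ (2 * m) * h * (Q ^ (m ^ 2) * Q ^ m) * inverse x ^ m / brf m ^ 2"
        unfolding q using h0 by (simp add: power2_eq_square)
      also have "\<dots> = h ^ (2 * m) * (h * Q ^ (m ^ 2) / ((x * iQ) ^ m * brf m ^ 2))"
        using x by (simp add: power_mult_distrib power_inverse divide_inverse mult_ac)
      finally show ?thesis .
    qed
    finally have c: "rcoeff m ^ 2 * (1 / h) * (\<Sum>N<p. iQ ^ (2 * m * N) * Q ^ (2 * m * m) * x ^ (2 * N) * inverse x ^ m * iQ ^ (2 * N) *
        (h ^ 2 / h ^ (2 * m) * D N)) = h ^ (2 * m) * chi_coeff (x * iQ) m"
      unfolding chi_coeff_def D_def by (simp only: mult.assoc)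
    show ?thesis
      unfolding c[unfolded D_def] ef_power[OF w] using h0 by (simp add: peval_smult)
  qed
  thus ?thesis by (simp add: chi_poly_def peval_sum sum_distrib_right)
qed

text \<open>One of the two halves of the algebra: $M=p_-$ for the sector +, and $M=-p_+$ for the sector -.\<close>

locale half = sector Q p e f k ki for Q p and e f k ki :: gA +
  fixes M :: int
  assumes k_KK: "k = KK M" and Q_qq: "Q = qq powi (2 * M * M)"
    and M_balancing: "M * (M - (int PM - int PP)) = int PP * int PM"
begin

lemma wt_P1: "wt (qq powi (2 * M * a)) (P1 a)"
  unfolding wt_def by (subst k_KK) (simp add: gK.kp_pj qz_powi mult_ac)

lemma Q_powers: "Q ^ n = qq powi (2 * M * M * int n)" "iQ ^ n = qq powi (- 2 * M * M * int n)"
  by (simp_all add: Q_qq qq_inverse_powi qq_powi_power)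

text \<open>The contribution of the N-th weight vector to the pseudotrace: K acts on it by
  \<open>qz\<close> to the power -2 M N, the power of \<open>qz\<close> comes from the inverse
  balancing element, and h^2 is the size of the nilpotent part of the Casimir element.\<close>

definition hterm :: "nat \<Rightarrow> int \<Rightarrow> nat \<Rightarrow> complex" where
  "hterm m b N = (if int LL dvd - 2 * M * int N - b then qz powi (- 2 * M * int N * (int PM - int PP)) *
     (h ^ 2 / h ^ (2 * m) * dnewton m (Q ^ (2 * N) * iQ)) else 0)"

definition chi_elem :: gA where
  "chi_elem = (\<Sum>m<p. \<Sum>b<LL. (rcoeff m ^ 2 * qq powi (2 * (M * int m) * int b + (2 * (M * int m)) ^ 2) *
     (1 / h * (\<Sum>N<p. hterm m (int b) N))) *s (e ^ m * (f ^ m * KK (- int b - M * int m))))"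

lemma chi_elem_P1: "chi_elem * P1 a = peval (chi_poly (qq powi (2 * M * a) * iQ)) Cas * P1 a"
proof -
  let ?x = "qq powi (2 * M * a)"
  let ?d = "\<lambda>m N. h ^ 2 / h ^ (2 * m) * dnewton m (Q ^ (2 * N) * iQ)"
  let ?c = "\<lambda>m N. iQ ^ (2 * m * N) * Q ^ (2 * m * m) * ?x ^ (2 * N) * inverse ?x ^ m * iQ ^ (2 * N)"
  have one: "(\<Sum>b<LL. (rcoeff m ^ 2 * qq powi (2 * (M * int m) * int b + (2 * (M * int m)) ^ 2) * (1 / h * (\<Sum>N<p. hterm m (int b) N))) *s
       (e ^ m * (f ^ m * KK (- int b - M * int m))) * P1 a) =
     (rcoeff m ^ 2 * (1 / h) * (\<Sum>N<p. ?c m N * ?d m N)) *s (e ^ m * (f ^ m * P1 a))" for m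
  proof -
    let ?q = "\<lambda>b. qq powi (2 * (M * int m) * b + (2 * (M * int m)) ^ 2)" and ?z = "\<lambda>b. qz powi (a * (- b - M * int m))"
    let ?F = "\<lambda>b N. ?q b * qz powi (- 2 * M * int N * (int PM - int PP)) * ?z b"
    have kp: "e ^ m * (f ^ m * KK (- int b - M * int m)) * P1 a = ?z (int b) *s (e ^ m * (f ^ m * P1 a))" for b
      by (simp add: mult.assoc gK.kp_pj)
    have s1: "(\<Sum>b<LL. if int LL dvd - 2 * M * int N - int b then ?F (int b) N else 0) = ?F (- 2 * M * int N) N" for N
    proof (rule gK.sum_delta)
      fix b b' assume "int LL dvd b - b'"
      then obtain r where "b - b' = int LL * r" by (auto simp: dvd_def)
      hence b: "b = b' + int LL * r" by simp
      have "?q b = ?q b'" by (rule qq_cong) (simp add: b int_LL algebra_simps)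
      moreover have "?z b = ?z b'" by (rule gK.zeta_cong) (simp add: b algebra_simps)
      ultimately show "?F b N = ?F b' N" by simp
    qed
    have s2: "?F (- 2 * M * int N) N = ?c m N" for N
    proof -
      let ?E = "2 * (M * int m) * (- 2 * M * int N) + (2 * (M * int m)) ^ 2 +
          2 * (- 2 * M * int N * (int PM - int PP)) + 2 * (a * (- (- 2 * M * int N) - M * int m))"
      let ?E' = "- 2 * M * M * int (2 * m * N) + 2 * M * M * int (2 * m * m) +
          2 * M * a * int (2 * N) + - (2 * M * a) * int m + - 2 * M * M * int (2 * N)"
      \<comment> \<open>By \<open>M_balancing\<close> the inverse balancing element contributes
        exactly Q^(-2N); this is what shifts the argument of \<open>chi_poly\<close> from x to x /
        Q.\<close>
      have "?E - ?E' = 4 * int N * (M * (M - (int PM - int PP)))" by (simp add: power2_eq_square algebra_simps)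
      hence d: "4 * int PP * int PM dvd ?E - ?E'" unfolding M_balancing by simp
      have "?F (- 2 * M * int N) N = qq powi ?E"
        unfolding qz_powi by (simp only: power_int_add[OF disjI1[OF qq_nz]])
      also have "\<dots> = qq powi ?E'" by (rule qq_cong[OF d])
      also have "\<dots> = ?c m N"
        unfolding Q_powers qq_inverse_powi qq_powi_power by (simp only: power_int_add[OF disjI1[OF qq_nz]])
      finally show ?thesis .
    qed
    have "(\<Sum>b<LL. (rcoeff m ^ 2 * ?q (int b) * (1 / h * (\<Sum>N<p. hterm m (int b) N))) *s
       (e ^ m * (f ^ m * KK (- int b - M * int m))) * P1 a) =
      (\<Sum>b<LL. \<Sum>N<p. rcoeff m ^ 2 * (1 / h) * (?q (int b) * hterm m (int b) N * ?z (int b))) *s (e ^ m * (f ^ m * P1 a))"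
      unfolding sca_mult_left kp by (simp add: sca.scale_sum_left sum_distrib_left sum_distrib_right mult_ac)
    also have "(\<Sum>b<LL. \<Sum>N<p. rcoeff m ^ 2 * (1 / h) * (?q (int b) * hterm m (int b) N * ?z (int b))) =
       rcoeff m ^ 2 * (1 / h) * (\<Sum>N<p. (\<Sum>b<LL. if int LL dvd - 2 * M * int N - int b then ?F (int b) N else 0) * ?d m N)"
      unfolding sum_distrib_left sum_distrib_right
      by (subst sum.swap) (simp add: hterm_def if_distrib if_distribR mult_ac cong: if_cong)
    finally show ?thesis unfolding s1 s2 .
  qed
  show ?thesis unfolding chi_elem_def sum_distrib_right one by (rule chi_sum[OF wt_P1])
qed

end

interpretation hp: half "Qp" PP "G Ep" "G Fp" "KK (int PM)" "KK (- int PM)" "int PM"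
  by unfold_locales (simp_all add: Qpar_qq algebra_simps)

interpretation hm: half "Qm" PM "G Fm" "G Em" "KK (- int PP)" "KK (int PP)" "- int PP"
  by unfold_locales (simp_all add: Qpar_qq algebra_simps)

section \<open>Values of the pseudotraces on the monomials occurring in M-bar\<close>

lemma (in qroot) dnewton_inverse:
  assumes "x = iQ ^ (2 * N)"
  shows "poly (pderiv (newton (\<lambda>l. csum (x * Q * Q ^ (2 * l))) m)) (csum Q) = dnewton m (Q ^ (2 * N) * iQ)"
proof -
  have "csum (x * Q * Q ^ (2 * l)) = csum (Q ^ (2 * N) * iQ * iQ ^ (2 * l))" for l
  proof -
    have "x * Q * Q ^ (2 * l) = inverse (Q ^ (2 * N) * iQ * iQ ^ (2 * l))"
      by (simp add: assms power_inverse)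
    thus ?thesis by (simp only: csum_inverse)
  qed
  thus ?thesis by (simp add: dnewton_def)
qed

text \<open>\<open>\<nu>\<close> numbers the weights by their exponent of Q_+, and hypothesis
  \<open>c\<close> says that the Casimir eigenvalue is \<open>csum Qp\<close>. Both are stated
  abstractly so that the two modules of the pseudotrace are covered at once.\<close>

lemma trNE_value:
  assumes r: "1 \<le> r" "r < PP" and \<alpha>: "\<alpha> ^ 2 = 1"
    and w: "\<And>n. n < r \<Longrightarrow> \<alpha> ^ PM * Qp powi (int r - 1 - 2 * int n) = inverse Qp ^ (2 * \<nu> n)"
    and w': "\<alpha> ^ PP * (- 1) ^ (r - 1) = 1" and c: "csum (\<alpha> ^ PM * Qp ^ r) = csum Qp"
    and m: "m < PP" "m' < PP"
  shows "trNE \<alpha> r (Gfe m n * (Gef m' n' * P1 a)) = (if m = m' \<and> n = 0 \<and> n' = 0 then \<Sum>i<r. hp.hterm m a (\<nu> i) else 0)"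
proof -
  let ?V = "proj_mod PP PM \<alpha> r 1"
  interpret T: tensor_module "proj_basis PP r" "proj_K PP Qp r (\<alpha> ^ PM * (- 1) ^ (1 - 1))"
    "proj_e PP Qp r (\<alpha> ^ PM * (- 1) ^ (1 - 1))" "proj_f PP r"
    "proj_basis PM 1" "proj_K PM Qm 1 (\<alpha> ^ PP * (- 1) ^ (r - 1))"
    "proj_e PM Qm 1 (\<alpha> ^ PP * (- 1) ^ (r - 1))" "proj_f PM 1" ?V "proj_k \<alpha> r 1"
    by (rule tensor_module_proj) (use r \<alpha> one_less_P in simp_all)
  have sq: "(\<alpha> ^ PM) ^ 2 = 1" using sign_power_sq[OF \<alpha>, of PM 0] by simp
  have "lookup (ga ?V (KK (int PM - int PP) * (Gfe m n * (Gef m' n' * P1 a))) (vec (Up i, Dn 0))) (Dn i, Dn 0) =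
      (if m = m' \<and> n = 0 \<and> n' = 0 then hp.hterm m a (\<nu> i) else 0)" if i: "i < r" for i
  proof -
    let ?t = "- 2 * int PM * int (\<nu> i)"
    have mem: "Up i \<in> proj_basis PP r" "Dn i \<in> proj_basis PP r" "Dn 0 \<in> proj_basis PM 1" using i by (auto simp: proj_basis_def)
    have tw: "inverse Qp ^ (2 * \<nu> i) = qq powi (2 * int PM * ?t)"
      unfolding iQ_power by (rule arg_cong[where f = "(powi) qq"]) simp
    have t2: "1 = qq powi (2 * int PP * ?t)"
      using qq_powi_eq_1[of "2 * int PP * ?t"] by (simp add: mult.assoc mult.left_commute)
    have k: "proj_k \<alpha> r 1 (Up i) (Dn 0) = qz powi ?t" "proj_k \<alpha> r 1 (Dn i) (Dn 0) = qz powi ?t"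
      by (rule T.kk_eq; use mem w[OF i] w' tw t2 in simp)+
    have C: "ga ?V sp.Cas (vec (Up i, Dn 0)) = scl (csum Qp) (vec (Up i, Dn 0)) + scl (qp.h ^ 2) (vec (Dn i, Dn 0))"
      "ga ?V sp.Cas (vec (Dn i, Dn 0)) = scl (csum Qp) (vec (Dn i, Dn 0))"
    proof -
      have e: "qp.h ^ 2 * (\<alpha> ^ PM * qint Qp i * qint Qp (r - i)) +
          csum (Qp * (\<alpha> ^ PM * Qp powi (int r - 1 - 2 * int i))) = csum Qp"
        using qp.weight_identity(2)[OF sq i] c by simp
      show "ga ?V sp.Cas (vec (Up i, Dn 0)) = scl (csum Qp) (vec (Up i, Dn 0)) + scl (qp.h ^ 2) (vec (Dn i, Dn 0))"
        unfolding T.Cas_act(1)[OF mem(1,3)] qp.proj_fe[OF r mem(1)]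
        using e by (simp add: scl.scale_right_distrib scl.scale_left_distrib[symmetric])
      show "ga ?V sp.Cas (vec (Dn i, Dn 0)) = scl (csum Qp) (vec (Dn i, Dn 0))"
        unfolding T.Cas_act(1)[OF mem(2,3)] qp.proj_fe[OF r mem(2)]
        using e by (simp add: scl.scale_right_distrib scl.scale_left_distrib[symmetric])
    qed
    have kill: "proj_e PM Qm 1 (\<alpha> ^ PP * (- 1) ^ (r - 1)) (Dn 0) = 0" "proj_f PM 1 (Dn 0) = 0" by simp_all
    show ?thesis
      unfolding T.pseudotrace_p[OF mem tbasis.distinct(1) kill k C m] hp.hterm_def
        qp.dnewton_inverse[OF tw[symmetric]] by simp
  qed
  thus ?thesis by (auto simp: ptr_def intro!: sum.neutral)
qed

lemma trNW_value:
  assumes r: "1 \<le> r" "r < PM" and \<alpha>: "\<alpha> ^ 2 = 1"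
    and w: "\<And>n. n < r \<Longrightarrow> \<alpha> ^ PP * Qm powi (int r - 1 - 2 * int n) = Qm ^ (2 * \<nu> n)"
    and w': "\<alpha> ^ PM * (- 1) ^ (r - 1) = 1" and c: "csum (\<alpha> ^ PP * Qm ^ r) = csum Qm"
    and n: "n < PM" "n' < PM"
  shows "trNW \<alpha> r (Gfe m n * (Gef m' n' * P1 a)) = (if n = n' \<and> m = 0 \<and> m' = 0 then \<Sum>i<r. hm.hterm n a (\<nu> i) else 0)"
proof -
  let ?V = "proj_mod PP PM \<alpha> 1 r"
  interpret T: tensor_module "proj_basis PP 1" "proj_K PP Qp 1 (\<alpha> ^ PM * (- 1) ^ (r - 1))"
    "proj_e PP Qp 1 (\<alpha> ^ PM * (- 1) ^ (r - 1))" "proj_f PP 1"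
    "proj_basis PM r" "proj_K PM Qm r (\<alpha> ^ PP * (- 1) ^ (1 - 1))"
    "proj_e PM Qm r (\<alpha> ^ PP * (- 1) ^ (1 - 1))" "proj_f PM r" ?V "proj_k \<alpha> 1 r"
    by (rule tensor_module_proj) (use r \<alpha> one_less_P in simp_all)
  have sq: "(\<alpha> ^ PP) ^ 2 = 1" using sign_power_sq[OF \<alpha>, of PP 0] by simp
  have "lookup (ga ?V (KK (int PM - int PP) * (Gfe m n * (Gef m' n' * P1 a))) (vec (Dn 0, Up i))) (Dn 0, Dn i) =
      (if n = n' \<and> m = 0 \<and> m' = 0 then hm.hterm n a (\<nu> i) else 0)" if i: "i < r" for i
  proof -
    let ?t = "2 * int PP * int (\<nu> i)"
    have mem: "Dn 0 \<in> proj_basis PP 1" "Up i \<in> proj_basis PM r" "Dn i \<in> proj_basis PM r" using i by (auto simp: proj_basis_def)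
    have tw: "Qm ^ (2 * \<nu> i) = qq powi (2 * int PP * ?t)"
      unfolding Q_power by (rule arg_cong[where f = "(powi) qq"]) simp
    have tw': "inverse Qm ^ (2 * \<nu> i) = qq powi (- 2 * int PP * ?t)"
      unfolding iQ_power by (rule arg_cong[where f = "(powi) qq"]) simp
    have t2: "1 = qq powi (2 * int PM * ?t)"
      using qq_powi_eq_1[of "2 * int PM * ?t"] by (simp add: mult.assoc mult.left_commute)
    have k: "proj_k \<alpha> 1 r (Dn 0) (Up i) = qz powi ?t" "proj_k \<alpha> 1 r (Dn 0) (Dn i) = qz powi ?t"
      by (rule T.kk_eq; use mem w[OF i] w' tw t2 in simp)+
    have C: "ga ?V sm.Cas (vec (Dn 0, Up i)) = scl (csum Qm) (vec (Dn 0, Up i)) + scl (qm.h ^ 2) (vec (Dn 0, Dn i))"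
      "ga ?V sm.Cas (vec (Dn 0, Dn i)) = scl (csum Qm) (vec (Dn 0, Dn i))"
    proof -
      have e: "qm.h ^ 2 * (\<alpha> ^ PP * qint Qm (i + 1) * qint Qm (r - (i + 1))) +
          csum (inverse Qm * (\<alpha> ^ PP * Qm powi (int r - 1 - 2 * int i))) = csum Qm"
        using qm.weight_identity(3)[OF sq i] c by simp
      show "ga ?V sm.Cas (vec (Dn 0, Up i)) = scl (csum Qm) (vec (Dn 0, Up i)) + scl (qm.h ^ 2) (vec (Dn 0, Dn i))"
        unfolding T.Cas_act(2)[OF mem(1,2)] qm.proj_ef[OF r mem(2)]
        using e by (simp add: scl.scale_right_distrib scl.scale_left_distrib[symmetric])
      show "ga ?V sm.Cas (vec (Dn 0, Dn i)) = scl (csum Qm) (vec (Dn 0, Dn i))"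
        unfolding T.Cas_act(2)[OF mem(1,3)] qm.proj_ef[OF r mem(3)]
        using e by (simp add: scl.scale_right_distrib scl.scale_left_distrib[symmetric])
    qed
    have kill: "proj_e PP Qp 1 (\<alpha> ^ PM * (- 1) ^ (r - 1)) (Dn 0) = 0" "proj_f PP 1 (Dn 0) = 0" by simp_all
    show ?thesis
      unfolding T.pseudotrace_m[OF mem tbasis.distinct(1) kill k C n] hm.hterm_def
        qm.dnewton_inverse[OF tw'[symmetric]] by simp
  qed
  thus ?thesis by (auto simp: ptr_def intro!: sum.neutral)
qed

lemma Qpar_self_power: "Qp ^ PP = (- 1) ^ PM" "Qm ^ PM = (- 1) ^ PP"
proof -
  have "Qpar a b ^ a = (- 1) ^ b" if "0 < a" for a b
    using qpar_self_power[OF that] by (metis Qpar_def power_mult mult.commute)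
  thus "Qp ^ PP = (- 1) ^ PM" "Qm ^ PM = (- 1) ^ PP" by simp_all
qed

definition gNE :: "gA \<Rightarrow> complex" where "gNE z = 1 / qp.h * (trNE 1 1 z + trNE (- 1) (PP - 1) z)"
definition gNW :: "gA \<Rightarrow> complex" where "gNW z = 1 / qm.h * (trNW 1 1 z + trNW (- 1) (PM - 1) z)"

lemma P_minus: "1 \<le> PP - 1" "PP - 1 < PP" "1 \<le> PM - 1" "PM - 1 < PM"
  using PP_ge_2 PM_ge_2 by auto

lemma gamma_coset: "gamma_NE PP PM (coset z) = gNE z" "gamma_NW PP PM (coset z) = gNW z"
  unfolding gamma_NE_def gamma_NW_def gNE_def gNW_def Let_def qp.h_def[symmetric] qm.h_def[symmetric]
  using twisted_trace_NE[of 1 1 z] twisted_trace_NE[of "PP - 1" "- 1" z]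
    twisted_trace_NW[of 1 1 z] twisted_trace_NW[of "PM - 1" "- 1" z] P_minus one_less_P
  by simp_all

lemma g_linear:
  "gNE (x + y) = gNE x + gNE y" "gNE (c *s x) = c * gNE x" "gNW (x + y) = gNW x + gNW y" "gNW (c *s x) = c * gNW x"
  using P_minus one_less_P by (simp_all add: gNE_def gNW_def ptr_linear proj_basis_def image_iff algebra_simps)

text \<open>The first module supplies N = 0 and the second N = 1, ..., p_+ - 1. Together their
  weights fill one full period of Q^(2N), which is what makes the sums in \<open>chi_coeff\<close>
  cyclic.\<close>

lemma gNE_value:
  assumes m: "m < PP" "m' < PP"
  shows "gNE (Gfe m n * (Gef m' n' * P1 a)) = (if m = m' \<and> n = 0 \<and> n' = 0 then 1 / qp.h * (\<Sum>N<PP. hp.hterm m a N) else 0)"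
proof -
  let ?Q = "Qp"
  have 1: "trNE 1 1 (Gfe m n * (Gef m' n' * P1 a)) = (if m = m' \<and> n = 0 \<and> n' = 0 then \<Sum>i<1. hp.hterm m a i else 0)"
    by (rule trNE_value) (use m one_less_P in simp_all)
  have QP: "(- 1) ^ PM * ?Q powi (int (PP - 1) - 1 - 2 * int n) = inverse ?Q ^ (2 * Suc n)" for n
  proof -
    have "int (PP - 1) - 1 - 2 * int n = int PP + - int (2 * Suc n)" using P_minus by simp
    hence "?Q powi (int (PP - 1) - 1 - 2 * int n) = ?Q ^ PP * inverse ?Q ^ (2 * Suc n)"
      by (simp only: power_int_add[OF disjI1[OF qp.Q_nz]] power_int_minus power_int_of_nat power_inverse)
    thus ?thesis unfolding Qpar_self_power by (simp add: power_mult_distrib[symmetric] del: power_Suc mult_Suc_right)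
  qed
  have s1: "(- 1) ^ PP * (- 1) ^ (PP - 1 - 1) = (1 :: complex)"
  proof -
    have "PP + (PP - 1 - 1) = 2 * (PP - 1)" using PP_ge_2 by simp
    thus ?thesis by (simp only: power_add[symmetric]) simp
  qed
  have c1: "csum ((- 1) ^ PM * ?Q ^ (PP - 1)) = csum ?Q"
  proof -
    have "?Q ^ PP = ?Q * ?Q ^ (PP - 1)" using PP_ge_2 by (metis PP_pos power_minus_mult mult.commute)
    hence "?Q ^ (PP - 1) = inverse ?Q * (- 1) ^ PM" unfolding Qpar_self_power by simp
    hence "(- 1) ^ PM * ?Q ^ (PP - 1) = inverse ?Q" by simp
    thus ?thesis by simp
  qed
  have 2: "trNE (- 1) (PP - 1) (Gfe m n * (Gef m' n' * P1 a)) = (if m = m' \<and> n = 0 \<and> n' = 0 then \<Sum>i<PP - 1. hp.hterm m a (Suc i) else 0)"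
    by (rule trNE_value) (use m P_minus QP s1 c1 in simp_all)
  have "(\<Sum>N<PP. hp.hterm m a N) = (\<Sum>i<1. hp.hterm m a i) + (\<Sum>i<PP - 1. hp.hterm m a (Suc i))"
    using sum.lessThan_Suc_shift[of "hp.hterm m a" "PP - 1"] PP_ge_2 by simp
  thus ?thesis unfolding gNE_def 1 2 by auto
qed

lemma gNW_value:
  assumes n: "n < PM" "n' < PM"
  shows "gNW (Gfe m n * (Gef m' n' * P1 a)) = (if n = n' \<and> m = 0 \<and> m' = 0 then 1 / qm.h * (\<Sum>N<PM. hm.hterm n a N) else 0)"
proof -
  let ?Q = "Qm"
  have 1: "trNW 1 1 (Gfe m n * (Gef m' n' * P1 a)) = (if n = n' \<and> m = 0 \<and> m' = 0 then \<Sum>i<1. hm.hterm n a i else 0)"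
    by (rule trNW_value) (use n one_less_P in simp_all)
  have QP: "(- 1) ^ PP * ?Q powi (int (PM - 1) - 1 - 2 * int n) = ?Q ^ (2 * (PM - 1 - n))" if "n < PM - 1" for n
  proof -
    have "int (PM - 1) - 1 - 2 * int n = int (2 * (PM - 1 - n)) - int PM" using that by simp
    hence "?Q powi (int (PM - 1) - 1 - 2 * int n) = ?Q ^ (2 * (PM - 1 - n)) / ?Q ^ PM"
      by (simp only: power_int_diff[OF disjI1[OF qm.Q_nz]] power_int_of_nat)
    thus ?thesis unfolding Qpar_self_power by simp
  qed
  have s1: "(- 1) ^ PM * (- 1) ^ (PM - 1 - 1) = (1 :: complex)"
  proof -
    have "PM + (PM - 1 - 1) = 2 * (PM - 1)" using PM_ge_2 by simp
    thus ?thesis by (simp only: power_add[symmetric]) simp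
  qed
  have c1: "csum ((- 1) ^ PP * ?Q ^ (PM - 1)) = csum ?Q"
  proof -
    have "?Q ^ PM = ?Q * ?Q ^ (PM - 1)" using PM_ge_2 by (metis PM_pos power_minus_mult mult.commute)
    hence "?Q ^ (PM - 1) = inverse ?Q * (- 1) ^ PP" unfolding Qpar_self_power by simp
    hence "(- 1) ^ PP * ?Q ^ (PM - 1) = inverse ?Q" by simp
    thus ?thesis by simp
  qed
  have 2: "trNW (- 1) (PM - 1) (Gfe m n * (Gef m' n' * P1 a)) = (if n = n' \<and> m = 0 \<and> m' = 0 then \<Sum>i<PM - 1. hm.hterm n a (PM - 1 - i) else 0)"
    by (rule trNW_value) (use n P_minus QP s1 c1 in simp_all)
  \<comment> \<open>With e_- and f_- exchanged, the weights of the second module run through the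
    list backwards.\<close>
  have "(\<Sum>i<PM - 1. hm.hterm n a (PM - 1 - i)) = (\<Sum>i<PM - 1. hm.hterm n a (Suc i))"
    by (rule sum.reindex_bij_witness[of _ "\<lambda>i. PM - 1 - Suc i" "\<lambda>i. PM - 1 - Suc i"]) (auto simp: Suc_diff_Suc)
  hence "(\<Sum>N<PM. hm.hterm n a N) = (\<Sum>i<1. hm.hterm n a i) + (\<Sum>i<PM - 1. hm.hterm n a (PM - 1 - i))"
    using sum.lessThan_Suc_shift[of "hm.hterm n a" "PM - 1"] PM_ge_2 by simp
  thus ?thesis unfolding gNW_def 1 2 by auto
qed

subsection \<open>Images under the Drinfeld map\<close>

lemma sum_diag:
  fixes F :: "nat \<Rightarrow> nat \<Rightarrow> nat \<Rightarrow> nat \<Rightarrow> 'v::comm_monoid_add"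
  assumes F: "\<And>m n m' n'. m < M \<Longrightarrow> n < N \<Longrightarrow> m' < M \<Longrightarrow> n' < N \<Longrightarrow> F m n m' n' = (if m' = m \<and> n = 0 \<and> n' = 0 then H m else 0)"
    and N: "0 < N"
  shows "(\<Sum>m<M. \<Sum>n<N. \<Sum>m'<M. \<Sum>n'<N. F m n m' n') = (\<Sum>m<M. H m)"
proof (rule sum.cong[OF refl])
  fix m assume "m \<in> {..<M}"
  hence m: "m < M" by simp
  have 1: "(\<Sum>n'<N. F m n m' n') = (if m' = m then if n = 0 then H m else 0 else 0)" if "n < N" "m' < M" for n m'
  proof -
    have "(\<Sum>n'<N. F m n m' n') = (\<Sum>n'<N. if n' = 0 then if m' = m then if n = 0 then H m else 0 else 0 else 0)"
      by (rule sum.cong[OF refl]) (simp add: F m that)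
    with N show ?thesis by simp
  qed
  have "(\<Sum>m'<M. \<Sum>n'<N. F m n m' n') = (if n = 0 then H m else 0)" if "n < N" for n
  proof -
    have "(\<Sum>m'<M. \<Sum>n'<N. F m n m' n') = (\<Sum>m'<M. if m' = m then if n = 0 then H m else 0 else 0)"
      by (rule sum.cong[OF refl]) (simp only: 1 that lessThan_iff)
    with m show ?thesis by simp
  qed
  hence "(\<Sum>n<N. \<Sum>m'<M. \<Sum>n'<N. F m n m' n') = (\<Sum>n<N. if n = 0 then H m else 0)"
    by (intro sum.cong refl) simp
  with N show "(\<Sum>n<N. \<Sum>m'<M. \<Sum>n'<N. F m n m' n') = H m" by simp
qed

lemma rr_0: "rr m 0 = sp.rcoeff m" "rr 0 n = sm.rcoeff n"
  by (simp_all add: rr_def sp.rcoeff_def sm.rcoeff_def qp.brf_def qm.brf_def)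

lemma chi_NW_coset: "chi_NW PP PM = coset hp.chi_elem"
  unfolding chi_NW_def drinfeld_map_coset[OF gamma_coset(1) g_linear(1,2)] hp.chi_elem_def
proof (rule arg_cong[where f = coset], rule sum_diag)
  fix m n m' n' assume "m < PP" "m' < PP"
  note v = gNE_value[OF this]
  show "(rr m n * rr m' n') *s (\<Sum>b<LL. (qq powi (wE m' n' * int b + wE m' n' ^ 2) * gNE (Gfe m n * (Gef m' n' * P1 (int b)))) *s
       (Gef m n * (Gfe m' n' * KK (- int b - wh m' n')))) =
    (if m' = m \<and> n = 0 \<and> n' = 0 then \<Sum>b<LL. (sp.rcoeff m ^ 2 * qq powi (2 * (int PM * int m) * int b + (2 * (int PM * int m)) ^ 2) *
       (1 / qp.h * (\<Sum>N<PP. hp.hterm m (int b) N))) *s (G Ep ^ m * (G Fp ^ m * KK (- int b - int PM * int m))) else 0)"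
    unfolding v by (auto simp: rr_0 wE_def wh_def sca.scale_sum_right power2_eq_square mult.assoc)
qed simp

lemma chi_NE_coset: "chi_NE PP PM = coset hm.chi_elem"
  unfolding chi_NE_def drinfeld_map_coset[OF gamma_coset(2) g_linear(3,4)] hm.chi_elem_def
\<comment> \<open>Interchanging the sums puts the surviving index n in front, as
  \<open>sum_diag\<close> expects.\<close>
proof (rule arg_cong[where f = coset], subst sum.swap, subst (3) sum.swap, rule sum_diag)
  fix n m n' m' assume "n < PM" "n' < PM"
  note v = gNW_value[OF this]
  show "(rr m n * rr m' n') *s (\<Sum>b<LL. (qq powi (wE m' n' * int b + wE m' n' ^ 2) * gNW (Gfe m n * (Gef m' n' * P1 (int b)))) *s
       (Gef m n * (Gfe m' n' * KK (- int b - wh m' n')))) =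
    (if n' = n \<and> m = 0 \<and> m' = 0 then \<Sum>b<LL. (sm.rcoeff n ^ 2 * qq powi (2 * (- int PP * int n) * int b + (2 * (- int PP * int n)) ^ 2) *
       (1 / qm.h * (\<Sum>N<PM. hm.hterm n (int b) N))) *s (G Fm ^ n * (G Em ^ n * KK (- int b - - int PP * int n))) else 0)"
    unfolding v by (auto simp: rr_0 wE_def wh_def sca.scale_sum_right power2_eq_square mult.assoc)
qed simp

section \<open>Spectral decomposition\<close>

lemma bezout_linear_power:
  fixes g :: "complex poly"
  assumes "poly g c \<noteq> 0"
  shows "\<exists>u v. u * [:- c, 1:] ^ m + v * g = 1"
proof (induction m)
  case 0
  show ?case by (rule exI[of _ 1], rule exI[of _ 0]) simp
next
  case (Suc m)
  then obtain u v where uv: "u * [:- c, 1:] ^ m + v * g = 1" by blast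
  have "poly (g - [:poly g c:]) c = 0" by simp
  then obtain g1 where g1: "g - [:poly g c:] = [:- c, 1:] * g1" unfolding poly_eq_0_iff_dvd by (rule dvdE)
  let ?b = "[:1 / poly g c:]"
  have "?b * [:poly g c:] = 1" using assms by simp
  hence 1: "- (?b * g1) * [:- c, 1:] + ?b * g = 1"
    using g1 by (metis (no_types, lifting) add_diff_cancel_left' diff_add_cancel distrib_left mult.assoc mult.commute mult_minus_left uminus_add_conv_diff)
  have "(u * - (?b * g1)) * [:- c, 1:] ^ Suc m + (u * [:- c, 1:] ^ m * ?b + v) * g =
      u * [:- c, 1:] ^ m * (- (?b * g1) * [:- c, 1:] + ?b * g) + v * g"
    by (simp only: power_Suc distrib_left distrib_right mult_ac add_ac)
  also have "\<dots> = 1" unfolding 1 using uv by simp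
  finally show ?case by blast
qed

text \<open>Induction on the set of roots. With 1 = u f + v g for a power f of one linear factor and
  the product g of the others, z splits into a piece killed by g and one killed by f. Both are
  polynomial multiples of z, which is why \<open>loc\<close> is phrased for such multiples.\<close>

lemma primary_decomposition:
  fixes C z :: "'m::presented_monoid alg"
  assumes "finite S" and zero: "\<Phi> 0" and add: "\<And>u v. \<Phi> u \<Longrightarrow> \<Phi> v \<Longrightarrow> \<Phi> (u + v)"
    and loc: "\<And>R c. c \<in> S \<Longrightarrow> peval ([:- c, 1:] ^ m c) C * (peval R C * z) = 0 \<Longrightarrow> \<Phi> (peval R C * z)"
    and ann: "peval (\<Prod>c\<in>S. [:- c, 1:] ^ m c) C * z = 0"
  shows "\<Phi> z"
  using assms(1) loc ann
proof (induction S arbitrary: z)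
  case empty
  thus ?case using zero by simp
next
  case (insert c S)
  let ?f = "[:- c, 1:] ^ m c" and ?g = "\<Prod>c\<in>S. [:- c, 1:] ^ m c"
  have "poly ?g c \<noteq> 0" using insert.hyps by (auto simp: poly_prod)
  then obtain u v where uv: "u * ?f + v * ?g = 1" using bezout_linear_power by blast
  have "z = peval (u * ?f + v * ?g) C * z" by (simp add: uv)
  hence z: "z = peval (u * ?f) C * z + peval (v * ?g) C * z" by (simp add: peval_add distrib_right)
  have c: "peval F C * (peval H C * w) = peval (F * H) C * w" for F H w by (simp add: peval_mult mult.assoc)
  have fg: "peval (?f * ?g) C * z = 0" using insert.prems(2) insert.hyps by simp
  have "\<Phi> (peval (u * ?f) C * z)"
  proof (rule insert.IH)
    fix R d assume d: "d \<in> S" "peval ([:- d, 1:] ^ m d) C * (peval R C * (peval (u * ?f) C * z)) = 0"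
    thus "\<Phi> (peval R C * (peval (u * ?f) C * z))"
      using insert.prems(1)[of d "R * (u * ?f)"] by (simp only: c insert_iff simp_thms)
  next
    have "?g * (u * ?f) = u * (?f * ?g)" by (simp only: mult_ac)
    thus "peval ?g C * (peval (u * ?f) C * z) = 0"
      unfolding c by (simp only: peval_mult[of u] mult.assoc fg mult_zero_right)
  qed
  moreover have "\<Phi> (peval (v * ?g) C * z)"
  proof (rule insert.prems(1))
    have "?f * (v * ?g) = v * (?f * ?g)" by (simp only: mult_ac)
    thus "peval ?f C * (peval (v * ?g) C * z) = 0"
      unfolding c by (simp only: peval_mult[of v] mult.assoc fg mult_zero_right)
  qed simp
  ultimately have "\<Phi> (peval (u * ?f) C * z + peval (v * ?g) C * z)" by (rule add)
  thus ?case using z by simp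
qed

lemma newton_fibers: "newton n p = (\<Prod>c\<in>n ` {..<p}. [:- c, 1:] ^ card {l \<in> {..<p}. n l = c})"
proof -
  have "newton n p = (\<Prod>c\<in>n ` {..<p}. \<Prod>l\<in>{l \<in> {..<p}. n l = c}. [:- n l, 1:])"
    unfolding newton_def by (rule prod.image_gen) simp
  also have "\<dots> = (\<Prod>c\<in>n ` {..<p}. \<Prod>l\<in>{l \<in> {..<p}. n l = c}. [:- c, 1:])"
    by (intro prod.cong refl) simp
  finally show ?thesis by simp
qed

text \<open>Equal values of \<open>csum\<close> mean equal or inverse arguments, so besides i only
  its partner j can give the same node.\<close>

lemma (in qroot) csum_fiber:
  assumes x: "x \<noteq> 0" and ij: "i < p" "j < p" "(x * Q) ^ 2 * Q ^ (2 * (i + j)) = 1"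
  shows "{l \<in> {..<p}. csum (x * Q * Q ^ (2 * l)) = csum (x * Q * Q ^ (2 * i))} \<subseteq> {i, j}"
proof
  fix l assume "l \<in> {l \<in> {..<p}. csum (x * Q * Q ^ (2 * l)) = csum (x * Q * Q ^ (2 * i))}"
  hence l: "l < p" and e: "csum (x * Q * Q ^ (2 * l)) = csum (x * Q * Q ^ (2 * i))" by auto
  have inj: "a = b" if "Q ^ (2 * a) = Q ^ (2 * b)" "a < p" "b < p" for a b
  proof (rule ccontr)
    assume "a \<noteq> b"
    have *: False if "a < b" "b < p" "Q ^ (2 * a) = Q ^ (2 * b)" for a b
    proof -
      have "2 * b = 2 * a + 2 * (b - a)" using that(1) by simp
      hence "Q ^ (2 * b) = Q ^ (2 * a) * Q ^ (2 * (b - a))" by (simp only: power_add)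
      hence "Q ^ (2 * (b - a)) = 1" using that(3) by simp
      thus False using Q_primitive[of "b - a"] that by simp
    qed
    from \<open>a \<noteq> b\<close> show False using *[of a b] *[of b a] that by (metis nat_neq_iff)
  qed
  from e have "Q ^ (2 * l) = Q ^ (2 * i) \<or> (x * Q * Q ^ (2 * l)) * (x * Q * Q ^ (2 * i)) = 1"
    using x by (subst (asm) csum_eq_iff) auto
  moreover have "Q ^ (2 * l) = Q ^ (2 * j)" if "(x * Q * Q ^ (2 * l)) * (x * Q * Q ^ (2 * i)) = 1"
  proof -
    have "(x * Q) ^ 2 * Q ^ (2 * i) * Q ^ (2 * l) = (x * Q) ^ 2 * Q ^ (2 * i) * Q ^ (2 * j)"
      using that ij(3) by (simp add: power2_eq_square power_add mult_ac distrib_left)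
    thus ?thesis using x by simp
  qed
  ultimately show "l \<in> {i, j}" using inj l ij by auto
qed

context sector
begin

text \<open>The multiplicity of a node is at most the order to which \<open>ribbon_chi_jet\<close>
  compares the two polynomials, so they agree on each primary piece up to the scalar.
  \<open>exists_partner\<close> supplies the second index of the node.\<close>

lemma spectral_induct:
  assumes w: "wt x z" and x: "x ^ (2 * p) = 1" and zero: "\<Phi> 0" and add: "\<And>u v. \<Phi> u \<Longrightarrow> \<Phi> v \<Longrightarrow> \<Phi> (u + v)"
    and loc: "\<And>R i j. i \<le> j \<Longrightarrow> j < p \<Longrightarrow> (x * Q) ^ 2 * Q ^ (2 * (i + j)) = 1 \<Longrightarrow>
      peval (rib_poly (x * Q)) Cas * (peval R Cas * z) = ((x * Q) ^ (2 * i) * Q ^ (2 * i ^ 2)) *s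
        (peval (1 + smult (1 / of_nat p) (chi_poly (x * iQ))) Cas * (peval R Cas * z)) \<Longrightarrow>
      (Cas - csum (x * Q ^ (2 * i + 1)) *s 1) * ((Cas - csum (x * Q ^ (2 * i + 1)) *s 1) * (peval R Cas * z)) = 0 \<Longrightarrow>
      \<Phi> (peval R Cas * z)"
  shows "\<Phi> z"
proof (rule primary_decomposition[where C = Cas and S = "(\<lambda>l. csum (x * Q * Q ^ (2 * l))) ` {..<p}"
      and m = "\<lambda>c. card {l \<in> {..<p}. csum (x * Q * Q ^ (2 * l)) = c}"])
  let ?n = "\<lambda>l. csum (x * Q * Q ^ (2 * l))" and ?m = "\<lambda>c. card {l \<in> {..<p}. csum (x * Q * Q ^ (2 * l)) = c}"
  show "peval (\<Prod>c\<in>?n ` {..<p}. [:- c, 1:] ^ ?m c) Cas * z = 0"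
    using Cas_relation[OF w] unfolding newton_fibers by simp
  fix R c assume "c \<in> ?n ` {..<p}" and kill: "peval ([:- c, 1:] ^ ?m c) Cas * (peval R Cas * z) = 0"
  then obtain l where l: "l < p" "c = ?n l" by auto
  have x0: "x \<noteq> 0" using w by (simp add: wt_def)
  obtain l' where l': "l' < p" "(x * Q) ^ 2 * Q ^ (2 * (l + l')) = 1" using exists_partner[OF x l(1)] by blast
  define i j where "i = min l l'" and "j = max l l'"
  have ij: "i \<le> j" "j < p" "(x * Q) ^ 2 * Q ^ (2 * (i + j)) = 1" "{l, l'} = {i, j}"
    using l l' by (auto simp: i_def j_def min_def max_def add.commute)
  have "?n l = ?n l'"
  proof -
    have "(x * Q * Q ^ (2 * l)) * (x * Q * Q ^ (2 * l')) = 1"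
      using l'(2) by (simp add: power2_eq_square power_add mult_ac distrib_left)
    thus ?thesis using x0 by (subst csum_eq_iff) auto
  qed
  hence ci: "c = csum (x * Q ^ (2 * i + 1))"
    using l(2) by (auto simp: i_def min_def mult_ac)
  have sub: "{k \<in> {..<p}. ?n k = c} \<subseteq> {i, j}"
    using csum_fiber[OF x0 l(1) l'] l(2) ij(4) by simp
  have mle: "?m c \<le> (if i < j then 2 else 1)"
  proof (cases "i < j")
    case True
    have "?m c \<le> card {i, j}" by (rule card_mono[OF _ sub]) simp
    with True show ?thesis by simp
  next
    case False
    have "?m c \<le> card {i}" by (rule card_mono) (use sub False ij(1) in auto)
    with False show ?thesis by simp
  qed
  have dvd_kill: "peval F Cas * (peval R Cas * z) = 0" if F: "[:- c, 1:] ^ ?m c dvd F" for F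
  proof -
    obtain F' where "F = [:- c, 1:] ^ ?m c * F'" using F by (rule dvdE)
    hence "F = F' * [:- c, 1:] ^ ?m c" by (simp only: mult.commute)
    thus ?thesis by (simp only: peval_mult mult.assoc[of "peval F' Cas"] kill mult_zero_right)
  qed
  show "\<Phi> (peval R Cas * z)"
  proof (rule loc[OF ij(1-3)])
    let ?F = "rib_poly (x * Q) - smult ((x * Q) ^ (2 * i) * Q ^ (2 * i ^ 2)) (1 + smult (1 / of_nat p) (chi_poly (x * iQ)))"
    have "[:- c, 1:] ^ (if i < j then 2 else 1) dvd ?F"
      using ribbon_chi_jet[OF x ij(1-3)] unfolding ci .
    hence "[:- c, 1:] ^ ?m c dvd ?F" using mle by (meson dvd_trans le_imp_power_dvd)
    from dvd_kill[OF this] show "peval (rib_poly (x * Q)) Cas * (peval R Cas * z) = ((x * Q) ^ (2 * i) * Q ^ (2 * i ^ 2)) *s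
        (peval (1 + smult (1 / of_nat p) (chi_poly (x * iQ))) Cas * (peval R Cas * z))"
      by (simp only: peval_diff peval_smult left_diff_distrib sca_mult_left right_minus_eq)
    have "?m c \<le> 2" using mle by (auto split: if_splits)
    hence "[:- c, 1:] ^ ?m c dvd [:- c, 1:] ^ 2" by (rule le_imp_power_dvd)
    from dvd_kill[OF this] show "(Cas - csum (x * Q ^ (2 * i + 1)) *s 1) * ((Cas - csum (x * Q ^ (2 * i + 1)) *s 1) * (peval R Cas * z)) = 0"
      unfolding ci[symmetric] by (simp add: power2_eq_square peval_mult mult.assoc del: mult_pCons_left mult_pCons_right)
  qed
qed (use zero add in auto)

end

section \<open>Central elements on weight spaces\<close>

definition central :: "gA \<Rightarrow> bool" where "central c \<longleftrightarrow> (\<forall>z. c * z = z * c)"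

lemma central_closed:
  "central 1" "central 0" "central x \<Longrightarrow> central y \<Longrightarrow> central (x + y)" "central x \<Longrightarrow> central (c *s x)"
  "central x \<Longrightarrow> central y \<Longrightarrow> central (x * y)" "central x \<Longrightarrow> central y \<Longrightarrow> central (x - y)"
proof -
  show "central x \<Longrightarrow> central y \<Longrightarrow> central (x * y)"
    unfolding central_def by (intro allI commute_prod[symmetric]) simp_all
qed (simp_all add: central_def distrib_left distrib_right left_diff_distrib right_diff_distrib)

lemma central_Cas: "central sp.Cas" "central sm.Cas"
  using Cas_central by (auto simp: central_def)

lemma central_peval: "central (peval P sp.Cas)" "central (peval P sm.Cas)"
  using peval_Cas_central by (auto simp: central_def)

text \<open>Every element is a combination of Casimir elements and monomials using only one of \<open>e, f\<close> in each sector.\<close>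

inductive_set pbw :: "gA set" where
  mono: "x \<in> {Ep, Fp} \<Longrightarrow> y \<in> {Em, Fm} \<Longrightarrow>
    c *s (sp.Cas ^ u * (sm.Cas ^ v * (G x ^ m * (G y ^ n * KK t)))) \<in> pbw"
| add: "w \<in> pbw \<Longrightarrow> z \<in> pbw \<Longrightarrow> w + z \<in> pbw"

lemma pbw_scale: "z \<in> pbw \<Longrightarrow> c *s z \<in> pbw"
proof (induction rule: pbw.induct)
  case mono
  thus ?case by (simp add: pbw.mono)
qed (simp add: sca.scale_right_distrib pbw.add)

lemma pbw_Cas: "z \<in> pbw \<Longrightarrow> sp.Cas * z \<in> pbw" "z \<in> pbw \<Longrightarrow> sm.Cas * z \<in> pbw"
proof -
  have c: "sm.Cas * (sp.Cas ^ u * w) = sp.Cas ^ u * (sm.Cas * w)" for u w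
    using Cas_central(2)[of "sp.Cas ^ u"] by (simp only: mult.assoc[symmetric])
  show "z \<in> pbw \<Longrightarrow> sp.Cas * z \<in> pbw"
  proof (induction rule: pbw.induct)
    case (mono x y c u v m n t)
    thus ?case using pbw.mono[of x y c "Suc u" v m n t] by (simp add: mult.assoc)
  qed (simp add: distrib_left pbw.add)
  show "z \<in> pbw \<Longrightarrow> sm.Cas * z \<in> pbw"
  proof (induction rule: pbw.induct)
    case (mono x y c' u v m n t)
    thus ?case using pbw.mono[of x y c' u "Suc v" m n t] by (simp add: mult.assoc c)
  qed (simp add: distrib_left pbw.add)
qed

lemma pbw_diff: "w \<in> pbw \<Longrightarrow> z \<in> pbw \<Longrightarrow> w - z \<in> pbw"
  using pbw.add[OF _ pbw_scale[of z "- 1"], of w] by simp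

lemma pbw_KK: "z \<in> pbw \<Longrightarrow> KK s * z \<in> pbw"
proof (induction rule: pbw.induct)
  case (mono x y c u v m n t)
  have "\<exists>a. KK s * (G x ^ m * (G y ^ n * w)) = a *s (G x ^ m * (G y ^ n * (KK s * w)))" for w
  proof -
    have k: "KK s * (g ^ k * w) = (qz powi (d * s)) ^ k *s (g ^ k * (KK s * w))" if "KK s * g = qz powi (d * s) *s (g * KK s)" for g w d k
      using power_commute[OF that, of 1 k] by (simp only: mult.assoc[symmetric] power_one_right mult_1_left sca_mult_left)
    show ?thesis unfolding k[OF KK_G] by (auto simp: intro!: exI)
  qed
  then obtain a where a: "KK s * (G x ^ m * (G y ^ n * KK t)) = a *s (G x ^ m * (G y ^ n * (KK s * KK t)))" by blast
  have "KK s * (sp.Cas ^ u * (sm.Cas ^ v * w)) = sp.Cas ^ u * (sm.Cas ^ v * (KK s * w))" for w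
  proof -
    have "KK s * (sp.Cas ^ u * w) = sp.Cas ^ u * (KK s * w)" "KK s * (sm.Cas ^ v * w) = sm.Cas ^ v * (KK s * w)" for w
      using power_commuting_commutes[OF sp_Cas_KK, of u s] power_commuting_commutes[OF sm_Cas_KK, of v s]
      by (simp_all only: mult.assoc[symmetric])
    thus ?thesis by (simp only:)
  qed
  hence "KK s * (c *s (sp.Cas ^ u * (sm.Cas ^ v * (G x ^ m * (G y ^ n * KK t))))) =
      (c * a) *s (sp.Cas ^ u * (sm.Cas ^ v * (G x ^ m * (G y ^ n * KK (s + t)))))"
    by (simp add: a gK.kp_add)
  thus ?case using pbw.mono[OF mono] by simp
qed (simp add: distrib_left pbw.add)

lemma ef_Cas:
  "G Fp * G Ep = (1 / qp.h ^ 2) *s (sp.Cas - Qp *s KK (int PM) - inverse Qp *s KK (- int PM))"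
  "G Ep * G Fp = (1 / qp.h ^ 2) *s (sp.Cas - inverse Qp *s KK (int PM) - Qp *s KK (- int PM))"
  "G Em * G Fm = (1 / qm.h ^ 2) *s (sm.Cas - Qm *s KK (- int PP) - inverse Qm *s KK (int PP))"
  "G Fm * G Em = (1 / qm.h ^ 2) *s (sm.Cas - inverse Qm *s KK (- int PP) - Qm *s KK (int PP))"
proof -
  have h: "(1 / qp.h ^ 2) *s (qp.h ^ 2 *s w) = w" "(1 / qm.h ^ 2) *s (qm.h ^ 2 *s w) = w" for w :: gA
    using qp.h_nz qm.h_nz by simp_all
  show "G Fp * G Ep = (1 / qp.h ^ 2) *s (sp.Cas - Qp *s KK (int PM) - inverse Qp *s KK (- int PM))"
    unfolding sp.Cas_def by (simp add: h del: sca.scale_scale)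
  show "G Ep * G Fp = (1 / qp.h ^ 2) *s (sp.Cas - inverse Qp *s KK (int PM) - Qp *s KK (- int PM))"
    unfolding sp.Cas_ef by (simp add: h del: sca.scale_scale)
  show "G Em * G Fm = (1 / qm.h ^ 2) *s (sm.Cas - Qm *s KK (- int PP) - inverse Qm *s KK (int PP))"
    unfolding sm.Cas_def by (simp add: h del: sca.scale_scale)
  show "G Fm * G Em = (1 / qm.h ^ 2) *s (sm.Cas - inverse Qm *s KK (- int PP) - Qm *s KK (int PP))"
    unfolding sm.Cas_ef by (simp add: h del: sca.scale_scale)
qed

text \<open>A new generator either lengthens the monomial of its sector or meets the opposite
  generator; then the product of the two is replaced by the Casimir element and powers of K
  (\<open>ef_Cas\<close>).\<close>

lemma pbw_gen: "z \<in> pbw \<Longrightarrow> G g * z \<in> pbw"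
proof (induction rule: pbw.induct)
  case (mono x y c u v m n t)
  let ?M = "\<lambda>x m y n t. G x ^ m * (G y ^ n * KK t)"
  have M: "?M x m y n t \<in> pbw" if "x \<in> {Ep, Fp}" "y \<in> {Em, Fm}" for x m y n t
    using pbw.mono[OF that, of 1 0 0 m n t] by simp
  have core: "G g * ?M x m y n t \<in> pbw"
  proof (cases "g = Kg")
    case True
    thus ?thesis using pbw_KK[OF M[OF mono], of 1] by (simp add: KK_1)
  next
    case False
    show ?thesis
    proof (cases "g \<in> {Ep, Fp}")
      case True
      show ?thesis
      proof (cases "g = x \<or> m = 0")
        case True
        hence "G g * ?M x m y n t = ?M g (Suc m) y n t" by (auto simp: mult.assoc)
        thus ?thesis using M[of g y "Suc m" n t] \<open>g \<in> {Ep, Fp}\<close> mono by simp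
      next
        case False
        then obtain m' where m': "m = Suc m'" by (cases m) auto
        have "G g * ?M x m y n t = (G g * G x) * ?M x m' y n t" by (simp add: m' mult.assoc)
        moreover have "\<exists>a b d. G g * G x = a *s (sp.Cas - b *s KK (int PM) - d *s KK (- int PM))"
          using False True mono ef_Cas(1,2) by blast
        ultimately obtain a b d where "G g * ?M x m y n t = a *s (sp.Cas * ?M x m' y n t - b *s (KK (int PM) * ?M x m' y n t) - d *s (KK (- int PM) * ?M x m' y n t))"
          by (auto simp: left_diff_distrib)
        thus ?thesis using M[OF mono] by (auto intro!: pbw_scale pbw_diff pbw_Cas pbw_KK)
      qed
    next
      case False
      hence g: "g \<in> {Em, Fm}" using \<open>g \<noteq> Kg\<close> by (cases g) auto
      have c: "G g * (G x ^ m * w) = G x ^ m * (G g * w)" for w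
        using pm_power_commute[OF mono(1) g, of m 1] by (simp add: mult.assoc[symmetric])
      show ?thesis
      proof (cases "g = y \<or> n = 0")
        case True
        hence "G g * ?M x m y n t = ?M x m g (Suc n) t" by (auto simp: mult.assoc c)
        thus ?thesis using M[of x g m "Suc n" t] g mono by simp
      next
        case False
        then obtain n' where n': "n = Suc n'" by (cases n) auto
        have "G g * ?M x m y n t = G x ^ m * ((G g * G y) * (G y ^ n' * KK t))" by (simp add: n' c mult.assoc)
        moreover have "\<exists>a b d. G g * G y = a *s (sm.Cas - b *s KK (- int PP) - d *s KK (int PP))"
          using False g mono ef_Cas(3,4) by blast
        ultimately obtain a b d where 1: "G g * ?M x m y n t = a *s (G x ^ m * (sm.Cas * (G y ^ n' * KK t)) -
            b *s (G x ^ m * (KK (- int PP) * (G y ^ n' * KK t))) - d *s (G x ^ m * (KK (int PP) * (G y ^ n' * KK t))))"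
          by (auto simp: left_diff_distrib right_diff_distrib)
        have k: "\<exists>a. KK s * G y ^ n' = a *s (G y ^ n' * KK s)" for s
          using power_commute[OF KK_G[of s y], of 1 n'] by auto
        have kk: "G x ^ m * (KK s * (G y ^ n' * KK t)) \<in> pbw" for s
        proof -
          obtain a where "KK s * G y ^ n' = a *s (G y ^ n' * KK s)" using k by blast
          hence "G x ^ m * (KK s * (G y ^ n' * KK t)) = a *s ?M x m y n' (s + t)"
            by (simp add: mult.assoc[symmetric]) (simp add: mult.assoc gK.kp_add)
          thus ?thesis using M[OF mono] by (auto intro!: pbw_scale)
        qed
        have "G x ^ m * (sm.Cas * w) = sm.Cas * (G x ^ m * w)" for w
          by (simp only: mult.assoc[symmetric] Cas_central(2)[of "G x ^ m"])
        thus ?thesis unfolding 1 using M[OF mono] kk by (auto intro!: pbw_scale pbw_diff pbw_Cas)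
      qed
    qed
  qed
  have C: "sp.Cas ^ u * w \<in> pbw" "sm.Cas ^ u * w \<in> pbw" if "w \<in> pbw" for u w
    by (induction u; use that pbw_Cas in \<open>simp add: mult.assoc\<close>)+
  have "G g * (sp.Cas ^ u * w) = sp.Cas ^ u * (G g * w)" "G g * (sm.Cas ^ v * w) = sm.Cas ^ v * (G g * w)" for w
    using power_commuting_commutes[OF Cas_G(1), of u g] power_commuting_commutes[OF Cas_G(2), of v g]
    by (simp_all only: mult.assoc[symmetric])
  hence "G g * (sp.Cas ^ u * (sm.Cas ^ v * w)) = sp.Cas ^ u * (sm.Cas ^ v * (G g * w))" for w
    by (simp only:)
  thus ?case using C core by (auto intro!: pbw_scale)
qed (simp add: distrib_left pbw.add)

lemma pbw_UNIV: "z \<in> pbw"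
proof -
  obtain x where x: "z = pr x" using pr_surj by metis
  have 0: "(0 :: gA) \<in> pbw" using pbw.mono[of Ep Em 0 0 0 0 0 0] by simp
  have "pr (vec w) \<in> pbw" for w
  proof (induction w)
    case Nil
    have "pr (vec ([] :: ggen list)) = 1" unfolding zero_list_def[symmetric] by simp
    thus ?case using pbw.mono[of Ep Em 1 0 0 0 0 0] by simp
  next
    case (Cons g w)
    have "pr (vec (g # w)) = G g * pr (vec w)" by (simp add: G_def vec_mult plus_list_def flip: pr_mult)
    thus ?case using pbw_gen[OF Cons] by simp
  qed
  moreover have "(\<Sum>a\<in>A. f a) \<in> pbw" if "\<And>a. f a \<in> pbw" for f and A :: "ggen list set"
    by (induction A rule: infinite_finite_induct) (auto simp: 0 that pbw.add)
  ultimately show ?thesis unfolding x pr_conv_lext[of x] lext_def by (simp add: pbw_scale)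
qed

text \<open>Congruence of w to the scalar \<gamma> modulo C_+ - c and C_- - c'. The cofactors are
  central so that both remainders are nilpotent wherever C_+ - c and C_- - c' are.\<close>

definition jets :: "complex \<Rightarrow> complex \<Rightarrow> complex \<Rightarrow> gA \<Rightarrow> bool" where
  "jets c c' \<gamma> w \<longleftrightarrow> (\<exists>A B. central A \<and> central B \<and> w = \<gamma> *s 1 + (sp.Cas - c *s 1) * A + (sm.Cas - c' *s 1) * B)"

lemma jets_central: "jets c c' \<gamma> w \<Longrightarrow> central w"
  using central_Cas by (auto simp: jets_def intro!: central_closed)

lemma jets_closed:
  "jets c c' 1 1" "jets c c' \<gamma> w \<Longrightarrow> jets c c' \<delta> z \<Longrightarrow> jets c c' (\<gamma> + \<delta>) (w + z)"
  "jets c c' \<gamma> w \<Longrightarrow> jets c c' (a * \<gamma>) (a *s w)" "jets c c' \<gamma> w \<Longrightarrow> jets c c' (c * \<gamma>) (sp.Cas * w)"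
  "jets c c' \<gamma> w \<Longrightarrow> jets c c' (c' * \<gamma>) (sm.Cas * w)"
proof -
  show "jets c c' 1 1" unfolding jets_def by (rule exI[of _ 0], rule exI[of _ 0]) (simp add: central_closed)
  show "jets c c' \<gamma> w \<Longrightarrow> jets c c' \<delta> z \<Longrightarrow> jets c c' (\<gamma> + \<delta>) (w + z)"
  proof -
    assume "jets c c' \<gamma> w" "jets c c' \<delta> z"
    then obtain A B A' B' where "central A" "central B" "w = \<gamma> *s 1 + (sp.Cas - c *s 1) * A + (sm.Cas - c' *s 1) * B"
      "central A'" "central B'" "z = \<delta> *s 1 + (sp.Cas - c *s 1) * A' + (sm.Cas - c' *s 1) * B'"
      by (auto simp: jets_def)
    thus ?thesis unfolding jets_def
      by (intro exI[of _ "A + A'"] exI[of _ "B + B'"]) (simp add: central_closed distrib_left sca.scale_left_distrib add_ac)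
  qed
  show sc: "jets c c' \<gamma> w \<Longrightarrow> jets c c' (a * \<gamma>) (a *s w)" for a \<gamma> w
  proof -
    assume "jets c c' \<gamma> w"
    then obtain A B where "central A" "central B" "w = \<gamma> *s 1 + (sp.Cas - c *s 1) * A + (sm.Cas - c' *s 1) * B"
      by (auto simp: jets_def)
    thus ?thesis unfolding jets_def
      by (intro exI[of _ "a *s A"] exI[of _ "a *s B"]) (simp add: central_closed sca.scale_right_distrib)
  qed
  show "jets c c' \<gamma> w \<Longrightarrow> jets c c' (c * \<gamma>) (sp.Cas * w)"
  proof -
    assume j: "jets c c' \<gamma> w"
    from sc[OF j, of c] obtain A B where AB: "central A" "central B" "c *s w = (c * \<gamma>) *s 1 + (sp.Cas - c *s 1) * A + (sm.Cas - c' *s 1) * B"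
      by (auto simp: jets_def)
    have "sp.Cas * w = c *s w + (sp.Cas - c *s 1) * w" by (simp add: left_diff_distrib)
    with AB jets_central[OF j] show ?thesis unfolding jets_def
      by (intro exI[of _ "A + w"] exI[of _ B]) (simp add: central_closed distrib_left add_ac)
  qed
  show "jets c c' \<gamma> w \<Longrightarrow> jets c c' (c' * \<gamma>) (sm.Cas * w)"
  proof -
    assume j: "jets c c' \<gamma> w"
    from sc[OF j, of c'] obtain A B where AB: "central A" "central B" "c' *s w = (c' * \<gamma>) *s 1 + (sp.Cas - c *s 1) * A + (sm.Cas - c' *s 1) * B"
      by (auto simp: jets_def)
    have "sm.Cas * w = c' *s w + (sm.Cas - c' *s 1) * w" by (simp add: left_diff_distrib)
    with AB jets_central[OF j] show ?thesis unfolding jets_def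
      by (intro exI[of _ A] exI[of _ "B + w"]) (simp add: central_closed distrib_left add_ac)
  qed
qed

lemma G_power_large: "x \<in> {Ep, Fp} \<Longrightarrow> PP \<le> m \<Longrightarrow> G x ^ m = 0" "y \<in> {Em, Fm} \<Longrightarrow> PM \<le> n \<Longrightarrow> G y ^ n = 0"
proof -
  have "a ^ m = 0" if "a ^ k = 0" "k \<le> m" for a :: gA and k m
    using that power_add[of a k "m - k"] by simp
  thus "x \<in> {Ep, Fp} \<Longrightarrow> PP \<le> m \<Longrightarrow> G x ^ m = 0" "y \<in> {Em, Fm} \<Longrightarrow> PM \<le> n \<Longrightarrow> G y ^ n = 0"
    using G_nilp by auto
qed

text \<open>Divisibility by 2 p_+ p_- makes p_+ divide m and p_- divide n, by coprimality. So a
  monomial with one generator per sector commutes with K only if it is trivial.\<close>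

lemma LL_dvd_weights:
  assumes "\<bar>d\<bar> = 1" "\<bar>d'\<bar> = 1" "m < PP" "n < PM" "int LL dvd 2 * int PM * (d * int m) + 2 * int PP * (d' * int n)"
  shows "m = 0 \<and> n = 0"
proof -
  have d: "d = 1 \<or> d = - 1" "d' = 1 \<or> d' = - 1" using assms by auto
  have "2 * (int PP * int PM) dvd 2 * (int PM * (d * int m) + int PP * (d' * int n))"
    using assms(5) by (simp add: int_LL algebra_simps)
  hence D: "int PP * int PM dvd int PM * (d * int m) + int PP * (d' * int n)"
    by (subst (asm) dvd_mult_cancel_left) simp
  have c: "coprime (int PP) (int PM)" using coprime_PP_PM by simp
  have "int PP dvd int PM * (d * int m)"
  proof -
    have "int PP dvd int PM * (d * int m) + int PP * (d' * int n)" using D by (rule dvd_mult_left)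
    thus ?thesis by (simp add: dvd_add_left_iff)
  qed
  hence "int PP dvd int m" using c d by (auto simp: coprime_dvd_mult_right_iff)
  hence m: "m = 0" using assms(3) by (auto simp: int_dvd_int_iff dest: dvd_imp_le)
  have "int PM dvd int PP * (d' * int n)"
  proof -
    have "int PM dvd int PM * (d * int m) + int PP * (d' * int n)" using D by (rule dvd_mult_right)
    thus ?thesis by (simp add: dvd_add_right_iff)
  qed
  hence "int PM dvd int n" using c d by (auto simp: coprime_dvd_mult_right_iff coprime_commute)
  hence "n = 0" using assms(4) by (auto simp: int_dvd_int_iff dest: dvd_imp_le)
  with m show ?thesis by simp
qed

text \<open>Between two copies of the projection only the PBW monomials of weight zero survive. By
  \<open>LL_dvd_weights\<close> these are products of Casimir elements and a power of K, which is a
  scalar there.\<close>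

lemma weight_space_jets: "\<exists>\<gamma> w. jets c c' \<gamma> w \<and> P1 a * z * P1 a = w * P1 a"
  using pbw_UNIV[of z]
proof (induction rule: pbw.induct)
  case (mono x y b u v m n t)
  let ?M = "G x ^ m * (G y ^ n * KK t)"
  have P: "P1 a * P1 a = P1 a" by (simp add: gK.pj_mult)
  have M: "\<exists>\<mu>. P1 a * ?M * P1 a = \<mu> *s P1 a"
  proof (cases "m < PP \<and> n < PM")
    case False
    hence "?M = 0" using G_power_large(1)[of x m] G_power_large(2)[of y n] mono by auto
    thus ?thesis by (intro exI[of _ 0]) simp
  next
    case True
    obtain d where d: "\<bar>d\<bar> = 1" "kw x = 2 * int PM * d" using mono(1) by (auto intro: that[of 1] that[of "- 1"])
    obtain d' where d': "\<bar>d'\<bar> = 1" "kw y = 2 * int PP * d'" using mono(2) by (auto intro: that[of 1] that[of "- 1"])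
    let ?w = "kw x * int m + kw y * int n"
    have "G Kg * (G x ^ m * G y ^ n) = qz powi ?w *s (G x ^ m * G y ^ n * G Kg)"
      by (rule gK.weight_mult) (rule gK.weight_power[OF G_K_commute])+
    from gK.gen_pj[OF this] have g: "G x ^ m * G y ^ n * P1 a = P1 (a + ?w) * (G x ^ m * G y ^ n)" .
    have "P1 a * ?M * P1 a = qz powi (a * t) *s (P1 a * (G x ^ m * G y ^ n * P1 a))"
      by (simp add: mult.assoc gK.kp_pj)
    also have "P1 a * (G x ^ m * G y ^ n * P1 a) = (P1 a * P1 (a + ?w)) * (G x ^ m * G y ^ n)"
      unfolding g by (simp only: mult.assoc)
    finally have e: "P1 a * ?M * P1 a = qz powi (a * t) *s ((P1 a * P1 (a + ?w)) * (G x ^ m * G y ^ n))" .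
    show ?thesis
    proof (cases "int LL dvd ?w")
      case True
      have "m = 0 \<and> n = 0"
        by (rule LL_dvd_weights[OF d(1) d'(1)]) (use True \<open>m < PP \<and> n < PM\<close> in \<open>simp_all add: d d' mult.assoc\<close>)
      thus ?thesis using e P by auto
    next
      case False
      moreover have "a - (a + ?w) = - ?w" by simp
      ultimately have "P1 a * P1 (a + ?w) = 0" by (simp only: gK.pj_mult dvd_minus_iff if_False)
      thus ?thesis unfolding e by (intro exI[of _ 0]) simp
    qed
  qed
  then obtain \<mu> where \<mu>: "P1 a * ?M * P1 a = \<mu> *s P1 a" ..
  have j: "\<exists>\<gamma>. jets c c' \<gamma> (sp.Cas ^ u * (sm.Cas ^ v * 1))"
  proof -
    have "\<exists>\<gamma>. jets c c' \<gamma> (sm.Cas ^ v * 1)"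
      by (induction v) (auto intro: jets_closed simp: mult.assoc)
    thus ?thesis by (induction u) (auto intro: jets_closed simp: mult.assoc)
  qed
  then obtain \<gamma> where \<gamma>: "jets c c' \<gamma> (sp.Cas ^ u * (sm.Cas ^ v * 1))" ..
  have "P1 a * (sp.Cas ^ u * (sm.Cas ^ v * ?M)) * P1 a = sp.Cas ^ u * (sm.Cas ^ v * 1) * (P1 a * ?M * P1 a)"
  proof -
    have "P1 a * (sp.Cas ^ u * (sm.Cas ^ v * 1)) = sp.Cas ^ u * (sm.Cas ^ v * 1) * P1 a"
      using jets_central[OF \<gamma>] by (simp add: central_def)
    thus ?thesis by (simp add: mult.assoc[symmetric])
  qed
  hence "P1 a * (b *s (sp.Cas ^ u * (sm.Cas ^ v * ?M))) * P1 a = ((b * \<mu>) *s (sp.Cas ^ u * (sm.Cas ^ v * 1))) * P1 a"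
    by (simp add: \<mu>)
  with jets_closed(3)[OF \<gamma>, of "b * \<mu>"] show ?case by blast
next
  case (add w z)
  then obtain \<gamma> w' \<delta> z' where "jets c c' \<gamma> w'" "P1 a * w * P1 a = w' * P1 a" "jets c c' \<delta> z'" "P1 a * z * P1 a = z' * P1 a"
    by blast
  moreover from this have "jets c c' (\<gamma> + \<delta>) (w' + z')" by (intro jets_closed(2))
  ultimately show ?case
    by (intro exI[of _ "\<gamma> + \<delta>"] exI[of _ "w' + z'"]) (simp add: distrib_left distrib_right)
qed

text \<open>On z the idempotent is \<gamma> + N, where N is a sum of two commuting elements that
  square to zero, so N^3 z = 0. Idempotency gives N z = N^2 z for \<gamma> = 0 and N z = - N^2 z for
  \<gamma> = 1; iterating yields N z = 0.\<close>

lemma idempotent_jet: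
  assumes j: "jets c c' \<gamma> w" and e: "\<epsilon> * \<epsilon> = \<epsilon>" "\<epsilon> * z = w * z" and \<gamma>: "\<gamma> = 0 \<or> \<gamma> = 1"
    and k: "(sp.Cas - c *s 1) * ((sp.Cas - c *s 1) * z) = 0" "(sm.Cas - c' *s 1) * ((sm.Cas - c' *s 1) * z) = 0"
  shows "\<epsilon> * z = \<gamma> *s z"
proof -
  obtain A B where AB: "central A" "central B" "w = \<gamma> *s 1 + (sp.Cas - c *s 1) * A + (sm.Cas - c' *s 1) * B"
    using j by (auto simp: jets_def)
  define x where "x = (sp.Cas - c *s 1) * A"
  define y where "y = (sm.Cas - c' *s 1) * B"
  have cx: "central x" "central y" "central (sp.Cas - c *s 1)" "central (sm.Cas - c' *s 1)"
    unfolding x_def y_def using AB central_Cas by (auto intro!: central_closed)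
  have com: "a * (b * s) = b * (a * s)" if "central a" for a b s
    using that by (metis central_def mult.assoc)
  have xx: "x * (x * s) = A * (A * ((sp.Cas - c *s 1) * ((sp.Cas - c *s 1) * s)))" for s
    unfolding x_def mult.assoc using com[OF AB(1)] by metis
  have yy: "y * (y * s) = B * (B * ((sm.Cas - c' *s 1) * ((sm.Cas - c' *s 1) * s)))" for s
    unfolding y_def mult.assoc using com[OF AB(2)] by metis
  have zz: "x * (x * z) = 0" "y * (y * z) = 0" using xx[of z] yy[of z] k by simp_all
  define N where "N = x + y"
  have N3: "N * (N * (N * z)) = 0"
  proof -
    have 1: "x * (x * (x * z)) = 0" "y * (x * (x * z)) = 0" "x * (y * (y * z)) = 0" "y * (y * (y * z)) = 0"
      by (simp_all add: zz)
    have 2: "x * (x * (y * z)) = 0" "x * (y * (x * z)) = 0" "y * (y * (x * z)) = 0" "y * (x * (y * z)) = 0"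
      using 1 com[OF cx(1)] com[OF cx(2)] by metis+
    show ?thesis by (simp add: N_def distrib_left distrib_right 1 2)
  qed
  have cN: "\<epsilon> * (N * s) = N * (\<epsilon> * s)" for s
    using com[of N] cx by (simp add: N_def central_closed)
  have ez: "\<epsilon> * z = \<gamma> *s z + N * z" by (simp add: e(2) AB(3) N_def x_def y_def distrib_right add.assoc)
  have ee: "\<epsilon> * (\<epsilon> * z) = \<epsilon> * z" by (simp add: mult.assoc[symmetric] e(1))
  from \<gamma> have "N * z = 0"
  proof
    assume "\<gamma> = 0"
    hence "N * (N * z) = N * z" using ee cN[of z] by (simp add: ez)
    thus ?thesis using N3 by simp
  next
    assume g: "\<gamma> = 1"
    hence "\<epsilon> * (z + N * z) = z + N * z" using ee by (simp add: ez)
    hence "(z + N * z) + N * (z + N * z) = z + N * z" unfolding distrib_left[of \<epsilon>] cN using ez g by simp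
    hence a: "N * z = - (N * (N * z))" by (simp add: distrib_left eq_neg_iff_add_eq_0)
    hence "N * (N * z) = - (N * (N * (N * z)))" by (metis mult_minus_right)
    thus ?thesis using a N3 by simp
  qed
  thus ?thesis using ez by simp
qed

subsection \<open>The irreducible module seen by a weight space\<close>

lemma sign_cases: "x ^ 2 = 1 \<longleftrightarrow> x = 1 \<or> x = - (1 :: complex)"
  by (simp add: power2_eq_1_iff)

text \<open>p_+ and p_- are not both even, so one of the two prescribed powers already fixes
  \<alpha>; the compatibility condition takes care of the other.\<close>

lemma common_sign:
  fixes A B :: complex
  assumes "A ^ 2 = 1" "B ^ 2 = 1" "A ^ PP = B ^ PM"
  shows "\<exists>\<alpha>\<in>{1, - 1}. \<alpha> ^ PM = A \<and> \<alpha> ^ PP = B"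
proof -
  have "\<not> (even PP \<and> even PM)" using coprime_PP_PM coprime_common_divisor_nat[of PP PM 2] by auto
  moreover have p: "(- 1 :: complex) ^ n = (if even n then 1 else - 1)" for n by simp
  ultimately show ?thesis using assms unfolding sign_cases
    by (cases "even PP"; cases "even PM") auto
qed

text \<open>The square of x Q^(2i+1) is Q^(2s) with s = p - (j - i), so it is a sign times Q^s. That
  is the form of the Casimir parameter of the s-dimensional irreducible module.\<close>

lemma (in qroot) central_character:
  assumes x: "x \<noteq> 0" and ij: "i \<le> j" "j < p" "(x * Q) ^ 2 * Q ^ (2 * (i + j)) = 1"
  obtains \<sigma> where "\<sigma> ^ 2 = 1" "\<sigma> * Q ^ (p - (j - i)) = x * Q ^ (2 * i + 1)"
proof
  let ?s = "p - (j - i)"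
  have "(x * Q ^ (2 * i + 1)) ^ 2 * Q ^ (2 * j) = ((x * Q) ^ 2 * Q ^ (2 * (i + j))) * Q ^ (2 * i)"
    by (simp add: power2_eq_square power_add mult_ac distrib_left)
  also have "\<dots> = Q ^ (2 * i) * Q ^ (2 * p)" using ij(3) by (simp add: Q_root)
  also have "\<dots> = Q ^ (2 * ?s) * Q ^ (2 * j)"
  proof -
    have "2 * i + 2 * p = 2 * ?s + 2 * j" using ij by simp
    thus ?thesis by (simp only: power_add[symmetric])
  qed
  finally have s: "(x * Q ^ (2 * i + 1)) ^ 2 = (Q ^ ?s) ^ 2" by (simp add: power_mult[symmetric] mult.commute)
  show "(x * Q ^ (2 * i + 1) / Q ^ ?s) ^ 2 = 1" unfolding power_divide s by simp
  show "x * Q ^ (2 * i + 1) / Q ^ ?s * Q ^ ?s = x * Q ^ (2 * i + 1)" by simp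
qed

text \<open>Supplies the irreducible module in which the scalars of central idempotents are read
  off. Each sector determines a dimension and a sign by \<open>central_character\<close>; the point
  is that both signs come from one \<alpha>.\<close>

lemma weight_vector:
  assumes ij: "i \<le> j" "j < PP" "(xp a * Qp) ^ 2 * Qp ^ (2 * (i + j)) = 1"
    and ij': "i' \<le> j'" "j' < PM" "(xm a * Qm) ^ 2 * Qm ^ (2 * (i' + j')) = 1"
  defines "s \<equiv> PP - (j - i)" and "s' \<equiv> PM - (j' - i')"
  obtains \<alpha> v where "\<alpha> \<in> {1, - 1}"
    "\<alpha> ^ PM * (- 1) ^ (s' - 1) * Qp ^ s = xp a * Qp ^ (2 * i + 1)"
    "\<alpha> ^ PP * (- 1) ^ (s - 1) * Qm ^ s' = xm a * Qm ^ (2 * i' + 1)"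
    "is_mod (irr_mod PP PM \<alpha> s s')" "v \<in> mspace (irr_mod PP PM \<alpha> s s')" "v \<noteq> 0"
    "ga (irr_mod PP PM \<alpha> s s') (P1 (int a)) v = v"
    "ga (irr_mod PP PM \<alpha> s s') sp.Cas v = scl (csum (xp a * Qp ^ (2 * i + 1))) v"
    "ga (irr_mod PP PM \<alpha> s s') sm.Cas v = scl (csum (xm a * Qm ^ (2 * i' + 1))) v"
proof -
  let ?Q = "Qp" and ?R = "Qm"
  have s: "1 \<le> s" "s \<le> PP" "i < s" "1 \<le> s'" "s' \<le> PM" "i' < s'" using ij ij' by (auto simp: s_def s'_def)
  obtain \<sigma> where \<sigma>: "\<sigma> ^ 2 = 1" "\<sigma> * ?Q ^ s = xp a * ?Q ^ (2 * i + 1)"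
    using qp.central_character[OF _ ij] unfolding s_def by auto
  obtain \<sigma>' where \<sigma>': "\<sigma>' ^ 2 = 1" "\<sigma>' * ?R ^ s' = xm a * ?R ^ (2 * i' + 1)"
    using qm.central_character[OF _ ij'] unfolding s'_def by auto
  have sq: "((- 1 :: complex) ^ n) ^ 2 = 1" for n by (simp flip: power_mult)
  have sgn: "(- 1 :: complex) ^ n * (- 1) ^ n = 1" for n by (simp flip: power_mult_distrib)
  \<comment> \<open>Both signs are governed by the eigenvalue of K^(PP PM), computed once from K_+
    and once from K_-. It is itself a sign, so the inversion of K_- does not matter.\<close>
  have pw: "(\<sigma> * (- 1) ^ (s' - 1)) ^ PP = (\<sigma>' * (- 1) ^ (s - 1)) ^ PM"
  proof -
    have x: "xp a ^ PP = xm a ^ PM"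
      unfolding qq_powi_power by (rule qq_cong) (simp add: algebra_simps)
    have odd: "(- 1 :: complex) ^ (n * (2 * k + 1)) = (- 1) ^ n" for n k
      by (simp add: distrib_left power_add mult.left_commute[of n 2])
    have QQ: "?Q ^ (n * PP) = (- 1) ^ (PM * n)" "?R ^ (n * PM) = (- 1) ^ (PP * n)" for n
      using Qpar_self_power by (metis power_mult mult.commute)+
    have "\<sigma> ^ PP * (- 1) ^ (PM * s) = xp a ^ PP * (- 1) ^ PM"
      using arg_cong[OF \<sigma>(2), of "\<lambda>z. z ^ PP"] by (simp only: power_mult_distrib power_mult[symmetric] QQ odd)
    moreover have "\<sigma>' ^ PM * (- 1) ^ (PP * s') = xm a ^ PM * (- 1) ^ PP"
      using arg_cong[OF \<sigma>'(2), of "\<lambda>z. z ^ PM"] by (simp only: power_mult_distrib power_mult[symmetric] QQ odd)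
    ultimately have e: "\<sigma> ^ PP * (- 1) ^ (PM * s) * (- 1) ^ PP = \<sigma>' ^ PM * (- 1) ^ (PP * s') * (- 1) ^ PM"
      unfolding x by (simp add: mult_ac)
    have m1: "(- 1 :: complex) ^ (n * t) = (- 1) ^ (n * (t - 1)) * (- 1) ^ n" if "1 \<le> t" for n t
    proof -
      have "n * t = n * (t - 1) + n" using that by (cases t) simp_all
      thus ?thesis by (simp only: power_add)
    qed
    have "(\<sigma> ^ PP * (- 1) ^ (PM * (s - 1))) * ((- 1) ^ PP * (- 1) ^ PM) = (\<sigma>' ^ PM * (- 1) ^ (PP * (s' - 1))) * ((- 1) ^ PP * (- 1) ^ PM)"
      using e unfolding m1[OF s(1)] m1[OF s(4)] by (simp only: mult_ac)
    hence "\<sigma> ^ PP * (- 1) ^ (PM * (s - 1)) = \<sigma>' ^ PM * (- 1) ^ (PP * (s' - 1))" by simp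
    hence "\<sigma> ^ PP * ((- 1) ^ (PM * (s - 1)) * (- 1) ^ (PM * (s - 1))) * (- 1) ^ (PP * (s' - 1)) =
        \<sigma>' ^ PM * ((- 1) ^ (PP * (s' - 1)) * (- 1) ^ (PP * (s' - 1))) * (- 1) ^ (PM * (s - 1))"
      by (simp only: mult.assoc[symmetric]) (simp only: mult_ac)
    thus ?thesis unfolding sgn by (simp add: power_mult_distrib power_mult[symmetric] mult.commute)
  qed
  obtain \<alpha> where \<alpha>: "\<alpha> \<in> {1, - 1}" "\<alpha> ^ PM = \<sigma> * (- 1) ^ (s' - 1)" "\<alpha> ^ PP = \<sigma>' * (- 1) ^ (s - 1)"
  proof -
    have "(\<sigma> * (- 1) ^ (s' - 1)) ^ 2 = 1" "(\<sigma>' * (- 1) ^ (s - 1)) ^ 2 = 1"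
      by (simp_all only: power_mult_distrib \<sigma>(1) \<sigma>'(1) sq mult_1_left)
    from common_sign[OF this pw] that show ?thesis by blast
  qed
  have a2: "\<alpha> ^ 2 = 1" using \<alpha>(1) by auto
  let ?V = "(irr_mod PP PM \<alpha> s s')"
  have as: "\<alpha> ^ PM * (- 1) ^ (s' - 1) = \<sigma>" "\<alpha> ^ PP * (- 1) ^ (s - 1) = \<sigma>'"
    by (simp_all add: \<alpha> mult.assoc sgn)
  interpret T: tensor_module "{..<s}" "qp.irr_w s \<sigma>" "qp.irr_e s \<sigma>" "qp.irr_f s"
    "{..<s'}" "qm.irr_w s' \<sigma>'" "qm.irr_e s' \<sigma>'" "qm.irr_f s'" "irr_mod PP PM \<alpha> s s'"
    "\<lambda>n n'. \<alpha> * qpar PP powi (int s - 1 - 2 * int n) * qpar PM powi (int s' - 1 - 2 * int n')"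
    using tensor_module_irr[OF s(1,2,4,5) a2] unfolding as .
  \<comment> \<open>The minus sector is used with e and f exchanged, so its index counts from the
    other end of the string.\<close>
  define n' where "n' = s' - 1 - i'"
  have mem: "i \<in> {..<s}" "n' \<in> {..<s'}" using s by (auto simp: n'_def)
  have w1: "qp.irr_w s \<sigma> i = qq powi (2 * int PM * int a)"
  proof -
    have "int s - 1 - 2 * int i = int s + - int (2 * i + 1)" by simp
    hence "qp.irr_w s \<sigma> i = (\<sigma> * ?Q ^ s) * inverse (?Q ^ (2 * i + 1))"
      unfolding qp.irr_w_def by (simp only: power_int_add[OF disjI1[OF qp.Q_nz]] power_int_minus power_int_of_nat mult.assoc)
    moreover have nz: "?Q ^ (2 * i + 1) \<noteq> 0" by simp
    ultimately show ?thesis unfolding \<sigma>(2) by (simp only: mult.assoc right_inverse[OF nz] mult_1_right)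
  qed
  have w2: "qm.irr_w s' \<sigma>' n' = qq powi (2 * int PP * int a)"
  proof -
    have "int s' - 1 - 2 * int n' = - int s' + int (2 * i' + 1)" using s by (simp add: n'_def)
    hence "qm.irr_w s' \<sigma>' n' = \<sigma>' * inverse (?R ^ s') * ?R ^ (2 * i' + 1)"
      unfolding qm.irr_w_def by (simp only: power_int_add[OF disjI1[OF qm.Q_nz]] power_int_minus power_int_of_nat mult.assoc)
    also have "\<sigma>' * inverse (?R ^ s') = inverse (\<sigma>' * ?R ^ s')" using \<sigma>'(1) unfolding sign_cases by auto
    also have "\<dots> = inverse (xm a * ?R ^ (2 * i' + 1))" unfolding \<sigma>'(2) ..
    also have "\<dots> * ?R ^ (2 * i' + 1) = inverse (xm a)"
    proof -
      have nz: "?R ^ (2 * i' + 1) \<noteq> 0" by simp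
      show ?thesis by (simp only: inverse_mult_distrib mult.assoc left_inverse[OF nz] mult_1_right)
    qed
    finally show ?thesis by (simp add: power_int_minus)
  qed
  have kk: "\<alpha> * qpar PP powi (int s - 1 - 2 * int i) * qpar PM powi (int s' - 1 - 2 * int n') = qz powi int a"
    using T.kk_eq[OF mem w1 w2] .
  show ?thesis
  proof (rule that[of \<alpha> "vec (i, n')"])
    show "\<alpha> \<in> {1, - 1}" "is_mod ?V" by (fact \<alpha>(1), fact T.is_mod_V)
    show "vec (i, n') \<in> mspace ?V" using mem by (intro mspace_closed) (simp add: T.basis_V)
    show "vec (i, n') \<noteq> 0" by (metis lookup_single_eq lookup_zero zero_neq_one)
    show "\<alpha> ^ PM * (- 1) ^ (s' - 1) * ?Q ^ s = xp a * ?Q ^ (2 * i + 1)" "\<alpha> ^ PP * (- 1) ^ (s - 1) * ?R ^ s' = xm a * ?R ^ (2 * i' + 1)"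
      unfolding as by (fact \<sigma>(2), fact \<sigma>'(2))
    show "ga ?V (P1 (int a)) (vec (i, n')) = vec (i, n')"
      using T.P1_act[OF mem kk, of "int a"] by simp
    have "ga ?V sp.Cas (vec (i, n')) = scl (csum (\<sigma> * ?Q ^ s)) (vec (i, n'))"
      unfolding T.Cas_act(1)[OF mem] qp.irr_ef(2)[OF mem(1)[simplified]]
      using qp.weight_identity(2)[OF \<sigma>(1) mem(1)[simplified]]
      by (simp add: qp.irr_w_def scl.scale_left_distrib[symmetric])
    thus "ga ?V sp.Cas (vec (i, n')) = scl (csum (xp a * ?Q ^ (2 * i + 1))) (vec (i, n'))"
      unfolding \<sigma>(2) .
    have "ga ?V sm.Cas (vec (i, n')) = scl (csum (\<sigma>' * ?R ^ s')) (vec (i, n'))"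
      unfolding T.Cas_act(2)[OF mem] qm.irr_ef(1)[OF mem(2)[simplified]]
      using qm.weight_identity(3)[OF \<sigma>'(1) mem(2)[simplified]]
      by (simp add: qm.irr_w_def scl.scale_left_distrib[symmetric])
    thus "ga ?V sm.Cas (vec (i, n')) = scl (csum (xm a * ?R ^ (2 * i' + 1))) (vec (i, n'))"
      unfolding \<sigma>'(2) .
  qed
qed

text \<open>Compressing \<epsilon> by the projection gives a jet with some value \<gamma>. Applied
  to v, it shows \<gamma> = \<delta>; then \<open>idempotent_jet\<close> removes the nilpotent
  part.\<close>

lemma idempotent_on_weight_space:
  assumes \<epsilon>: "central \<epsilon>" "\<epsilon> * \<epsilon> = \<epsilon>" and V: "is_mod V" "v \<in> mspace V" "v \<noteq> 0"
    and act: "ga V (P1 a) v = v" "ga V sp.Cas v = scl c v" "ga V sm.Cas v = scl c' v" "ga V \<epsilon> v = scl \<delta> v" and \<delta>: "\<delta> = 0 \<or> \<delta> = 1"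
    and z: "z = U * P1 a" "central U"
    and k: "(sp.Cas - c *s 1) * ((sp.Cas - c *s 1) * z) = 0" "(sm.Cas - c' *s 1) * ((sm.Cas - c' *s 1) * z) = 0"
  shows "\<epsilon> * z = \<delta> *s z"
proof -
  obtain \<gamma> w where w: "jets c c' \<gamma> w" "P1 a * \<epsilon> * P1 a = w * P1 a" using weight_space_jets by blast
  note gs = ga_simps[OF V(1)]
  have mem: "ga V y v \<in> mspace V" for y using gs(9) V(2) .
  obtain A B where AB: "central A" "central B" "w = \<gamma> *s 1 + (sp.Cas - c *s 1) * A + (sm.Cas - c' *s 1) * B"
    using w(1) by (auto simp: jets_def)
  have "(sp.Cas - c *s 1) * A = A * (sp.Cas - c *s 1)" "(sm.Cas - c' *s 1) * B = B * (sm.Cas - c' *s 1)"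
    using AB by (auto simp: central_def)
  hence wv: "ga V w v = scl \<gamma> v"
    unfolding AB(3) using V(2) act ga_0[OF V(1)] by (simp add: gs)
  have "ga V (P1 a * \<epsilon> * P1 a) v = scl \<delta> v" using V(2) act by (simp add: gs mspace_closed)
  moreover have "ga V (w * P1 a) v = scl \<gamma> v" using V(2) act wv by (simp add: gs)
  ultimately have "scl \<delta> v = scl \<gamma> v" unfolding w(2) by (simp only:)
  hence \<gamma>: "\<gamma> = \<delta>" using V(3) by simp
  have "P1 a * P1 a = P1 a" by (simp add: gK.pj_mult)
  hence "\<epsilon> * z = U * (P1 a * \<epsilon> * P1 a)"
    using z \<epsilon>(1) by (metis central_def mult.assoc)
  also have "\<dots> = w * z" unfolding w(2) using z jets_central[OF w(1)] by (metis central_def mult.assoc)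
  finally have "\<epsilon> * z = w * z" .
  from idempotent_jet[OF w(1) \<epsilon>(2) this _ k] show ?thesis using \<delta> \<gamma> by simp
qed

subsection \<open>Blocks and conformal dimensions\<close>

text \<open>The reflection of (r, r') to (PP - r, PM - r') exchanges the two sides of the line p_- r
  + p_+ r' = p_+ p_-. As no label lies on this line, exactly one of two reflected labels is in
  \<open>index_set1\<close>.\<close>

lemma no_resonance:
  assumes "1 \<le> r" "r < PP"
  shows "PM * r + PP * r' \<noteq> PP * PM"
proof
  assume e: "PM * r + PP * r' = PP * PM"
  have "PP dvd PM * r" using e by (metis dvd_add_left_iff dvd_triv_left)
  hence "PP dvd r" using coprime_PP_PM by (simp add: coprime_dvd_mult_right_iff)
  with assms show False by (auto dest: dvd_imp_le)
qed

text \<open>An inverse of \<open>block\<close>: the label of the unique block that contains the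
  given irreducible module (\<open>blab_in\<close>, \<open>blab_unique\<close>).\<close>

definition blab :: "complex \<Rightarrow> nat \<Rightarrow> nat \<Rightarrow> nat \<times> nat" where
  "blab \<alpha> s s' =
    (if s = PP \<and> s' = PM then (if \<alpha> = 1 then (PP, PM) else (0, PM))
     else if s' = PM then (if \<alpha> = 1 then (s, PM) else (PP - s, PM))
     else if s = PP then (if \<alpha> = 1 then (PP, s') else (PP, PM - s'))
     else if \<alpha> = 1 then (if PM * s + PP * s' \<le> PP * PM then (s, s') else (PP - s, PM - s'))
     else (if PM * (PP - s) + PP * s' \<le> PP * PM then (PP - s, s') else (s, PM - s')))"

lemma reflect_sum: "r \<le> PP \<Longrightarrow> r' \<le> PM \<Longrightarrow> PM * (PP - r) + PP * (PM - r') + (PM * r + PP * r') = 2 * (PP * PM)"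
proof -
  assume r: "r \<le> PP" "r' \<le> PM"
  have "PM * (PP - r) + PM * r = PP * PM" "PP * (PM - r') + PP * r' = PP * PM"
    using r by (simp_all only: add_mult_distrib2[symmetric] le_add_diff_inverse2) (simp add: mult.commute)
  thus ?thesis by linarith
qed

lemma reflect_le: "r \<le> PP \<Longrightarrow> r' \<le> PM \<Longrightarrow> PM * (PP - r) + PP * (PM - r') \<le> PP * PM \<longleftrightarrow> PP * PM \<le> PM * r + PP * r'"
  using reflect_sum[of r r'] by linarith

lemma blab_in:
  assumes "\<alpha> \<in> {1, - 1}" "1 \<le> s" "s \<le> PP" "1 \<le> s'" "s' \<le> PM"
  shows "blab \<alpha> s s' \<in> index_set PP PM \<and> (\<alpha>, s, s') \<in> block PP PM (blab \<alpha> s s')"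
proof -
  have r: "PM * s + PP * (PM - s') \<le> PP * PM" if "\<not> PM * (PP - s) + PP * s' \<le> PP * PM"
    using reflect_le[of "PP - s" s'] that assms by simp
  have r': "PM * (PP - s) + PP * (PM - s') \<le> PP * PM" if "\<not> PM * s + PP * s' \<le> PP * PM"
    using reflect_le[of s s'] that assms by simp
  have le: "s < PP \<Longrightarrow> s \<le> PP - Suc 0 \<and> PP - s \<noteq> PP \<and> Suc 0 \<le> PP - s \<and> PP - s \<le> PP - Suc 0"
    "s' < PM \<Longrightarrow> s' \<le> PM - Suc 0 \<and> PM - s' \<noteq> PM \<and> Suc 0 \<le> PM - s' \<and> PM - s' \<le> PM - Suc 0"
    using assms by auto
  have ne: "PP \<noteq> 0" "PM \<noteq> 0" "(- 1 :: complex) \<noteq> 1" using PP_ge_2 PM_ge_2 by auto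
  have "s < PP \<or> s = PP" "s' < PM \<or> s' = PM" "\<alpha> = 1 \<or> \<alpha> = - 1" using assms by auto
  then consider "s = PP" "s' = PM" | "s < PP" "s' = PM" | "s = PP" "s' < PM"
    | "s < PP" "s' < PM" "\<alpha> = 1" "PM * s + PP * s' \<le> PP * PM" | "s < PP" "s' < PM" "\<alpha> = 1" "\<not> PM * s + PP * s' \<le> PP * PM"
    | "s < PP" "s' < PM" "\<alpha> = - 1" "PM * (PP - s) + PP * s' \<le> PP * PM"
    | "s < PP" "s' < PM" "\<alpha> = - 1" "\<not> PM * (PP - s) + PP * s' \<le> PP * PM"
    by blast
  thus ?thesis
  proof cases
    case 4 thus ?thesis using assms le by (simp add: blab_def index_set_def index_set1_def block_def)
  next
    case 5 thus ?thesis using assms le r' by (simp add: blab_def index_set_def index_set1_def block_def)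
  next
    case 6 thus ?thesis using assms le ne by (simp add: blab_def index_set_def index_set1_def block_def)
  next
    case 7 thus ?thesis using assms le ne r by (simp add: blab_def index_set_def index_set1_def block_def)
  qed (use assms PP_ge_2 PM_ge_2 in \<open>auto simp: blab_def index_set_def block_def\<close>)
qed

lemma blab_unique:
  assumes \<alpha>: "\<alpha> \<in> {1, - 1}" and i: "i \<in> index_set PP PM" and b: "(\<alpha>, s, s') \<in> block PP PM i"
  shows "i = blab \<alpha> s s'"
proof -
  obtain r r' where ir: "i = (r, r')" by (cases i)
  from i ir consider "1 \<le> r" "r < PP" "1 \<le> r'" "r' < PM" "PM * r + PP * r' \<le> PP * PM"
    | "1 \<le> r" "r < PP" "r' = PM" | "r = PP" "1 \<le> r'" "r' < PM" | "r = PP" "r' = PM" | "r = 0" "r' = PM"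
    using PP_ge_2 PM_ge_2 by (auto simp: index_set_def index_set1_def)
  thus ?thesis
  proof cases
    case 1
    have n: "\<not> PM * (PP - r) + PP * (PM - r') \<le> PP * PM"
      using reflect_le[of r r'] no_resonance[of r r'] 1 by auto
    show ?thesis using b n 1 by (auto simp: ir block_def blab_def)
  qed (use b PP_ge_2 PM_ge_2 in \<open>auto simp: ir block_def blab_def\<close>)
qed

text \<open>Its square minus (p_- - p_+)^2 is the exponent of q in the eigenvalue of v on the
  irreducible module; changing \<alpha> from 1 to -1 shifts it by p_+ p_-.\<close>

definition bweight :: "complex \<Rightarrow> nat \<Rightarrow> nat \<Rightarrow> int" where
  "bweight \<alpha> s s' = int PM * int s - int PP * int s' + (if \<alpha> = 1 then 0 else int PP * int PM)"

lemma qq_exp: "qq powi n = exp (2 * \<i> * of_real pi * (of_int n / (4 * of_nat PP * of_nat PM)))"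
proof -
  have "qq powi n = exp (of_int n * (\<i> * of_real pi / of_nat (2 * PP * PM)))"
    unfolding qq_def qpar_def by (rule exp_power_int)
  thus ?thesis by (simp add: field_simps)
qed

text \<open>Moving between the modules of a block changes the square of \<open>bweight\<close> by a
  multiple of 4 p_+ p_-, which q does not see; the four positions in a block are compared with the
  label directly.\<close>

lemma conf_dim_weight:
  assumes \<alpha>: "\<alpha> \<in> {1, - 1}" and i: "i \<in> index_set PP PM" and b: "(\<alpha>, s, s') \<in> block PP PM i"
  shows "exp (2 * \<i> * of_real pi * conf_dim PP PM i) = qq powi (bweight \<alpha> s s' ^ 2 - (int PM - int PP) ^ 2)"
proof -
  obtain r r' where ir: "i = (r, r')" by (cases i)
  let ?B = "int PP * int r' - int PM * int r"
  have "conf_dim PP PM i = of_int (?B ^ 2 - (int PP - int PM) ^ 2) / (4 * of_nat PP * of_nat PM)"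
    by (simp add: ir conf_dim_def)
  hence "exp (2 * \<i> * of_real pi * conf_dim PP PM i) = qq powi (?B ^ 2 - (int PP - int PM) ^ 2)"
    by (simp only: qq_exp)
  also have "\<dots> = qq powi (bweight \<alpha> s s' ^ 2 - (int PM - int PP) ^ 2)"
  proof (rule qq_cong)
    have *: "\<exists>k. ?B ^ 2 - bweight \<alpha> s s' ^ 2 = 4 * int PP * int PM * k"
    proof -
      have r: "r \<le> PP" "r' \<le> PM" using i ir PP_ge_2 PM_ge_2 by (auto simp: index_set_def index_set1_def)
      have ne: "(- 1 :: complex) \<noteq> 1" by simp
      from b ir r consider "\<alpha> = 1" "s = r" "s' = r'" | "\<alpha> = - 1" "int s = int PP - int r" "s' = r'"
        | "\<alpha> = - 1" "s = r" "int s' = int PM - int r'" | "\<alpha> = 1" "int s = int PP - int r" "int s' = int PM - int r'"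
        by (auto simp: block_def of_nat_diff split: if_splits)
      thus ?thesis
      proof cases
        case 1
        thus ?thesis by (intro exI[of _ 0]) (simp add: bweight_def power2_commute)
      next
        case 2
        have "?B ^ 2 - bweight \<alpha> s s' ^ 2 = 4 * int PP * int PM * (int PM * int r + int PP * int r' - int PP * int PM - int r * int r')"
          by (simp add: bweight_def 2 power2_eq_square algebra_simps)
        thus ?thesis ..
      next
        case 3
        have "?B ^ 2 - bweight \<alpha> s s' ^ 2 = 4 * int PP * int PM * (- (int r * int r'))"
          by (simp add: bweight_def 3 power2_eq_square algebra_simps)
        thus ?thesis ..
      next
        case 4
        have "?B ^ 2 - bweight \<alpha> s s' ^ 2 = 4 * int PP * int PM * 0"
          by (simp add: bweight_def 4 power2_eq_square algebra_simps)
        thus ?thesis ..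
      qed
    qed
    then obtain k where k: "?B ^ 2 - bweight \<alpha> s s' ^ 2 = 4 * int PP * int PM * k" ..
    have "(int PP - int PM) ^ 2 = (int PM - int PP) ^ 2" by (rule power2_commute)
    with k have "?B ^ 2 - (int PP - int PM) ^ 2 - (bweight \<alpha> s s' ^ 2 - (int PM - int PP) ^ 2) = 4 * int PP * int PM * k" by linarith
    thus "4 * int PP * int PM dvd ?B ^ 2 - (int PP - int PM) ^ 2 - (bweight \<alpha> s s' ^ 2 - (int PM - int PP) ^ 2)"
      by (simp only: dvd_triv_left)
  qed
  finally show ?thesis .
qed

text \<open>All factors are powers of q, so exponents are compared modulo 4 p_+ p_-. On the left
  they complete to E^2 - p_+^2 - p_-^2 plus 2 p_+ p_- times an odd number. The two equations in
  \<open>e\<close> make E - B divisible by 2 p_+ and by 2 p_-, hence by 2 p_+ p_-, and then E^2 and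
  B^2 agree modulo 4 p_+ p_-.\<close>

lemma ribbon_eigenvalue:
  assumes \<alpha>: "\<alpha> \<in> {1, - 1}" and s: "1 \<le> s" "1 \<le> s'"
    and e: "\<alpha> ^ PM * (- 1) ^ (s' - 1) * Qp ^ s = xp a * Qp ^ (2 * i + 1)"
      "\<alpha> ^ PP * (- 1) ^ (s - 1) * Qm ^ s' = xm a * Qm ^ (2 * i' + 1)"
  shows "qq powi (int a ^ 2 + 2 * int a * (int PM - int PP)) * ((xp a * Qp) ^ (2 * i) * Qp ^ (2 * i ^ 2)) *
      ((xm a * Qm) ^ (2 * i') * Qm ^ (2 * i' ^ 2)) =
    qq powi (bweight \<alpha> s s' ^ 2 - (int PM - int PP) ^ 2)"
proof -
  let ?em = "(- 2 * int PP * int a * int (2 * i') + 2 * int PP * int PP * int (2 * i') + 2 * int PP * int PP * int (2 * i' ^ 2))"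
  let ?ep = "(2 * int PM * int a * int (2 * i) + 2 * int PM * int PM * int (2 * i) + 2 * int PM * int PM * int (2 * i ^ 2))"
  define \<nu> :: int where "\<nu> = (if \<alpha> = 1 then 0 else 1)"
  have m1: "(- 1) = qq powi (2 * int PP * int PM)"
  proof -
    have "qq powi (2 * int PP * int PM) = qpar (2 * PP * PM) ^ (2 * PP * PM)"
      unfolding qq_def power_int_of_nat[symmetric] by simp
    thus ?thesis using qpar_self_power[of "2 * PP * PM"] by simp
  qed
  have al: "\<alpha> = qq powi (2 * int PP * int PM * \<nu>)" using \<alpha> m1 by (auto simp: \<nu>_def)
  have E1: "qq powi (2 * int PP * int PM * \<nu> * int PM + 2 * int PP * int PM * int (s' - 1) + 2 * int PM * int PM * int s) =
      qq powi (2 * int PM * int a + 2 * int PM * int PM * int (2 * i + 1))"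
    using e(1) unfolding Q_power m1 by (subst (asm) al) (simp only: qq_powi_power power_int_add[OF disjI1[OF qq_nz]] mult.assoc)
  have E2: "qq powi (2 * int PP * int PM * \<nu> * int PP + 2 * int PP * int PM * int (s - 1) + 2 * int PP * int PP * int s') =
      qq powi (- 2 * int PP * int a + 2 * int PP * int PP * int (2 * i' + 1))"
    using e(2) unfolding Q_power m1 by (subst (asm) al) (simp only: qq_powi_power power_int_add[OF disjI1[OF qq_nz]] mult.assoc)
  have root: "4 * int PP * int PM dvd x - y" if "qq powi x = qq powi y" for x y
    using that qq_powi_eq_1[of "x - y"] by (simp add: power_int_diff)
  obtain k1 where k1: "2 * int PP * int PM * \<nu> * int PM + 2 * int PP * int PM * int (s' - 1) + 2 * int PM * int PM * int s -
      (2 * int PM * int a + 2 * int PM * int PM * int (2 * i + 1)) = 4 * int PP * int PM * k1"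
    using root[OF E1] by (auto simp: dvd_def)
  obtain k2 where k2: "2 * int PP * int PM * \<nu> * int PP + 2 * int PP * int PM * int (s - 1) + 2 * int PP * int PP * int s' -
      (- 2 * int PP * int a + 2 * int PP * int PP * int (2 * i' + 1)) = 4 * int PP * int PM * k2"
    using root[OF E2] by (auto simp: dvd_def)
  have pos: "2 * int PM \<noteq> 0" "2 * int PP \<noteq> 0" using PP_ge_2 PM_ge_2 by auto
  have s1: "int (s' - 1) = int s' - 1" "int (s - 1) = int s - 1" using s by simp_all
  have K1: "int PP * \<nu> * int PM + int PP * (int s' - 1) + int PM * int s - (int a + int PM * (2 * int i + 1)) = 2 * int PP * k1"
  proof -
    have "(2 * int PM) * (int PP * \<nu> * int PM + int PP * (int s' - 1) + int PM * int s - (int a + int PM * (2 * int i + 1))) = (2 * int PM) * (2 * int PP * k1)"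
      using k1 unfolding s1 by (simp add: algebra_simps)
    thus ?thesis using pos by (simp only: mult_cancel_left simp_thms)
  qed
  have K2: "int PM * \<nu> * int PP + int PM * (int s - 1) + int PP * int s' - (- int a + int PP * (2 * int i' + 1)) = 2 * int PM * k2"
  proof -
    have "(2 * int PP) * (int PM * \<nu> * int PP + int PM * (int s - 1) + int PP * int s' - (- int a + int PP * (2 * int i' + 1))) = (2 * int PP) * (2 * int PM * k2)"
      using k2 unfolding s1 by (simp add: algebra_simps)
    thus ?thesis using pos by (simp only: mult_cancel_left simp_thms)
  qed
  define E where "E = int a + int PM * (2 * int i + 1) - int PP * (2 * int i' + 1)"
  define B where "B = int PM * int s - int PP * int s' + \<nu> * (int PP * int PM)"
  have "E - B = 2 * int PP * (int s' - int i' - 1 - k1)" using K1 by (simp add: E_def B_def algebra_simps)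
  hence d1: "int PP dvd (E - B) div 2" "even (E - B)" by auto
  have "E - B = 2 * int PM * (k2 + int i + 1 - int s - \<nu> * int PP)" using K2 by (simp add: E_def B_def algebra_simps)
  hence d2: "int PM dvd (E - B) div 2" by auto
  have "int PP * int PM dvd (E - B) div 2" using coprime_PP_PM by (intro divides_mult[OF d1(1) d2]) simp
  then obtain k where "(E - B) div 2 = int PP * int PM * k" by (rule dvdE)
  moreover have "E - B = 2 * ((E - B) div 2)" using d1(2) by simp
  ultimately have k: "E - B = 2 * (int PP * int PM * k)" by simp
  have EB: "E ^ 2 - B ^ 2 = 4 * int PP * int PM * (k * (B + int PP * int PM * k))"
  proof -
    have "E = B + 2 * (int PP * int PM * k)" using k by simp
    thus ?thesis by (simp add: power2_eq_square algebra_simps)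
  qed
  have lhs: "qq powi (int a ^ 2 + 2 * int a * (int PM - int PP)) * ((xp a * Qp) ^ (2 * i) * Qp ^ (2 * i ^ 2)) *
      ((xm a * Qm) ^ (2 * i') * Qm ^ (2 * i' ^ 2)) =
    qq powi (int a ^ 2 + 2 * int a * (int PM - int PP) +
      ?ep +
      ?em)"
    unfolding power_mult_distrib qq_powi_power Q_power by (simp only: power_int_add[OF disjI1[OF qq_nz]])
  have Bw: "bweight \<alpha> s s' = B" by (simp add: bweight_def B_def \<nu>_def)
  show ?thesis unfolding lhs Bw
  proof (rule qq_cong)
    have "int a ^ 2 + 2 * int a * (int PM - int PP) +
      ?ep +
      ?em =
      E ^ 2 + 2 * int PM * int PP * ((2 * int i + 1) * (2 * int i' + 1)) - int PM ^ 2 - int PP ^ 2"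
      by (simp add: E_def power2_eq_square algebra_simps)
    hence "int a ^ 2 + 2 * int a * (int PM - int PP) +
      ?ep +
      ?em -
      (B ^ 2 - (int PM - int PP) ^ 2) = (E ^ 2 - B ^ 2) + 4 * int PP * int PM * (2 * int i * int i' + int i + int i')"
      by (simp add: power2_eq_square algebra_simps)
    thus "4 * int PP * int PM dvd int a ^ 2 + 2 * int a * (int PM - int PP) +
      ?ep +
      ?em -
      (B ^ 2 - (int PM - int PP) ^ 2)" unfolding EB by (simp only: dvd_add dvd_triv_left)
  qed
qed

section \<open>The ribbon element\<close>

lemma finite_index_set: "finite (index_set PP PM)"
proof -
  have "index_set PP PM \<subseteq> {..PP} \<times> {..PM}" by (auto simp: index_set_def index_set1_def)
  thus ?thesis by (rule finite_subset) simp
qed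

lemma central_left_commute: "central b \<Longrightarrow> b * (c * w) = c * (b * w)"
  by (metis central_def mult.assoc)

text \<open>F p and H F p are successive primary components of the projection p. The replacement for
  P is known on F p, the one for N only on H F p; centrality brings each factor next to the vector
  on which it is known.\<close>

lemma ribbon_on_eigenspace:
  assumes c: "central A" "central B" "central P" "central N" "central F" "central H"
    and v: "v * p = \<kappa> *s (P * N * p)" and s: "s * p = A * (B * p)"
    and P: "P * (F * p) = k *s (A * (F * p))" and N: "N * (H * (F * p)) = l *s (B * (H * (F * p)))"
    and b: "b * (H * (F * p)) = \<mu> *s (H * (F * p))" and \<mu>: "\<kappa> * k * l = \<mu>"
  shows "v * (H * (F * p)) = b * s * (H * (F * p))"
proof -
  note com = central_left_commute
  have "v * (H * (F * p)) = H * (F * (v * p))"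
    by (simp only: com[OF c(6), of v, symmetric] com[OF c(5), of v, symmetric])
  also have "\<dots> = \<kappa> *s (P * (N * (H * (F * p))))"
    by (simp only: v sca_mult_right mult.assoc[of P] com[OF c(5), of P] com[OF c(5), of N] com[OF c(6), of P] com[OF c(6), of N])
  also have "\<dots> = (\<kappa> * l) *s (B * (H * (P * (F * p))))"
    by (simp only: N sca_mult_right sca.scale_scale com[OF c(3), of B] com[OF c(3), of H])
  also have "\<dots> = \<mu> *s (B * (H * (A * (F * p))))"
    using \<mu> by (simp add: P mult_ac)
  also have "B * (H * (A * (F * p))) = A * (B * (H * (F * p)))"
    by (simp only: com[OF c(1), of B] com[OF c(1), of H])
  also have "\<mu> *s (A * (B * (H * (F * p)))) = b * (A * (B * (H * (F * p))))"
    by (simp only: com[OF c(1), of b, symmetric] com[OF c(2), of b, symmetric] b sca_mult_right)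
  also have "A * (B * (H * (F * p))) = H * (F * (s * p))"
    by (simp only: s com[OF c(5), of A] com[OF c(5), of B] com[OF c(6), of A] com[OF c(6), of B])
  also have "\<dots> = s * (H * (F * p))"
    by (simp only: com[OF c(6), of s, symmetric] com[OF c(5), of s, symmetric])
  finally show ?thesis by (simp only: mult.assoc)
qed

lemma ribbon_formula_fixed: "ribbon_formula PP PM"
  unfolding ribbon_formula_def
proof (intro allI impI)
  fix e assume "block_idempotents PP PM e"
  hence prim: "\<And>i. i \<in> index_set PP PM \<Longrightarrow> primitive_central_idempotent (g_alg PP PM) (e i)"
    and act_e: "\<And>i \<alpha> s s' v. i \<in> index_set PP PM \<Longrightarrow> \<alpha> \<in> {1, - 1} \<Longrightarrow> s \<in> {1..PP} \<Longrightarrow> s' \<in> {1..PM} \<Longrightarrow>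
      v \<in> mspace (irr_mod PP PM \<alpha> s s') \<Longrightarrow> act (irr_mod PP PM \<alpha> s s') (e i) v = (if (\<alpha>, s, s') \<in> block PP PM i then v else 0)"
    unfolding block_idempotents_def by blast+
  have gp: "g_alg PP PM = presented rels" by (simp add: g_alg_def rels_g)
  have "\<exists>y. e i = coset y \<and> central y \<and> y * y = y" if "i \<in> index_set PP PM" for i
  proof -
    from prim[OF that] have c: "e i \<in> ring_center (g_alg PP PM)" "e i \<otimes>\<^bsub>g_alg PP PM\<^esub> e i = e i"
      by (auto simp: primitive_central_idempotent_def)
    then obtain y :: gA where y: "e i = coset y" by (auto simp: ring_center_def carrier_G)
    have "y * z = z * y" for z using c(1) unfolding y ring_center_def gp presented_carrier by auto
    moreover have "y * y = y" using c(2) unfolding y gp by simp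
    ultimately show ?thesis using y unfolding central_def by blast
  qed
  then obtain \<epsilon> where \<epsilon>: "\<And>i. i \<in> index_set PP PM \<Longrightarrow> e i = coset (\<epsilon> i)" "\<And>i. i \<in> index_set PP PM \<Longrightarrow> central (\<epsilon> i)"
    "\<And>i. i \<in> index_set PP PM \<Longrightarrow> \<epsilon> i * \<epsilon> i = \<epsilon> i"
    by metis
  let ?lam = "\<lambda>i. exp (2 * \<i> * of_real pi * conf_dim PP PM i)"
  define vb where "vb = (\<Sum>i\<in>index_set PP PM. ?lam i *s \<epsilon> i)"
  define vs where "vs = (1 + (1 / of_nat PP) *s hp.chi_elem) * (1 + (1 / of_nat PM) *s hm.chi_elem)"
  have local: "vv * P1 (int a) = vb * vs * P1 (int a)" if a: "a < LL" for a
  proof -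
    let ?p = "P1 (int a)" and ?x = "xp a" and ?y = "xm a" and ?Q = "Qp" and ?R = "Qm"
    let ?Phi = "\<lambda>z. vv * z = vb * vs * z"
    have roots: "?x ^ (2 * PP) = 1" "?y ^ (2 * PM) = 1"
    proof -
      have "2 * int PM * int a * int (2 * PP) = 4 * int PP * int PM * int a"
        "- 2 * int PP * int a * int (2 * PM) = 4 * int PP * int PM * (- int a)" by simp_all
      thus "?x ^ (2 * PP) = 1" "?y ^ (2 * PM) = 1" unfolding qq_powi_power qq_powi_eq_1 by (simp_all only: dvd_triv_left)
    qed
    let ?A = "peval (1 + smult (1 / of_nat PP) (qp.chi_poly (?x * inverse ?Q))) sp.Cas"
    let ?B = "peval (1 + smult (1 / of_nat PM) (qm.chi_poly (?y * inverse ?R))) sm.Cas"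
    have A: "(1 + (1 / of_nat PP) *s hp.chi_elem) * ?p = ?A * ?p" "(1 + (1 / of_nat PM) *s hm.chi_elem) * ?p = ?B * ?p"
      by (simp_all add: distrib_right hp.chi_elem_P1 hm.chi_elem_P1 peval_add peval_smult)
    note com = central_left_commute
    have vsp: "vs * ?p = ?A * (?B * ?p)"
    proof -
      have "vs * ?p = (1 + (1 / of_nat PP) *s hp.chi_elem) * (?B * ?p)" by (simp only: vs_def mult.assoc A(2))
      also have "\<dots> = ?B * (?A * ?p)" by (simp only: com[OF central_peval(2), symmetric] A(1))
      also have "\<dots> = ?A * (?B * ?p)" by (rule com[OF central_peval(2)])
      finally show ?thesis .
    qed
    show ?thesis
    \<comment> \<open>The pieces \<open>?z1\<close> obtained from C_+ are still weight vectors for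
      the minus sector, so each can be split further by C_-.\<close>
    proof (rule sp.spectral_induct[OF wt_P1(1) roots(1), where \<Phi> = ?Phi])
      fix F i j
      let ?z1 = "peval F sp.Cas * ?p" and ?c = "csum (?x * ?Q ^ (2 * i + 1))"
      assume ij: "i \<le> j" "j < PP" "(?x * ?Q) ^ 2 * ?Q ^ (2 * (i + j)) = 1"
        and r1: "peval (qp.rib_poly (?x * ?Q)) sp.Cas * ?z1 = ((?x * ?Q) ^ (2 * i) * ?Q ^ (2 * i ^ 2)) *s (?A * ?z1)"
        and k1: "(sp.Cas - ?c *s 1) * ((sp.Cas - ?c *s 1) * ?z1) = 0"
      have w1: "sm.wt ?y ?z1"
      proof -
        have "KK (- int PP) * ?z1 = peval F sp.Cas * (KK (- int PP) * ?p)"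
          by (simp only: com[OF central_peval(1), of F])
        thus ?thesis using wt_P1(2)[of "int a"] by (simp add: sm.wt_def)
      qed
      show "?Phi ?z1"
      proof (rule sm.spectral_induct[OF w1 roots(2), where \<Phi> = ?Phi])
        fix H i' j'
        let ?z = "peval H sm.Cas * ?z1" and ?c' = "csum (?y * ?R ^ (2 * i' + 1))"
        assume ij': "i' \<le> j'" "j' < PM" "(?y * ?R) ^ 2 * ?R ^ (2 * (i' + j')) = 1"
          and r2: "peval (qm.rib_poly (?y * ?R)) sm.Cas * ?z = ((?y * ?R) ^ (2 * i') * ?R ^ (2 * i' ^ 2)) *s (?B * ?z)"
          and k2: "(sm.Cas - ?c' *s 1) * ((sm.Cas - ?c' *s 1) * ?z) = 0"
        let ?U = "peval H sm.Cas * peval F sp.Cas" and ?s = "PP - (j - i)" and ?s' = "PM - (j' - i')"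
        have U: "central ?U" by (intro central_closed central_peval)
        have z: "?z = ?U * ?p" by (simp only: mult.assoc)
        have k1z: "(sp.Cas - ?c *s 1) * ((sp.Cas - ?c *s 1) * ?z) = 0"
        proof -
          have "(sp.Cas - ?c *s 1) * ((sp.Cas - ?c *s 1) * ?z) = peval H sm.Cas * ((sp.Cas - ?c *s 1) * ((sp.Cas - ?c *s 1) * ?z1))"
            by (simp only: com[OF central_peval(2), of H, symmetric])
          thus ?thesis by (simp only: k1 mult_zero_right)
        qed
        obtain \<alpha> v where \<alpha>: "\<alpha> \<in> {1, - 1}" "\<alpha> ^ PM * (- 1) ^ (?s' - 1) * ?Q ^ ?s = ?x * ?Q ^ (2 * i + 1)"
            "\<alpha> ^ PP * (- 1) ^ (?s - 1) * ?R ^ ?s' = ?y * ?R ^ (2 * i' + 1)"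
          and V: "is_mod (irr_mod PP PM \<alpha> ?s ?s')" "v \<in> mspace (irr_mod PP PM \<alpha> ?s ?s')" "v \<noteq> 0"
          and act: "ga (irr_mod PP PM \<alpha> ?s ?s') ?p v = v" "ga (irr_mod PP PM \<alpha> ?s ?s') sp.Cas v = scl ?c v"
            "ga (irr_mod PP PM \<alpha> ?s ?s') sm.Cas v = scl ?c' v"
          by (rule weight_vector[OF ij ij'])
        have s: "1 \<le> ?s" "?s \<le> PP" "1 \<le> ?s'" "?s' \<le> PM" using ij ij' by auto
        \<comment> \<open>The module found by \<open>weight_vector\<close> lies in exactly one
          block, which decides between 1 and 0.\<close>
        have \<epsilon>z: "\<epsilon> l * ?z = (if l = blab \<alpha> ?s ?s' then ?z else 0)" if l: "l \<in> index_set PP PM" for l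
        proof -
          let ?del = "if l = blab \<alpha> ?s ?s' then 1 else 0 :: complex"
          have "(\<alpha>, ?s, ?s') \<in> block PP PM l \<longleftrightarrow> l = blab \<alpha> ?s ?s'"
            using blab_in[OF \<alpha>(1) s] blab_unique[OF \<alpha>(1) l] by blast
          hence "ga (irr_mod PP PM \<alpha> ?s ?s') (\<epsilon> l) v = scl ?del v"
            using act_e[OF l \<alpha>(1) _ _ V(2)] s by (simp add: ga_def \<epsilon>(1)[OF l, symmetric])
          from idempotent_on_weight_space[OF \<epsilon>(2)[OF l] \<epsilon>(3)[OF l] V act this _ z U k1z k2]
          show ?thesis by simp
        qed
        have vbz: "vb * ?z = qq powi (bweight \<alpha> ?s ?s' ^ 2 - (int PM - int PP) ^ 2) *s ?z"
        proof -
          have "vb * ?z = (\<Sum>l\<in>index_set PP PM. if l = blab \<alpha> ?s ?s' then ?lam l *s ?z else 0)"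
            unfolding vb_def sum_distrib_right by (rule sum.cong[OF refl]) (use \<epsilon>z in auto)
          also have "\<dots> = ?lam (blab \<alpha> ?s ?s') *s ?z"
            using blab_in[OF \<alpha>(1) s] finite_index_set by simp
          finally show ?thesis using conf_dim_weight[OF \<alpha>(1)] blab_in[OF \<alpha>(1) s] by simp
        qed
        show "?Phi ?z"
          by (rule ribbon_on_eigenspace[OF _ _ _ _ _ _ vv_P1[OF a] vsp r1 r2 vbz
                ribbon_eigenvalue[OF \<alpha>(1) s(1,3) \<alpha>(2,3)]]) (rule central_peval)+
      qed (simp_all add: distrib_left)
    qed (simp_all add: distrib_left)
  qed
  have "vv = vv * (\<Sum>a<LL. P1 (int a))" by (simp add: gK.pj_sum)
  also have "\<dots> = vb * vs * (\<Sum>a<LL. P1 (int a))" unfolding sum_distrib_left using local by simp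
  also have "\<dots> = vb * vs" by (simp add: gK.pj_sum)
  finally have "vv = vb * vs" .
  interpret ring "g_alg PP PM" unfolding gp by (rule ring_presented)
  have "(\<Oplus>\<^bsub>g_alg PP PM\<^esub>i\<in>index_set PP PM. scalar_mult (g_rels PP PM) (?lam i) (e i)) =
      (\<Oplus>\<^bsub>g_alg PP PM\<^esub>i\<in>index_set PP PM. coset (?lam i *s \<epsilon> i))"
    by (rule finsum_cong') (simp_all add: carrier_G \<epsilon>(1) rels_g[symmetric])
  also have "\<dots> = coset vb" unfolding gp vb_def by (rule finsum_coset[OF finite_index_set])
  finally show "ribbon PP PM =
    (\<Oplus>\<^bsub>g_alg PP PM\<^esub>i\<in>index_set PP PM. scalar_mult (g_rels PP PM) (?lam i) (e i)) \<otimes>\<^bsub>g_alg PP PM\<^esub>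
    ((\<one>\<^bsub>g_alg PP PM\<^esub> \<oplus>\<^bsub>g_alg PP PM\<^esub> scalar_mult (g_rels PP PM) (1 / of_nat PP) (chi_NW PP PM)) \<otimes>\<^bsub>g_alg PP PM\<^esub>
     (\<one>\<^bsub>g_alg PP PM\<^esub> \<oplus>\<^bsub>g_alg PP PM\<^esub> scalar_mult (g_rels PP PM) (1 / of_nat PM) (chi_NE PP PM)))"
    unfolding ribbon_coset chi_NW_coset chi_NE_coset unfolding gp rels_g[symmetric] \<open>vv = vb * vs\<close> vs_def by simp
qed

theorem proposition4p3p1:
  fixes pp pm :: nat and e :: "nat \<times> nat \<Rightarrow> ggen free_alg set"
  assumes "2 \<le> pp" and "2 \<le> pm" and "coprime pp pm"
    and "block_idempotents pp pm e"
  shows "ribbon pp pm =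
    (\<Oplus>\<^bsub>g_alg pp pm\<^esub>i\<in>index_set pp pm.
        scalar_mult (g_rels pp pm) (exp (2 * \<i> * of_real pi * conf_dim pp pm i)) (e i))
    \<otimes>\<^bsub>g_alg pp pm\<^esub>
    ((\<one>\<^bsub>g_alg pp pm\<^esub> \<oplus>\<^bsub>g_alg pp pm\<^esub> scalar_mult (g_rels pp pm) (1 / of_nat pp) (chi_NW pp pm))
     \<otimes>\<^bsub>g_alg pp pm\<^esub>
     (\<one>\<^bsub>g_alg pp pm\<^esub> \<oplus>\<^bsub>g_alg pp pm\<^esub> scalar_mult (g_rels pp pm) (1 / of_nat pm) (chi_NE pp pm)))"
proof -
  have "ribbon_formula pp pm"
  proof (rule ccontr)
    assume "\<not> ribbon_formula pp pm"
    moreover have "admissible pp pm" using assms(1-3) by (simp add: admissible_def)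
    ultimately show False using params_counterexample ribbon_formula_fixed by blast
  qed
  then show ?thesis using assms(4) unfolding ribbon_formula_def by blast
qed

end
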